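(* Let $n$ be a positive integer, let $G=SL(n)$ over $\mathbb{C}$, let $P_1,P_2$ be parabolic subgroups of $G$, and let $X=G/P_1\times G/P_2$ with the diagonal action of $G$. If the complexity $c_G(X)$ equals $1$, then the number of $G$-orbits in $X$ is at most $10$.
   Context: Complexity: for a connected reductive complex algebraic group $G$ with Borel subgroup $B$ and an irreducible $G$-variety $X$, the complexity $c_G(X)$ is the codimension in $X$ of a general $B$-orbit (equivalently, the minimal codimension of a $B$-orbit). The group $G$ acts diagonally on $G/P_1\times G/P_2$ by $g\cdot(x,y)=(gx,gy)$. *)

theory Defs
  imports
    "HOL-Analysis.Abstract_Topology"
    "HOL-Library.Extended_Nat"
    "HOL-Algebra.Left_Coset"
    "HOL-Algebra.Solvable_Groups"
    "HOL-Algebra.Group_Action"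
    "Jordan_Normal_Form.Determinant"
begin

section \<open>Zariski topologies and quotient topologies\<close>

inductive_set poly_funs :: "('a \<Rightarrow> complex) set \<Rightarrow> ('a \<Rightarrow> complex) set"
  for C :: "('a \<Rightarrow> complex) set" where
  const: "(\<lambda>_. c) \<in> poly_funs C"
| coord: "f \<in> C \<Longrightarrow> f \<in> poly_funs C"
| add: "f \<in> poly_funs C \<Longrightarrow> g \<in> poly_funs C \<Longrightarrow> (\<lambda>x. f x + g x) \<in> poly_funs C"
| mult: "f \<in> poly_funs C \<Longrightarrow> g \<in> poly_funs C \<Longrightarrow> (\<lambda>x. f x * g x) \<in> poly_funs C"

text \<open>The open sets are the complements in \<open>S\<close> of common zero sets of families of polynomials in
  the coordinate functions \<open>C\<close>; see \<open>closedin_zariski\<close>.\<close>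

definition zariski :: "'a set \<Rightarrow> ('a \<Rightarrow> complex) set \<Rightarrow> 'a topology" where
  "zariski S C = topology (\<lambda>U. \<exists>F \<subseteq> poly_funs C. U = {x \<in> S. \<exists>f\<in>F. f x \<noteq> 0})"

lemma openin_zariski:
  "openin (zariski S C) U \<longleftrightarrow> (\<exists>F \<subseteq> poly_funs C. U = {x \<in> S. \<exists>f\<in>F. f x \<noteq> 0})"
proof -
  let ?L = "\<lambda>U. \<exists>F \<subseteq> poly_funs C. U = {x \<in> S. \<exists>f\<in>F. f x \<noteq> 0}"
  have "istopology ?L"
    unfolding istopology_def
  proof (intro conjI allI impI)
    fix U V assume "?L U" "?L V"
    then obtain F G where F: "F \<subseteq> poly_funs C" "U = {x \<in> S. \<exists>f\<in>F. f x \<noteq> 0}"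
      and G: "G \<subseteq> poly_funs C" "V = {x \<in> S. \<exists>f\<in>G. f x \<noteq> 0}"
      by blast
    let ?H = "{\<lambda>x. f x * g x | f g. f \<in> F \<and> g \<in> G}"
    have sub: "?H \<subseteq> poly_funs C"
      using F(1) G(1) by (auto intro: poly_funs.mult)
    have "U \<inter> V = {x \<in> S. \<exists>h\<in>?H. h x \<noteq> 0}"
    proof (intro Set.set_eqI iffI)
      fix x assume "x \<in> U \<inter> V"
      then obtain f g where fg: "x \<in> S" "f \<in> F" "f x \<noteq> 0" "g \<in> G" "g x \<noteq> 0"
        unfolding F(2) G(2) by blast
      then have "(\<lambda>x. f x * g x) \<in> ?H" by blast
      moreover have "f x * g x \<noteq> 0" using fg by simp
      ultimately have "\<exists>h\<in>?H. h x \<noteq> 0"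
        by (intro bexI[where x = "\<lambda>x. f x * g x" and P = "\<lambda>h. h x \<noteq> 0"])
      with fg(1) show "x \<in> {x \<in> S. \<exists>h\<in>?H. h x \<noteq> 0}"
        by (intro CollectI conjI)
    next
      fix x assume "x \<in> {x \<in> S. \<exists>h\<in>?H. h x \<noteq> 0}"
      then show "x \<in> U \<inter> V"
        unfolding F(2) G(2) by auto
    qed
    with sub show "?L (U \<inter> V)"
      by (intro exI[of _ ?H] conjI)
  next
    fix K assume K: "\<forall>U\<in>K. ?L U"
    let ?H = "{f \<in> poly_funs C. \<exists>U\<in>K. \<forall>x\<in>S. f x \<noteq> 0 \<longrightarrow> x \<in> U}"
    have "\<Union>K = {x \<in> S. \<exists>h\<in>?H. h x \<noteq> 0}"
    proof (intro Set.set_eqI iffI)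
      fix x assume "x \<in> \<Union>K"
      then obtain U where U: "U \<in> K" "x \<in> U" by (elim UnionE)
      from K U(1) have "?L U" by (rule bspec)
      then obtain F where F: "F \<subseteq> poly_funs C" "U = {x \<in> S. \<exists>f\<in>F. f x \<noteq> 0}"
        by (elim exE conjE)
      from U(2) obtain f where f: "x \<in> S" "f \<in> F" "f x \<noteq> 0"
        unfolding F(2) by (elim CollectE conjE bexE)
      have "\<forall>y\<in>S. f y \<noteq> 0 \<longrightarrow> y \<in> U"
        using f(2) unfolding F(2) by simp blast
      then have "f \<in> ?H"
        using F(1) f(2) U(1) by blast
      with f show "x \<in> {x \<in> S. \<exists>h\<in>?H. h x \<noteq> 0}"
        by blast
    next
      fix x assume "x \<in> {x \<in> S. \<exists>h\<in>?H. h x \<noteq> 0}"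
      then show "x \<in> \<Union>K" by simp blast
    qed
    moreover have "?H \<subseteq> poly_funs C"
      by (rule Collect_restrict)
    ultimately show "?L (\<Union>K)"
      by (intro exI[of _ ?H] conjI)
  qed
  then show ?thesis
    unfolding zariski_def by (simp add: topology_inverse')
qed

lemma topspace_zariski [simp]: "topspace (zariski S C) = S"
proof -
  have "openin (zariski S C) S"
    unfolding openin_zariski
    by (rule exI[of _ "{\<lambda>_. 1}"]) (auto intro: poly_funs.const)
  then show ?thesis
    unfolding topspace_def openin_zariski by auto
qed

lemma closedin_zariski:
  "closedin (zariski S C) Z \<longleftrightarrow> (\<exists>F \<subseteq> poly_funs C. Z = {x \<in> S. \<forall>f\<in>F. f x = 0})"
  unfolding closedin_def openin_zariski topspace_zariski
proof safe
  fix F assume "Z \<subseteq> S" "F \<subseteq> poly_funs C" "S - Z = {x \<in> S. \<exists>f\<in>F. f x \<noteq> 0}"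
  then have "Z = {x \<in> S. \<forall>f\<in>F. f x = 0}" by blast
  with \<open>F \<subseteq> poly_funs C\<close> show "\<exists>F\<subseteq>poly_funs C. Z = {x \<in> S. \<forall>f\<in>F. f x = 0}" by blast
next
  fix F assume "F \<subseteq> poly_funs C"
  then show "\<exists>Fa\<subseteq>poly_funs C. S - {x \<in> S. \<forall>f\<in>F. f x = 0} = {x \<in> S. \<exists>f\<in>Fa. f x \<noteq> 0}"
    by (intro exI[of _ F]) auto
qed

definition quotient_topology :: "'a topology \<Rightarrow> ('a \<Rightarrow> 'b) \<Rightarrow> 'b topology" where
  "quotient_topology T q =
     topology (\<lambda>U. U \<subseteq> q ` topspace T \<and> openin T {x \<in> topspace T. q x \<in> U})"

lemma openin_quotient_topology:
  "openin (quotient_topology T q) U \<longleftrightarrow>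
     U \<subseteq> q ` topspace T \<and> openin T {x \<in> topspace T. q x \<in> U}"
proof -
  have "istopology (\<lambda>U. U \<subseteq> q ` topspace T \<and> openin T {x \<in> topspace T. q x \<in> U})"
    unfolding istopology_def
  proof (intro conjI allI impI)
    fix U V
    assume U: "U \<subseteq> q ` topspace T \<and> openin T {x \<in> topspace T. q x \<in> U}"
      and V: "V \<subseteq> q ` topspace T \<and> openin T {x \<in> topspace T. q x \<in> V}"
    show "U \<inter> V \<subseteq> q ` topspace T" using U by blast
    have "{x \<in> topspace T. q x \<in> U \<inter> V} =
        {x \<in> topspace T. q x \<in> U} \<inter> {x \<in> topspace T. q x \<in> V}" by blast
    then show "openin T {x \<in> topspace T. q x \<in> U \<inter> V}"
      using U V by (simp only: openin_Int)
  next
    fix K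
    assume *: "\<forall>U\<in>K. U \<subseteq> q ` topspace T \<and> openin T {x \<in> topspace T. q x \<in> U}"
    then show "\<Union>K \<subseteq> q ` topspace T" by blast
    have "openin T (\<Union>U\<in>K. {x \<in> topspace T. q x \<in> U})"
      using * by (intro openin_Union) auto
    also have "(\<Union>U\<in>K. {x \<in> topspace T. q x \<in> U}) = {x \<in> topspace T. q x \<in> \<Union>K}" by blast
    finally show "openin T {x \<in> topspace T. q x \<in> \<Union>K}" .
  qed
  then show ?thesis
    unfolding quotient_topology_def by (simp add: topology_inverse')
qed

lemma topspace_quotient_topology [simp]:
  "topspace (quotient_topology T q) = q ` topspace T"
proof -
  have "{x \<in> topspace T. q x \<in> q ` topspace T} = topspace T" by blast
  then have "openin (quotient_topology T q) (q ` topspace T)"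
    unfolding openin_quotient_topology by simp
  then show ?thesis
    by (meson openin_quotient_topology openin_subset openin_topspace subset_antisym)
qed

lemma quotient_map_quotient_topology: "quotient_map T (quotient_topology T q) q"
  unfolding quotient_map_def openin_quotient_topology by auto


section \<open>Codimension and complexity\<close>

definition irreducible_closedin :: "'a topology \<Rightarrow> 'a set \<Rightarrow> bool" where
  "irreducible_closedin T Z \<longleftrightarrow>
     closedin T Z \<and> Z \<noteq> {} \<and>
     (\<forall>A B. closedin T A \<longrightarrow> closedin T B \<longrightarrow> Z \<subseteq> A \<union> B \<longrightarrow> Z \<subseteq> A \<or> Z \<subseteq> B)"

text \<open>Krull codimension of the closure of \<open>Y\<close>. It is meaningful only for irreducible \<open>Y\<close>
  (otherwise there is no chain and the value is \<open>0\<close>); below it is only applied to orbits of a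
  connected algebraic group, which are irreducible and open in their closure.\<close>

definition codim :: "'a topology \<Rightarrow> 'a set \<Rightarrow> enat" where
  "codim T Y =
     Sup {enat k | k. \<exists>Z :: nat \<Rightarrow> 'a set. Z 0 = T closure_of Y \<and>
            (\<forall>i\<le>k. irreducible_closedin T (Z i)) \<and> (\<forall>i<k. Z i \<subset> Z (Suc i))}"

definition complexity ::
    "('g, 'm) monoid_scheme \<Rightarrow> 'g set \<Rightarrow> 'x topology \<Rightarrow> ('g \<Rightarrow> 'x \<Rightarrow> 'x) \<Rightarrow> enat" where
  "complexity G B T \<phi> = (INF Y \<in> orbits (G\<lparr>carrier := B\<rparr>) (topspace T) \<phi>. codim T Y)"


section \<open>Borel and parabolic subgroups\<close>

text \<open>Here \<open>T\<close> is the Zariski topology of the algebraic group \<open>G\<close>.\<close>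

definition closed_connected_solvable ::
    "('g, 'm) monoid_scheme \<Rightarrow> 'g topology \<Rightarrow> 'g set \<Rightarrow> bool" where
  "closed_connected_solvable G T H \<longleftrightarrow>
     subgroup H G \<and> closedin T H \<and> connectedin T H \<and> solvable (G\<lparr>carrier := H\<rparr>)"

definition borel_subgroup :: "('g, 'm) monoid_scheme \<Rightarrow> 'g topology \<Rightarrow> 'g set \<Rightarrow> bool" where
  "borel_subgroup G T B \<longleftrightarrow>
     closed_connected_solvable G T B \<and>
     (\<forall>H. closed_connected_solvable G T H \<longrightarrow> B \<subseteq> H \<longrightarrow> H = B)"

definition parabolic_subgroup :: "('g, 'm) monoid_scheme \<Rightarrow> 'g topology \<Rightarrow> 'g set \<Rightarrow> bool" where
  "parabolic_subgroup G T P \<longleftrightarrow>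
     subgroup P G \<and> closedin T P \<and> (\<exists>B. borel_subgroup G T B \<and> B \<subseteq> P)"


section \<open>The group SL(n) and its double flag varieties\<close>

definition SL :: "nat \<Rightarrow> complex mat monoid" where
  "SL n = \<lparr>carrier = {A \<in> carrier_mat n n. det A = 1}, monoid.mult = (*), one = 1\<^sub>m n\<rparr>"

lemma group_SL: "group (SL n)"
proof (rule groupI)
  fix A assume "A \<in> carrier (SL n)"
  then have c: "A \<in> carrier_mat n n" "det A = 1" by (simp_all add: SL_def)
  have adj: "adj_mat A \<in> carrier_mat n n" "adj_mat A * A = 1\<^sub>m n"
    using adj_mat(1)[OF c(1)] adj_mat(3)[OF c(1)] c(2) by (auto simp: smult_mat_def)
  have "det (adj_mat A) = 1"
    using det_mult[OF adj(1) c(1)] adj(2) c(2) by simp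
  then show "\<exists>B\<in>carrier (SL n). B \<otimes>\<^bsub>SL n\<^esub> A = \<one>\<^bsub>SL n\<^esub>"
    using adj by (intro bexI[of _ "adj_mat A"]) (simp_all add: SL_def)
next
  fix A B C assume "A \<in> carrier (SL n)" "B \<in> carrier (SL n)" "C \<in> carrier (SL n)"
  then show "A \<otimes>\<^bsub>SL n\<^esub> B \<otimes>\<^bsub>SL n\<^esub> C = A \<otimes>\<^bsub>SL n\<^esub> (B \<otimes>\<^bsub>SL n\<^esub> C)"
    by (simp add: SL_def assoc_mult_mat[of _ n n _ n _ n])
next
  fix A B assume "A \<in> carrier (SL n)" "B \<in> carrier (SL n)"
  then show "A \<otimes>\<^bsub>SL n\<^esub> B \<in> carrier (SL n)"
    by (auto simp: SL_def det_mult[of _ n])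
qed (auto simp: SL_def)

definition SL_topology :: "nat \<Rightarrow> complex mat topology" where
  "SL_topology n = zariski (carrier (SL n)) {\<lambda>A. A $$ (i, j) | i j. i < n \<and> j < n}"

text \<open>The Zariski topology of the variety \<open>SL(n) \<times> SL(n)\<close>, which is finer than the product of the
  two Zariski topologies.\<close>

definition SL2_topology :: "nat \<Rightarrow> (complex mat \<times> complex mat) topology" where
  "SL2_topology n = zariski (carrier (SL n) \<times> carrier (SL n))
     ({\<lambda>(g, h). g $$ (i, j) | i j. i < n \<and> j < n} \<union> {\<lambda>(g, h). h $$ (i, j) | i j. i < n \<and> j < n})"

definition double_flag ::
    "nat \<Rightarrow> complex mat set \<Rightarrow> complex mat set \<Rightarrow> (complex mat set \<times> complex mat set) set" where
  "double_flag n P1 P2 = (lcosets\<^bsub>SL n\<^esub> P1) \<times> (lcosets\<^bsub>SL n\<^esub> P2)"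

text \<open>The Zariski topology of \<open>G/P1 \<times> G/P2\<close>, regarded as the homogeneous space
  \<open>(G \<times> G)/(P1 \<times> P2)\<close>: the orbit map of a homogeneous space of an algebraic group is open, so the
  topology of the variety is the quotient topology.\<close>

definition double_flag_topology ::
    "nat \<Rightarrow> complex mat set \<Rightarrow> complex mat set \<Rightarrow> (complex mat set \<times> complex mat set) topology" where
  "double_flag_topology n P1 P2 =
     quotient_topology (SL2_topology n) (\<lambda>(g, h). (g <#\<^bsub>SL n\<^esub> P1, h <#\<^bsub>SL n\<^esub> P2))"

lemma topspace_double_flag_topology:
  "topspace (double_flag_topology n P1 P2) = double_flag n P1 P2"
  unfolding double_flag_topology_def SL2_topology_def double_flag_def LCOSETS_def by force

definition diag_action ::
    "nat \<Rightarrow> complex mat \<Rightarrow> complex mat set \<times> complex mat set \<Rightarrow> complex mat set \<times> complex mat set" where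
  "diag_action n g = (\<lambda>(x, y). (g <#\<^bsub>SL n\<^esub> x, g <#\<^bsub>SL n\<^esub> y))"

end

theory Submission
  imports
    "HOL-Computational_Algebra.Fundamental_Theorem_Algebra"
    "HOL-Analysis.Topology_Euclidean_Space"
    "HOL-Combinatorics.Permutations"
    "Jordan_Normal_Form.Char_Poly"
    Defs
begin

text \<open>By the theorem of Lie and Kolchin (\<open>lie_kolchin\<close>) and the Bruhat decomposition, \<open>B\<close> is conjugate to the
 group of lower triangular matrices and \<open>P1\<close>, \<open>P2\<close> are conjugate to groups of block upper triangular
 matrices, with lists \<open>p\<close> and \<open>q\<close> of block sizes (\<open>borel_conjugate_lower\<close>, \<open>parabolic_conjugate\<close>). The
 complexity depends only on \<open>p\<close> and \<open>q\<close>, and is read off from conormal spaces: the conormal space of a Borel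
 orbit at the point \<open>(g, h)\<close> consists of the pairs \<open>(A, B)\<close> in the two nilradicals such that
 \<open>g A g\<inverse> + h B h\<inverse>\<close> is strictly lower triangular.

 If some conormal space is zero, the orbit is dense and the complexity is \<open>0\<close> (\<open>dense_borel_orbit\<close>). If
 every conormal space contains a plane, then no orbit is dense and not even a one-parameter family of orbits
 is dense (\<open>wild_family_not_dense\<close>); the closures of an orbit, of a family and of everything form a chain, and
 the complexity is at least \<open>2\<close> (\<open>codim_wild\<close>). The second property, called wild, is checked for five small
 shapes by counting unknowns and equations, and is inherited by larger and by finer shapes (\<open>wildl_grow\<close>,
 \<open>wildl_refine\<close>), because planes in conormal spaces persist in limits (\<open>plane_limit\<close>).

 The orbits of \<open>SL n\<close> are double cosets of \<open>P1\<close> and \<open>P2\<close>; by the Bruhat decomposition they are distinguished by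
 tables of natural numbers with row sums \<open>p\<close> and column sums \<open>q\<close> (\<open>card_group_orbits\<close>). The classification
 (\<open>classification\<close>) shows that a shape that neither has a dense orbit nor dominates one of the five wild shapes
 admits at most ten tables.\<close>

abbreviation SG :: "nat => complex mat set" where "SG n \<equiv> carrier (SL n)"

abbreviation sqm :: "nat => 'a mat set" where "sqm n \<equiv> carrier_mat n n"

abbreviation idm :: "nat => complex mat" where "idm n \<equiv> 1\<^sub>m n"

abbreviation zrm :: "nat => complex mat" where "zrm n \<equiv> 0\<^sub>m n n"

abbreviation smul :: "complex => complex mat => complex mat" (infixl "*%" 70) where "c *% A \<equiv> c \<cdot>\<^sub>m A"

section \<open>Finite systems of linear equations\<close>

text \<open>Gaussian elimination, in the form of a set \<open>K\<close> of free unknowns together with the solutions that form the dual basis on \<open>K\<close>.\<close>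

lemma dual_solutions:
 fixes a :: "'e => 'i => complex"
 assumes "finite E" "finite I"
 shows "\<exists>K\<subseteq>I. card I \<le> card K + card E &
  (\<exists>s. \<forall>m\<in>K. (\<forall>k\<in>K. s m k = (if k = m then 1 else 0)) & (\<forall>i. i \<notin> I --> s m i = 0) &
    (\<forall>e\<in>E. (\<Sum>i\<in>I. a e i * s m i) = 0))" using assms(1)
proof (induction rule: finite_induct)
 case empty
 show ?case by (rule exI[of _ I], simp, rule exI[of _ "%m i. if i = m then 1 else 0"]) auto
next
 case (insert e E)
 then obtain K s where K: "K \<subseteq> I" "card I \<le> card K + card E"
  and s: "\<And>m k. m \<in> K ==> k \<in> K ==> s m k = (if k = m then 1 else (0::complex))"
   "\<And>m i. m \<in> K ==> i \<notin> I ==> s m i = 0"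
   "\<And>m f. m \<in> K ==> f \<in> E ==> (\<Sum>i\<in>I. a f i * s m i) = 0" by blast
 define l where "l m = (\<Sum>i\<in>I. a e i * s m i)" for m
 show ?case
 proof (cases "\<forall>m\<in>K. l m = 0")
  case True
  thus ?thesis using K s insert.hyps unfolding l_def by (intro exI[of _ K] conjI exI[of _ s]) auto
 next
  case False
  then obtain p where p: "p \<in> K" "l p ~= 0" by auto
  define s' where "s' m i = s m i - l m / l p * s p i" for m i
  have fK: "finite K" using K(1) assms(2) finite_subset by auto
  have lin: "(\<Sum>i\<in>I. a f i * s' m i) = (\<Sum>i\<in>I. a f i * s m i) - l m / l p * (\<Sum>i\<in>I. a f i * s p i)" for f m
   unfolding s'_def by (simp add: algebra_simps sum_subtractf sum_distrib_left)
  show ?thesis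
  proof (intro exI[of _ "K - {p}"] conjI exI[of _ s'] ballI allI impI)
   show "K - {p} \<subseteq> I" using K by auto
   show "card I \<le> card (K - {p}) + card (insert e E)" using K(2) p(1) fK insert.hyps by (auto simp: card_Diff_singleton)
  next
   fix m k assume "m \<in> K - {p}" "k \<in> K - {p}"
   thus "s' m k = (if k = m then 1 else 0)" using s(1) p(1) by (simp add: s'_def)
  next
   fix m i assume "m \<in> K - {p}" "i \<notin> I"
   thus "s' m i = 0" using s(2) p(1) by (simp add: s'_def)
  next
   fix m f assume m: "m \<in> K - {p}" and f: "f \<in> insert e E"
   show "(\<Sum>i\<in>I. a f i * s' m i) = 0"
   proof (cases "f = e")
    case True
    thus ?thesis using p(2) unfolding lin by (simp add: l_def[symmetric])
   next
    case False
    thus ?thesis using f m p(1) s(3) unfolding lin by simp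
   qed
  qed
 qed
qed

lemma nonzero_solution:
 fixes a :: "'e => 'i => complex"
 assumes "finite E" "finite I" "card E < card I"
 obtains v where "\<exists>i\<in>I. v i ~= 0" "\<And>i. i \<notin> I ==> v i = 0" "\<And>e. e \<in> E ==> (\<Sum>i\<in>I. a e i * v i) = 0"
proof -
 obtain K s where K: "K \<subseteq> I" "card I \<le> card K + card E"
  and s: "\<And>m k. m \<in> K ==> k \<in> K ==> s m k = (if k = m then 1 else (0::complex))"
   "\<And>m i. m \<in> K ==> i \<notin> I ==> s m i = 0"
   "\<And>m f. m \<in> K ==> f \<in> E ==> (\<Sum>i\<in>I. a f i * s m i) = 0" using dual_solutions[OF assms(1,2), of a] by blast
 from K(2) assms(3) have "card K ~= 0" by simp
 then obtain m where m: "m \<in> K" by fastforce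
 show thesis by (rule that[of "s m"]) (use m K(1) s in \<open>auto intro!: bexI[of _ m]\<close>)
qed

lemma span_or_functional:
 fixes w :: "'z => 'i => complex" and t :: "'i => complex"
 assumes "finite Z" "finite I"
 shows "(\<exists>y. \<forall>i\<in>I. t i = (\<Sum>z\<in>Z. y z * w z i)) \<or>
  (\<exists>c. (\<forall>z\<in>Z. (\<Sum>i\<in>I. c i * w z i) = 0) & (\<Sum>i\<in>I. c i * t i) ~= 0)" using assms(1)
proof (induction arbitrary: t rule: finite_induct)
 case empty
 show ?case
 proof (cases "\<forall>i\<in>I. t i = 0")
  case False
  then obtain j where "j \<in> I" "t j ~= 0" by auto
  moreover from this have "(\<Sum>i\<in>I. (if i = j then 1 else 0) * t i) = t j"
   using assms(2) by (simp add: if_distrib[of "%x. x * _"] cong: if_cong)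
  ultimately show ?thesis by (intro disjI2 exI[of _ "%i. if i = j then 1 else 0"]) auto
 qed auto
next
 case (insert z Z)
 have extend: "\<exists>y. \<forall>i\<in>I. t i = (\<Sum>z\<in>insert z Z. y z * w z i)"
  if y: "\<forall>i\<in>I. t i - b * w z i = (\<Sum>z\<in>Z. y z * w z i)" for b y
 proof (intro exI[of _ "y(z := b)"] ballI)
  fix i assume "i \<in> I"
  have "(\<Sum>x\<in>Z. (y(z := b)) x * w x i) = (\<Sum>z\<in>Z. y z * w z i)" using insert.hyps by (intro sum.cong) auto
  thus "t i = (\<Sum>x\<in>insert z Z. (y(z := b)) x * w x i)"
   using y \<open>i \<in> I\<close> insert.hyps by (simp add: algebra_simps)
 qed
 from insert.IH[of t] show ?case
 proof
  assume "\<exists>y. \<forall>i\<in>I. t i = (\<Sum>z\<in>Z. y z * w z i)"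
  thus ?thesis using extend[of 0] by auto
 next
  assume "\<exists>c. (\<forall>z\<in>Z. (\<Sum>i\<in>I. c i * w z i) = 0) & (\<Sum>i\<in>I. c i * t i) ~= 0"
  then obtain c where c: "\<And>x. x \<in> Z ==> (\<Sum>i\<in>I. c i * w x i) = 0" "(\<Sum>i\<in>I. c i * t i) ~= 0" by blast
  define cw where "cw = (\<Sum>i\<in>I. c i * w z i)"
  define ct where "ct = (\<Sum>i\<in>I. c i * t i)"
  show ?thesis
  proof (cases "cw = 0")
   case True
   thus ?thesis using c unfolding cw_def by blast
  next
   case False
   from insert.IH[of "%i. t i - ct / cw * w z i"] show ?thesis
   proof
    assume "\<exists>y. \<forall>i\<in>I. t i - ct / cw * w z i = (\<Sum>z\<in>Z. y z * w z i)"
    thus ?thesis using extend by blast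
   next
    assume "\<exists>c. (\<forall>z\<in>Z. (\<Sum>i\<in>I. c i * w z i) = 0) & (\<Sum>i\<in>I. c i * (t i - ct / cw * w z i)) ~= 0"
    then obtain d where d: "\<And>x. x \<in> Z ==> (\<Sum>i\<in>I. d i * w x i) = 0"
     "(\<Sum>i\<in>I. d i * (t i - ct / cw * w z i)) ~= 0" by blast
    define dw where "dw = (\<Sum>i\<in>I. d i * w z i)"
    define e where "e i = d i - dw / cw * c i" for i
    have lin: "(\<Sum>i\<in>I. e i * f i) = (\<Sum>i\<in>I. d i * f i) - dw / cw * (\<Sum>i\<in>I. c i * f i)" for f
     unfolding e_def by (simp add: algebra_simps sum_subtractf sum_distrib_left)
    have eq: "(\<Sum>i\<in>I. d i * (t i - ct / cw * w z i)) = (\<Sum>i\<in>I. d i * t i) - ct / cw * dw"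
     unfolding dw_def by (simp add: algebra_simps sum_subtractf sum_distrib_left)
    have "(\<Sum>i\<in>I. e i * t i) = (\<Sum>i\<in>I. d i * t i) - ct / cw * dw" unfolding lin ct_def by (simp add: mult.commute)
    hence "(\<Sum>i\<in>I. e i * t i) ~= 0" using d(2) unfolding eq by simp
    moreover have "(\<Sum>i\<in>I. e i * w z i) = 0" unfolding lin using False by (simp add: cw_def[symmetric] dw_def[symmetric])
    moreover have "(\<Sum>i\<in>I. e i * w x i) = 0" if "x \<in> Z" for x unfolding lin using that c(1) d(1) by simp
    ultimately show ?thesis by (intro disjI2 exI[of _ e]) auto
   qed
  qed
 qed
qed

section \<open>Polynomial functions of one variable\<close>

definition is_poly :: "(complex => complex) => bool" where
 "is_poly f \<longleftrightarrow> (\<exists>p. \<forall>t. f t = poly p t)"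

definition deg_le :: "nat => (complex => complex) => bool" where
 "deg_le d f \<longleftrightarrow> (\<exists>p. degree p \<le> d & (\<forall>t. f t = poly p t))"

lemma deg_le_const [intro]: "deg_le d (%t. c)" unfolding deg_le_def by (rule exI[of _ "[:c:]"]) auto

lemma deg_le_id: "1 \<le> d ==> deg_le d (%t. t)" unfolding deg_le_def by (rule exI[of _ "[:0,1:]"]) auto

lemma deg_le_add: "deg_le d f ==> deg_le d g ==> deg_le d (%t. f t + g t)" unfolding deg_le_def by (metis degree_add_le poly_add)

lemma deg_le_mult: "deg_le d f ==> deg_le e g ==> deg_le (d + e) (%t. f t * g t)"
 unfolding deg_le_def by (metis (no_types, lifting) add_mono degree_mult_le le_trans poly_mult)

lemma deg_le_sum: "(\<And>i. i \<in> I ==> deg_le d (f i)) ==> deg_le d (%t. \<Sum>i\<in>I. f i t)"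
 by (induction I rule: infinite_finite_induct) (auto intro: deg_le_add)

lemma deg_le_prod: "finite I ==> (\<And>i. i \<in> I ==> deg_le d (f i)) ==> deg_le (card I * d) (%t. \<Prod>i\<in>I. f i t)"
 by (induction I rule: finite_induct) (auto intro: deg_le_mult)

lemma deg_le_zero:
 assumes "deg_le d f" "finite A" "card A > d" "\<And>t. t \<in> A ==> f t = 0"
 shows "f t = 0"
proof -
 obtain p where p: "degree p \<le> d" "\<And>t. f t = poly p t" using assms(1) unfolding deg_le_def by auto
 have "p = 0"
 proof (rule ccontr)
  assume "p ~= 0"
  hence "card {t. poly p t = 0} \<le> degree p" "finite {t. poly p t = 0}" by (auto simp: card_poly_roots_bound poly_roots_finite)
  moreover have "card A \<le> card {t. poly p t = 0}" using assms(4) p(2) calculation(2) by (intro card_mono) auto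
  ultimately show False using p(1) assms(3) by linarith
 qed
 thus ?thesis by (simp add: p)
qed

lemma is_poly_deg: "is_poly f \<longleftrightarrow> (\<exists>d. deg_le d f)" unfolding is_poly_def deg_le_def by auto

lemma is_poly_const [intro]: "is_poly (%t. c)"
 and is_poly_id [intro]: "is_poly (%t. t)" unfolding is_poly_deg using deg_le_const deg_le_id by blast+

lemma is_poly_add [intro]: "is_poly f ==> is_poly g ==> is_poly (%t. f t + g t)" unfolding is_poly_def by (metis poly_add)

lemma is_poly_diff [intro]: "is_poly f ==> is_poly g ==> is_poly (%t. f t - g t)" unfolding is_poly_def by (metis poly_diff)

lemma is_poly_mult [intro]: "is_poly f ==> is_poly g ==> is_poly (%t. f t * g t)" unfolding is_poly_def by (metis poly_mult)

lemma is_poly_sum [intro]: "(\<And>i. i \<in> I ==> is_poly (f i)) ==> is_poly (%t. \<Sum>i\<in>I. f i t)"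
 by (induction I rule: infinite_finite_induct) auto

lemma is_poly_prod [intro]: "(\<And>i. i \<in> I ==> is_poly (f i)) ==> is_poly (%t. \<Prod>i\<in>I. f i t)"
 by (induction I rule: infinite_finite_induct) auto

lemma is_poly_finite_zeros:
 assumes "is_poly f" "f a ~= 0"
 shows "finite {t. f t = 0}"
proof -
 obtain p where p: "\<And>t. f t = poly p t" using assms(1) unfolding is_poly_def by auto
 hence "p ~= 0" using assms(2) by auto
 thus ?thesis using poly_roots_finite[of p] by (simp add: p)
qed

lemma is_poly_continuous: "is_poly f ==> isCont f t" unfolding is_poly_def by (metis ext poly_isCont)

definition poly_mat :: "nat => (complex => complex mat) => bool" where
 "poly_mat n M \<longleftrightarrow> (\<forall>t. M t \<in> sqm n) & (\<forall>i<n. \<forall>j<n. is_poly (%t. M t $$ (i, j)))"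

lemma poly_matI:
 "(\<And>t. M t \<in> sqm n) ==> (\<And>i j. i < n ==> j < n ==> is_poly (%t. M t $$ (i, j))) ==> poly_mat n M"
 unfolding poly_mat_def by auto

lemma poly_matD:
 "poly_mat n M ==> M t \<in> sqm n"
 "poly_mat n M ==> i < n ==> j < n ==> is_poly (%t. M t $$ (i, j))" unfolding poly_mat_def by auto

lemma poly_mat_const: "A \<in> sqm n ==> poly_mat n (%t. A)" by (rule poly_matI) auto

lemma mult_mat_sum:
 assumes "A \<in> carrier_mat n m" "B \<in> carrier_mat m k" "i < n" "j < k"
 shows "(A * B) $$ (i, j) = (\<Sum>l<m. A $$ (i, l) * B $$ (l, j))" using assms by (simp add: scalar_prod_def lessThan_atLeast0)

lemma poly_mat_mult:
 assumes "poly_mat n M" "poly_mat n N"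
 shows "poly_mat n (%t. M t * N t)"
proof (rule poly_matI)
 show "M t * N t \<in> sqm n" for t using assms by (meson mult_carrier_mat poly_matD(1))
 fix i j assume ij: "i < n" "j < n"
 have eq: "(%t. (M t * N t) $$ (i, j)) = (%t. \<Sum>l<n. M t $$ (i, l) * N t $$ (l, j))"
  using mult_mat_sum[OF poly_matD(1)[OF assms(1)] poly_matD(1)[OF assms(2)] ij] by auto
 show "is_poly (%t. (M t * N t) $$ (i, j))" unfolding eq using assms ij by (auto intro!: is_poly_sum is_poly_mult dest: poly_matD(2))
qed

lemma poly_mat_det:
 assumes "poly_mat n M"
 shows "is_poly (%t. det (M t))"
proof -
 have eq: "(%t. det (M t)) = (%t. \<Sum>p\<in>{p. p permutes {0..<n}}. signof p * (\<Prod>i = 0..<n. M t $$ (i, p i)))"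
  using det_def'[OF poly_matD(1)[OF assms]] by auto
 show ?thesis unfolding eq
 proof (intro is_poly_sum is_poly_mult is_poly_const is_poly_prod)
  fix p i assume p: "p \<in> {p. p permutes {0..<n}}" "i \<in> {0..<n}"
  hence "p i < n" using permutes_in_image[of p "{0..<n}" i] by auto
  thus "is_poly (%t. M t $$ (i, p i))" using p poly_matD(2)[OF assms] by auto
 qed
qed

lemma poly_mat_adj:
 assumes "poly_mat n M"
 shows "poly_mat n (%t. adj_mat (M t))"
proof (rule poly_matI)
 show "adj_mat (M t) \<in> sqm n" for t using adj_mat(1)[OF poly_matD(1)[OF assms]] .
 fix i j assume ij: "i < n" "j < n"
 have dim: "dim_row (M t) = n" "dim_col (M t) = n" for t using poly_matD(1)[OF assms, of t] by auto
 have eq: "(%t. adj_mat (M t) $$ (i, j)) = (%t. (-1)^(j+i) * det (mat_delete (M t) j i))"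
  using ij by (simp add: adj_mat_def cofactor_def dim)
 have "poly_mat (n - 1) (%t. mat_delete (M t) j i)"
 proof (rule poly_matI)
  show "mat_delete (M t) j i \<in> carrier_mat (n - 1) (n - 1)" for t by (rule mat_delete_carrier[OF poly_matD(1)[OF assms]])
  fix k l assume "k < n - 1" "l < n - 1"
  thus "is_poly (%t. mat_delete (M t) j i $$ (k, l))" unfolding mat_delete_def using dim ij by (auto intro!: poly_matD(2)[OF assms])
 qed
 thus "is_poly (%t. adj_mat (M t) $$ (i, j))" unfolding eq by (intro is_poly_mult is_poly_const poly_mat_det)
qed

definition seg :: "complex mat => complex mat => complex => complex mat" where
 "seg A B t = (1 - t) *% A + t *% B"

lemma seg_carrier [simp]: "A \<in> carrier_mat n m ==> B \<in> carrier_mat n m ==> seg A B t \<in> carrier_mat n m"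
 unfolding seg_def by auto

lemma seg_0: "A \<in> carrier_mat n m ==> B \<in> carrier_mat n m ==> seg A B 0 = A"
 and seg_1: "A \<in> carrier_mat n m ==> B \<in> carrier_mat n m ==> seg A B 1 = B" unfolding seg_def by (auto intro!: eq_matI)

lemma seg_index: "A \<in> carrier_mat n m ==> B \<in> carrier_mat n m ==> i < n ==> j < m ==>
 seg A B t $$ (i, j) = (1 - t) * A $$ (i, j) + t * B $$ (i, j)" unfolding seg_def by auto

lemma poly_mat_seg: "A \<in> sqm n ==> B \<in> sqm n ==> poly_mat n (seg A B)"
 by (rule poly_matI) (auto simp: seg_index intro!: is_poly_add is_poly_mult is_poly_diff)

lemma seg_invertible:
 assumes "A \<in> sqm n" "B \<in> sqm n" "det A ~= 0 \<or> det B ~= 0"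
 shows "finite {t. det (seg A B t) = 0}" using assms is_poly_finite_zeros[OF poly_mat_det[OF poly_mat_seg[OF assms(1,2)]], of 0]
  is_poly_finite_zeros[OF poly_mat_det[OF poly_mat_seg[OF assms(1,2)]], of 1] by (auto simp: seg_0 seg_1)

section \<open>Invertible matrices and pattern algebras\<close>

declare assoc_mult_mat [simp del]

definition GL :: "nat => complex mat set" where
 "GL n = {g \<in> sqm n. det g ~= 0}"

definition ginv :: "complex mat => complex mat" where
 "ginv g = (1 / det g) *% adj_mat g"

lemma GLI: "g \<in> sqm n ==> det g ~= 0 ==> g \<in> GL n"
 and GL_det: "g \<in> GL n ==> det g ~= 0"
 and GL_carrier [simp]: "g \<in> GL n ==> g \<in> sqm n" by (simp_all add: GL_def)

lemma ginv_carrier [simp]: "g \<in> GL n ==> ginv g \<in> sqm n"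
 unfolding ginv_def by (rule smult_carrier_mat, rule adj_mat(1), rule GL_carrier)

lemma ginv_right [simp]: "g \<in> GL n ==> g * ginv g = idm n"
proof -
 assume g: "g \<in> GL n"
 hence c: "g \<in> sqm n" "det g ~= 0" unfolding GL_def by blast+
 have "g * ginv g = (1 / det g) *% (g * adj_mat g)" unfolding ginv_def by (rule mult_smult_distrib[OF c(1) adj_mat(1)[OF c(1)]])
 also have "\<dots> = idm n" unfolding adj_mat(2)[OF c(1)] using c(2) by (auto intro!: eq_matI)
 finally show ?thesis .
qed

lemma ginv_left [simp]: "g \<in> GL n ==> ginv g * g = idm n" by (rule mat_mult_left_right_inverse[of g n "ginv g"]) simp_all

lemma mult_assoc_sq:
 "A \<in> sqm n ==> B \<in> sqm n ==> C \<in> sqm n ==> (A * B) * C = A * (B * (C :: complex mat))" by (rule assoc_mult_mat)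

lemma mult_sq [simp]:
 "A \<in> sqm n ==> B \<in> sqm n ==> A * B \<in> sqm n" by (rule mult_carrier_mat)

lemma GL_I: "g \<in> sqm n ==> h \<in> sqm n ==> g * h = idm n ==> g \<in> GL n" using det_mult[of g n h] by (intro GLI) auto

lemma ginv_GL [simp]: "g \<in> GL n ==> ginv g \<in> GL n" using GL_I[of "ginv g" n g] by simp

lemma GL_mult [simp]: "g \<in> GL n ==> h \<in> GL n ==> g * h \<in> GL n" using det_mult[of g n h] by (auto intro!: GLI simp: GL_det)

lemma one_GL [simp]: "idm n \<in> GL n" by (rule GLI) auto

lemma ginv_left_cancel [simp]: "g \<in> GL n ==> A \<in> sqm n ==> ginv g * (g * A) = A"
 by (subst mult_assoc_sq[of _ n, symmetric]) auto

lemma ginv_right_cancel [simp]: "g \<in> GL n ==> A \<in> sqm n ==> g * (ginv g * A) = A"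
 by (subst mult_assoc_sq[of _ n, symmetric]) auto

lemma ginv_unique:
 assumes "g \<in> GL n" "h \<in> sqm n" "g * h = idm n"
 shows "ginv g = h"
proof -
 have "h = ginv g * (g * h)" using assms(1,2) by simp
 thus ?thesis unfolding assms(3) using ginv_carrier[OF assms(1)] by simp
qed

lemma ginv_mult: "g \<in> GL n ==> h \<in> GL n ==> ginv (g * h) = ginv h * ginv g"
proof (rule ginv_unique[of _ n])
 assume gh: "g \<in> GL n" "h \<in> GL n"
 have "g * h * (ginv h * ginv g) = g * (h * (ginv h * ginv g))" using gh by (intro mult_assoc_sq[of _ n]) auto
 thus "g * h * (ginv h * ginv g) = idm n" using gh by simp
qed auto

lemma ginv_ginv [simp]: "g \<in> GL n ==> ginv (ginv g) = g" by (rule ginv_unique[of _ n]) auto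

lemma ginv_one [simp]: "ginv (idm n) = idm n" by (rule ginv_unique[of _ n]) auto

definition par :: "nat => (nat => nat) => complex mat set" where
 "par n \<sigma> = {A \<in> sqm n. \<forall>i<n. \<forall>j<n. \<sigma> j < \<sigma> i --> A $$ (i, j) = 0}"

abbreviation upr :: "nat => complex mat set" where "upr n \<equiv> par n (%i. i)"

definition nilrad :: "nat => (nat => nat) => complex mat set" where
 "nilrad n \<sigma> = {A \<in> sqm n. \<forall>i<n. \<forall>j<n. \<sigma> j \<le> \<sigma> i --> A $$ (i, j) = 0}"

definition low :: "nat => complex mat set" where
 "low n = par n (%i. n - i)"

lemma parI: "A \<in> sqm n ==> (\<And>i j. i < n ==> j < n ==> \<sigma> j < \<sigma> i ==> A $$ (i, j) = 0) ==> A \<in> par n \<sigma>"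
 and parD: "A \<in> par n \<sigma> ==> i < n ==> j < n ==> \<sigma> j < \<sigma> i ==> A $$ (i, j) = 0"
 and nilradI: "A \<in> sqm n ==> (\<And>i j. i < n ==> j < n ==> \<sigma> j \<le> \<sigma> i ==> A $$ (i, j) = 0) ==> A \<in> nilrad n \<sigma>"
 and nilradD: "A \<in> nilrad n \<sigma> ==> i < n ==> j < n ==> \<sigma> j \<le> \<sigma> i ==> A $$ (i, j) = 0"
 and lowI: "A \<in> sqm n ==> (\<And>i j. i < n ==> j < n ==> i < j ==> A $$ (i, j) = 0) ==> A \<in> low n"
 and lowD: "A \<in> low n ==> i < n ==> j < n ==> i < j ==> A $$ (i, j) = 0" by (auto simp: par_def nilrad_def low_def diff_less_mono2)

lemma par_carrier [simp]: "A \<in> par n \<sigma> ==> A \<in> sqm n"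
 and nilrad_carrier [simp]: "A \<in> nilrad n \<sigma> ==> A \<in> sqm n"
 and low_carrier [simp]: "A \<in> low n ==> A \<in> sqm n" by (auto simp: par_def nilrad_def low_def)

lemma par_one [simp]: "idm n \<in> par n \<sigma>" by (rule parI) auto

lemma low_one [simp]: "idm n \<in> low n" by (rule lowI) auto

lemma par_mult [simp]:
 assumes "A \<in> par n \<sigma>" "B \<in> par n \<sigma>" shows "A * B \<in> par n \<sigma>"
proof (rule parI)
 fix i j assume ij: "i < n" "j < n" "\<sigma> j < \<sigma> i"
 have "A $$ (i, l) * B $$ (l, j) = 0" if "l < n" for l
  using parD[OF assms(1) ij(1) that] parD[OF assms(2) that ij(2)] ij(3) by (cases "\<sigma> l < \<sigma> i") auto
 thus "(A * B) $$ (i, j) = 0" using assms ij by (subst mult_mat_sum[of _ n n _ n]) (auto intro!: sum.neutral)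
qed (use assms in simp)

lemma low_mult [simp]: "A \<in> low n ==> B \<in> low n ==> A * B \<in> low n" unfolding low_def by (rule par_mult)

lemma par_nilrad_mult:
 assumes "A \<in> par n \<sigma>" "B \<in> nilrad n \<sigma>" shows "A * B \<in> nilrad n \<sigma>" "B * A \<in> nilrad n \<sigma>"
proof -
 show "A * B \<in> nilrad n \<sigma>"
 proof (rule nilradI)
  fix i j assume ij: "i < n" "j < n" "\<sigma> j \<le> \<sigma> i"
  have "A $$ (i, l) * B $$ (l, j) = 0" if "l < n" for l
   using parD[OF assms(1) ij(1) that] nilradD[OF assms(2) that ij(2)] ij(3) by (cases "\<sigma> l < \<sigma> i") auto
  thus "(A * B) $$ (i, j) = 0" using assms ij by (subst mult_mat_sum[of _ n n _ n]) (auto intro!: sum.neutral)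
 qed (use assms in simp)
 show "B * A \<in> nilrad n \<sigma>"
 proof (rule nilradI)
  fix i j assume ij: "i < n" "j < n" "\<sigma> j \<le> \<sigma> i"
  have "B $$ (i, l) * A $$ (l, j) = 0" if "l < n" for l
   using parD[OF assms(1) that ij(2)] nilradD[OF assms(2) ij(1) that] ij(3) by (cases "\<sigma> l \<le> \<sigma> i") auto
  thus "(B * A) $$ (i, j) = 0" using assms ij by (subst mult_mat_sum[of _ n n _ n]) (auto intro!: sum.neutral)
 qed (use assms in simp)
qed

lemma index_lin [simp]:
 "A \<in> sqm n ==> B \<in> sqm n ==> i < n ==> j < n ==>
  (a *% A + b *% B) $$ (i, j) = a * A $$ (i, j) + b * (B $$ (i, j) :: complex)" by auto

lemma index_add_sq:
 "A \<in> sqm n ==> B \<in> sqm n ==> i < n ==> j < n ==>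
  (A + B) $$ (i, j) = A $$ (i, j) + (B $$ (i, j) :: complex)" by auto

lemma index_smult_sq:
 "A \<in> sqm n ==> i < n ==> j < n ==> (a *% A) $$ (i, j) = a * (A $$ (i, j) :: complex)" by auto

lemma lin_carrier [simp]:
 "A \<in> sqm n ==> B \<in> sqm n ==> a *% A + b *% (B :: complex mat) \<in> sqm n" by auto

lemma nilrad_lin:
 assumes "A \<in> nilrad n \<sigma>" "B \<in> nilrad n \<sigma>" shows "a *% A + b *% B \<in> nilrad n \<sigma>"
 using assms by (intro nilradI) (simp_all add: nilradD[OF assms(1)] nilradD[OF assms(2)] index_lin[of _ n])

lemma par_lin:
 assumes "A \<in> par n \<sigma>" "B \<in> par n \<sigma>" shows "a *% A + b *% B \<in> par n \<sigma>"
 using assms by (intro parI) (simp_all add: parD[OF assms(1)] parD[OF assms(2)] index_lin[of _ n])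

lemma par_smult:
 assumes "A \<in> par n \<sigma>" shows "a *% A \<in> par n \<sigma>"
 using assms carrier_matD[OF par_carrier[OF assms]] by (intro parI) (auto simp: parD[OF assms])

lemma coord_sum:
 fixes v :: "nat \<times> nat => complex"
 assumes "I \<subseteq> {..<n} \<times> {..<n}" "\<And>p. p \<notin> I ==> v p = 0"
 shows "(\<Sum>p\<in>I. f p * v p) = (\<Sum>i<n. \<Sum>j<n. f (i, j) * v (i, j))"
proof -
 have "(\<Sum>p\<in>I. f p * v p) = (\<Sum>p\<in>{..<n} \<times> {..<n}. f p * v p)" using assms by (intro sum.mono_neutral_left) auto
 thus ?thesis by (simp add: sum.cartesian_product case_prod_unfold)
qed

text \<open>The unknowns are the entries of \<open>y\<close> and a scalar \<open>s\<close>, the equations say \<open>x y = s\<close>; there is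
 one unknown more than there are equations, and \<open>s = 0\<close> would force \<open>y = 0\<close>.\<close>

lemma par_ginv [simp]:
 assumes "x \<in> par n \<sigma>" "x \<in> GL n"
 shows "ginv x \<in> par n \<sigma>"
proof -
 define I where "I = {(i, j). i < n & j < n & \<sigma> i \<le> \<sigma> j}"
 have fin: "finite I" unfolding I_def by (rule finite_subset[of _ "{..<n} \<times> {..<n}"]) auto
 define a where "a e p = (case p of None => (if fst e = snd e then - 1 else 0)
   | Some (i, j) => if j = snd e then x $$ (fst e, i) else 0)" for e :: "nat \<times> nat" and p
 have "card I < card (insert None (Some ` I))" using fin by (subst card_insert_disjoint) (auto simp: card_image)
 then obtain v where v: "\<exists>p\<in>insert None (Some ` I). v p ~= 0" "\<And>p. p \<notin> insert None (Some ` I) ==> v p = 0"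
  "\<And>e. e \<in> I ==> (\<Sum>p\<in>insert None (Some ` I). a e p * v p) = 0"
  using nonzero_solution[of I "insert None (Some ` I)" a] fin by blast
 define y where "y = mat n n (%p. v (Some p))"
 have yc: "y \<in> sqm n" by (simp add: y_def)
 have yp: "y \<in> par n \<sigma>"
 proof (rule parI)
  fix i j assume "i < n" "j < n" "\<sigma> j < \<sigma> i"
  thus "y $$ (i, j) = 0" using v(2)[of "Some (i, j)"] by (auto simp: y_def I_def image_iff)
 qed (rule yc)
 have xy: "x * y = v None *% idm n"
 proof (rule eq_matI)
  fix r c assume "r < dim_row (v None *% idm n)" "c < dim_col (v None *% idm n)"
  hence rc: "r < n" "c < n" by auto
  show "(x * y) $$ (r, c) = (v None *% idm n) $$ (r, c)"
  proof (cases "(r, c) \<in> I")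
   case True
   have "(\<Sum>p\<in>I. a (r, c) (Some p) * v (Some p)) = (\<Sum>i<n. \<Sum>j<n. a (r, c) (Some (i, j)) * v (Some (i, j)))"
    using v(2) by (intro coord_sum) (auto simp: I_def image_iff)
   also have "\<dots> = (\<Sum>i<n. \<Sum>j<n. if j = c then x $$ (r, i) * v (Some (i, j)) else 0)"
    by (intro sum.cong) (auto simp: a_def)
   also have "\<dots> = (\<Sum>i<n. x $$ (r, i) * v (Some (i, c)))" using rc by (simp add: sum.delta)
   also have "\<dots> = (x * y) $$ (r, c)" using mult_mat_sum[OF par_carrier[OF assms(1)] yc rc] rc by (simp add: y_def)
   finally have *: "(\<Sum>p\<in>I. a (r, c) (Some p) * v (Some p)) = (x * y) $$ (r, c)" .
   have "a (r, c) None * v None + (\<Sum>p\<in>I. a (r, c) (Some p) * v (Some p)) = 0"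
    using v(3)[OF True] fin by (simp add: sum.reindex)
   thus ?thesis using rc unfolding * by (auto simp: a_def add_eq_0_iff split: if_splits)
  next
   case False
   hence "(x * y) $$ (r, c) = 0" "r ~= c" using parD[OF par_mult[OF assms(1) yp] rc] rc by (auto simp: I_def not_le)
   thus ?thesis using rc by simp
  qed
 qed (use carrier_matD[OF par_carrier[OF assms(1)]] yc in auto)
 have "v None ~= 0"
 proof
  assume 0: "v None = 0"
  have "y = ginv x * (x * y)" using assms yc by simp
  also have "\<dots> = zrm n"
  proof -
   have z: "0 *% idm n = (zrm n :: complex mat)" by (rule eq_matI) auto
   show ?thesis unfolding xy 0 z using ginv_carrier[OF assms(2)] by simp
  qed
  finally have "\<And>i j. i < n ==> j < n ==> v (Some (i, j)) = 0" unfolding y_def by (metis index_mat(1) index_zero_mat(1))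
  thus False using v(1) 0 by (auto simp: I_def)
 qed
 have "x * ((1 / v None) *% y) = (1 / v None) *% (x * y)" using assms yc by (simp add: mult_smult_distrib[of _ n n _ n])
 also have "\<dots> = idm n" unfolding xy using \<open>v None ~= 0\<close> by (auto intro!: eq_matI)
 finally have "ginv x = (1 / v None) *% y" using assms yc by (intro ginv_unique[of _ n]) auto
 thus ?thesis using par_smult[OF yp] by simp
qed

lemma low_ginv [simp]: "x \<in> low n ==> x \<in> GL n ==> ginv x \<in> low n" unfolding low_def by (rule par_ginv)

section \<open>Conormal spaces of triples of flags\<close>

definition conormal ::
  "nat => (nat => nat) => (nat => nat) => complex mat => complex mat => complex mat => complex mat => bool" where
 "conormal n \<sigma> \<tau> g h A B \<longleftrightarrow> A \<in> nilrad n \<sigma> & B \<in> nilrad n \<tau> &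
   (\<forall>r<n. \<forall>c<n. r \<le> c --> (g * A * ginv g + h * B * ginv h) $$ (r, c) = 0)"

definition indep2 :: "nat => complex mat => complex mat => complex mat => complex mat => bool" where
 "indep2 n A B A' B' \<longleftrightarrow> (\<forall>a b. a *% A + b *% A' = zrm n --> a *% B + b *% B' = zrm n --> a = 0 & b = 0)"

definition plane :: "nat => (nat => nat) => (nat => nat) => complex mat => complex mat => bool" where
 "plane n \<sigma> \<tau> g h \<longleftrightarrow>
   (\<exists>A B A' B'. conormal n \<sigma> \<tau> g h A B & conormal n \<sigma> \<tau> g h A' B' & indep2 n A B A' B')"

definition wild :: "nat => (nat => nat) => (nat => nat) => bool" where
 "wild n \<sigma> \<tau> \<longleftrightarrow> (\<forall>g\<in>GL n. \<forall>h\<in>GL n. plane n \<sigma> \<tau> g h)"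

definition lam :: "nat => (nat => nat => complex) => complex mat => complex" where
 "lam n l A = (\<Sum>i<n. \<Sum>j<n. l i j * A $$ (i, j))"

lemma lam_lin:
 "A \<in> sqm n ==> B \<in> sqm n ==> lam n l (a *% A + b *% B) = a * lam n l A + b * lam n l B"
 by (simp add: lam_def sum_distrib_left sum.distrib algebra_simps index_lin[of _ n] del: index_add_mat)

lemma conj_lin:
 assumes "g \<in> sqm n" "k \<in> sqm n" "A \<in> sqm n" "B \<in> sqm n"
 shows "g * (a *% A + b *% B) * k = a *% (g * A * k) + b *% (g * B * k :: complex mat)"
proof -
 have "g * (a *% A + b *% B) = a *% (g * A) + b *% (g * B)"
  using assms by (simp add: mult_add_distrib_mat[of _ n n _ n] mult_smult_distrib[of _ n n _ n])
 thus ?thesis using assms by (simp add: add_mult_distrib_mat[of _ n n _ _ n] mult_smult_assoc_mat[of _ n n _ n])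
qed

lemma conormal_lin:
 assumes "g \<in> GL n" "h \<in> GL n" "conormal n \<sigma> \<tau> g h A B" "conormal n \<sigma> \<tau> g h A' B'"
 shows "conormal n \<sigma> \<tau> g h (a *% A + b *% A') (a *% B + b *% B')"
proof -
 have c: "A \<in> sqm n" "B \<in> sqm n" "A' \<in> sqm n" "B' \<in> sqm n" using assms(3,4) by (auto simp: conormal_def)
 have k: "g * A * ginv g \<in> sqm n" "g * A' * ginv g \<in> sqm n"
   "h * B * ginv h \<in> sqm n" "h * B' * ginv h \<in> sqm n" using c assms(1,2) by auto
 show ?thesis unfolding conormal_def
 proof (intro conjI allI impI)
  fix r s assume rs: "r < n" "s < n" "r \<le> s"
  have "(g * A * ginv g + h * B * ginv h) $$ (r, s) = 0" "(g * A' * ginv g + h * B' * ginv h) $$ (r, s) = 0"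
   using assms(3,4) rs by (auto simp: conormal_def)
  hence e: "(g * A * ginv g) $$ (r, s) + (h * B * ginv h) $$ (r, s) = 0"
   "(g * A' * ginv g) $$ (r, s) + (h * B' * ginv h) $$ (r, s) = 0"
   using k rs by (simp_all add: index_add_sq[of _ n] del: index_mult_mat(1) index_add_mat)
  have "(g * (a *% A + b *% A') * ginv g + h * (a *% B + b *% B') * ginv h) $$ (r, s)
   = a * ((g * A * ginv g) $$ (r, s) + (h * B * ginv h) $$ (r, s)) + b * ((g * A' * ginv g) $$ (r, s) + (h * B' * ginv h) $$ (r, s))"
   using c k rs assms(1,2) by (simp add: conj_lin[of _ n] index_add_sq[of _ n] index_smult_sq[of _ n] index_lin[of _ n] algebra_simps del: index_mult_mat(1) index_add_mat index_smult_mat)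
  thus "(g * (a *% A + b *% A') * ginv g + h * (a *% B + b *% B') * ginv h) $$ (r, s) = 0" unfolding e by simp
 qed (use assms(3,4) in \<open>auto simp: conormal_def intro!: nilrad_lin\<close>)
qed

lemma plane_iff:
 assumes g: "g \<in> GL n" "h \<in> GL n"
 shows "plane n \<sigma> \<tau> g h \<longleftrightarrow>
  (\<forall>l m. \<exists>A B. conormal n \<sigma> \<tau> g h A B & (A ~= zrm n \<or> B ~= zrm n) & lam n l A + lam n m B = 0)"
 (is "?L \<longleftrightarrow> ?R")
proof
 assume ?L
 then obtain A B A' B' where 1: "conormal n \<sigma> \<tau> g h A B" "conormal n \<sigma> \<tau> g h A' B'" "indep2 n A B A' B'"
  unfolding plane_def by blast
 have c: "A \<in> sqm n" "B \<in> sqm n" "A' \<in> sqm n" "B' \<in> sqm n" using 1 by (auto simp: conormal_def)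
 show ?R
 proof (intro allI)
  fix l m
  define x where "x = lam n l A + lam n m B"
  define y where "y = lam n l A' + lam n m B'"
  define a where "a = (if y = 0 then 0 else y)"
  define b where "b = (if y = 0 then 1 else - x)"
  have ab: "a ~= 0 \<or> b ~= 0" "a * x + b * y = 0" by (auto simp: a_def b_def)
  show "\<exists>A B. conormal n \<sigma> \<tau> g h A B & (A ~= zrm n \<or> B ~= zrm n) & lam n l A + lam n m B = 0"
  proof (intro exI conjI)
   show "conormal n \<sigma> \<tau> g h (a *% A + b *% A') (a *% B + b *% B')" by (rule conormal_lin[OF g 1(1,2)])
   show "a *% A + b *% A' ~= zrm n \<or> a *% B + b *% B' ~= zrm n" using 1(3) ab(1) unfolding indep2_def by blast
   show "lam n l (a *% A + b *% A') + lam n m (a *% B + b *% B') = 0" using ab(2) c by (simp add: lam_lin x_def y_def algebra_simps)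
  qed
 qed
next
 assume R: ?R
 obtain A B where 1: "conormal n \<sigma> \<tau> g h A B" "A ~= zrm n \<or> B ~= zrm n"
  using R[rule_format, of "%_ _. 0" "%_ _. 0"] by auto
 have c: "A \<in> sqm n" "B \<in> sqm n" using 1 by (auto simp: conormal_def)
 have "(\<exists>i<n. \<exists>j<n. A $$ (i, j) ~= 0) \<or> (\<exists>i<n. \<exists>j<n. B $$ (i, j) ~= 0)"
  using 1(2) c by (metis carrier_matD eq_matI index_zero_mat)
 then obtain l m where lm: "lam n l A + lam n m B ~= 0"
 proof (elim disjE exE conjE)
  fix i j assume "i < n" "j < n" "A $$ (i, j) ~= 0"
  moreover have "lam n (%p q. if p = i then if q = j then 1 else 0 else 0) A + lam n (%_ _. 0) B = A $$ (i, j)"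
   using \<open>i < n\<close> \<open>j < n\<close> by (simp add: lam_def if_distrib[of "%x. x * _"] sum.If_cases cong: if_cong)
  ultimately show thesis using that by metis
 next
  fix i j assume "i < n" "j < n" "B $$ (i, j) ~= 0"
  moreover have "lam n (%_ _. 0) A + lam n (%p q. if p = i then if q = j then 1 else 0 else 0) B = B $$ (i, j)"
   using \<open>i < n\<close> \<open>j < n\<close> by (simp add: lam_def if_distrib[of "%x. x * _"] sum.If_cases cong: if_cong)
  ultimately show thesis using that by metis
 qed
 obtain A' B' where 2: "conormal n \<sigma> \<tau> g h A' B'" "A' ~= zrm n \<or> B' ~= zrm n" "lam n l A' + lam n m B' = 0"
  using R by blast
 have c': "A' \<in> sqm n" "B' \<in> sqm n" using 2 by (auto simp: conormal_def)
 have "indep2 n A B A' B'" unfolding indep2_def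
 proof (intro allI impI)
  fix a b assume e: "a *% A + b *% A' = zrm n" "a *% B + b *% B' = zrm n"
  have "lam n l (a *% A + b *% A') + lam n m (a *% B + b *% B') = 0" unfolding e by (simp add: lam_def)
  hence "a * (lam n l A + lam n m B) + b * (lam n l A' + lam n m B') = 0" using c c' by (simp add: lam_lin algebra_simps)
  hence a: "a = 0" using lm 2(3) by simp
  have "b = 0"
  proof (rule ccontr)
   assume "b ~= 0"
   moreover have "b * A' $$ (i, j) = 0" "b * B' $$ (i, j) = 0" if "i < n" "j < n" for i j
    using arg_cong[OF e(1), of "%M. M $$ (i, j)"] arg_cong[OF e(2), of "%M. M $$ (i, j)"] that c c' a by auto
   ultimately have "A' = zrm n" "B' = zrm n" using c' by (auto intro!: eq_matI)
   thus False using 2(2) by auto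
  qed
  with a show "a = 0 & b = 0" by simp
 qed
 with 1 2 show ?L unfolding plane_def by blast
qed

section \<open>Semicontinuity\<close>

lemma subseq_coords:
 fixes f :: "nat => 'i => complex"
 assumes "finite I" "\<And>i. i \<in> I ==> bounded (range (%k. f k i))"
 shows "\<exists>r l. strict_mono r & (\<forall>i\<in>I. (%k. f (r k) i) \<longlonglongrightarrow> l i)" using assms
proof (induction I rule: finite_induct)
 case empty
 show ?case by (rule exI[of _ id]) (auto simp: strict_mono_def)
next
 case (insert i I)
 then obtain r l where r: "strict_mono r" "\<And>i. i \<in> I ==> (%k. f (r k) i) \<longlonglongrightarrow> l i" by auto
 have "bounded (range (%k. f (r k) i))" by (rule bounded_subset[OF insert.prems[of i]]) auto
 then obtain l' r' where r': "strict_mono r'" "((%k. f (r k) i) \<circ> r') \<longlonglongrightarrow> l'"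
  using bounded_imp_convergent_subsequence by blast
 have "(%k. f ((r \<circ> r') k) j) \<longlonglongrightarrow> (l(i := l')) j" if "j \<in> insert i I" for j
  using r'(2) LIMSEQ_subseq_LIMSEQ[OF r(2)[of j] r'(1)] that insert.hyps by (auto simp: o_def)
 moreover have "strict_mono (r \<circ> r')" using r(1) r'(1) by (rule strict_mono_o)
 ultimately show ?case by blast
qed

lemma limit_solution:
 fixes a :: "complex => 'e => 'i => complex"
 assumes fin: "finite I" "finite F"
  and cont: "\<And>e i. e \<in> E ==> i \<in> I ==> isCont (%t. a t e i) t0"
  and sol: "\<And>t. t \<notin> F ==> \<exists>v. (\<exists>i\<in>I. v i ~= 0) & (\<forall>e\<in>E. (\<Sum>i\<in>I. a t e i * v i) = 0)"
 shows "\<exists>v. (\<exists>i\<in>I. v i ~= 0) & (\<forall>e\<in>E. (\<Sum>i\<in>I. a t0 e i * v i) = 0)"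
proof -
 define s where "s k = t0 + of_real (inverse (real (Suc k)))" for k
 have "inj s" unfolding s_def by (auto simp: inj_def)
 hence "finite (s -` F)" using fin(2) by (rule finite_vimageI[rotated])
 then obtain N where N: "\<And>k. s k \<in> F ==> k < N" by (metis finite_nat_set_iff_bounded vimageI)
 define t where "t k = s (k + N)" for k
 have tF: "t k \<notin> F" for k using N[of "k + N"] by (auto simp: t_def)
 have "(%k. of_real (inverse (real (Suc k))) :: complex) \<longlonglongrightarrow> of_real 0"
  using LIMSEQ_inverse_real_of_nat by (rule tendsto_of_real)
 hence "s \<longlonglongrightarrow> t0 + of_real 0" unfolding s_def by (intro tendsto_add tendsto_const)
 hence lim: "t \<longlonglongrightarrow> t0" unfolding t_def by (simp add: LIMSEQ_ignore_initial_segment)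
 obtain v where v: "\<And>k. \<exists>i\<in>I. v k i ~= (0::complex)" "\<And>k e. e \<in> E ==> (\<Sum>i\<in>I. a (t k) e i * v k i) = 0"
  using sol[OF tF] by metis
 define S where "S k = (\<Sum>i\<in>I. cmod (v k i))" for k
 have S: "S k > 0" for k unfolding S_def using v(1)[of k] fin(1) by (auto intro: sum_pos2)
 define V where "V k i = v k i / of_real (S k)" for k i
 have V1: "(\<Sum>i\<in>I. cmod (V k i)) = 1" for k
  using S[of k] unfolding V_def by (simp add: norm_divide sum_divide_distrib[symmetric] S_def[symmetric])
 have VE: "(\<Sum>i\<in>I. a (t k) e i * V k i) = 0" if "e \<in> E" for k e
  using v(2)[OF that, of k] unfolding V_def by (simp add: sum_divide_distrib[symmetric])
 have "bounded (range (%k. V k i))" if "i \<in> I" for i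
 proof -
  have "cmod (V k i) \<le> 1" for k using member_le_sum[of i I "%i. cmod (V k i)"] that fin(1) V1[of k] by auto
  thus ?thesis unfolding bounded_iff by blast
 qed
 then obtain r l where r: "strict_mono r" "\<And>i. i \<in> I ==> (%k. V (r k) i) \<longlonglongrightarrow> l i"
  using subseq_coords[OF fin(1), of V] by blast
 have limr: "(%k. t (r k)) \<longlonglongrightarrow> t0" using LIMSEQ_subseq_LIMSEQ[OF lim r(1)] by (simp add: o_def)
 have "(\<Sum>i\<in>I. a t0 e i * l i) = 0" if "e \<in> E" for e
 proof -
  have "(%k. \<Sum>i\<in>I. a (t (r k)) e i * V (r k) i) \<longlonglongrightarrow> (\<Sum>i\<in>I. a t0 e i * l i)"
   using r(2) isCont_tendsto_compose[OF cont[OF that] limr] by (intro tendsto_sum tendsto_mult) auto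
  thus ?thesis using VE[OF that] by (simp add: LIMSEQ_const_iff)
 qed
 moreover have "(\<Sum>i\<in>I. cmod (l i)) = 1"
 proof -
  have "(%k. \<Sum>i\<in>I. cmod (V (r k) i)) \<longlonglongrightarrow> (\<Sum>i\<in>I. cmod (l i))"
   using r(2) by (intro tendsto_sum tendsto_norm) auto
  thus ?thesis using V1 by (simp add: LIMSEQ_const_iff)
 qed
 hence "\<exists>i\<in>I. l i ~= 0" by (metis norm_zero sum.neutral zero_neq_one)
 ultimately show ?thesis by blast
qed

definition unk :: "nat => (nat => nat) => (nat => nat) => (bool \<times> nat \<times> nat) set" where
 "unk n \<sigma> \<tau> = {(b, i, j). i < n & j < n & (if b then \<sigma> i < \<sigma> j else \<tau> i < \<tau> j)}"

definition entry2 :: "complex mat => complex mat => bool \<times> nat \<times> nat => complex" where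
 "entry2 A B u = (if fst u then A $$ snd u else B $$ snd u)"

lemma finite_unk [simp]: "finite (unk n \<sigma> \<tau>)"
 by (rule finite_subset[of _ "UNIV \<times> {..<n} \<times> {..<n}"]) (auto simp: unk_def)

lemma unk_sum:
 assumes "A \<in> nilrad n \<sigma>" "B \<in> nilrad n \<tau>"
 shows "(\<Sum>u\<in>unk n \<sigma> \<tau>. f u * entry2 A B u) =
  (\<Sum>i<n. \<Sum>j<n. f (True, i, j) * A $$ (i, j)) + (\<Sum>i<n. \<Sum>j<n. f (False, i, j) * B $$ (i, j))"
proof -
 have n1: "\<sigma> i < \<sigma> j" if "A $$ (i, j) ~= 0" "i < n" "j < n" for i j using nilradD[OF assms(1)] that not_less by blast
 have n2: "\<tau> i < \<tau> j" if "B $$ (i, j) ~= 0" "i < n" "j < n" for i j using nilradD[OF assms(2)] that not_less by blast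
 have "(\<Sum>u\<in>unk n \<sigma> \<tau>. f u * entry2 A B u) = (\<Sum>u\<in>UNIV \<times> ({..<n} \<times> {..<n}). f u * entry2 A B u)"
  by (rule sum.mono_neutral_left)
    (auto simp: unk_def entry2_def n1 n2 split: if_splits)
 also have "\<dots> = (\<Sum>b\<in>UNIV. \<Sum>p\<in>{..<n} \<times> {..<n}. f (b, p) * entry2 A B (b, p))"
  by (simp add: sum.cartesian_product case_prod_unfold)
 also have "\<dots> = (\<Sum>p\<in>{..<n} \<times> {..<n}. f (True, p) * A $$ p) + (\<Sum>p\<in>{..<n} \<times> {..<n}. f (False, p) * B $$ p)"
  by (simp add: UNIV_bool entry2_def add.commute)
 finally show ?thesis by (simp add: sum.cartesian_product case_prod_unfold)
qed

lemma conj_entry: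
 assumes "g \<in> sqm n" "A \<in> sqm n" "k \<in> sqm n" "r < n" "c < n"
 shows "(g * A * k) $$ (r, c) = (\<Sum>i<n. \<Sum>j<n. g $$ (r, i) * k $$ (j, c) * (A $$ (i, j) :: complex))"
proof -
 have "(g * A * k) $$ (r, c) = (\<Sum>j<n. (\<Sum>i<n. g $$ (r, i) * A $$ (i, j)) * k $$ (j, c))"
  using assms by (simp add: mult_mat_sum[of _ n n _ n] del: index_mult_mat)
 also have "\<dots> = (\<Sum>j<n. \<Sum>i<n. g $$ (r, i) * k $$ (j, c) * A $$ (i, j))"
  by (simp add: sum_distrib_left sum_distrib_right mult_ac)
 also have "\<dots> = (\<Sum>i<n. \<Sum>j<n. g $$ (r, i) * k $$ (j, c) * A $$ (i, j))" by (rule sum.swap)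
 finally show ?thesis .
qed

definition coef :: "complex mat => complex mat => (nat => nat => complex) => (nat => nat => complex) =>
  (nat \<times> nat) option => bool \<times> nat \<times> nat => complex" where
 "coef g h l m e = (%(b, i, j). case e of None => if b then l i j else m i j
   | Some (r, c) => if b then det h * (g $$ (r, i) * adj_mat g $$ (j, c)) else det g * (h $$ (r, i) * adj_mat h $$ (j, c)))"

lemma coef_sum:
 assumes "g \<in> GL n" "h \<in> GL n" "A \<in> nilrad n \<sigma>" "B \<in> nilrad n \<tau>"
 shows "(\<Sum>u\<in>unk n \<sigma> \<tau>. coef g h l m None u * entry2 A B u) = lam n l A + lam n m B"
  and "r < n ==> c < n ==> (\<Sum>u\<in>unk n \<sigma> \<tau>. coef g h l m (Some (r, c)) u * entry2 A B u)
   = det g * det h * (g * A * ginv g + h * B * ginv h) $$ (r, c)"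
proof -
 show "(\<Sum>u\<in>unk n \<sigma> \<tau>. coef g h l m None u * entry2 A B u) = lam n l A + lam n m B"
  unfolding unk_sum[OF assms(3,4)] by (simp add: coef_def lam_def)
 assume rc: "r < n" "c < n"
 have e: "det k * (k * C * ginv k) $$ (r, c) = (\<Sum>i<n. \<Sum>j<n. k $$ (r, i) * adj_mat k $$ (j, c) * C $$ (i, j))"
  if k: "k \<in> GL n" and C: "C \<in> sqm n" for k C
 proof -
  have "adj_mat k \<in> sqm n" using adj_mat(1)[of k n] k by simp
  hence "ginv k $$ (j, c) = adj_mat k $$ (j, c) / det k" if "j < n" for j
   using rc that unfolding ginv_def by (simp add: index_smult_sq[of _ n])
  thus ?thesis using k C rc GL_det[OF k] by (simp add: conj_entry[of _ n] sum_distrib_left)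
 qed
 have "det g * det h * (g * A * ginv g + h * B * ginv h) $$ (r, c)
   = det h * (det g * (g * A * ginv g) $$ (r, c)) + det g * (det h * (h * B * ginv h) $$ (r, c))"
  using assms rc by (simp add: index_add_sq[of _ n] algebra_simps del: index_mult_mat(1) index_add_mat)
 thus "(\<Sum>u\<in>unk n \<sigma> \<tau>. coef g h l m (Some (r, c)) u * entry2 A B u)
   = det g * det h * (g * A * ginv g + h * B * ginv h) $$ (r, c)" unfolding unk_sum[OF assms(3,4)] using assms
  by (simp add: e coef_def sum_distrib_left mult_ac)
qed

definition upper_pairs :: "nat => (nat \<times> nat) set" where
 "upper_pairs n = {(r, c). r \<le> c & c < n}"

lemma finite_upper_pairs [simp]: "finite (upper_pairs n)"
 by (rule finite_subset[of _ "{..<n} \<times> {..<n}"]) (auto simp: upper_pairs_def)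

lemma conormal_coords:
 assumes "g \<in> GL n" "h \<in> GL n"
 shows "(\<exists>A B. conormal n \<sigma> \<tau> g h A B & (A ~= zrm n \<or> B ~= zrm n) & lam n l A + lam n m B = 0) \<longleftrightarrow>
  (\<exists>v. (\<exists>u\<in>unk n \<sigma> \<tau>. v u ~= 0) &
    (\<forall>e\<in>insert None (Some ` upper_pairs n). (\<Sum>u\<in>unk n \<sigma> \<tau>. coef g h l m e u * v u) = 0))"
 (is "?L \<longleftrightarrow> ?R")
proof
 assume ?L
 then obtain A B where AB: "conormal n \<sigma> \<tau> g h A B" "A ~= zrm n \<or> B ~= zrm n" "lam n l A + lam n m B = 0" by blast
 hence nil: "A \<in> nilrad n \<sigma>" "B \<in> nilrad n \<tau>" by (auto simp: conormal_def)
 have "\<exists>u\<in>unk n \<sigma> \<tau>. entry2 A B u ~= 0"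
 proof (rule ccontr)
  assume "\<not> ?thesis"
  hence z: "\<And>b i j. (b, i, j) \<in> unk n \<sigma> \<tau> ==> entry2 A B (b, i, j) = 0" by blast
  have "A $$ (i, j) = 0" "B $$ (i, j) = 0" if "i < n" "j < n" for i j
   using z[of True i j] z[of False i j] nilradD[OF nil(1) that] nilradD[OF nil(2) that] that
   by (auto simp: unk_def entry2_def not_less[symmetric])
  hence "A = zrm n" "B = zrm n"
   using carrier_matD[OF nilrad_carrier[OF nil(1)]] carrier_matD[OF nilrad_carrier[OF nil(2)]] by (auto intro!: eq_matI)
  with AB(2) show False by simp
 qed
 moreover have "(\<Sum>u\<in>unk n \<sigma> \<tau>. coef g h l m e u * entry2 A B u) = 0" if "e \<in> insert None (Some ` upper_pairs n)" for e
  using that AB(1,3) coef_sum[OF assms nil, where l = l and m = m] by (auto simp: upper_pairs_def conormal_def)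
 ultimately show ?R by blast
next
 assume ?R
 then obtain v where v: "\<exists>u\<in>unk n \<sigma> \<tau>. v u ~= 0"
  "\<And>e. e \<in> insert None (Some ` upper_pairs n) ==> (\<Sum>u\<in>unk n \<sigma> \<tau>. coef g h l m e u * v u) = 0" by blast
 define A where "A = mat n n (%(i, j). if \<sigma> i < \<sigma> j then v (True, i, j) else 0)"
 define B where "B = mat n n (%(i, j). if \<tau> i < \<tau> j then v (False, i, j) else 0)"
 have nil: "A \<in> nilrad n \<sigma>" "B \<in> nilrad n \<tau>" by (auto simp: A_def B_def intro!: nilradI)
 have ev: "entry2 A B u = v u" if "u \<in> unk n \<sigma> \<tau>" for u
  using that by (auto simp: entry2_def A_def B_def unk_def split: if_splits)
 have eq: "(\<Sum>u\<in>unk n \<sigma> \<tau>. coef g h l m e u * entry2 A B u) = 0" if "e \<in> insert None (Some ` upper_pairs n)" for e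
  using v(2)[OF that] ev by simp
 have "conormal n \<sigma> \<tau> g h A B" unfolding conormal_def
 proof (intro conjI nil allI impI)
  fix r c assume rc: "r < n" "c < n" "r \<le> c"
  hence "Some (r, c) \<in> insert None (Some ` upper_pairs n)" by (auto simp: upper_pairs_def)
  from eq[OF this] show "(g * A * ginv g + h * B * ginv h) $$ (r, c) = 0"
   unfolding coef_sum(2)[OF assms nil rc(1,2)] using GL_det[OF assms(1)] GL_det[OF assms(2)] by simp
 qed
 moreover have "lam n l A + lam n m B = 0" using eq[of None] coef_sum(1)[OF assms nil, of l m] by simp
 moreover have "A ~= zrm n \<or> B ~= zrm n"
 proof -
  obtain b i j where u: "(b, i, j) \<in> unk n \<sigma> \<tau>" "v (b, i, j) ~= 0" using v(1) by (metis prod_cases3)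
  hence "i < n" "j < n" by (auto simp: unk_def)
  thus ?thesis using u ev[OF u(1)] by (cases b) (auto simp: entry2_def)
 qed
 ultimately show ?L by blast
qed

text \<open>A two-dimensional conormal space survives in a limit: along a polynomial curve the linear conditions have polynomial coefficients, and the rank can only drop at a special parameter.\<close>

lemma plane_limit:
 assumes pm: "poly_mat n g" "poly_mat n h" and t0: "g t0 \<in> GL n" "h t0 \<in> GL n" and F: "finite F"
  and pl: "\<And>t. t \<notin> F ==> g t \<in> GL n & h t \<in> GL n & plane n \<sigma> \<tau> (g t) (h t)"
 shows "plane n \<sigma> \<tau> (g t0) (h t0)" unfolding plane_iff[OF t0] conormal_coords[OF t0]
proof (intro allI)
 fix l m
 show "\<exists>v. (\<exists>u\<in>unk n \<sigma> \<tau>. v u ~= 0) &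
    (\<forall>e\<in>insert None (Some ` upper_pairs n). (\<Sum>u\<in>unk n \<sigma> \<tau>. coef (g t0) (h t0) l m e u * v u) = 0)"
 proof (rule limit_solution[OF finite_unk F, where E = "insert None (Some ` upper_pairs n)" and a = "%t e u. coef (g t) (h t) l m e u"])
  fix t assume "t \<notin> F"
  hence t: "g t \<in> GL n" "h t \<in> GL n" "plane n \<sigma> \<tau> (g t) (h t)" using pl by auto
  show "\<exists>v. (\<exists>i\<in>unk n \<sigma> \<tau>. v i ~= 0) &
    (\<forall>e\<in>insert None (Some ` upper_pairs n). (\<Sum>i\<in>unk n \<sigma> \<tau>. coef (g t) (h t) l m e i * v i) = 0)"
   using t(3) unfolding plane_iff[OF t(1,2)] conormal_coords[OF t(1,2)] by blast
 next
  fix e u assume "e \<in> insert None (Some ` upper_pairs n)" "u \<in> unk n \<sigma> \<tau>"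
  hence "is_poly (%t. coef (g t) (h t) l m e u)"
   using poly_matD(2)[OF pm(1)] poly_matD(2)[OF pm(2)] poly_mat_det[OF pm(1)] poly_mat_det[OF pm(2)]
    poly_matD(2)[OF poly_mat_adj[OF pm(1)]] poly_matD(2)[OF poly_mat_adj[OF pm(2)]]
   by (cases "fst u") (auto simp: coef_def unk_def upper_pairs_def intro!: is_poly_mult split: if_splits)
  thus "isCont (%t. coef (g t) (h t) l m e u) t0" by (rule is_poly_continuous)
 qed
qed

section \<open>The dimension count\<close>

lemma trace_nilrad:
 assumes "g \<in> GL n" "A \<in> nilrad n \<sigma>"
 shows "(\<Sum>r<n. (g * A * ginv g) $$ (r, r)) = 0"
proof -
 have "(\<Sum>r<n. (g * A * ginv g) $$ (r, r)) = (\<Sum>r<n. \<Sum>i<n. \<Sum>j<n. g $$ (r, i) * ginv g $$ (j, r) * A $$ (i, j))"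
  using assms by (intro sum.cong) (auto simp: conj_entry[of _ n] simp del: index_mult_mat)
 also have "\<dots> = (\<Sum>i<n. \<Sum>r<n. \<Sum>j<n. g $$ (r, i) * ginv g $$ (j, r) * A $$ (i, j))" by (rule sum.swap)
 also have "\<dots> = (\<Sum>i<n. \<Sum>j<n. \<Sum>r<n. g $$ (r, i) * ginv g $$ (j, r) * A $$ (i, j))"
  by (intro sum.cong refl sum.swap)
 also have "\<dots> = (\<Sum>i<n. \<Sum>j<n. (\<Sum>r<n. ginv g $$ (j, r) * g $$ (r, i)) * A $$ (i, j))"
  by (simp add: sum_distrib_left sum_distrib_right mult_ac)
 also have "\<dots> = (\<Sum>i<n. \<Sum>j<n. (ginv g * g) $$ (j, i) * A $$ (i, j))"
  using assms by (intro sum.cong refl arg_cong2[of _ _ _ _ "(*)"] mult_mat_sum[symmetric]) auto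
 also have "\<dots> = 0" unfolding ginv_left[OF assms(1)] using nilradD[OF assms(2)] by (intro sum.neutral ballI) auto
 finally show ?thesis .
qed

lemma card_upper_pairs: "card (upper_pairs n) = n * (n + 1) div 2"
proof -
 have eq: "upper_pairs n = (%(c, r). (r, c)) ` (SIGMA c:{..<n}. {..c})" by (auto simp: upper_pairs_def image_iff)
 have "card (upper_pairs n) = card (SIGMA c:{..<n}. {..c})" unfolding eq by (rule card_image) (auto simp: inj_on_def)
 also have "\<dots> = (\<Sum>c<n. Suc c)" by simp
 also have "\<dots> = n * (n + 1) div 2" by (induction n) auto
 finally show ?thesis .
qed

text \<open>There are at most \<open>n (n + 1) / 2\<close> linear conditions, one for each upper triangular position, and they are dependent, because nilpotent matrices have trace zero. So one unknown more than conditions already gives a plane of solutions.\<close>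

lemma wild_by_dimension:
 assumes "n * (n + 1) div 2 < card (unk n \<sigma> \<tau>)"
 shows "wild n \<sigma> \<tau>" unfolding wild_def
proof (intro ballI)
 fix g h assume gh: "g \<in> GL n" "h \<in> GL n"
 have n: "n > 0"
 proof (rule ccontr)
  assume "\<not> n > 0"
  hence "unk n \<sigma> \<tau> = {}" by (auto simp: unk_def)
  thus False using assms by simp
 qed
 define N where "N = (n - 1, n - 1)"
 define E where "E = insert None (Some ` (upper_pairs n - {N}))"
 have "N \<in> upper_pairs n" using n by (auto simp: N_def upper_pairs_def)
 hence "card (upper_pairs n) = Suc (card (upper_pairs n - {N}))" by (intro card.remove) auto
 hence "card E = card (upper_pairs n)" unfolding E_def by (subst card_insert_disjoint) (auto simp: card_image)
 hence cE: "card E < card (unk n \<sigma> \<tau>)" "finite E" using assms unfolding card_upper_pairs E_def by auto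
 show "plane n \<sigma> \<tau> g h" unfolding plane_iff[OF gh]
 proof (intro allI)
  fix l m
  obtain v where v: "\<exists>u\<in>unk n \<sigma> \<tau>. v u ~= 0" "\<And>e. e \<in> E ==> (\<Sum>u\<in>unk n \<sigma> \<tau>. coef g h l m e u * v u) = 0"
   using nonzero_solution[OF cE(2) finite_unk cE(1), of "coef g h l m"] by metis
  define A where "A = mat n n (%(i, j). if \<sigma> i < \<sigma> j then v (True, i, j) else 0)"
  define B where "B = mat n n (%(i, j). if \<tau> i < \<tau> j then v (False, i, j) else 0)"
  have nil: "A \<in> nilrad n \<sigma>" "B \<in> nilrad n \<tau>" by (auto simp: A_def B_def intro!: nilradI)
  have ev: "entry2 A B u = v u" if "u \<in> unk n \<sigma> \<tau>" for u
   using that by (auto simp: entry2_def A_def B_def unk_def split: if_splits)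
  have eq: "(\<Sum>u\<in>unk n \<sigma> \<tau>. coef g h l m e u * v u) = (\<Sum>u\<in>unk n \<sigma> \<tau>. coef g h l m e u * entry2 A B u)" for e
   using ev by simp
  define d where "d r = (g * A * ginv g + h * B * ginv h) $$ (r, r)" for r
  have d0: "d r = 0" if "r < n - 1" for r
  proof -
   have "Some (r, r) \<in> E" using that by (auto simp: E_def N_def upper_pairs_def)
   from v(2)[OF this] show ?thesis
    unfolding eq using that coef_sum(2)[OF gh nil, where r = r and c = r and l = l and m = m] GL_det[OF gh(1)] GL_det[OF gh(2)]
    by (simp add: d_def)
  qed
  have "(\<Sum>r<n. d r) = (\<Sum>r<n. (g * A * ginv g) $$ (r, r)) + (\<Sum>r<n. (h * B * ginv h) $$ (r, r))"
   unfolding sum.distrib[symmetric] d_def using gh nil by (intro sum.cong refl index_add_sq[of _ n]) auto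
  also have "\<dots> = 0" using trace_nilrad[OF gh(1) nil(1)] trace_nilrad[OF gh(2) nil(2)] by simp
  finally have "(\<Sum>r<Suc (n - 1). d r) = 0" using n by simp
  hence dN: "d (n - 1) = 0" using d0 by simp
  have "(\<Sum>u\<in>unk n \<sigma> \<tau>. coef g h l m (Some N) u * v u) = 0"
   unfolding eq using n coef_sum(2)[OF gh nil, where r = "n - 1" and c = "n - 1" and l = l and m = m] dN by (simp add: d_def N_def)
  hence "(\<Sum>u\<in>unk n \<sigma> \<tau>. coef g h l m e u * v u) = 0" if "e \<in> insert None (Some ` upper_pairs n)" for e
   using v(2)[of e] that unfolding E_def by (cases "e = Some N") auto
  with v(1) show "\<exists>A B. conormal n \<sigma> \<tau> g h A B & (A ~= zrm n \<or> B ~= zrm n) & lam n l A + lam n m B = 0"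
   unfolding conormal_coords[OF gh] by blast
 qed
qed

section \<open>Change of coordinates\<close>

lemma sq_simps [simp]:
 fixes A :: "complex mat"
 assumes "A \<in> sqm n"
 shows "A * zrm n = zrm n" "zrm n * A = zrm n" "A * idm n = A" "idm n * A = A"
  "zrm n + A = A" "A + zrm n = A" using assms by auto

lemma low_eq: "low n = par n (%i. n - i)" by (simp add: low_def)

lemma conormal_iff:
 assumes "g \<in> GL n" "h \<in> GL n"
 shows "conormal n \<sigma> \<tau> g h A B \<longleftrightarrow> A \<in> nilrad n \<sigma> & B \<in> nilrad n \<tau> &
  g * A * ginv g + h * B * ginv h \<in> nilrad n (%i. n - i)"
proof -
 have "g * A * ginv g + h * B * ginv h \<in> nilrad n (%i. n - i) \<longleftrightarrow>
   (\<forall>r<n. \<forall>c<n. r \<le> c --> (g * A * ginv g + h * B * ginv h) $$ (r, c) = 0)"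
  if "A \<in> nilrad n \<sigma>" "B \<in> nilrad n \<tau>"
 proof -
  have "g * A * ginv g + h * B * ginv h \<in> sqm n" using assms that by simp
  moreover have "n - c \<le> n - r \<longleftrightarrow> r \<le> c" if "r < n" "c < n" for r c using that by auto
  ultimately show ?thesis unfolding nilrad_def by simp
 qed
 thus ?thesis unfolding conormal_def by blast
qed

lemma conj_zero:
 assumes "k \<in> GL n" "A \<in> sqm n" "ginv k * A * k = zrm n"
 shows "A = zrm n"
proof -
 have "k * (ginv k * A * k) * ginv k = A" using assms(1,2) by (simp add: mult_assoc_sq[of _ n])
 thus ?thesis unfolding assms(3) using assms(1) by simp
qed

lemma conj_group:
 assumes "b \<in> GL n" "g \<in> GL n" "p \<in> GL n" "A \<in> sqm n"
 shows "(b * g * p) * (ginv p * A * p) * ginv (b * g * p) = b * (g * A * ginv g) * ginv b"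
 using assms by (simp add: ginv_mult[of _ n] mult_assoc_sq[of _ n])

lemma par_nilrad_conj:
 assumes "p \<in> par n \<sigma>" "p \<in> GL n" "A \<in> nilrad n \<sigma>"
 shows "ginv p * A * p \<in> nilrad n \<sigma>" "p * A * ginv p \<in> nilrad n \<sigma>"
 using par_nilrad_mult(2)[OF assms(1) par_nilrad_mult(1)[OF par_ginv[OF assms(1,2)] assms(3)]]
  par_nilrad_mult(2)[OF par_ginv[OF assms(1,2)] par_nilrad_mult(1)[OF assms(1,3)]] by auto

lemma conormal_move:
 assumes g: "g \<in> GL n" "h \<in> GL n" and b: "b \<in> low n" "b \<in> GL n"
  and p: "p \<in> par n \<sigma>" "p \<in> GL n" and q: "q \<in> par n \<tau>" "q \<in> GL n"
  and con: "conormal n \<sigma> \<tau> g h A B"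
 shows "conormal n \<sigma> \<tau> (b * g * p) (b * h * q) (ginv p * A * p) (ginv q * B * q)"
proof -
 have nil: "A \<in> nilrad n \<sigma>" "B \<in> nilrad n \<tau>" "g * A * ginv g + h * B * ginv h \<in> nilrad n (%i. n - i)"
  using con conormal_iff[OF g] by auto
 have "b * (g * A * ginv g) * ginv b + b * (h * B * ginv h) * ginv b
   = b * (g * A * ginv g + h * B * ginv h) * ginv b"
 proof -
  have "b * (g * A * ginv g + h * B * ginv h) = b * (g * A * ginv g) + b * (h * B * ginv h)"
   using g b nil by (intro mult_add_distrib_mat[of _ n n _ n]) auto
  thus ?thesis using g b nil by (simp add: add_mult_distrib_mat[of _ n n _ _ n])
 qed
 hence "(b * g * p) * (ginv p * A * p) * ginv (b * g * p) + (b * h * q) * (ginv q * B * q) * ginv (b * h * q)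
  = b * (g * A * ginv g + h * B * ginv h) * ginv b" using g b p q nil by (simp add: conj_group[of _ n])
 moreover have "b * (g * A * ginv g + h * B * ginv h) * ginv b \<in> nilrad n (%i. n - i)"
  using b nil unfolding low_eq by (intro par_nilrad_conj)
 ultimately show ?thesis using g b p q nil by (subst conormal_iff) (simp_all add: par_nilrad_conj)
qed

lemma plane_move:
 assumes g: "g \<in> GL n" "h \<in> GL n" and b: "b \<in> low n" "b \<in> GL n"
  and p: "p \<in> par n \<sigma>" "p \<in> GL n" and q: "q \<in> par n \<tau>" "q \<in> GL n"
  and pl: "plane n \<sigma> \<tau> g h"
 shows "plane n \<sigma> \<tau> (b * g * p) (b * h * q)"
proof -
 obtain A B A' B' where 1: "conormal n \<sigma> \<tau> g h A B" "conormal n \<sigma> \<tau> g h A' B'" "indep2 n A B A' B'"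
  using pl unfolding plane_def by blast
 have c: "A \<in> sqm n" "B \<in> sqm n" "A' \<in> sqm n" "B' \<in> sqm n" using 1 by (auto simp: conormal_def)
 have "indep2 n (ginv p * A * p) (ginv q * B * q) (ginv p * A' * p) (ginv q * B' * q)" unfolding indep2_def
 proof (intro allI impI)
  fix x y assume e: "x *% (ginv p * A * p) + y *% (ginv p * A' * p) = zrm n"
   "x *% (ginv q * B * q) + y *% (ginv q * B' * q) = zrm n"
  have "ginv p * (x *% A + y *% A') * p = zrm n" unfolding e(1)[symmetric] by (rule conj_lin) (use c p in simp_all)
  moreover have "ginv q * (x *% B + y *% B') * q = zrm n" unfolding e(2)[symmetric] by (rule conj_lin) (use c q in simp_all)
  ultimately have "x *% A + y *% A' = zrm n" "x *% B + y *% B' = zrm n"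
   using c conj_zero[OF p(2), of "x *% A + y *% A'"] conj_zero[OF q(2), of "x *% B + y *% B'"] lin_carrier by blast+
  thus "x = 0 & y = 0" using 1(3) unfolding indep2_def by blast
 qed
 thus ?thesis using conormal_move[OF g b p q 1(1)] conormal_move[OF g b p q 1(2)] unfolding plane_def by blast
qed

lemma conormal_swap: "g \<in> GL n ==> h \<in> GL n ==> conormal n \<sigma> \<tau> g h A B \<longleftrightarrow> conormal n \<tau> \<sigma> h g B A"
proof -
 assume "g \<in> GL n" "h \<in> GL n"
 hence "g * A * ginv g + h * B * ginv h = h * B * ginv h + g * A * ginv g"
  if "A \<in> sqm n" "B \<in> sqm n" using that by (intro comm_add_mat[of _ n n]) auto
 thus ?thesis unfolding conormal_def by (auto simp del: index_add_mat)
qed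

lemma plane_swap:
 assumes "g \<in> GL n" "h \<in> GL n" "plane n \<sigma> \<tau> g h"
 shows "plane n \<tau> \<sigma> h g"
proof -
 obtain A B A' B' where 1: "conormal n \<sigma> \<tau> g h A B" "conormal n \<sigma> \<tau> g h A' B'" "indep2 n A B A' B'"
  using assms(3) unfolding plane_def by blast
 have "indep2 n B A B' A'" using 1(3) unfolding indep2_def by blast
 moreover have "conormal n \<tau> \<sigma> h g B A" "conormal n \<tau> \<sigma> h g B' A'"
  using 1(1,2) conormal_swap[OF assms(1,2)] by auto
 ultimately show ?thesis unfolding plane_def by blast
qed

lemma wild_swap: "wild n \<sigma> \<tau> ==> wild n \<tau> \<sigma>" unfolding wild_def using plane_swap by blast

lemma nilrad_mono: "(\<And>i j. i < n ==> j < n ==> \<sigma> i < \<sigma> j ==> \<sigma>' i < \<sigma>' j) ==> nilrad n \<sigma> \<subseteq> nilrad n \<sigma>'"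
 unfolding nilrad_def by (auto simp: not_less[symmetric])

text \<open>The nilradical of a smaller parabolic subgroup is larger, and so are the conormal spaces.\<close>

lemma wild_refine:
 assumes "wild n \<sigma> \<tau>" "\<And>i j. i < n ==> j < n ==> \<sigma> i < \<sigma> j ==> \<sigma>' i < \<sigma>' j"
 shows "wild n \<sigma>' \<tau>"
proof -
 have "conormal n \<sigma>' \<tau> g h A B" if "conormal n \<sigma> \<tau> g h A B" for g h A B
  using that nilrad_mono[of n \<sigma> \<sigma>'] assms(2) unfolding conormal_def by blast
 thus ?thesis using assms(1) unfolding wild_def plane_def by blast
qed

section \<open>Dense orbits\<close>

lemma ex_inverse_linear:
 fixes w :: "'z => 'i => complex"
 assumes "finite Z" "finite I" and "\<And>c. (\<And>z. z \<in> Z ==> (\<Sum>i\<in>I. c i * w z i) = 0) ==> \<forall>i\<in>I. c i = 0"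
 shows "\<exists>y. \<forall>e\<in>I. \<forall>i\<in>I. (\<Sum>z\<in>Z. y e z * w z i) = (if i = e then 1 else 0)"
proof -
 have "\<exists>y. \<forall>i\<in>I. (if i = e then 1 else 0) = (\<Sum>z\<in>Z. y z * w z i)" for e
 proof -
  have "(\<Sum>i\<in>I. c i * (if i = e then 1 else 0)) = 0" if "\<forall>z\<in>Z. (\<Sum>i\<in>I. c i * w z i) = 0" for c
   using assms(3)[of c] that by (intro sum.neutral) auto
  thus ?thesis using span_or_functional[OF assms(1,2), of "%i. if i = e then 1 else 0" w] by blast
 qed
 then obtain y where "\<And>e. \<forall>i\<in>I. (if i = e then 1 else 0) = (\<Sum>z\<in>Z. y e z * w z i)" by metis
 thus ?thesis by (intro exI[of _ y]) auto
qed

text \<open>If \<open>w 0\<close> is onto, then for almost all \<open>t\<close> the inhomogeneous system \<open>w t z = b t\<close> has a solution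
 that depends polynomially on \<open>t\<close>, up to a denominator \<open>d t\<close>.\<close>

lemma solve_along_curve:
 fixes w :: "complex => 'z => 'i => complex"
 assumes fin: "finite Z" "finite I"
  and onto: "\<And>c. (\<And>z. z \<in> Z ==> (\<Sum>i\<in>I. c i * w 0 z i) = 0) ==> \<forall>i\<in>I. c i = 0"
  and pw: "\<And>z i. z \<in> Z ==> i \<in> I ==> is_poly (%t. w t z i)"
  and pb: "\<And>i. i \<in> I ==> is_poly (%t. b t i)" and b0: "\<And>i. i \<in> I ==> b 0 i = 0"
 obtains d x where "is_poly d" "d 0 = 1" "\<And>z. z \<in> Z ==> is_poly (%t. x t z)" "\<And>z. z \<in> Z ==> x 0 z = 0"
  "\<And>t i. i \<in> I ==> (\<Sum>z\<in>Z. x t z * w t z i) = d t * b t i"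
proof -
 obtain y where y: "\<And>e i. e \<in> I ==> i \<in> I ==> (\<Sum>z\<in>Z. y e z * w 0 z i) = (if i = e then 1 else 0)"
  using ex_inverse_linear[OF fin onto] by blast
 define m where "m = card I"
 obtain f where f: "bij_betw f {0..<m} I" using ex_bij_betw_nat_finite[OF fin(2)] m_def by blast
 have fI: "f a \<in> I" if "a < m" for a using f that by (auto simp: bij_betw_def)
 have finj: "f a = f a' \<longleftrightarrow> a = a'" if "a < m" "a' < m" for a a' using f that by (auto simp: bij_betw_def inj_on_def)
 define N where "N t = mat m m (%(i, e). \<Sum>z\<in>Z. y (f e) z * w t z (f i))" for t
 have pN: "poly_mat m N" by (rule poly_matI) (auto simp: N_def intro!: is_poly_sum is_poly_mult pw fI)
 have N0: "N 0 = 1\<^sub>m m" by (rule eq_matI) (auto simp: N_def y fI finj)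
 define u where "u t e = (\<Sum>k<m. adj_mat (N t) $$ (e, k) * b t (f k))" for t e
 have Nu: "(\<Sum>e<m. N t $$ (i, e) * u t e) = det (N t) * b t (f i)" if "i < m" for t i
 proof -
  have Nc: "N t \<in> carrier_mat m m" by (rule poly_matD[OF pN])
  have "(\<Sum>e<m. N t $$ (i, e) * u t e) = (\<Sum>e<m. \<Sum>k<m. N t $$ (i, e) * adj_mat (N t) $$ (e, k) * b t (f k))"
   unfolding u_def by (simp add: sum_distrib_left mult_ac)
  also have "\<dots> = (\<Sum>k<m. \<Sum>e<m. N t $$ (i, e) * adj_mat (N t) $$ (e, k) * b t (f k))" by (rule sum.swap)
  also have "\<dots> = (\<Sum>k<m. (\<Sum>e<m. N t $$ (i, e) * adj_mat (N t) $$ (e, k)) * b t (f k))" by (simp add: sum_distrib_right)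
  also have "\<dots> = (\<Sum>k<m. (N t * adj_mat (N t)) $$ (i, k) * b t (f k))"
   using that by (intro sum.cong refl arg_cong2[of _ _ _ _ "(*)"] mult_mat_sum[symmetric, OF Nc adj_mat(1)[OF Nc]]) auto
  also have "\<dots> = (\<Sum>k<m. if k = i then det (N t) * b t (f k) else 0)"
   unfolding adj_mat(2)[OF Nc] using that by (intro sum.cong refl) auto
  also have "\<dots> = det (N t) * b t (f i)" using that by simp
  finally show ?thesis .
 qed
 show thesis
 proof (rule that[of "%t. det (N t)" "%t z. \<Sum>e<m. u t e * y (f e) z"])
  show "is_poly (%t. det (N t))" by (rule poly_mat_det[OF pN])
  show "det (N 0) = 1" by (simp add: N0)
  show "is_poly (%t. \<Sum>e<m. u t e * y (f e) z)" for z unfolding u_def using poly_matD(2)[OF poly_mat_adj[OF pN]]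
   by (auto intro!: is_poly_sum is_poly_mult pb fI)
  show "(\<Sum>e<m. u 0 e * y (f e) z) = 0" for z unfolding u_def by (auto intro!: sum.neutral simp: b0 fI)
  fix t i assume "i \<in> I"
  then obtain a where a: "a < m" "i = f a" using f by (auto simp: bij_betw_def)
  have "(\<Sum>z\<in>Z. (\<Sum>e<m. u t e * y (f e) z) * w t z i) = (\<Sum>z\<in>Z. \<Sum>e<m. (y (f e) z * w t z i) * u t e)"
   by (simp add: sum_distrib_left sum_distrib_right mult_ac)
  also have "\<dots> = (\<Sum>e<m. \<Sum>z\<in>Z. (y (f e) z * w t z i) * u t e)" by (rule sum.swap)
  also have "\<dots> = (\<Sum>e<m. N t $$ (a, e) * u t e)" using a by (simp add: N_def sum_distrib_right)
  finally show "(\<Sum>z\<in>Z. (\<Sum>e<m. u t e * y (f e) z) * w t z i) = det (N t) * b t i" using Nu[OF a(1)] a(2) by simp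
 qed
qed

lemma is_poly_if:
 "(P ==> is_poly f) ==> (\<not> P ==> is_poly g) ==> is_poly (%t. if P then f t else g t)" by (cases P) auto

lemma sum_bool_square:
 "(\<Sum>i\<in>UNIV \<times> {..<n} \<times> {..<n}. f i) =
  (\<Sum>r<n. \<Sum>c<n. f (True, r, c)) + (\<Sum>r<n. \<Sum>c<n. f (False, r, c :: nat) :: complex)"
proof -
 have 1: "(\<Sum>i\<in>UNIV \<times> {..<n} \<times> {..<n}. f i) = (\<Sum>b\<in>UNIV. \<Sum>p\<in>{..<n} \<times> {..<n}. f (b, p))"
  by (simp add: sum.cartesian_product)
 have 2: "(\<Sum>b\<in>UNIV. k b) = k True + k False" for k :: "bool => complex" by (simp add: UNIV_bool add.commute)
 have 3: "(\<Sum>p\<in>{..<n} \<times> {..<n}. f (b, p)) = (\<Sum>r<n. \<Sum>c<n. f (b, r, c))" for b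
  by (simp add: sum.cartesian_product)
 show ?thesis unfolding 1 2 3 ..
qed

definition bpq_ok :: "(nat => nat) => (nat => nat) => nat => nat \<times> nat => bool" where
 "bpq_ok \<sigma> \<tau> k = (%(i, j). if k = 0 then j \<le> i else if k = 1 then \<sigma> i \<le> \<sigma> j else \<tau> i \<le> \<tau> j)"

definition bpq :: "nat => (nat => nat) => (nat => nat) => (nat \<times> nat \<times> nat) set" where
 "bpq n \<sigma> \<tau> = (SIGMA k:{0, 1, 2}. {p \<in> {..<n} \<times> {..<n}. bpq_ok \<sigma> \<tau> k p})"

lemma finite_bpq [simp]: "finite (bpq n \<sigma> \<tau>)" unfolding bpq_def by (intro finite_SigmaI) auto

lemma sum_bpq:
 fixes F :: "nat \<times> nat \<times> nat => complex"
 shows "(\<Sum>z\<in>bpq n \<sigma> \<tau>. F z) = (\<Sum>i<n. \<Sum>j<n. if j \<le> i then F (0, i, j) else 0) +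
  (\<Sum>i<n. \<Sum>j<n. if \<sigma> i \<le> \<sigma> j then F (1, i, j) else 0) +
  (\<Sum>i<n. \<Sum>j<n. if \<tau> i \<le> \<tau> j then F (2, i, j) else 0)"
proof -
 have "(\<Sum>z\<in>bpq n \<sigma> \<tau>. F z) = (\<Sum>k\<in>{0, 1, 2}. \<Sum>p\<in>{p \<in> {..<n} \<times> {..<n}. bpq_ok \<sigma> \<tau> k p}. F (k, p))"
  unfolding bpq_def by (subst sum.Sigma) auto
 also have "\<dots> = (\<Sum>k\<in>{0, 1, 2}. \<Sum>p\<in>{..<n} \<times> {..<n}. if bpq_ok \<sigma> \<tau> k p then F (k, p) else 0)"
  by (intro sum.cong refl sum.inter_filter) auto
 also have "\<dots> = (\<Sum>k\<in>{0, 1, 2}. \<Sum>i<n. \<Sum>j<n. if bpq_ok \<sigma> \<tau> k (i, j) then F (k, i, j) else 0)"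
  by (intro sum.cong refl) (auto simp: sum.cartesian_product intro!: sum.cong)
 finally show ?thesis by (simp add: bpq_ok_def add.assoc cong: if_cong)
qed

text \<open>The tangent map of the orbit at \<open>(g, h)\<close>: the variable \<open>(k, i, j)\<close> is the \<open>(i, j)\<close> entry of
 an element of the lower triangular algebra (\<open>k = 0\<close>) or of one of the two parabolic algebras.\<close>

definition orbit_coef :: "complex mat => complex mat => complex mat => complex mat =>
  nat \<times> nat \<times> nat => bool \<times> nat \<times> nat => complex" where
 "orbit_coef g h x y = (%(k, i, j) (s, r, c).
   if k = 0 then if r = i then (if s then g else h) $$ (j, c) else 0
   else if k = 1 then if s & c = j then - (x $$ (r, i)) else 0
   else if \<not> s & c = j then - (y $$ (r, i)) else 0)"

lemma orbit_onto:
 assumes g: "g \<in> GL n" "h \<in> GL n"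
  and null: "\<And>A B. conormal n \<sigma> \<tau> g h A B ==> A = zrm n & B = zrm n"
  and c: "\<And>z. z \<in> bpq n \<sigma> \<tau> ==> (\<Sum>i\<in>UNIV \<times> {..<n} \<times> {..<n}. c i * orbit_coef g h g h z i) = 0"
 shows "\<forall>i\<in>UNIV \<times> {..<n} \<times> {..<n}. c i = 0"
proof -
 define C where "C b = mat n n (%(s, r). c (b, r, s))" for b
 have Cc: "C b \<in> sqm n" for b by (simp add: C_def)
 have nil1: "C True * g \<in> nilrad n \<sigma>"
 proof (rule nilradI)
  fix j i assume ij: "j < n" "i < n" "\<sigma> i \<le> \<sigma> j"
  hence "(1, i, j) \<in> bpq n \<sigma> \<tau>" by (auto simp: bpq_def bpq_ok_def)
  from c[OF this] ij(1) have "(\<Sum>r<n. c (True, r, j) * g $$ (r, i)) = 0"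
   by (simp add: sum_bool_square orbit_coef_def if_distrib[of "%x. _ * x"] sum_negf cong: if_cong)
  thus "(C True * g) $$ (j, i) = 0" using ij g mult_mat_sum[OF Cc GL_carrier[OF g(1)] ij(1,2), of True] by (simp add: C_def)
 qed (use Cc g in simp)
 have nil2: "C False * h \<in> nilrad n \<tau>"
 proof (rule nilradI)
  fix j i assume ij: "j < n" "i < n" "\<tau> i \<le> \<tau> j"
  hence "(2, i, j) \<in> bpq n \<sigma> \<tau>" by (auto simp: bpq_def bpq_ok_def)
  from c[OF this] ij(1) have "(\<Sum>r<n. c (False, r, j) * h $$ (r, i)) = 0"
   by (simp add: sum_bool_square orbit_coef_def if_distrib[of "%x. _ * x"] sum_negf cong: if_cong)
  thus "(C False * h) $$ (j, i) = 0" using ij g mult_mat_sum[OF Cc GL_carrier[OF g(2)] ij(1,2), of False] by (simp add: C_def)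
 qed (use Cc g in simp)
 have gC: "g * (C True * g) * ginv g = g * C True" "h * (C False * h) * ginv h = h * C False"
  using g Cc by (simp_all add: mult_assoc_sq[of _ n])
 have "conormal n \<sigma> \<tau> g h (C True * g) (C False * h)" unfolding conormal_def gC
 proof (intro conjI nil1 nil2 allI impI)
  fix j i assume ij: "j < n" "i < n" "j \<le> i"
  hence "(0, i, j) \<in> bpq n \<sigma> \<tau>" by (auto simp: bpq_def bpq_ok_def)
  from c[OF this] have "(\<Sum>r<n. \<Sum>s<n. if r = i then c (True, r, s) * g $$ (j, s) else 0) +
    (\<Sum>r<n. \<Sum>s<n. if r = i then c (False, r, s) * h $$ (j, s) else 0) = 0"
   by (simp add: sum_bool_square orbit_coef_def if_distrib[of "%x. _ * x"] cong: if_cong)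
  moreover have "(\<Sum>r<n. \<Sum>s<n. if r = i then f r s else 0) = (\<Sum>s<n. f i s :: complex)" for f
   using ij(2) by (subst sum.swap) simp
  ultimately have "(\<Sum>s<n. c (True, i, s) * g $$ (j, s)) + (\<Sum>s<n. c (False, i, s) * h $$ (j, s)) = 0" by simp
  moreover have "(g * C True) $$ (j, i) = (\<Sum>s<n. c (True, i, s) * g $$ (j, s))"
   using mult_mat_sum[OF GL_carrier[OF g(1)] Cc ij(1,2), of True] ij by (simp add: C_def mult.commute)
  moreover have "(h * C False) $$ (j, i) = (\<Sum>s<n. c (False, i, s) * h $$ (j, s))"
   using mult_mat_sum[OF GL_carrier[OF g(2)] Cc ij(1,2), of False] ij by (simp add: C_def mult.commute)
  ultimately show "(g * C True + h * C False) $$ (j, i) = 0"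
   using g Cc ij index_add_sq[of "g * C True" n "h * C False" j i] by (simp del: index_mult_mat index_add_mat)
 qed
 from null[OF this] have z: "C True * g = zrm n" "C False * h = zrm n" by auto
 have "C True = (C True * g) * ginv g" "C False = (C False * h) * ginv h" using g Cc by (simp_all add: mult_assoc_sq[of _ n])
 hence "C b = zrm n" for b unfolding z using g by (cases b) simp_all
 hence "C b $$ (s, r) = 0" if "s < n" "r < n" for b s r using that by simp
 hence "c (b, r, s) = 0" if "s < n" "r < n" for b s r using that unfolding C_def by simp
 thus ?thesis by auto
qed

text \<open>If the conormal space at \<open>t = 0\<close> vanishes, then the tangent map of the orbit is onto. Solvability of the linear system for \<open>b\<close>, \<open>p\<close>, \<open>q\<close> is an open condition on \<open>t\<close>, and so is their invertibility.\<close>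

lemma orbit_along_curve:
 assumes X: "poly_mat n X" "poly_mat n Y" and g: "X 0 \<in> GL n" "Y 0 \<in> GL n"
  and null: "\<And>A B. conormal n \<sigma> \<tau> (X 0) (Y 0) A B ==> A = zrm n & B = zrm n"
 shows "finite {t. \<not> (\<exists>b p q. b \<in> low n & b \<in> GL n & p \<in> par n \<sigma> & p \<in> GL n & q \<in> par n \<tau> & q \<in> GL n &
  X t = b * X 0 * p & Y t = b * Y 0 * q)}"
proof -
 define w where "w t = orbit_coef (X 0) (Y 0) (X t) (Y t)" for t
 define I where "I = (UNIV :: bool set) \<times> {..<n} \<times> {..<n}"
 define b0 where "b0 t = (%(s, r, c). if s then X t $$ (r, c) - X 0 $$ (r, c) else Y t $$ (r, c) - Y 0 $$ (r, c))" for t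
 have fI: "finite I" by (simp add: I_def)
 have onto: "\<forall>i\<in>I. c i = 0" if "\<And>z. z \<in> bpq n \<sigma> \<tau> ==> (\<Sum>i\<in>I. c i * w 0 z i) = 0" for c
  using orbit_onto[OF g null] that unfolding I_def w_def by blast
 have pw: "is_poly (%t. w t z i)" if "z \<in> bpq n \<sigma> \<tau>" "i \<in> I" for z i
 proof -
  have m: "is_poly (%t. - (X t $$ (r, i)))" "is_poly (%t. - (Y t $$ (r, i)))" if "r < n" "i < n" for r i
   using is_poly_mult[OF is_poly_const[of "-1"] poly_matD(2)[OF X(1) that]]
    is_poly_mult[OF is_poly_const[of "-1"] poly_matD(2)[OF X(2) that]] by auto
  obtain k a b s r c where zi: "z = (k, a, b)" "i = (s, r, c)" by (metis prod_cases3)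
  hence "a < n" "b < n" "r < n" "c < n" using that by (auto simp: bpq_def I_def)
  thus ?thesis using m unfolding zi w_def orbit_coef_def by (cases "k = 0"; cases "k = 1"; cases s; cases "c = b"; cases "r = a"; simp add: is_poly_const)
 qed
 have pb: "is_poly (%t. b0 t i)" if "i \<in> I" for i using that poly_matD(2)[OF X(1)] poly_matD(2)[OF X(2)]
  by (cases "fst i") (auto simp: b0_def I_def intro!: is_poly_diff)
 have b00: "b0 0 i = 0" for i by (auto simp: b0_def split: prod.splits)
 obtain d x where d: "is_poly d" "d 0 = 1" "\<And>z. z \<in> bpq n \<sigma> \<tau> ==> is_poly (%t. x t z)"
  "\<And>z. z \<in> bpq n \<sigma> \<tau> ==> x 0 z = 0"
  "\<And>t i. i \<in> I ==> (\<Sum>z\<in>bpq n \<sigma> \<tau>. x t z * w t z i) = d t * b0 t i"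
 proof (rule solve_along_curve[of "bpq n \<sigma> \<tau>" I w b0])
  show "finite (bpq n \<sigma> \<tau>)" "finite I" by (simp_all add: fI)
  show "\<forall>i\<in>I. c i = 0" if "\<And>z. z \<in> bpq n \<sigma> \<tau> ==> (\<Sum>i\<in>I. c i * w 0 z i) = 0" for c
   using that by (rule onto)
  show "is_poly (%t. w t z i)" if "z \<in> bpq n \<sigma> \<tau>" "i \<in> I" for z i using that by (rule pw)
  show "is_poly (%t. b0 t i)" if "i \<in> I" for i using that by (rule pb)
  show "b0 0 i = 0" for i by (rule b00)
 qed (rule that)
 define M where "M k t = mat n n (%(i, j). if bpq_ok \<sigma> \<tau> k (i, j) then (if i = j then d t else 0) + x t (k, i, j) else 0)" for k t
 have Mc: "M k t \<in> sqm n" for k t by (simp add: M_def)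
 have pM: "poly_mat n (M k)" if "k \<in> {0, 1, 2}" for k
 proof (rule poly_matI)
  fix i j assume ij: "i < n" "j < n"
  have "is_poly (%t. (if i = j then d t else 0) + x t (k, i, j))" if "bpq_ok \<sigma> \<tau> k (i, j)"
   using that ij \<open>k \<in> {0, 1, 2}\<close> d(1) by (intro is_poly_add d(3) is_poly_if) (auto simp: bpq_def)
  thus "is_poly (%t. M k t $$ (i, j))" using ij by (cases "bpq_ok \<sigma> \<tau> k (i, j)") (auto simp: M_def)
 qed (rule Mc)
 have M0: "M k 0 = idm n" if k: "k \<in> {0, 1, 2}" for k
 proof (rule eq_matI)
  fix i j assume ij: "i < dim_row (idm n)" "j < dim_col (idm n)"
  have ok: "bpq_ok \<sigma> \<tau> k (i, i)" by (simp add: bpq_ok_def)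
  have "x 0 (k, i, j) = 0" if "bpq_ok \<sigma> \<tau> k (i, j)" using that ij k by (intro d(4)) (auto simp: bpq_def)
  thus "M k 0 $$ (i, j) = idm n $$ (i, j)" using ij ok d(2) by (auto simp: M_def)
 qed (simp_all add: M_def)
 have eq: "M 0 t * X 0 = X t * M 1 t" "M 0 t * Y 0 = Y t * M 2 t" for t
 proof -
  have sq: "X t \<in> sqm n" "Y t \<in> sqm n" "X 0 \<in> sqm n" "Y 0 \<in> sqm n"
   using poly_matD(1)[OF X(1)] poly_matD(1)[OF X(2)] by auto
  have sw: "(\<Sum>i<n. \<Sum>j<n. if P i j then if i = a then f i j else 0 else 0) = (\<Sum>j<n. if P a j then f a j else (0::complex))"
   if "a < n" for P f a
  proof -
   have eq: "(\<Sum>i<n. \<Sum>j<n. if P i j then if i = a then f i j else 0 else 0) = (\<Sum>i<n. if i = a then \<Sum>j<n. if P i j then f i j else 0 else 0)"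
    by (intro sum.cong) (auto intro!: sum.neutral cong: if_cong)
   show ?thesis unfolding eq using that by simp
  qed
  have sw': "(\<Sum>i<n. \<Sum>j<n. if P i j then if j = a then f i j else 0 else 0) = (\<Sum>i<n. if P i a then f i a else (0::complex))"
   if "a < n" for P f a
  proof -
   have eq: "(\<Sum>i<n. \<Sum>j<n. if P i j then if j = a then f i j else 0 else 0) = (\<Sum>i<n. \<Sum>j<n. if j = a then if P i j then f i j else 0 else 0)"
    by (intro sum.cong) auto
   show ?thesis unfolding eq using that by simp
  qed
  have Ml: "(M 0 t * G) $$ (r, c) = d t * G $$ (r, c) + (\<Sum>j<n. if j \<le> r then x t (0, r, j) * G $$ (j, c) else 0)"
   if "G \<in> sqm n" "r < n" "c < n" for G r c
  proof -
   have "(M 0 t * G) $$ (r, c) = (\<Sum>j<n. (if j = r then d t * G $$ (j, c) else 0) + (if j \<le> r then x t (0, r, j) * G $$ (j, c) else 0))"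
    unfolding mult_mat_sum[OF Mc that] by (intro sum.cong refl) (use that in \<open>auto simp: M_def bpq_ok_def algebra_simps\<close>)
   thus ?thesis using that by (simp add: sum.distrib)
  qed
  have Mr: "(G * M k t) $$ (r, c) = d t * G $$ (r, c) + (\<Sum>i<n. if bpq_ok \<sigma> \<tau> k (i, c) then x t (k, i, c) * G $$ (r, i) else 0)"
   if "G \<in> sqm n" "r < n" "c < n" for G r c k
  proof -
   have "(G * M k t) $$ (r, c) = (\<Sum>i<n. (if i = c then d t * G $$ (r, i) else 0) + (if bpq_ok \<sigma> \<tau> k (i, c) then x t (k, i, c) * G $$ (r, i) else 0))"
    unfolding mult_mat_sum[OF that(1) Mc that(2,3)]
    by (intro sum.cong refl) (use that in \<open>auto simp: M_def bpq_ok_def algebra_simps\<close>)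
   thus ?thesis using that by (simp add: sum.distrib)
  qed
  show "M 0 t * X 0 = X t * M 1 t"
  proof (rule eq_matI)
   fix r c assume "r < dim_row (X t * M 1 t)" "c < dim_col (X t * M 1 t)"
   hence rc: "r < n" "c < n" using sq Mc[of 1 t] by auto
   hence "(True, r, c) \<in> I" by (simp add: I_def)
   from d(5)[OF this, of t] have "(\<Sum>j<n. if j \<le> r then x t (0, r, j) * X 0 $$ (j, c) else 0)
     + (\<Sum>i<n. if \<sigma> i \<le> \<sigma> c then - (x t (1, i, c) * X t $$ (r, i)) else 0) = d t * (X t $$ (r, c) - X 0 $$ (r, c))"
    unfolding sum_bpq w_def orbit_coef_def b0_def
    by (simp add: if_distrib[of "%x. _ * x"] sw[OF rc(1)] sw'[OF rc(2)] eq_commute[of r] eq_commute[of c] cong: if_cong)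
   moreover have "(\<Sum>i<n. if \<sigma> i \<le> \<sigma> c then - (x t (1, i, c) * X t $$ (r, i)) else 0)
     = - (\<Sum>i<n. if \<sigma> i \<le> \<sigma> c then x t (1, i, c) * X t $$ (r, i) else 0)"
    unfolding sum_negf[symmetric] by (intro sum.cong) auto
   ultimately show "(M 0 t * X 0) $$ (r, c) = (X t * M 1 t) $$ (r, c)"
    unfolding Ml[OF sq(3) rc] Mr[OF sq(1) rc] by (simp add: bpq_ok_def algebra_simps)
  qed (use sq Mc[of 0 t] Mc[of 1 t] in auto)
  show "M 0 t * Y 0 = Y t * M 2 t"
  proof (rule eq_matI)
   fix r c assume "r < dim_row (Y t * M 2 t)" "c < dim_col (Y t * M 2 t)"
   hence rc: "r < n" "c < n" using sq Mc[of 2 t] by auto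
   hence "(False, r, c) \<in> I" by (simp add: I_def)
   from d(5)[OF this, of t] have "(\<Sum>j<n. if j \<le> r then x t (0, r, j) * Y 0 $$ (j, c) else 0)
     + (\<Sum>i<n. if \<tau> i \<le> \<tau> c then - (x t (2, i, c) * Y t $$ (r, i)) else 0) = d t * (Y t $$ (r, c) - Y 0 $$ (r, c))"
    unfolding sum_bpq w_def orbit_coef_def b0_def
    by (simp add: if_distrib[of "%x. _ * x"] sw[OF rc(1)] sw'[OF rc(2)] eq_commute[of r] eq_commute[of c] cong: if_cong)
   moreover have "(\<Sum>i<n. if \<tau> i \<le> \<tau> c then - (x t (2, i, c) * Y t $$ (r, i)) else 0)
     = - (\<Sum>i<n. if \<tau> i \<le> \<tau> c then x t (2, i, c) * Y t $$ (r, i) else 0)"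
    unfolding sum_negf[symmetric] by (intro sum.cong) auto
   ultimately show "(M 0 t * Y 0) $$ (r, c) = (Y t * M 2 t) $$ (r, c)"
    unfolding Ml[OF sq(4) rc] Mr[OF sq(2) rc] by (simp add: bpq_ok_def algebra_simps)
  qed (use sq Mc[of 0 t] Mc[of 2 t] in auto)
 qed
 have fin: "finite {t. det (M k t) = 0}" if "k \<in> {0, 1, 2}" for k
  by (rule is_poly_finite_zeros[OF poly_mat_det[OF pM[OF that]], of 0]) (simp add: M0[OF that])
 have pat: "M 0 t \<in> low n" "M 1 t \<in> par n \<sigma>" "M 2 t \<in> par n \<tau>" for t
  by (auto simp: M_def bpq_ok_def intro!: lowI parI)
 show ?thesis
 proof (rule finite_subset)
  show "finite (\<Union>k\<in>{0, 1, 2}. {t. det (M k t) = 0})" using fin by auto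
  show "{t. \<not> (\<exists>b p q. b \<in> low n & b \<in> GL n & p \<in> par n \<sigma> & p \<in> GL n & q \<in> par n \<tau> & q \<in> GL n &
   X t = b * X 0 * p & Y t = b * Y 0 * q)} \<subseteq> (\<Union>k\<in>{0, 1, 2}. {t. det (M k t) = 0})"
  proof (rule subsetI, rule ccontr)
   fix t assume 1: "t \<in> {t. \<not> (\<exists>b p q. b \<in> low n & b \<in> GL n & p \<in> par n \<sigma> & p \<in> GL n & q \<in> par n \<tau> & q \<in> GL n &
    X t = b * X 0 * p & Y t = b * Y 0 * q)}"
    and "t \<notin> (\<Union>k\<in>{0, 1, 2}. {t. det (M k t) = 0})"
   hence GL: "M 0 t \<in> GL n" "M 1 t \<in> GL n" "M 2 t \<in> GL n" using Mc by (auto intro!: GLI)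
   have "X t = M 0 t * X 0 * ginv (M 1 t)" "Y t = M 0 t * Y 0 * ginv (M 2 t)"
    unfolding eq using GL poly_matD(1)[OF X(1)] poly_matD(1)[OF X(2)] by (simp_all add: mult_assoc_sq[of _ n])
   thus False using 1 GL pat[of t] par_ginv ginv_GL by blast
  qed
 qed
qed

section \<open>Reduction to a Levi subgroup\<close>

definition levi :: "nat => (nat => nat) => (nat => nat) => complex mat => complex mat => bool" where
 "levi n \<sigma> \<tau> g A \<longleftrightarrow> A \<in> nilrad n \<sigma> &
   (\<forall>r<n. \<forall>c<n. r \<le> c --> \<tau> r = \<tau> c --> (g * A * ginv g) $$ (r, c) = 0)"

definition levi_plane :: "nat => (nat => nat) => (nat => nat) => complex mat => bool" where
 "levi_plane n \<sigma> \<tau> g \<longleftrightarrow> (\<exists>A A'. levi n \<sigma> \<tau> g A & levi n \<sigma> \<tau> g A' &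
   (\<forall>a b. a *% A + b *% A' = zrm n --> a = 0 & b = 0))"

lemma levi_carrier: "levi n \<sigma> \<tau> g A ==> A \<in> sqm n" unfolding levi_def by (blast intro: nilrad_carrier)

lemma levi_conormal:
 assumes g: "g \<in> GL n" and mono: "mono_on {..<n} \<tau>" and A: "levi n \<sigma> \<tau> g A"
 shows "\<exists>B. conormal n \<sigma> \<tau> g (idm n) A B"
proof -
 define Y where "Y = g * A * ginv g"
 have Y: "Y \<in> sqm n" using g levi_carrier[OF A] by (simp add: Y_def)
 define B where "B = mat n n (%(r, c). if \<tau> r < \<tau> c then - (Y $$ (r, c)) else 0)"
 have B: "B \<in> nilrad n \<tau>" by (auto simp: B_def intro!: nilradI)
 have "(Y + idm n * B * ginv (idm n)) $$ (r, c) = 0" if rc: "r < n" "c < n" "r \<le> c" for r c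
 proof -
  have "(Y + idm n * B * ginv (idm n)) $$ (r, c) = Y $$ (r, c) + B $$ (r, c)"
   using rc Y B by (simp add: index_add_sq[of _ n] del: index_add_mat)
  moreover have "\<tau> r < \<tau> c \<or> \<tau> r = \<tau> c" using mono_onD[OF mono _ _ rc(3)] rc by auto
  moreover have "Y $$ (r, c) = 0" if "\<tau> r = \<tau> c" using A rc that unfolding levi_def Y_def by blast
  ultimately show ?thesis using rc by (auto simp: B_def)
 qed
 moreover have "A \<in> nilrad n \<sigma>" using A by (simp add: levi_def)
 ultimately show ?thesis using B unfolding conormal_def Y_def by blast
qed

lemma conormal_levi:
 assumes g: "g \<in> GL n" and con: "conormal n \<sigma> \<tau> g (idm n) A B"
 shows "levi n \<sigma> \<tau> g A"
proof -
 have nil: "A \<in> nilrad n \<sigma>" "B \<in> nilrad n \<tau>" using con by (auto simp: conormal_def)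
 have "(g * A * ginv g) $$ (r, c) = 0" if rc: "r < n" "c < n" "r \<le> c" "\<tau> r = \<tau> c" for r c
 proof -
  have "(g * A * ginv g + idm n * B * ginv (idm n)) $$ (r, c) = (g * A * ginv g) $$ (r, c) + B $$ (r, c)"
   using rc g nil by (simp add: index_add_sq[of _ n] del: index_add_mat index_mult_mat)
  moreover have "B $$ (r, c) = 0" using nilradD[OF nil(2)] rc by simp
  moreover have "(g * A * ginv g + idm n * B * ginv (idm n)) $$ (r, c) = 0" using con rc unfolding conormal_def by blast
  ultimately show ?thesis by (simp del: index_mult_mat index_add_mat)
 qed
 thus ?thesis using nil unfolding levi_def by blast
qed

lemma conormal_zero:
 assumes g: "g \<in> GL n" and mono: "mono_on {..<n} \<tau>"
  and con: "conormal n \<sigma> \<tau> g (idm n) (zrm n) B"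
 shows "B = zrm n"
proof (rule eq_matI)
 have B: "B \<in> nilrad n \<tau>" using con by (simp add: conormal_def)
 show "dim_row B = dim_row (zrm n)" "dim_col B = dim_col (zrm n)" using carrier_matD[OF nilrad_carrier[OF B]] by auto
 fix r c assume "r < dim_row (zrm n)" "c < dim_col (zrm n)"
 hence rc: "r < n" "c < n" by auto
 show "B $$ (r, c) = zrm n $$ (r, c)"
 proof (cases "r \<le> c")
  case True
  hence "(g * zrm n * ginv g + idm n * B * ginv (idm n)) $$ (r, c) = 0" using con rc unfolding conormal_def by blast
  thus ?thesis using g B rc by simp
 next
  case False
  thus ?thesis using nilradD[OF B rc] mono_onD[OF mono, of c r] rc by simp
 qed
qed

lemma levi_plane_iff:
 assumes g: "g \<in> GL n" and mono: "mono_on {..<n} \<tau>"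
 shows "levi_plane n \<sigma> \<tau> g \<longleftrightarrow> plane n \<sigma> \<tau> g (idm n)"
proof
 assume "levi_plane n \<sigma> \<tau> g"
 then obtain A A' where 1: "levi n \<sigma> \<tau> g A" "levi n \<sigma> \<tau> g A'" "\<And>a b. a *% A + b *% A' = zrm n ==> a = 0 & b = 0"
  unfolding levi_plane_def by blast
 obtain B B' where "conormal n \<sigma> \<tau> g (idm n) A B" "conormal n \<sigma> \<tau> g (idm n) A' B'"
  using levi_conormal[OF g mono 1(1)] levi_conormal[OF g mono 1(2)] by blast
 moreover have "indep2 n A B A' B'" using 1(3) unfolding indep2_def by blast
 ultimately show "plane n \<sigma> \<tau> g (idm n)" unfolding plane_def by blast
next
 assume "plane n \<sigma> \<tau> g (idm n)"
 then obtain A B A' B' where 1: "conormal n \<sigma> \<tau> g (idm n) A B" "conormal n \<sigma> \<tau> g (idm n) A' B'" "indep2 n A B A' B'"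
  unfolding plane_def by blast
 have "a = 0 & b = 0" if z: "a *% A + b *% A' = zrm n" for a b
 proof -
  have "conormal n \<sigma> \<tau> g (idm n) (zrm n) (a *% B + b *% B')" using conormal_lin[OF g one_GL 1(1,2), of a b] unfolding z .
  from conormal_zero[OF g mono this] show ?thesis using z 1(3) unfolding indep2_def by blast
 qed
 thus "levi_plane n \<sigma> \<tau> g" using conormal_levi[OF g 1(1)] conormal_levi[OF g 1(2)] unfolding levi_plane_def by blast
qed

text \<open>For generic \<open>h\<close> the flags defined by \<open>1\<close> (fixed by the lower triangular matrices) and \<open>h\<close>
 are opposite, so that \<open>h\<close> may be moved to \<open>1\<close>; the general case follows by semicontinuity.\<close>

lemma wild_of_levi:
 assumes mono: "mono_on {..<n} \<tau>" and lw: "\<And>g. g \<in> GL n ==> levi_plane n \<sigma> \<tau> g"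
 shows "wild n \<sigma> \<tau>" unfolding wild_def
proof (intro ballI)
 fix g h assume gh: "g \<in> GL n" "h \<in> GL n"
 define Y where "Y = seg (idm n) h"
 have Y: "poly_mat n Y" "Y 0 = idm n" "Y 1 = h"
  using gh seg_0[of "idm n" n n h] seg_1[of "idm n" n n h] by (auto simp: Y_def intro!: poly_mat_seg)
 define F where "F = {t. \<not> (\<exists>b p q. b \<in> low n & b \<in> GL n & p \<in> par n (%_. 0) & p \<in> GL n & q \<in> par n \<tau> & q \<in> GL n &
  idm n = b * idm n * p & Y t = b * Y 0 * q)}"
 have "finite F" unfolding F_def
 proof (rule orbit_along_curve[where X = "%t. idm n"])
  show "poly_mat n (%t. idm n)" by (rule poly_mat_const) simp
  fix A B assume con: "conormal n (%_. 0) \<tau> (idm n) (Y 0) A B"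
  hence "A \<in> nilrad n (%_. 0)" by (simp add: conormal_def)
  hence "A = zrm n" using carrier_matD[OF nilrad_carrier] nilradD by (intro eq_matI) auto
  thus "A = zrm n & B = zrm n" using conormal_zero[OF one_GL mono, where \<sigma> = "%_. 0" and B = B] con unfolding Y(2) by auto
 qed (simp_all add: Y)
 hence "plane n \<sigma> \<tau> g (Y 1)"
 proof (rule plane_limit[of n "%t. g" Y 1 F, rotated 4])
  show "poly_mat n (%t. g)" using gh by (intro poly_mat_const) simp
  fix t assume "t \<notin> F"
  then obtain b q where b: "b \<in> low n" "b \<in> GL n" "q \<in> par n \<tau>" "q \<in> GL n" "Y t = b * idm n * q"
   unfolding F_def Y(2) by blast
  have "plane n \<sigma> \<tau> (ginv b * g) (idm n)" using lw[of "ginv b * g"] b gh by (simp add: levi_plane_iff[OF _ mono])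
  hence "plane n \<sigma> \<tau> (b * (ginv b * g) * idm n) (b * idm n * q)" using b gh by (intro plane_move) auto
  thus "g \<in> GL n & Y t \<in> GL n & plane n \<sigma> \<tau> g (Y t)" using b gh by simp
 qed (use gh Y in auto)
 thus "plane n \<sigma> \<tau> g h" by (simp add: Y)
qed

lemma levi_of_wild:
 assumes mono: "mono_on {..<n} \<tau>" and w: "wild n \<sigma> \<tau>" and g: "g \<in> GL n"
 shows "levi_plane n \<sigma> \<tau> g" using w g one_GL unfolding wild_def levi_plane_iff[OF g mono] by blast

text \<open>By semicontinuity it is enough to consider generic \<open>g\<close>.\<close>

lemma levi_generic:
 assumes mono: "mono_on {..<n} \<tau>" and ij: "i < n"
  and gen: "\<And>g. g \<in> GL n ==> ginv g $$ (i, i) ~= 0 ==> levi_plane n \<sigma> \<tau> g" and g: "g \<in> GL n"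
 shows "levi_plane n \<sigma> \<tau> g"
proof -
 define X where "X = seg (idm n) g"
 have X: "poly_mat n X" "X 0 = idm n" "X 1 = g"
  using g seg_0[of "idm n" n n g] seg_1[of "idm n" n n g] by (auto simp: X_def intro!: poly_mat_seg)
 have adj: "ginv k $$ (i, i) = adj_mat k $$ (i, i) / det k" if "k \<in> sqm n" for k
  using adj_mat(1)[OF that] ij unfolding ginv_def by (simp add: index_smult_sq[of _ n])
 define F where "F = {t. det (X t) = 0} \<union> {t. adj_mat (X t) $$ (i, i) = 0}"
 have "adj_mat (idm n) $$ (i, i) ~= (0::complex)" using adj[of "idm n"] ij by auto
 hence "finite {t. adj_mat (X t) $$ (i, i) = 0}"
  using poly_matD(2)[OF poly_mat_adj[OF X(1)] ij ij] X(2) by (intro is_poly_finite_zeros[of _ 0]) auto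
 moreover have "finite {t. det (X t) = 0}" by (rule is_poly_finite_zeros[OF poly_mat_det[OF X(1)], of 0]) (simp add: X(2))
 ultimately have "finite F" unfolding F_def by simp
 hence "plane n \<sigma> \<tau> (X 1) (idm n)"
 proof (rule plane_limit[of n X "%t. idm n" 1 F, rotated 4])
  show "poly_mat n (%t. idm n)" by (intro poly_mat_const) simp
  fix t assume t: "t \<notin> F"
  have Xt: "X t \<in> GL n" using t poly_matD(1)[OF X(1)] by (intro GLI) (auto simp: F_def)
  moreover have "ginv (X t) $$ (i, i) ~= 0" using t adj[OF GL_carrier[OF Xt]] by (auto simp: F_def)
  ultimately show "X t \<in> GL n & idm n \<in> GL n & plane n \<sigma> \<tau> (X t) (idm n)"
   using gen[OF Xt] levi_plane_iff[OF Xt mono] by auto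
 qed (use g X in auto)
 thus ?thesis using levi_plane_iff[OF g mono] by (simp add: X)
qed

section \<open>Reordering the blocks\<close>

definition perm_mat :: "nat => (nat => nat) => complex mat" where
 "perm_mat n f = mat n n (%(r, s). if s = f r then 1 else 0)"

lemma perm_mat_carrier [simp]: "perm_mat n f \<in> sqm n" by (simp add: perm_mat_def)

lemma perm_mat_left:
 assumes "M \<in> sqm n" "f r < n" "r < n" "c < n"
 shows "(perm_mat n f * M) $$ (r, c) = M $$ (f r, c)"
proof -
 have "(perm_mat n f * M) $$ (r, c) = (\<Sum>s<n. if s = f r then M $$ (s, c) else 0)"
  unfolding mult_mat_sum[OF perm_mat_carrier assms(1,3,4)] using assms by (intro sum.cong) (auto simp: perm_mat_def)
 thus ?thesis using assms by simp
qed

lemma perm_mat_right: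
 assumes "M \<in> sqm n" "f permutes {..<n}" "r < n" "c < n"
 shows "(M * perm_mat n f) $$ (r, f c) = M $$ (r, c)"
proof -
 have fc: "f c < n" using permutes_in_image[OF assms(2), of c] assms(4) by simp
 have "(M * perm_mat n f) $$ (r, f c) = (\<Sum>s<n. if s = c then M $$ (r, s) else 0)"
  unfolding mult_mat_sum[OF assms(1) perm_mat_carrier assms(3) fc]
  using fc permutes_inj[OF assms(2)] by (intro sum.cong) (auto simp: perm_mat_def inj_eq)
 thus ?thesis using assms by simp
qed

lemma perm_mat_GL [simp]:
 assumes "f permutes {..<n}"
 shows "perm_mat n f \<in> GL n" "ginv (perm_mat n f) = perm_mat n (inv_into UNIV f)"
proof -
 have inv: "inv_into UNIV f permutes {..<n}" using assms by (rule permutes_inv)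
 have "perm_mat n f * perm_mat n (inv_into UNIV f) = idm n"
 proof (rule eq_matI)
  fix r c assume "r < dim_row (idm n)" "c < dim_col (idm n)"
  hence rc: "r < n" "c < n" by auto
  have fr: "f r < n" using permutes_in_image[OF assms, of r] rc by simp
  show "(perm_mat n f * perm_mat n (inv_into UNIV f)) $$ (r, c) = idm n $$ (r, c)"
   using perm_mat_left[of "perm_mat n (inv_into UNIV f)" n f r c] fr rc permutes_inverses(2)[OF assms] by (auto simp: perm_mat_def)
 qed (simp_all add: perm_mat_def)
 thus "perm_mat n f \<in> GL n" "ginv (perm_mat n f) = perm_mat n (inv_into UNIV f)"
  using GL_I[of "perm_mat n f" n "perm_mat n (inv_into UNIV f)"] ginv_unique[of "perm_mat n f" n "perm_mat n (inv_into UNIV f)"] by auto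
qed

lemma levi_reorder:
 assumes f: "f permutes {..<n}"
  and ord: "\<And>r c. r \<le> c ==> c < n ==> \<tau> r = \<tau> c ==> f r \<le> f c & \<tau>' (f r) = \<tau>' (f c)"
  and g: "g \<in> GL n" and A: "levi n \<sigma> \<tau>' (perm_mat n (inv_into UNIV f) * g) A"
 shows "levi n \<sigma> \<tau> g A"
proof -
 define k where "k = perm_mat n (inv_into UNIV f) * g"
 have inv: "inv_into UNIV f permutes {..<n}" using f by (rule permutes_inv)
 have k: "k \<in> GL n" using g inv by (simp add: k_def)
 have Ac: "A \<in> sqm n" using A by (rule levi_carrier)
 have gk: "g = perm_mat n f * k"
  using ginv_left_cancel[of "perm_mat n (inv_into UNIV f)" n g] inv g permutes_inv_inv[OF f] by (simp add: k_def)
 have eq: "g * A * ginv g = perm_mat n f * ((k * A * ginv k) * perm_mat n (inv_into UNIV f))"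
  unfolding gk using k f Ac by (simp add: ginv_mult[of _ n] mult_assoc_sq[of _ n])
 have "(g * A * ginv g) $$ (r, c) = (k * A * ginv k) $$ (f r, f c)" if "r < n" "c < n" for r c
 proof -
  have fr: "f r < n" "f c < n" using permutes_in_image[OF f] that by auto
  have "(g * A * ginv g) $$ (r, c) = ((k * A * ginv k) * perm_mat n (inv_into UNIV f)) $$ (f r, c)"
   unfolding eq using k Ac fr that by (intro perm_mat_left) simp_all
  also have "\<dots> = (k * A * ginv k) $$ (f r, f c)"
   using perm_mat_right[of "k * A * ginv k" n "inv_into UNIV f" "f r" "f c"] k Ac inv fr permutes_inverses(2)[OF f] by simp
  finally show ?thesis .
 qed
 thus ?thesis using A ord permutes_in_image[OF f] unfolding levi_def k_def[symmetric] by auto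
qed

lemma levi_plane_reorder:
 assumes f: "f permutes {..<n}"
  and ord: "\<And>r c. r \<le> c ==> c < n ==> \<tau> r = \<tau> c ==> f r \<le> f c & \<tau>' (f r) = \<tau>' (f c)"
  and lw: "\<And>g. g \<in> GL n ==> levi_plane n \<sigma> \<tau>' g" and g: "g \<in> GL n"
 shows "levi_plane n \<sigma> \<tau> g"
proof -
 have "perm_mat n (inv_into UNIV f) * g \<in> GL n" using g permutes_inv[OF f] by simp
 from lw[OF this] show ?thesis unfolding levi_plane_def using levi_reorder[OF f ord g] by blast
qed

section \<open>Adding one dimension\<close>

lemma levi_move:
 assumes g: "g \<in> GL n" and p: "p \<in> par n \<sigma>" "p \<in> GL n" and A: "levi n \<sigma> \<tau> (g * p) A"
 shows "levi n \<sigma> \<tau> g (p * A * ginv p)"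
proof -
 have Ac: "A \<in> sqm n" using A by (rule levi_carrier)
 have "g * (p * A * ginv p) * ginv g = (g * p) * A * ginv (g * p)" using g p Ac by (simp add: ginv_mult[of _ n] mult_assoc_sq[of _ n])
 thus ?thesis using A par_nilrad_conj(2)[OF p] unfolding levi_def by simp
qed

lemma levi_plane_move:
 assumes g: "g \<in> GL n" and p: "p \<in> par n \<sigma>" "p \<in> GL n" and pl: "levi_plane n \<sigma> \<tau> (g * p)"
 shows "levi_plane n \<sigma> \<tau> g"
proof -
 obtain A A' where 1: "levi n \<sigma> \<tau> (g * p) A" "levi n \<sigma> \<tau> (g * p) A'"
  "\<And>a b. a *% A + b *% A' = zrm n ==> a = 0 & b = 0" using pl unfolding levi_plane_def by blast
 have c: "A \<in> sqm n" "A' \<in> sqm n" using 1 by (auto intro: levi_carrier)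
 have "a = 0 & b = 0" if z: "a *% (p * A * ginv p) + b *% (p * A' * ginv p) = zrm n" for a b
 proof -
  have "ginv (ginv p) * (a *% A + b *% A') * ginv p = zrm n"
   unfolding ginv_ginv[OF p(2)] z[symmetric] by (rule conj_lin) (use c p in simp_all)
  from conj_zero[OF ginv_GL[OF p(2)] _ this] show ?thesis using 1(3) c lin_carrier by blast
 qed
 thus ?thesis using levi_move[OF g p 1(1)] levi_move[OF g p 1(2)] unfolding levi_plane_def by blast
qed

text \<open>Quotient by the line \<open>e_n\<close>: if this line is in general position with respect to the flag of
 \<open>g\<close>, then one may change the last column of \<open>g\<close> to \<open>e_n\<close>, and an \<open>n \<times> n\<close> solution extended by
 zero is a solution.\<close>

lemma levi_extend:
 fixes n :: nat
 defines "m \<equiv> n + 1"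
 assumes last: "\<And>i. i < n ==> \<sigma> i \<le> \<sigma> n" and lw: "\<And>g. g \<in> GL n ==> levi_plane n \<sigma> \<tau> g"
  and g: "g \<in> GL m" and gn: "ginv g $$ (n, n) ~= 0"
 shows "levi_plane m \<sigma> \<tau> g"
proof -
 define p where "p = mat m m (%(i, j). if j = n then ginv g $$ (i, n) else if i = j then 1 else 0)"
 have pc: "p \<in> carrier_mat m m" by (simp add: p_def)
 have "upper_triangular p" unfolding upper_triangular_def by (auto simp: p_def m_def)
 hence "det p = prod_list (diag_mat p)" using pc by (rule det_upper_triangular)
 moreover have "0 \<notin> set (diag_mat p)" using gn unfolding diag_mat_def by (auto simp: p_def m_def)
 ultimately have pGL: "p \<in> GL m" using pc by (intro GLI) (auto simp: prod_list_zero_iff)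
 have pp: "p \<in> par m \<sigma>"
 proof (rule parI)
  fix i j assume ij: "i < m" "j < m" "\<sigma> j < \<sigma> i"
  hence "j ~= n" "i ~= j" using last[of i] by (auto simp: m_def less_Suc_eq)
  thus "p $$ (i, j) = 0" using ij by (simp add: p_def)
 qed (rule pc)
 have nm: "n < m" by (simp add: m_def)
 define h where "h = g * p"
 have h: "h \<in> GL m" using g pGL by (simp add: h_def)
 have hn: "h $$ (r, n) = (if r = n then 1 else 0)" if "r < m" for r
 proof -
  have "h $$ (r, n) = (\<Sum>l<m. g $$ (r, l) * ginv g $$ (l, n))" unfolding h_def mult_mat_sum[OF GL_carrier[OF g] pc that nm]
   by (intro sum.cong) (auto simp: m_def p_def)
  also have "\<dots> = (g * ginv g) $$ (r, n)" by (rule mult_mat_sum[OF GL_carrier[OF g] ginv_carrier[OF g] that nm, symmetric])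
  also have "\<dots> = (if r = n then 1 else 0)" unfolding ginv_right[OF g] using that by (auto simp: m_def)
  finally show ?thesis .
 qed
 define k where "k = mat n n (%p. h $$ p)"
 define c where "c = mat 1 n (%(_, j). h $$ (n, j))"
 have kc: "k \<in> sqm n" "c \<in> carrier_mat 1 n" by (simp_all add: k_def c_def)
 have blk: "h = four_block_mat k (0\<^sub>m n 1) c (1\<^sub>m 1)"
 proof (rule eq_matI)
  fix i j assume "i < dim_row (four_block_mat k (0\<^sub>m n 1) c (1\<^sub>m 1))" "j < dim_col (four_block_mat k (0\<^sub>m n 1) c (1\<^sub>m 1))"
  hence "i < m" "j < m" by (simp_all add: k_def m_def)
  moreover from this have "i < n \<or> i = n" "j < n \<or> j = n" by (auto simp: m_def)
  ultimately show "h $$ (i, j) = four_block_mat k (0\<^sub>m n 1) c (1\<^sub>m 1) $$ (i, j)"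
   using hn[of i] by (auto simp: k_def c_def m_def)
 qed (use carrier_matD[OF GL_carrier[OF h]] in \<open>auto simp: k_def m_def\<close>)
 have "det h = det k * det (1\<^sub>m 1 :: complex mat)"
  unfolding blk by (rule det_four_block_mat_upper_right_zero[OF kc(1) refl kc(2)]) simp
 hence kGL: "k \<in> GL n" using GL_det[OF h] kc by (intro GLI) auto
 define E where "E A = four_block_mat A (0\<^sub>m n 1) (0\<^sub>m 1 n) (0\<^sub>m 1 1 :: complex mat)" for A
 have Ec: "E A \<in> carrier_mat m m" if "A \<in> sqm n" for A using that by (auto simp: E_def m_def)
 have Ei: "E A $$ (i, j) = (if i < n & j < n then A $$ (i, j) else 0)" if "A \<in> sqm n" "i < m" "j < m" for A i j
  using that by (auto simp: E_def m_def)
 have ext: "levi m \<sigma> \<tau> h (E A)" if A: "levi n \<sigma> \<tau> k A" for A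
 proof -
  have Ac: "A \<in> sqm n" using A by (rule levi_carrier)
  define Y where "Y = k * A * ginv k"
  define \<rho> where "\<rho> = c * A * ginv k"
  have Yc: "Y \<in> sqm n" "\<rho> \<in> carrier_mat 1 n"
   using kGL Ac mult_carrier_mat[OF mult_carrier_mat[OF kc(2) Ac] ginv_carrier[OF kGL]] by (simp_all add: Y_def \<rho>_def)
  have Yk: "Y * k = k * A" using kGL Ac by (simp add: Y_def mult_assoc_sq[of _ n])
  have rk: "\<rho> * k = c * A"
  proof -
   have "\<rho> * k = c * A * (ginv k * k)" unfolding \<rho>_def
    by (rule assoc_mult_mat[OF mult_carrier_mat[OF kc(2) Ac] ginv_carrier[OF kGL] kc(1)])
   thus ?thesis unfolding ginv_left[OF kGL] right_mult_one_mat[OF mult_carrier_mat[OF kc(2) Ac]] .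
  qed
  define Z where "Z = four_block_mat Y (0\<^sub>m n 1) \<rho> (0\<^sub>m 1 1)"
  have Zc: "Z \<in> carrier_mat m m" using Yc by (auto simp: Z_def m_def)
  have "Z * h = four_block_mat (Y * k + 0\<^sub>m n 1 * c) (Y * 0\<^sub>m n 1 + 0\<^sub>m n 1 * 1\<^sub>m 1) (\<rho> * k + 0\<^sub>m 1 1 * c) (\<rho> * 0\<^sub>m n 1 + 0\<^sub>m 1 1 * 1\<^sub>m 1)"
   unfolding Z_def blk by (rule mult_four_block_mat) (use Yc kc in auto)
  also have "\<dots> = four_block_mat (k * A) (0\<^sub>m n 1) (c * A) (0\<^sub>m 1 1)" unfolding Yk rk using kc Ac Yc by auto
  also have "\<dots> = four_block_mat (k * A + 0\<^sub>m n 1 * 0\<^sub>m 1 n) (k * 0\<^sub>m n 1 + 0\<^sub>m n 1 * 0\<^sub>m 1 1) (c * A + 1\<^sub>m 1 * 0\<^sub>m 1 n) (c * 0\<^sub>m n 1 + 1\<^sub>m 1 * 0\<^sub>m 1 1)"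
   using kc Ac Yc by auto
  also have "\<dots> = h * E A" unfolding E_def blk by (rule mult_four_block_mat[symmetric]) (use Ac kc in auto)
  finally have "Z * h = h * E A" .
  hence "h * E A * ginv h = Z * h * ginv h" by simp
  also have "\<dots> = Z" using Zc h by (simp add: mult_assoc_sq[of _ m])
  finally have hZ: "h * E A * ginv h = Z" .
  show ?thesis unfolding levi_def hZ
  proof (intro conjI allI impI)
   show "E A \<in> nilrad m \<sigma>"
   proof (rule nilradI)
    fix i j assume "i < m" "j < m" "\<sigma> j \<le> \<sigma> i"
    thus "E A $$ (i, j) = 0" using nilradD[of A n \<sigma> i j] A unfolding levi_def by (simp add: Ei[OF Ac])
   qed (rule Ec[OF Ac])
   fix r s assume rs: "r < m" "s < m" "r \<le> s" "\<tau> r = \<tau> s"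
   hence "s < n \<or> s = n" by (auto simp: m_def)
   thus "Z $$ (r, s) = 0"
   proof
    assume "s < n"
    hence "Y $$ (r, s) = 0" using A rs unfolding levi_def Y_def by simp
    thus ?thesis using rs \<open>s < n\<close> Yc by (simp add: Z_def m_def)
   next
    assume "s = n"
    thus ?thesis using rs Yc by (auto simp: Z_def m_def)
   qed
  qed
 qed
 obtain A A' where 1: "levi n \<sigma> \<tau> k A" "levi n \<sigma> \<tau> k A'" "\<And>a b. a *% A + b *% A' = zrm n ==> a = 0 & b = 0"
  using lw[OF kGL] unfolding levi_plane_def by blast
 have Ac: "A \<in> sqm n" "A' \<in> sqm n" using 1 by (auto intro: levi_carrier)
 have "a = 0 & b = 0" if z: "a *% E A + b *% E A' = 0\<^sub>m m m" for a b
 proof (rule 1(3), rule eq_matI)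
  fix i j assume "i < dim_row (zrm n)" "j < dim_col (zrm n)"
  hence ij: "i < n" "j < n" "i < m" "j < m" by (auto simp: m_def)
  have "(a *% E A + b *% E A') $$ (i, j) = 0" unfolding z using ij by simp
  thus "(a *% A + b *% A') $$ (i, j) = zrm n $$ (i, j)"
   using ij Ac by (simp add: index_lin[OF Ec[OF Ac(1)] Ec[OF Ac(2)]] Ei del: index_add_mat)
 qed (use Ac in auto)
 hence "levi_plane m \<sigma> \<tau> h" using ext[OF 1(1)] ext[OF 1(2)] unfolding levi_plane_def by blast
 thus ?thesis unfolding h_def by (rule levi_plane_move[OF g pp pGL])
qed

text \<open>For flags in general position the quotient by the last coordinate line is a pair of flags of one dimension less, whose conormal vectors lift.\<close>

lemma wild_extend:
 assumes "mono_on {..<n + 1} \<tau>" "\<And>i. i < n ==> \<sigma> i \<le> \<sigma> n" "wild n \<sigma> \<tau>"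
 shows "wild (n + 1) \<sigma> \<tau>"
proof (rule wild_of_levi[OF assms(1)], rule levi_generic[OF assms(1), of n])
 have m: "mono_on {..<n} \<tau>" using assms(1) by (rule mono_on_subset) auto
 fix g assume "g \<in> GL (n + 1)" "ginv g $$ (n, n) ~= 0"
 thus "levi_plane (n + 1) \<sigma> \<tau> g" using assms(2) levi_of_wild[OF m assms(3)] by (intro levi_extend)
qed simp_all

section \<open>Block sizes\<close>

text \<open>\<open>block p i\<close> is the number of the block of size \<open>p ! _\<close> that contains \<open>i\<close>.\<close>

fun block :: "nat list => nat => nat" where
 "block [] i = 0"
| "block (a # p) i = (if i < a then 0 else Suc (block p (i - a)))"

lemma block_append:
 "block (p @ q) i = (if i < sum_list p then block p i else length p + block q (i - sum_list p))" by (induction p arbitrary: i) auto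

lemma block_mono: "i \<le> j ==> block p i \<le> block p j" by (induction p arbitrary: i j) auto

lemma block_mono_on: "mono_on A (block p)" by (rule mono_onI) (rule block_mono)

lemma block_less: "i < sum_list p ==> block p i < length p" by (induction p arbitrary: i) auto

definition wildl :: "nat list => nat list => bool" where
 "wildl p q \<longleftrightarrow> sum_list p = sum_list q & wild (sum_list p) (block p) (block q)"

lemma wildl_swap: "wildl p q ==> wildl q p" unfolding wildl_def using wild_swap by metis

lemma wild_cong:
 assumes "wild n \<sigma> \<tau>" "\<And>i. i < n ==> \<sigma> i = \<sigma>' i" "\<And>i. i < n ==> \<tau> i = \<tau>' i"
 shows "wild n \<sigma>' \<tau>'"
proof -
 have "wild n \<sigma>' \<tau>" by (rule wild_refine[OF assms(1)]) (simp add: assms(2))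
 hence "wild n \<tau> \<sigma>'" by (rule wild_swap)
 hence "wild n \<tau>' \<sigma>'" by (rule wild_refine) (simp add: assms(3))
 thus ?thesis by (rule wild_swap)
qed

lemma wildl_extend:
 assumes "wildl (p @ [a]) (q @ [b])"
 shows "wildl (p @ [Suc a]) (q @ [Suc b])"
proof -
 define n where "n = sum_list p + a"
 have n: "n = sum_list q + b" using assms by (simp add: wildl_def n_def)
 have "wild (sum_list (p @ [a])) (block (p @ [a])) (block (q @ [b]))" using assms unfolding wildl_def by blast
 hence "wild n (block (p @ [a])) (block (q @ [b]))" by (simp add: n_def)
 hence "wild n (block (p @ [Suc a])) (block (q @ [Suc b]))"
 proof (rule wild_cong)
  show "block (p @ [a]) i = block (p @ [Suc a]) i" if "i < n" for i using that by (auto simp: block_append n_def)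
  show "block (q @ [b]) i = block (q @ [Suc b]) i" if "i < n" for i using that by (auto simp: block_append n)
 qed
 hence "wild (n + 1) (block (p @ [Suc a])) (block (q @ [Suc b]))" by (intro wild_extend) (auto intro: block_mono_on block_mono)
 moreover have "sum_list (p @ [Suc a]) = n + 1" "sum_list (q @ [Suc b]) = n + 1" using n by (simp_all add: n_def)
 ultimately show ?thesis unfolding wildl_def by simp
qed

definition exchange :: "nat => nat => nat => nat => nat" where
 "exchange s a b r = (if r < s then r else if r < s + b then r + a else if r < s + b + a then r - b else r)"

lemma exchange_permutes:
 assumes "s + a + b \<le> n" shows "exchange s a b permutes {..<n}"
 by (rule inj_imp_permutes) (use assms in \<open>auto simp: exchange_def inj_on_def split: if_splits\<close>)

lemma exchange_order:
 assumes "r \<le> c" "block (u @ [b, a] @ v) r = block (u @ [b, a] @ v) c"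
 shows "exchange (sum_list u) a b r \<le> exchange (sum_list u) a b c &
  block (u @ [a, b] @ v) (exchange (sum_list u) a b r) = block (u @ [a, b] @ v) (exchange (sum_list u) a b c)"
proof -
 have v: "block (u @ [x, y] @ v) i = (if i < sum_list u then block u i else if i < sum_list u + x then length u
   else if i < sum_list u + x + y then length u + 1 else length u + 2 + block v (i - (sum_list u + x + y)))" for x y i
  by (auto simp: block_append)
 have lu: "i < sum_list u ==> block u i < length u" for i by (rule block_less)
 define s where "s = sum_list u"
 note v' = v[folded s_def]
 have lt: "i < s ==> block u i < length u" for i unfolding s_def by (rule lu)
 consider "r < s" "c < s" | "s \<le> r" "r < s + b" "s \<le> c" "c < s + b"
  | "s + b \<le> r" "r < s + b + a" "s + b \<le> c" "c < s + b + a" | "s + b + a \<le> r" "s + b + a \<le> c"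
  using assms(1) assms(2)[unfolded v'] lt[of r] lt[of c] by (auto split: if_splits)
 thus ?thesis unfolding s_def[symmetric] exchange_def v'
  by cases (use assms(1) assms(2)[unfolded v'] in \<open>auto simp: ac_simps\<close>)
qed

lemma wildl_exchange:
 assumes "wildl p (u @ [a, b] @ v)"
 shows "wildl p (u @ [b, a] @ v)"
proof -
 define n where "n = sum_list p"
 have w: "wild n (block p) (block (u @ [a, b] @ v))" and "n = sum_list (u @ [a, b] @ v)"
  using assms unfolding wildl_def n_def by blast+
 hence n: "n = sum_list u + a + b + sum_list v" "n = sum_list (u @ [b, a] @ v)" by simp_all
 have "wild n (block p) (block (u @ [b, a] @ v))"
 proof (rule wild_of_levi[OF block_mono_on], rule levi_plane_reorder)
  show "exchange (sum_list u) a b permutes {..<n}" by (rule exchange_permutes) (simp add: n(1))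
  fix r c assume rc: "r \<le> c" "c < n" "block (u @ [b, a] @ v) r = block (u @ [b, a] @ v) c"
  show "exchange (sum_list u) a b r \<le> exchange (sum_list u) a b c &
    block (u @ [a, b] @ v) (exchange (sum_list u) a b r) = block (u @ [a, b] @ v) (exchange (sum_list u) a b c)"
   using rc(1,3) by (rule exchange_order)
 next
  show "levi_plane n (block p) (block (u @ [a, b] @ v)) g" if "g \<in> GL n" for g using levi_of_wild[OF block_mono_on w that] .
 qed
 thus ?thesis using n(2) unfolding wildl_def n_def by simp
qed

lemma wildl_move: "wildl p (pre @ x # u @ v) \<longleftrightarrow> wildl p (pre @ u @ x # v)"
proof (induction u arbitrary: pre)
 case (Cons a u)
 have "wildl p (pre @ x # (a # u) @ v) \<longleftrightarrow> wildl p ((pre @ [a]) @ x # u @ v)"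
  using wildl_exchange[of p pre x a "u @ v"] wildl_exchange[of p pre a x "u @ v"] by auto
 thus ?case using Cons[of "pre @ [a]"] by simp
qed simp

lemma wildl_perm_right:
 assumes "mset q = mset q'" shows "wildl p (pre @ q) \<longleftrightarrow> wildl p (pre @ q')" using assms
proof (induction q arbitrary: q' pre)
 case (Cons x q)
 have "x \<in> set q'" using Cons.prems by (metis list.set_intros(1) mset_eq_setD)
 then obtain u v where q': "q' = u @ x # v" by (meson split_list)
 have "mset q = mset (u @ v)" using Cons.prems unfolding q' by simp
 from Cons.IH[OF this, of "pre @ [x]"] show ?case unfolding q' using wildl_move[of p pre x u v] by simp
qed simp

lemma wildl_perm:
 assumes "mset p = mset p'" "mset q = mset q'" "wildl p q"
 shows "wildl p' q'"
proof -
 have "wildl p q'" using wildl_perm_right[OF assms(2), of p "[]"] assms(3) by simp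
 hence "wildl q' p" by (rule wildl_swap)
 hence "wildl q' p'" using wildl_perm_right[OF assms(1), of q' "[]"] by simp
 thus ?thesis by (rule wildl_swap)
qed

lemma wildl_refine: "wildl ((a + b) # p) q ==> wildl (a # b # p) q"
proof -
 assume w: "wildl ((a + b) # p) q"
 have "wild (sum_list ((a + b) # p)) (block (a # b # p)) (block q)"
  by (rule wild_refine[of _ "block ((a + b) # p)"]) (use w in \<open>auto simp: wildl_def split: if_splits\<close>)
 thus ?thesis using w unfolding wildl_def by (simp add: add.assoc)
qed

lemma list_le_split:
 assumes "list_all2 (\<le>) p p'" "sum_list p < sum_list p'"
 shows "\<exists>u a v. p' = u @ [Suc a] @ v & list_all2 (\<le>) p (u @ [a :: nat] @ v)" using assms
proof (induction rule: list_all2_induct)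
 case (Cons x xs y ys)
 show ?case
 proof (cases "x < y")
  case True
  then obtain a where "y = Suc a" "x \<le> a" by (metis Suc_le_D Suc_leI Suc_le_mono)
  with Cons.hyps show ?thesis by (intro exI[of _ "[]"] exI[of _ a] exI[of _ ys]) auto
 next
  case False
  hence "sum_list xs < sum_list ys" using Cons by auto
  with Cons obtain u a v where "ys = u @ [Suc a] @ v" "list_all2 (\<le>) xs (u @ [a] @ v)" by blast
  with Cons.hyps show ?thesis by (intro exI[of _ "y # u"] exI[of _ a] exI[of _ v]) auto
 qed
qed simp

lemma list_le_sum: "list_all2 (\<le>) p p' ==> sum_list p \<le> (sum_list p' :: nat)" by (induction rule: list_all2_induct) auto

lemma list_le_eq: "list_all2 (\<le>) p p' ==> sum_list p = (sum_list p' :: nat) ==> p = p'"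
proof (induction rule: list_all2_induct)
 case (Cons x xs y ys)
 thus ?case using list_le_sum[of xs ys] by auto
qed simp

text \<open>Two shapes with the same sum that dominate a wild pair entry by entry are reached by repeatedly enlarging one block on each side; the order of the blocks does not matter.\<close>

lemma wildl_grow:
 assumes "wildl p0 q0" "list_all2 (\<le>) p0 p" "list_all2 (\<le>) q0 q" "sum_list p = sum_list q"
 shows "wildl p q" using assms(2-4)
proof (induction "sum_list p" arbitrary: p q rule: less_induct)
 case less
 have s0: "sum_list p0 = sum_list q0" using assms(1) by (simp add: wildl_def)
 show ?case
 proof (cases "sum_list p0 = sum_list p")
  case True
  hence "p0 = p" "q0 = q" using list_le_eq less.prems s0 by auto
  thus ?thesis using assms(1) by simp
 next
  case False
  hence "sum_list p0 < sum_list p" "sum_list q0 < sum_list q" using list_le_sum[OF less.prems(1)] s0 less.prems(3) by auto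
  then obtain u a v u' a' v' where p: "p = u @ [Suc a] @ v" "list_all2 (\<le>) p0 (u @ [a] @ v)"
   and q: "q = u' @ [Suc a'] @ v'" "list_all2 (\<le>) q0 (u' @ [a'] @ v')"
   using list_le_split[OF less.prems(1)] list_le_split[OF less.prems(2)] by blast
  have "wildl (u @ [a] @ v) (u' @ [a'] @ v')" by (rule less.hyps) (use p q less.prems(3) in auto)
  hence "wildl ((u @ v) @ [a]) ((u' @ v') @ [a'])" by (rule wildl_perm[rotated 2]) auto
  hence "wildl ((u @ v) @ [Suc a]) ((u' @ v') @ [Suc a'])" by (rule wildl_extend)
  thus ?thesis by (rule wildl_perm[rotated 2]) (auto simp: p q)
 qed
qed

lemma card_unk:
 "card (unk n \<sigma> \<tau>) = (\<Sum>i<n. \<Sum>j<n. (if \<sigma> i < \<sigma> j then 1 else 0) + (if \<tau> i < \<tau> j then 1 else 0))"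
proof -
 have c: "card {p \<in> {..<n} \<times> {..<n}. \<rho> (fst p) < \<rho> (snd p)} = (\<Sum>i<n. \<Sum>j<n. if \<rho> i < \<rho> j then 1 else 0)" for \<rho> :: "nat => nat"
 proof -
  have "card {p \<in> {..<n} \<times> {..<n}. \<rho> (fst p) < \<rho> (snd p)} = (\<Sum>p\<in>{..<n} \<times> {..<n}. if \<rho> (fst p) < \<rho> (snd p) then 1 else 0)"
   by (simp add: sum.If_cases Int_def)
  thus ?thesis by (simp add: sum.cartesian_product case_prod_unfold)
 qed
 have "unk n \<sigma> \<tau> = Pair True ` {p \<in> {..<n} \<times> {..<n}. \<sigma> (fst p) < \<sigma> (snd p)} \<union> Pair False ` {p \<in> {..<n} \<times> {..<n}. \<tau> (fst p) < \<tau> (snd p)}"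
  by (auto simp: unk_def split: if_splits)
 hence "card (unk n \<sigma> \<tau>) = card {p \<in> {..<n} \<times> {..<n}. \<sigma> (fst p) < \<sigma> (snd p)} + card {p \<in> {..<n} \<times> {..<n}. \<tau> (fst p) < \<tau> (snd p)}"
  by (simp add: card_Un_disjoint card_image inj_on_def disjoint_iff image_iff)
 thus ?thesis unfolding c by (simp add: sum.distrib)
qed

lemma wildl_dim:
 assumes "sum_list p = n" "sum_list q = n"
  "n * (n + 1) div 2 < (\<Sum>i<n. \<Sum>j<n. (if block p i < block p j then 1 else 0) + (if block q i < block q j then 1 else 0))"
 shows "wildl p q" using assms wild_by_dimension[of n "block p" "block q"] unfolding card_unk wildl_def by simp

section \<open>Five wild shapes\<close>

lemma wild_base1: "wildl [4, 4] [2, 3, 3]" by (rule wildl_dim[where n = 8], simp, simp, code_simp)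
lemma wild_base2: "wildl [3, 3] [1, 1, 2, 2]" by (rule wildl_dim[where n = 6], simp, simp, code_simp)
lemma wild_base3: "wildl [2, 3] [1, 1, 1, 1, 1]" by (rule wildl_dim[where n = 5], simp, simp, code_simp)
lemma wild_base4: "wildl [1, 2, 2] [1, 2, 2]" by (rule wildl_dim[where n = 5], simp, simp, code_simp)
lemma wild_base5: "wildl [1, 1, 2] [1, 1, 1, 1]" by (rule wildl_dim[where n = 4], simp, simp, code_simp)

section \<open>Counting points on grids\<close>

definition lag :: "nat => nat => complex => complex" where
 "lag d k t = (\<Prod>m\<in>{..d} - {k}. (t - of_nat m) / (of_nat k - of_nat m))"

lemma lag_grid: "k \<le> d ==> l \<le> d ==> lag d k (of_nat l) = (if l = k then 1 else 0)"
 unfolding lag_def by (auto intro!: prod.neutral)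

lemma lag_deg:
 assumes "k \<le> d" "deg_le r X"
 shows "deg_le (d * r) (%s. lag d k (X s))"
proof -
 have c: "card ({..d} - {k}) = d" using assms(1) by simp
 have "deg_le r (%s. (X s - of_nat m) / (of_nat k - of_nat m))" for m
 proof -
  have "deg_le (r + 0) (%s. (X s + (- of_nat m)) * (1 / (of_nat k - of_nat m)))"
   by (intro deg_le_mult deg_le_add assms(2) deg_le_const)
  thus ?thesis by simp
 qed
 hence "deg_le (card ({..d} - {k}) * r) (%s. \<Prod>m\<in>{..d} - {k}. (X s - of_nat m) / (of_nat k - of_nat m))"
  by (intro deg_le_prod) auto
 thus ?thesis unfolding c lag_def .
qed

text \<open>The polynomial with prescribed values \<open>c\<close> on the grid \<open>{0..d}\<^sup>T\<close>.\<close>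

definition grid_poly :: "'e set => nat => (('e => nat) => complex) => ('e => complex) => complex" where
 "grid_poly T d c x = (\<Sum>a\<in>T \<rightarrow>\<^sub>E {..d}. c a * (\<Prod>e\<in>T. lag d (a e) (x e)))"

lemma grid_poly_grid:
 assumes "finite T" "a \<in> T \<rightarrow>\<^sub>E {..d}"
 shows "grid_poly T d c (%e. of_nat (a e)) = c a"
proof -
 have "(\<Prod>e\<in>T. lag d (b e) (of_nat (a e))) = (if b = a then 1 else 0)" if b: "b \<in> T \<rightarrow>\<^sub>E {..d}" for b
 proof (cases "b = a")
  case True
  thus ?thesis using assms(2) by (auto intro!: prod.neutral simp: lag_grid PiE_iff)
 next
  case False
  then obtain e where e: "e \<in> T" "b e ~= a e" using assms(2) b by (meson PiE_ext)
  hence "lag d (b e) (of_nat (a e)) = 0" using assms(2) b by (auto simp: lag_grid PiE_iff)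
  thus ?thesis using False e assms(1) by (simp add: prod_zero_iff) blast
 qed
 hence "grid_poly T d c (%e. of_nat (a e)) = (\<Sum>b\<in>T \<rightarrow>\<^sub>E {..d}. if b = a then c b else 0)"
  unfolding grid_poly_def by (intro sum.cong) auto
 thus ?thesis using assms finite_PiE[of T "%_. {..d}"] by simp
qed

lemma grid_poly_deg:
 assumes "finite T" "\<And>e. e \<in> T ==> deg_le r (%s. X s e)"
 shows "deg_le (card T * (d * r)) (%s. grid_poly T d c (X s))" unfolding grid_poly_def
proof (rule deg_le_sum)
 fix a assume a: "a \<in> T \<rightarrow>\<^sub>E {..d}"
 have "deg_le (0 + card T * (d * r)) (%s. c a * (\<Prod>e\<in>T. lag d (a e) (X s e)))"
  by (intro deg_le_mult deg_le_const deg_le_prod lag_deg assms) (use a in \<open>auto simp: PiE_iff\<close>)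
 thus "deg_le (card T * (d * r)) (%s. c a * (\<Prod>e\<in>T. lag d (a e) (X s e)))" by simp
qed

lemma grid_zero:
 fixes F :: "('j => complex) => complex"
 assumes "finite J" "\<And>j y. j \<in> J ==> deg_le D (%s. F (y(j := s)))"
  and "\<And>y. y \<in> J \<rightarrow>\<^sub>E of_nat ` {..D} ==> F y = 0"
  and y: "\<And>j. j \<notin> J ==> y j = undefined"
 shows "F y = 0"
proof -
 have "\<forall>y :: 'j => complex. (\<forall>j\<in>J - A. y j \<in> of_nat ` {..D}) --> (\<forall>j. j \<notin> J --> y j = undefined) --> F y = 0"
  if "finite A" "A \<subseteq> J" for A using that
 proof (induction A rule: finite_induct)
  case empty
  thus ?case using assms(3) by (auto simp: PiE_iff extensional_def)
 next
  case (insert j A)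
  show ?case
  proof (intro allI impI)
   fix y :: "'j => complex"
   assume y: "\<forall>i\<in>J - insert j A. y i \<in> of_nat ` {..D}" "\<forall>i. i \<notin> J --> y i = undefined"
   have "F (y(j := s)) = 0" for s
   proof (rule deg_le_zero[where f = "%s. F (y(j := s))" and d = D and A = "of_nat ` {..D}"])
    show "deg_le D (%s. F (y(j := s)))" using insert.prems by (intro assms(2)) auto
    show "D < card ((of_nat :: nat => complex) ` {..D})" by (subst card_image) (auto simp: inj_on_def)
    show "F (y(j := s)) = 0" if "s \<in> of_nat ` {..D}" for s using insert y that by auto
   qed auto
   from this[of "y j"] show "F y = 0" by simp
  qed
 qed
 from this[of J] show ?thesis using assms(1) y by auto
qed

text \<open>Polynomials in \<open>card T\<close> variables of degree at most \<open>d\<close> in each variable form a space of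
 dimension \<open>(d + 1) ^ card T\<close>, while vanishing on the images of \<open>O(d)\<close> many affine spaces of
 dimension at most \<open>card T - 2\<close> amounts to \<open>O(d ^ (card T - 1))\<close> linear conditions.\<close>

lemma vanishing_polynomial:
 fixes \<Phi> :: "complex => ('j => complex) => 'e => complex"
 assumes T: "finite T" "card T \<ge> 2" and \<Theta>: "infinite \<Theta>"
  and J: "\<And>t. t \<in> \<Theta> ==> finite (J t) & card (J t) + 2 \<le> card T"
  and deg: "\<And>t e j y. t \<in> \<Theta> ==> e \<in> T ==> deg_le 2 (%s. \<Phi> t (y(j := s)) e)"
 shows "\<exists>d c \<Theta>'. \<Theta>' \<subseteq> \<Theta> & finite \<Theta>' & card T * d < card \<Theta>' & (\<exists>x. grid_poly T d c x ~= 0) &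
  (\<forall>t\<in>\<Theta>'. \<forall>y. (\<forall>j. j \<notin> J t --> y j = undefined) --> grid_poly T d c (\<Phi> t y) = 0)"
proof -
 define m where "m = card T"
 obtain l where l: "m = l + 2" using T(2) unfolding m_def by (metis add.commute le_Suc_ex)
 define d where "d = (2 * m) ^ m"
 define D where "D = m * (d * 2)"
 obtain \<Theta>' where \<Theta>': "\<Theta>' \<subseteq> \<Theta>" "finite \<Theta>'" "card \<Theta>' = m * d + 1"
  using infinite_arbitrarily_large[OF \<Theta>] by blast
 define E where "E = (SIGMA t:\<Theta>'. J t \<rightarrow>\<^sub>E (of_nat :: nat => complex) ` {..D})"
 have finE: "finite E" unfolding E_def using \<Theta>'(1,2) J by (intro finite_SigmaI finite_PiE) auto
 have finG: "finite (T \<rightarrow>\<^sub>E {..d})" using T(1) by (intro finite_PiE) auto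
 have cG: "card ((of_nat :: nat => complex) ` {..D}) = D + 1" by (subst card_image) (auto simp: inj_on_def)
 have "card E = (\<Sum>t\<in>\<Theta>'. (D + 1) ^ card (J t))"
  unfolding E_def using \<Theta>'(1,2) J by (subst card_SigmaI) (auto intro!: sum.cong finite_PiE simp: card_PiE cG)
 also have "\<dots> \<le> (\<Sum>t\<in>\<Theta>'. (D + 1) ^ (m - 2))"
 proof (intro sum_mono power_increasing)
  fix t assume "t \<in> \<Theta>'"
  hence "card (J t) + 2 \<le> m" using J \<Theta>'(1) unfolding m_def by blast
  thus "card (J t) \<le> m - 2" by simp
 qed simp
 also have "\<dots> = (m * d + 1) * (D + 1) ^ (m - 2)" using \<Theta>'(3) by simp
 also have "\<dots> \<le> (D + 1) * (D + 1) ^ (m - 2)" by (intro mult_right_mono) (auto simp: D_def)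
 also have "\<dots> = (D + 1) ^ (m - 1)" by (simp add: l)
 also have "\<dots> \<le> (2 * m * (d + 1)) ^ (m - 1)" by (intro power_mono) (auto simp: D_def l algebra_simps)
 also have "\<dots> = (2 * m) ^ (m - 1) * (d + 1) ^ (m - 1)" by (rule power_mult_distrib)
 also have "\<dots> < (d + 1) * (d + 1) ^ (m - 1)"
 proof (rule mult_strict_right_mono)
  have "(2 * m) ^ (m - 1) \<le> d" unfolding d_def by (intro power_increasing) (auto simp: l)
  thus "(2 * m) ^ (m - 1) < d + 1" by simp
 qed simp
 also have "\<dots> = (d + 1) ^ m" by (simp add: l)
 also have "\<dots> = card (T \<rightarrow>\<^sub>E {..d})" using T(1) by (simp add: card_PiE m_def)
 finally have "card E < card (T \<rightarrow>\<^sub>E {..d})" .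
 then obtain c where c: "\<exists>a\<in>T \<rightarrow>\<^sub>E {..d}. c a ~= 0" and "\<And>a. a \<notin> T \<rightarrow>\<^sub>E {..d} ==> c a = 0"
  and cE: "\<And>e. e \<in> E ==> (\<Sum>a\<in>T \<rightarrow>\<^sub>E {..d}. (\<Prod>i\<in>T. lag d (a i) (\<Phi> (fst e) (snd e) i)) * c a) = 0"
  by (rule nonzero_solution[OF finE finG, of "%e a. \<Prod>i\<in>T. lag d (a i) (\<Phi> (fst e) (snd e) i)"]) (rule that)
 have "\<exists>x. grid_poly T d c x ~= 0"
 proof -
  obtain a where a: "a \<in> T \<rightarrow>\<^sub>E {..d}" "c a ~= 0" using c by blast
  thus ?thesis using grid_poly_grid[OF T(1) a(1), of c] by (intro exI[of _ "%e. of_nat (a e)"]) simp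
 qed
 moreover have "grid_poly T d c (\<Phi> t y) = 0" if t: "t \<in> \<Theta>'" and y: "\<And>j. j \<notin> J t ==> y j = undefined" for t y
 proof (rule grid_zero[where J = "J t" and D = D and F = "%y. grid_poly T d c (\<Phi> t y)"])
  show "finite (J t)" using J t \<Theta>'(1) by auto
  show "deg_le D (%s. grid_poly T d c (\<Phi> t (y(j := s))))" for j y
   unfolding D_def m_def using t \<Theta>'(1) by (intro grid_poly_deg T(1) deg) auto
  show "grid_poly T d c (\<Phi> t y) = 0" if "y \<in> J t \<rightarrow>\<^sub>E of_nat ` {..D}" for y
   using cE[of "(t, y)"] t that unfolding E_def grid_poly_def by (simp add: mult.commute)
 qed (rule y)
 ultimately show ?thesis using \<Theta>' unfolding m_def by (intro exI[of _ d] exI[of _ c] exI[of _ \<Theta>']) auto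
qed

section \<open>Stabilizers are large\<close>

definition lower_pairs :: "nat => (nat \<times> nat) set" where
 "lower_pairs n = {(r, c). r < n & c \<le> r}"

lemma finite_lower_pairs [simp]: "finite (lower_pairs n)"
 by (rule finite_subset[of _ "{..<n} \<times> {..<n}"]) (auto simp: lower_pairs_def)

text \<open>The conormal space is dual to the cokernel of the tangent map of the orbit, so a plane in it makes the stabilizer of the point at least two dimensions larger than for a dense orbit.\<close>

lemma stabilizer_dual:
 assumes gh: "g \<in> GL n" "h \<in> GL n" and pl: "plane n \<sigma> \<tau> g h"
 shows "\<exists>K s. K \<subseteq> lower_pairs n & card (lower_pairs n) + 2 \<le> card K + card (unk n \<sigma> \<tau>) &
  (\<forall>m\<in>K. s m \<in> low n & (\<forall>k\<in>K. s m $$ k = (if k = m then 1 else 0)) &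
    ginv g * s m * g \<in> par n \<sigma> & ginv h * s m * h \<in> par n \<tau>)"
proof -
 define a where "a u p = (case u of (b, i, j) => case p of (r, c) =>
  if b then ginv g $$ (j, r) * g $$ (c, i) else ginv h $$ (j, r) * h $$ (c, i))" for u :: "bool \<times> nat \<times> nat" and p
 have rel: "(\<Sum>u\<in>unk n \<sigma> \<tau>. a u p * entry2 A B u) = 0" if con: "conormal n \<sigma> \<tau> g h A B" and p: "p \<in> lower_pairs n" for A B p
 proof -
  obtain r c where rc: "p = (r, c)" "r < n" "c \<le> r" "c < n" using p by (auto simp: lower_pairs_def)
  have nil: "A \<in> nilrad n \<sigma>" "B \<in> nilrad n \<tau>" using con by (auto simp: conormal_def)
  have "(\<Sum>u\<in>unk n \<sigma> \<tau>. a u p * entry2 A B u) = (g * A * ginv g) $$ (c, r) + (h * B * ginv h) $$ (c, r)"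
   unfolding unk_sum[OF nil] using gh nil rc by (simp add: a_def conj_entry[of _ n] mult.commute)
  also have "\<dots> = (g * A * ginv g + h * B * ginv h) $$ (c, r)"
   using gh nil rc by (simp add: index_add_sq[of _ n] del: index_mult_mat index_add_mat)
  also have "\<dots> = 0" using con rc unfolding conormal_def by blast
  finally show ?thesis .
 qed
 have nz: "\<exists>u\<in>unk n \<sigma> \<tau>. entry2 A B u ~= 0" if con: "conormal n \<sigma> \<tau> g h A B" and ne: "A ~= zrm n \<or> B ~= zrm n" for A B
 proof (rule ccontr)
  assume "\<not> ?thesis"
  hence z: "\<And>b i j. (b, i, j) \<in> unk n \<sigma> \<tau> ==> entry2 A B (b, i, j) = 0" by blast
  have nil: "A \<in> nilrad n \<sigma>" "B \<in> nilrad n \<tau>" using con by (auto simp: conormal_def)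
  have "A $$ (i, j) = 0" "B $$ (i, j) = 0" if "i < n" "j < n" for i j
   using z[of True i j] z[of False i j] nilradD[OF nil(1) that] nilradD[OF nil(2) that] that
   by (auto simp: unk_def entry2_def not_less[symmetric])
  hence "A = zrm n" "B = zrm n"
   using carrier_matD[OF nilrad_carrier[OF nil(1)]] carrier_matD[OF nilrad_carrier[OF nil(2)]] by (auto intro!: eq_matI)
  with ne show False by simp
 qed
 obtain A B where AB: "conormal n \<sigma> \<tau> g h A B" "A ~= zrm n \<or> B ~= zrm n" using pl unfolding plane_iff[OF gh] by blast
 obtain u1 where u1: "u1 \<in> unk n \<sigma> \<tau>" "entry2 A B u1 ~= 0" using nz[OF AB] by blast
 obtain b1 i1 j1 where u1e: "u1 = (b1, i1, j1)" "i1 < n" "j1 < n" using u1(1) by (auto simp: unk_def)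
 have pick: "(\<Sum>i<n. \<Sum>j<n. (if i = i1 then if j = j1 then 1 else 0 else 0) * M $$ (i, j)) = (M $$ (i1, j1) :: complex)" for M
  using u1e by (simp add: if_distrib[of "%x. x * _"] sum.If_cases cong: if_cong)
 obtain A' B' where AB': "conormal n \<sigma> \<tau> g h A' B'" "A' ~= zrm n \<or> B' ~= zrm n" "entry2 A' B' u1 = 0"
 proof (cases b1)
  case True
  obtain A' B' where "conormal n \<sigma> \<tau> g h A' B'" "A' ~= zrm n \<or> B' ~= zrm n"
   "lam n (%i j. if i = i1 then if j = j1 then 1 else 0 else 0) A' + lam n (%_ _. 0) B' = 0"
   using pl unfolding plane_iff[OF gh] by blast
  thus thesis using that True unfolding lam_def pick u1e by (simp add: entry2_def)
 next
  case False
  obtain A' B' where "conormal n \<sigma> \<tau> g h A' B'" "A' ~= zrm n \<or> B' ~= zrm n"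
   "lam n (%_ _. 0) A' + lam n (%i j. if i = i1 then if j = j1 then 1 else 0 else 0) B' = 0"
   using pl unfolding plane_iff[OF gh] by blast
  thus thesis using that False unfolding lam_def pick u1e by (simp add: entry2_def)
 qed
 obtain u2 where u2: "u2 \<in> unk n \<sigma> \<tau>" "entry2 A' B' u2 ~= 0" using nz[OF AB'(1,2)] by blast
 have ne: "u2 ~= u1" using u2 AB'(3) by auto
 define E where "E = unk n \<sigma> \<tau> - {u1, u2}"
 have finE: "finite E" by (simp add: E_def)
 have cE: "card (unk n \<sigma> \<tau>) = card E + 2"
 proof -
  have "unk n \<sigma> \<tau> = insert u1 (insert u2 E)" using u1 u2 by (auto simp: E_def)
  moreover have "u1 \<notin> insert u2 E" "u2 \<notin> E" "finite E" using ne by (auto simp: E_def)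
  ultimately show ?thesis by simp
 qed
 have "\<exists>K\<subseteq>lower_pairs n. card (lower_pairs n) \<le> card K + card E &
  (\<exists>s. \<forall>m\<in>K. (\<forall>k\<in>K. s m k = (if k = m then 1 else 0)) & (\<forall>i. i \<notin> lower_pairs n --> s m i = 0) &
    (\<forall>f\<in>E. (\<Sum>i\<in>lower_pairs n. a f i * s m i) = 0))" by (rule dual_solutions[OF finE finite_lower_pairs])
 then obtain K s where K: "K \<subseteq> lower_pairs n" "card (lower_pairs n) \<le> card K + card E"
  and s0: "\<forall>m\<in>K. (\<forall>k\<in>K. s m k = (if k = m then 1 else 0)) & (\<forall>i. i \<notin> lower_pairs n --> s m i = 0) &
    (\<forall>f\<in>E. (\<Sum>i\<in>lower_pairs n. a f i * s m i) = 0)" by (elim exE conjE) (rule that)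
 have s: "\<And>m k. m \<in> K ==> k \<in> K ==> s m k = (if k = m then 1 else (0::complex))"
   "\<And>m i. m \<in> K ==> i \<notin> lower_pairs n ==> s m i = 0"
   "\<And>m f. m \<in> K ==> f \<in> E ==> (\<Sum>i\<in>lower_pairs n. a f i * s m i) = 0" by (use s0 in simp) (use s0 in blast)+
 define S where "S m = mat n n (%p. s m p)" for m
 have "S m \<in> low n & (\<forall>k\<in>K. S m $$ k = (if k = m then 1 else 0)) &
    ginv g * S m * g \<in> par n \<sigma> & ginv h * S m * h \<in> par n \<tau>" if m: "m \<in> K" for m
 proof -
  have Sc: "S m \<in> sqm n" by (simp add: S_def)
  have Sl: "S m \<in> low n" using s(2)[OF m] by (intro lowI Sc) (auto simp: S_def lower_pairs_def)
  define eq where "eq u = (\<Sum>p\<in>lower_pairs n. a u p * s m p)" for u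
  have lin: "(\<Sum>u\<in>unk n \<sigma> \<tau>. entry2 C D u * eq u) = 0" if "conormal n \<sigma> \<tau> g h C D" for C D
  proof -
   have "(\<Sum>u\<in>unk n \<sigma> \<tau>. entry2 C D u * eq u) = (\<Sum>u\<in>unk n \<sigma> \<tau>. \<Sum>p\<in>lower_pairs n. a u p * entry2 C D u * s m p)"
    unfolding eq_def by (simp add: sum_distrib_left mult_ac)
   also have "\<dots> = (\<Sum>p\<in>lower_pairs n. \<Sum>u\<in>unk n \<sigma> \<tau>. a u p * entry2 C D u * s m p)" by (rule sum.swap)
   also have "\<dots> = 0" by (simp add: sum_distrib_right[symmetric] rel[OF that])
   finally show ?thesis .
  qed
  have split: "(\<Sum>u\<in>unk n \<sigma> \<tau>. f u) = f u1 + f u2 + (\<Sum>u\<in>E. f u)" for f :: "_ => complex"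
  proof -
   have "unk n \<sigma> \<tau> = insert u1 (insert u2 E)" using u1 u2 by (auto simp: E_def)
   moreover have "u1 \<notin> insert u2 E" "u2 \<notin> E" "finite E" using ne by (auto simp: E_def)
   ultimately show ?thesis by simp
  qed
  have E0: "(\<Sum>u\<in>E. entry2 C D u * eq u) = 0" for C D using s(3)[OF m] by (intro sum.neutral) (auto simp: eq_def)
  have e2: "eq u2 = 0" using lin[OF AB'(1)] u2(2) AB'(3) unfolding split E0 by simp
  have e1: "eq u1 = 0" using lin[OF AB(1)] u1(2) e2 unfolding split E0 by simp
  have eq0: "eq u = 0" if "u \<in> unk n \<sigma> \<tau>" for u
   using that e1 e2 s(3)[OF m, of u] by (cases "u \<in> E") (auto simp: E_def eq_def)
  have sub: "lower_pairs n \<subseteq> {..<n} \<times> {..<n}" by (auto simp: lower_pairs_def)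
  have conj: "(ginv k * S m * k) $$ (j, i) = (\<Sum>p\<in>lower_pairs n. ginv k $$ (j, fst p) * k $$ (snd p, i) * s m p)"
   if "k \<in> GL n" "j < n" "i < n" for k i j
  proof -
   have "(\<Sum>p\<in>lower_pairs n. ginv k $$ (j, fst p) * k $$ (snd p, i) * s m p)
    = (\<Sum>r<n. \<Sum>c<n. ginv k $$ (j, r) * k $$ (c, i) * s m (r, c))"
    using coord_sum[OF sub s(2)[OF m], where f = "%p. ginv k $$ (j, fst p) * k $$ (snd p, i)"] by simp
   thus ?thesis using that Sc by (simp add: conj_entry[of _ n] S_def)
  qed
  have "ginv g * S m * g \<in> par n \<sigma>"
  proof (rule parI)
   fix j i assume ij: "j < n" "i < n" "\<sigma> i < \<sigma> j"
   hence "(True, i, j) \<in> unk n \<sigma> \<tau>" by (simp add: unk_def)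
   from eq0[OF this] show "(ginv g * S m * g) $$ (j, i) = 0"
    unfolding conj[OF gh(1) ij(1,2)] eq_def a_def by (simp add: case_prod_unfold)
  qed (use gh Sc in simp)
  moreover have "ginv h * S m * h \<in> par n \<tau>"
  proof (rule parI)
   fix j i assume ij: "j < n" "i < n" "\<tau> i < \<tau> j"
   hence "(False, i, j) \<in> unk n \<sigma> \<tau>" by (simp add: unk_def)
   from eq0[OF this] show "(ginv h * S m * h) $$ (j, i) = 0"
    unfolding conj[OF gh(2) ij(1,2)] eq_def a_def by (simp add: case_prod_unfold)
  qed (use gh Sc in simp)
  moreover have "S m $$ k = (if k = m then 1 else 0)" if "k \<in> K" for k
   using s(1)[OF m that] K(1) that by (auto simp: S_def lower_pairs_def)
  ultimately show ?thesis using Sl by blast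
 qed
 thus ?thesis using K cE by (intro exI[of _ K] exI[of _ S]) auto
qed

section \<open>One-parameter families of orbits in the wild case\<close>

lemma card_bpq: "card (bpq n \<sigma> \<tau>) + card (unk n \<sigma> \<tau>) = card (lower_pairs n) + 2 * n\<^sup>2"
proof -
 have le: "card {p \<in> {..<n} \<times> {..<n}. \<rho> (fst p) \<le> \<rho> (snd p)} + card {p \<in> {..<n} \<times> {..<n}. \<rho> (fst p) < \<rho> (snd p)} = n\<^sup>2"
  for \<rho> :: "nat => nat"
 proof -
  have "card {p \<in> {..<n} \<times> {..<n}. \<rho> (fst p) < \<rho> (snd p)} = card {p \<in> {..<n} \<times> {..<n}. \<rho> (snd p) < \<rho> (fst p)}"
   by (rule bij_betw_same_card[of prod.swap]) (auto simp: bij_betw_def inj_on_def image_iff)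
  moreover have "card {p \<in> {..<n} \<times> {..<n}. \<rho> (fst p) \<le> \<rho> (snd p)} + card {p \<in> {..<n} \<times> {..<n}. \<rho> (snd p) < \<rho> (fst p)}
    = card ({p \<in> {..<n} \<times> {..<n}. \<rho> (fst p) \<le> \<rho> (snd p)} \<union> {p \<in> {..<n} \<times> {..<n}. \<rho> (snd p) < \<rho> (fst p)})"
   by (rule card_Un_disjoint[symmetric]) auto
  moreover have "{p \<in> {..<n} \<times> {..<n}. \<rho> (fst p) \<le> \<rho> (snd p)} \<union> {p \<in> {..<n} \<times> {..<n}. \<rho> (snd p) < \<rho> (fst p)} = {..<n} \<times> {..<n}"
   by auto
  ultimately show ?thesis by (simp add: power2_eq_square)
 qed
 have b: "card (bpq n \<sigma> \<tau>) = card (lower_pairs n) + card {p \<in> {..<n} \<times> {..<n}. \<sigma> (fst p) \<le> \<sigma> (snd p)}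
   + card {p \<in> {..<n} \<times> {..<n}. \<tau> (fst p) \<le> \<tau> (snd p)}"
 proof -
  have "card (bpq n \<sigma> \<tau>) = (\<Sum>k\<in>{0, 1, 2}. card {p \<in> {..<n} \<times> {..<n}. bpq_ok \<sigma> \<tau> k p})"
   unfolding bpq_def by (rule card_SigmaI) auto
  moreover have "{p \<in> {..<n} \<times> {..<n}. bpq_ok \<sigma> \<tau> 0 p} = lower_pairs n"
   by (auto simp: bpq_ok_def lower_pairs_def)
  moreover have "{p \<in> {..<n} \<times> {..<n}. bpq_ok \<sigma> \<tau> 1 p} = {p \<in> {..<n} \<times> {..<n}. \<sigma> (fst p) \<le> \<sigma> (snd p)}"
   by (auto simp: bpq_ok_def)
  moreover have "{p \<in> {..<n} \<times> {..<n}. bpq_ok \<sigma> \<tau> 2 p} = {p \<in> {..<n} \<times> {..<n}. \<tau> (fst p) \<le> \<tau> (snd p)}"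
   by (auto simp: bpq_ok_def)
  ultimately show ?thesis by simp
 qed
 have u: "card (unk n \<sigma> \<tau>) = card {p \<in> {..<n} \<times> {..<n}. \<sigma> (fst p) < \<sigma> (snd p)} + card {p \<in> {..<n} \<times> {..<n}. \<tau> (fst p) < \<tau> (snd p)}"
 proof -
  have "unk n \<sigma> \<tau> = Pair True ` {p \<in> {..<n} \<times> {..<n}. \<sigma> (fst p) < \<sigma> (snd p)} \<union> Pair False ` {p \<in> {..<n} \<times> {..<n}. \<tau> (fst p) < \<tau> (snd p)}"
   by (auto simp: unk_def split: if_splits)
  thus ?thesis by (simp add: card_Un_disjoint card_image inj_on_def disjoint_iff image_iff)
 qed
 show ?thesis using le[of \<sigma>] le[of \<tau>] unfolding b u by simp
qed

text \<open>Up to the stabilizer, a generic lower triangular matrix has the same entries at the positions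
 \<open>K\<close> as the identity matrix.\<close>

definition slice :: "nat => (nat \<times> nat) set => complex mat set" where
 "slice n K = {w \<in> low n. \<forall>k\<in>K. w $$ k = idm n $$ k}"

text \<open>Modulo the stabilizer, a Borel orbit is swept out by a slice of smaller dimension.\<close>

lemma slice_reaches:
 fixes s :: "nat \<times> nat => complex mat"
 assumes K: "K \<subseteq> lower_pairs n" and b: "b \<in> low n" and gh: "g \<in> GL n" "h \<in> GL n"
  and s: "\<And>m. m \<in> K ==> s m \<in> low n" "\<And>m k. m \<in> K ==> k \<in> K ==> s m $$ k = (if k = m then 1 else 0)"
   "\<And>m. m \<in> K ==> ginv g * s m * g \<in> par n \<sigma>" "\<And>m. m \<in> K ==> ginv h * s m * h \<in> par n \<tau>"
 shows "finite {t. \<not> (\<exists>w p q. w \<in> slice n K & p \<in> par n \<sigma> & q \<in> par n \<tau> &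
  seg (idm n) b t * g = w * g * p & seg (idm n) b t * h = w * h * q)}"
proof -
 define B where "B = seg (idm n) b"
 have B: "poly_mat n B" "B 0 = idm n" using b seg_0[of "idm n" n n b] by (auto simp: B_def intro!: poly_mat_seg)
 have Bl: "B t \<in> low n" for t unfolding B_def seg_def low_def using b by (intro par_lin) (simp_all add: low_def)
 have fK: "finite K" using finite_subset[OF K finite_lower_pairs] .
 have Kn: "fst k < n" "snd k < n" if "k \<in> K" for k using that K by (auto simp: lower_pairs_def)
 have sc: "s m \<in> sqm n" if "m \<in> K" for m using s(1)[OF that] by simp
 define W where "W t z k = (B t * s z) $$ k" for t z k
 have pW: "is_poly (%t. W t z k)" if "z \<in> K" "k \<in> K" for z k
  using poly_matD(2)[OF poly_mat_mult[OF B(1) poly_mat_const[OF sc[OF that(1)]]] Kn[OF that(2)]] unfolding W_def by simp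
 have W0: "W 0 z k = (if k = z then 1 else 0)" if "z \<in> K" "k \<in> K" for z k
  unfolding W_def B(2) using sc[OF that(1)] s(2)[OF that] by simp
 define b0 where "b0 t k = idm n $$ k - B t $$ k" for t k
 have pb: "is_poly (%t. b0 t k)" if "k \<in> K" for k
  using poly_matD(2)[OF B(1) Kn[OF that]] unfolding b0_def by (intro is_poly_diff is_poly_const) simp
 obtain d x where d: "is_poly d" "d 0 = 1" "\<And>z. z \<in> K ==> is_poly (%t. x t z)"
  "\<And>z. z \<in> K ==> x 0 z = 0"
  "\<And>t i. i \<in> K ==> (\<Sum>z\<in>K. x t z * W t z i) = d t * b0 t i"
 proof (rule solve_along_curve[of K K W b0])
  show "\<forall>i\<in>K. c i = 0" if "\<And>z. z \<in> K ==> (\<Sum>i\<in>K. c i * W 0 z i) = 0" for c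
  proof
   fix z assume z: "z \<in> K"
   have "(\<Sum>i\<in>K. c i * W 0 z i) = (\<Sum>i\<in>K. if i = z then c i else 0)" using z by (intro sum.cong) (auto simp: W0)
   thus "c z = 0" using that[OF z] z fK by simp
  qed
  show "is_poly (%t. W t z i)" if "z \<in> K" "i \<in> K" for z i using that by (rule pW)
  show "is_poly (%t. b0 t i)" if "i \<in> K" for i using that by (rule pb)
  show "b0 0 i = 0" for i by (simp add: b0_def B)
 qed (rule fK, rule fK, rule that)
 define E where "E t = mat n n (%p. d t * idm n $$ p + (\<Sum>z\<in>K. x t z * s z $$ p))" for t
 have Ec: "E t \<in> sqm n" for t by (simp add: E_def)
 have Ei: "E t $$ (i, j) = d t * idm n $$ (i, j) + (\<Sum>z\<in>K. x t z * s z $$ (i, j))" if "i < n" "j < n" for t i j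
  using that by (simp add: E_def del: index_one_mat)
 have pE: "poly_mat n E"
  by (rule poly_matI[OF Ec], subst Ei) (auto intro!: is_poly_add is_poly_mult is_poly_sum d simp del: index_one_mat)
 have E0: "E 0 = idm n" by (rule eq_matI) (auto simp: E_def d intro!: sum.neutral)
 have El: "E t \<in> low n" for t by (rule lowI[OF Ec]) (auto simp: Ei lowD[OF s(1)] intro!: sum.neutral)
 have conjE: "ginv k * E t * k \<in> par n \<rho>"
  if k: "k \<in> GL n" and st: "\<And>m. m \<in> K ==> ginv k * s m * k \<in> par n \<rho>" for k \<rho> t
 proof (rule parI)
  show "ginv k * E t * k \<in> sqm n" using k Ec by simp
  fix i j assume ij: "i < n" "j < n" "\<rho> j < \<rho> i"
  have s0: "(\<Sum>a<n. \<Sum>c<n. ginv k $$ (i, a) * k $$ (c, j) * s z $$ (a, c)) = 0" if "z \<in> K" for z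
   using parD[OF st[OF that] ij] k sc[OF that] ij by (simp add: conj_entry[of _ n] del: index_mult_mat)
  have one0: "(\<Sum>a<n. \<Sum>c<n. ginv k $$ (i, a) * k $$ (c, j) * idm n $$ (a, c)) = 0"
  proof -
   have "(ginv k * idm n * k) $$ (i, j) = 0" using k ij by auto
   thus ?thesis using k ij by (simp add: conj_entry[of _ n] del: index_mult_mat index_one_mat sq_simps)
  qed
  have "(ginv k * E t * k) $$ (i, j) = (\<Sum>a<n. \<Sum>c<n. ginv k $$ (i, a) * k $$ (c, j) * E t $$ (a, c))"
   using k Ec ij by (intro conj_entry) auto
  also have "\<dots> = (\<Sum>a<n. \<Sum>c<n. d t * (ginv k $$ (i, a) * k $$ (c, j) * idm n $$ (a, c))
    + (\<Sum>z\<in>K. x t z * (ginv k $$ (i, a) * k $$ (c, j) * s z $$ (a, c))))"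
   by (intro sum.cong refl) (simp add: Ei algebra_simps sum_distrib_left del: index_one_mat)
  also have "\<dots> = d t * (\<Sum>a<n. \<Sum>c<n. ginv k $$ (i, a) * k $$ (c, j) * idm n $$ (a, c))
    + (\<Sum>a<n. \<Sum>c<n. \<Sum>z\<in>K. x t z * (ginv k $$ (i, a) * k $$ (c, j) * s z $$ (a, c)))"
   by (simp add: sum.distrib sum_distrib_left del: index_one_mat)
  also have "(\<Sum>a<n. \<Sum>c<n. \<Sum>z\<in>K. x t z * (ginv k $$ (i, a) * k $$ (c, j) * s z $$ (a, c)))
    = (\<Sum>a<n. \<Sum>z\<in>K. \<Sum>c<n. x t z * (ginv k $$ (i, a) * k $$ (c, j) * s z $$ (a, c)))"
   by (intro sum.cong refl sum.swap)
  also have "\<dots> = (\<Sum>z\<in>K. \<Sum>a<n. \<Sum>c<n. x t z * (ginv k $$ (i, a) * k $$ (c, j) * s z $$ (a, c)))"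
   by (rule sum.swap)
  also have "\<dots> = (\<Sum>z\<in>K. x t z * (\<Sum>a<n. \<Sum>c<n. ginv k $$ (i, a) * k $$ (c, j) * s z $$ (a, c)))"
   by (simp add: sum_distrib_left)
  also have "\<dots> = 0" using s0 by simp
  finally show "(ginv k * E t * k) $$ (i, j) = 0" unfolding one0 by simp
 qed
 have BE: "(B t * E t) $$ k = d t * idm n $$ k" if k: "k \<in> K" for t k
 proof -
  obtain r c where rc: "k = (r, c)" "r < n" "c < n" using Kn[OF k] by (cases k) auto
  have "(B t * E t) $$ (r, c) = (\<Sum>l<n. B t $$ (r, l) * E t $$ (l, c))" by (rule mult_mat_sum[OF poly_matD(1)[OF B(1)] Ec rc(2,3)])
  also have "\<dots> = (\<Sum>l<n. d t * (B t $$ (r, l) * idm n $$ (l, c)) + (\<Sum>z\<in>K. x t z * (B t $$ (r, l) * s z $$ (l, c))))"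
   using rc by (intro sum.cong refl) (simp add: Ei algebra_simps sum_distrib_left del: index_one_mat)
  also have "\<dots> = d t * (\<Sum>l<n. B t $$ (r, l) * idm n $$ (l, c)) + (\<Sum>l<n. \<Sum>z\<in>K. x t z * (B t $$ (r, l) * s z $$ (l, c)))"
   by (simp add: sum.distrib sum_distrib_left del: index_one_mat)
  also have "(\<Sum>l<n. \<Sum>z\<in>K. x t z * (B t $$ (r, l) * s z $$ (l, c))) = (\<Sum>z\<in>K. \<Sum>l<n. x t z * (B t $$ (r, l) * s z $$ (l, c)))"
   by (rule sum.swap)
  also have "\<dots> = (\<Sum>z\<in>K. x t z * W t z (r, c))" unfolding W_def using poly_matD(1)[OF B(1)] sc rc
   by (intro sum.cong refl) (simp add: mult_mat_sum[of _ n n _ n] sum_distrib_left del: index_mult_mat)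
  also have "\<dots> = d t * b0 t (r, c)" using d(5)[OF k] rc by simp
  also have "(\<Sum>l<n. B t $$ (r, l) * idm n $$ (l, c)) = (B t * idm n) $$ (r, c)"
   by (rule mult_mat_sum[OF poly_matD(1)[OF B(1)] _ rc(2,3), symmetric]) simp
  also have "B t * idm n = B t" using poly_matD(1)[OF B(1)] by simp
  finally show ?thesis unfolding rc(1) b0_def by (simp add: algebra_simps del: index_one_mat)
 qed
 show ?thesis
 proof (rule finite_subset)
  show "finite ({t. d t = 0} \<union> {t. det (E t) = 0})"
   using is_poly_finite_zeros[OF d(1), of 0] is_poly_finite_zeros[OF poly_mat_det[OF pE], of 0] d(2) E0 by simp
  show "{t. \<not> (\<exists>w p q. w \<in> slice n K & p \<in> par n \<sigma> & q \<in> par n \<tau> &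
   seg (idm n) b t * g = w * g * p & seg (idm n) b t * h = w * h * q)} \<subseteq> {t. d t = 0} \<union> {t. det (E t) = 0}"
  proof (rule subsetI, rule ccontr)
   fix t assume 1: "t \<in> {t. \<not> (\<exists>w p q. w \<in> slice n K & p \<in> par n \<sigma> & q \<in> par n \<tau> &
    seg (idm n) b t * g = w * g * p & seg (idm n) b t * h = w * h * q)}"
    and "t \<notin> {t. d t = 0} \<union> {t. det (E t) = 0}"
   hence dt: "d t ~= 0" and EG: "E t \<in> GL n" using Ec by (auto intro!: GLI)
   define w where "w = (1 / d t) *% (B t * E t)"
   have wl: "w \<in> low n" unfolding w_def low_def using Bl[of t] El[of t] by (intro par_smult par_mult) (simp_all add: low_def)
   have Bc: "B t \<in> sqm n" using Bl by simp
   have ws: "w \<in> slice n K" unfolding slice_def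
   proof (intro CollectI conjI wl ballI)
    fix k assume k: "k \<in> K"
    then obtain r c where rc: "k = (r, c)" "r < n" "c < n" using Kn[OF k] by (cases k) auto
    show "w $$ k = idm n $$ k" using BE[OF k, of t] dt Bc Ec unfolding w_def rc(1)
     by (simp add: index_smult_sq[of _ n] rc(2,3) del: index_mult_mat index_one_mat)
   qed
   have main: "\<exists>p\<in>par n \<rho>. B t * k = w * k * p" if k: "k \<in> GL n" and st: "\<And>m. m \<in> K ==> ginv k * s m * k \<in> par n \<rho>" for k \<rho>
   proof -
    have kG: "ginv k * E t * k \<in> GL n" using k EG by simp
    define p where "p = d t *% ginv (ginv k * E t * k)"
    have pp: "p \<in> par n \<rho>" unfolding p_def using par_ginv[OF conjE[OF k st] kG] by (rule par_smult)
    have "w * k * p = d t *% ((1 / d t) *% (B t * E t * k * ginv (ginv k * E t * k)))" unfolding w_def p_def using Bc Ec k kG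
     by (simp add: mult_smult_assoc_mat[of _ n n _ n] mult_smult_distrib[of _ n n _ n])
    also have "\<dots> = B t * E t * k * ginv (ginv k * E t * k)" using dt by (intro eq_matI) auto
    also have "\<dots> = B t * k" using Bc Ec k EG by (simp add: ginv_mult[of _ n] mult_assoc_sq[of _ n])
    finally show ?thesis using pp by metis
   qed
   obtain p where "p \<in> par n \<sigma>" "B t * g = w * g * p" using main[OF gh(1) s(3)] by blast
   moreover obtain q where "q \<in> par n \<tau>" "B t * h = w * h * q" using main[OF gh(2) s(4)] by blast
   ultimately show False using 1 ws unfolding B_def by blast
  qed
 qed
qed

lemma is_poly_zero_cofinite:
 assumes "is_poly f" "finite F" "\<And>u. u \<notin> F ==> f u = 0"
 shows "f a = 0"
proof (rule ccontr)
 assume "f a ~= 0"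
 hence "finite {u. f u = 0}" using assms(1) by (intro is_poly_finite_zeros)
 moreover have "(UNIV :: complex set) = {u. f u = 0} \<union> F" using assms(3) by blast
 ultimately have "finite (UNIV :: complex set)" using assms(2) by (metis finite_Un)
 thus False using infinite_UNIV_char_0 by blast
qed

lemma is_poly_grid_poly:
 assumes "\<And>e. e \<in> T ==> is_poly (%s. X s e)"
 shows "is_poly (%s. grid_poly T d c (X s))"
proof -
 have "is_poly (%s. (X s e - a) / b)" if "e \<in> T" for e a b
  using is_poly_mult[OF is_poly_diff[OF assms[OF that] is_poly_const[of a]] is_poly_const[of "1 / b"]] by simp
 thus ?thesis unfolding grid_poly_def lag_def by (intro is_poly_sum is_poly_mult is_poly_prod is_poly_const) auto
qed

definition pt :: "complex mat => complex mat => bool \<times> nat \<times> nat => complex" where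
 "pt x y = (%(s, p). if s then x $$ p else y $$ p)"

definition coords :: "nat => (bool \<times> nat \<times> nat) set" where
 "coords n = UNIV \<times> {..<n} \<times> {..<n}"

lemma finite_coords [simp]: "finite (coords n)" and card_coords: "card (coords n) = 2 * n\<^sup>2"
 by (simp_all add: coords_def power2_eq_square)

text \<open>The orbits of the points of a line are parametrized by at least one coordinate fewer than there are matrix entries. Counting the polynomials of bounded degree shows that some nonzero polynomial vanishes on all of them.\<close>

theorem wild_family_not_dense:
 assumes w: "wild n \<sigma> \<tau>" and n: "n > 0"
  and X: "\<And>t. X t \<in> sqm n" "\<And>i j. i < n ==> j < n ==> deg_le 1 (%t. X t $$ (i, j))"
  and Y: "\<And>t. Y t \<in> sqm n" "\<And>i j. i < n ==> j < n ==> deg_le 1 (%t. Y t $$ (i, j))"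
  and inv: "det (X t0) ~= 0" "det (Y t1) ~= 0"
 shows "\<exists>d c. (\<exists>x. grid_poly (coords n) d c x ~= 0) &
  (\<forall>t. \<forall>b\<in>low n. \<forall>p\<in>par n \<sigma>. \<forall>q\<in>par n \<tau>. grid_poly (coords n) d c (pt (b * X t * p) (b * Y t * q)) = 0)"
proof -
 define \<Theta> where "\<Theta> = {t. X t \<in> GL n & Y t \<in> GL n}"
 have pX: "poly_mat n X" "poly_mat n Y" using X(1) Y(1) by (intro poly_matI; force simp: is_poly_deg intro: X(2) Y(2))+
 have "finite {t. det (X t) = 0}" "finite {t. det (Y t) = 0}"
  using is_poly_finite_zeros[OF poly_mat_det[OF pX(1)] inv(1)] is_poly_finite_zeros[OF poly_mat_det[OF pX(2)] inv(2)] by auto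
 moreover have "(UNIV :: complex set) = \<Theta> \<union> {t. det (X t) = 0} \<union> {t. det (Y t) = 0}"
  using X(1) Y(1) by (auto simp: \<Theta>_def intro: GLI)
 ultimately have inf\<Theta>: "infinite \<Theta>" using infinite_UNIV_char_0[where 'a = complex] by (metis finite_Un)
 have "\<exists>K s. K \<subseteq> lower_pairs n & card (lower_pairs n) + 2 \<le> card K + card (unk n \<sigma> \<tau>) &
  (\<forall>m\<in>K. s m \<in> low n & (\<forall>k\<in>K. s m $$ k = (if k = m then 1 else 0)) &
    ginv (X t) * s m * X t \<in> par n \<sigma> & ginv (Y t) * s m * Y t \<in> par n \<tau>)" if "t \<in> \<Theta>" for t
  using that w unfolding \<Theta>_def wild_def by (intro stabilizer_dual) auto
 hence "\<forall>t\<in>\<Theta>. \<exists>K s. K \<subseteq> lower_pairs n & card (lower_pairs n) + 2 \<le> card K + card (unk n \<sigma> \<tau>) &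
  (\<forall>m\<in>K. s m \<in> low n & (\<forall>k\<in>K. s m $$ k = (if k = m then 1 else 0)) &
    ginv (X t) * s m * X t \<in> par n \<sigma> & ginv (Y t) * s m * Y t \<in> par n \<tau>)" by blast
 from bchoice[OF this] obtain K where K0: "\<forall>t\<in>\<Theta>. \<exists>s. K t \<subseteq> lower_pairs n &
  card (lower_pairs n) + 2 \<le> card (K t) + card (unk n \<sigma> \<tau>) &
  (\<forall>m\<in>K t. s m \<in> low n & (\<forall>k\<in>K t. s m $$ k = (if k = m then 1 else 0)) &
    ginv (X t) * s m * X t \<in> par n \<sigma> & ginv (Y t) * s m * Y t \<in> par n \<tau>)" by blast
 from bchoice[OF this] obtain s where Ks: "\<forall>t\<in>\<Theta>. K t \<subseteq> lower_pairs n &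
  card (lower_pairs n) + 2 \<le> card (K t) + card (unk n \<sigma> \<tau>) &
  (\<forall>m\<in>K t. s t m \<in> low n & (\<forall>k\<in>K t. s t m $$ k = (if k = m then 1 else 0)) &
    ginv (X t) * s t m * X t \<in> par n \<sigma> & ginv (Y t) * s t m * Y t \<in> par n \<tau>)" by blast
 define J where "J t = bpq n \<sigma> \<tau> - Pair 0 ` K t" for t
 define W where "W t y = mat n n (%(i, j). if (i, j) \<in> K t then idm n $$ (i, j) else if j \<le> i then y (0, i, j) else 0)"
  for t and y :: "nat \<times> nat \<times> nat => complex"
 define P where "P y = mat n n (%(i, j). if \<sigma> i \<le> \<sigma> j then y (1, i, j) else 0)" for y :: "nat \<times> nat \<times> nat => complex"
 define Q where "Q y = mat n n (%(i, j). if \<tau> i \<le> \<tau> j then y (2, i, j) else 0)" for y :: "nat \<times> nat \<times> nat => complex"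
 define \<Phi> where "\<Phi> t y = pt (W t y * X t * P y) (W t y * Y t * Q y)" for t y
 have cJ: "finite (J t) & card (J t) + 2 \<le> card (coords n)" if t: "t \<in> \<Theta>" for t
 proof -
  have K: "K t \<subseteq> lower_pairs n" "card (lower_pairs n) + 2 \<le> card (K t) + card (unk n \<sigma> \<tau>)" using Ks t by auto
  have sub: "Pair 0 ` K t \<subseteq> bpq n \<sigma> \<tau>" using K(1) by (auto simp: bpq_def bpq_ok_def lower_pairs_def)
  have "card (J t) = card (bpq n \<sigma> \<tau>) - card (K t)" unfolding J_def using sub finite_subset[OF K(1) finite_lower_pairs]
   by (subst card_Diff_subset) (auto simp: card_image inj_on_def)
  moreover have "card (K t) \<le> card (bpq n \<sigma> \<tau>)" using card_mono[OF finite_bpq sub] by (simp add: card_image inj_on_def)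
  ultimately show ?thesis using K(2) card_bpq[of n \<sigma> \<tau>] unfolding card_coords by (auto simp: J_def)
 qed
 have upd: "deg_le 1 (%u. (y(j := u)) i)" for y :: "nat \<times> nat \<times> nat => complex" and i j
  by (cases "i = j") (auto intro: deg_le_id)
 have if_deg: "deg_le 1 (%u. if B then f u else 0)" if "deg_le 1 f" for B f using that by (cases B) auto
 have entry_deg: "deg_le (k + l) (%u. (A u * Z u * C u) $$ (r, c))"
  if "\<And>u. A u \<in> sqm n" "\<And>u. C u \<in> sqm n" "\<And>u. Z u \<in> sqm n"
   "r < n" "c < n" and AC: "\<And>i j. i < n ==> j < n ==> deg_le k (%u. A u $$ (r, i) * C u $$ (j, c))"
   and Z: "\<And>i j. i < n ==> j < n ==> deg_le l (%u. Z u $$ (i, j))"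
  for A Z C :: "complex => complex mat" and k l r c
 proof -
  have "(%u. (A u * Z u * C u) $$ (r, c)) = (%u. \<Sum>i<n. \<Sum>j<n. A u $$ (r, i) * C u $$ (j, c) * Z u $$ (i, j))"
   using that by (intro ext conj_entry) auto
  moreover have "deg_le (k + l) (%u. \<Sum>i<n. \<Sum>j<n. A u $$ (r, i) * C u $$ (j, c) * Z u $$ (i, j))"
   by (intro deg_le_sum deg_le_mult AC Z) simp_all
  ultimately show ?thesis by simp
 qed
 have Wc: "W t y \<in> sqm n" "P y \<in> sqm n" "Q y \<in> sqm n" for t y by (simp_all add: W_def P_def Q_def)
 have deg: "deg_le 2 (%u. \<Phi> t (y(j := u)) e)" if "e \<in> coords n" for t y j e
 proof -
  obtain b r c where e: "e = (b, r, c)" "r < n" "c < n" using \<open>e \<in> coords n\<close> by (auto simp: coords_def)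
  have Wd: "deg_le 1 (%u. W t (y(j := u)) $$ (a, i))" if "a < n" "i < n" for a i
   using that upd[of y j "(0, a, i)"] by (cases "(a, i) \<in> K t"; cases "i \<le> a") (auto simp: W_def)
  have Pd: "deg_le 1 (%u. P (y(j := u)) $$ (a, i))" if "a < n" "i < n" for a i
   using that upd[of y j "(1, a, i)"] by (cases "\<sigma> a \<le> \<sigma> i") (auto simp: P_def)
  have Qd: "deg_le 1 (%u. Q (y(j := u)) $$ (a, i))" if "a < n" "i < n" for a i
   using that upd[of y j "(2, a, i)"] by (cases "\<tau> a \<le> \<tau> i") (auto simp: Q_def)
  have "deg_le ((1 + 1) + 0) (%u. (W t (y(j := u)) * X t * P (y(j := u))) $$ (r, c))"
  proof (rule entry_deg)
   show "deg_le (1 + 1) (%u. W t (y(j := u)) $$ (r, i) * P (y(j := u)) $$ (k, c))" if "i < n" "k < n" for i k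
    using that e by (intro deg_le_mult Wd Pd)
  qed (use Wc X(1) e in \<open>auto intro: deg_le_const\<close>)
  moreover have "deg_le ((1 + 1) + 0) (%u. (W t (y(j := u)) * Y t * Q (y(j := u))) $$ (r, c))"
  proof (rule entry_deg)
   show "deg_le (1 + 1) (%u. W t (y(j := u)) $$ (r, i) * Q (y(j := u)) $$ (k, c))" if "i < n" "k < n" for i k
    using that e by (intro deg_le_mult Wd Qd)
  qed (use Wc Y(1) e in \<open>auto intro: deg_le_const\<close>)
  ultimately show ?thesis unfolding \<Phi>_def pt_def e(1) by (cases b) (simp_all add: numeral_2_eq_2)
 qed
 obtain d c \<Theta>' where V: "\<Theta>' \<subseteq> \<Theta>" "finite \<Theta>'" "card (coords n) * d < card \<Theta>'"
  "\<exists>x. grid_poly (coords n) d c x ~= 0"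
  "\<forall>t\<in>\<Theta>'. \<forall>y. (\<forall>j. j \<notin> J t --> y j = undefined) --> grid_poly (coords n) d c (\<Phi> t y) = 0"
 proof -
  have "card (coords n) \<ge> 2" using n by (auto simp: card_coords)
  hence "\<exists>d c \<Theta>'. \<Theta>' \<subseteq> \<Theta> & finite \<Theta>' & card (coords n) * d < card \<Theta>' & (\<exists>x. grid_poly (coords n) d c x ~= 0) &
   (\<forall>t\<in>\<Theta>'. \<forall>y. (\<forall>j. j \<notin> J t --> y j = undefined) --> grid_poly (coords n) d c (\<Phi> t y) = 0)"
   by (rule vanishing_polynomial[OF finite_coords _ inf\<Theta>]) (rule cJ, assumption, rule deg, assumption)
  thus thesis by (elim exE conjE) (rule that, assumption, assumption, assumption, blast, assumption)
 qed
 define f where "f = grid_poly (coords n) d c"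
 have on_slice: "f (pt (w * X t * p) (w * Y t * q)) = 0"
  if t: "t \<in> \<Theta>'" and w: "w \<in> slice n (K t)" and p: "p \<in> par n \<sigma>" and q: "q \<in> par n \<tau>" for t w p q
 proof -
  define y where "y = (%(k, i, j). if (k, i, j) \<in> J t then (if k = 0 then w else if k = 1 then p else q) $$ (i, j) else undefined)"
  have wl: "w \<in> low n" and wK: "\<And>k. k \<in> K t ==> w $$ k = idm n $$ k" using w by (auto simp: slice_def)
  have "W t y = w"
  proof (rule eq_matI)
   fix i j assume "i < dim_row w" "j < dim_col w"
   hence ij: "i < n" "j < n" using carrier_matD[OF low_carrier[OF wl]] by auto
   have "(0, i, j) \<in> J t" if "(i, j) \<notin> K t" "j \<le> i" using that ij by (auto simp: J_def bpq_def bpq_ok_def)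
   thus "W t y $$ (i, j) = w $$ (i, j)" using ij wK[of "(i, j)"] lowD[OF wl ij] by (auto simp: W_def y_def simp del: index_one_mat)
  qed (use carrier_matD[OF low_carrier[OF wl]] in \<open>auto simp: W_def\<close>)
  moreover have "P y = p"
  proof (rule eq_matI)
   fix i j assume "i < dim_row p" "j < dim_col p"
   hence ij: "i < n" "j < n" using carrier_matD[OF par_carrier[OF p]] by auto
   have "(1, i, j) \<in> J t" if "\<sigma> i \<le> \<sigma> j" using that ij by (auto simp: J_def bpq_def bpq_ok_def)
   thus "P y $$ (i, j) = p $$ (i, j)" using ij parD[OF p ij] by (auto simp: P_def y_def)
  qed (use carrier_matD[OF par_carrier[OF p]] in \<open>auto simp: P_def\<close>)
  moreover have "Q y = q"
  proof (rule eq_matI)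
   fix i j assume "i < dim_row q" "j < dim_col q"
   hence ij: "i < n" "j < n" using carrier_matD[OF par_carrier[OF q]] by auto
   have "(2, i, j) \<in> J t" if "\<tau> i \<le> \<tau> j" using that ij by (auto simp: J_def bpq_def bpq_ok_def)
   thus "Q y $$ (i, j) = q $$ (i, j)" using ij parD[OF q ij] by (auto simp: Q_def y_def)
  qed (use carrier_matD[OF par_carrier[OF q]] in \<open>auto simp: Q_def\<close>)
  moreover have "\<forall>j. j \<notin> J t --> y j = undefined" by (auto simp: y_def)
  ultimately show ?thesis using V(5) t unfolding \<Phi>_def f_def by metis
 qed
 have on_low: "f (pt (b * X t * p) (b * Y t * q)) = 0"
  if t: "t \<in> \<Theta>'" and b: "b \<in> low n" and p: "p \<in> par n \<sigma>" and q: "q \<in> par n \<tau>" for t b p q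
 proof -
  have t\<Theta>: "t \<in> \<Theta>" using t V(1) by blast
  hence GL: "X t \<in> GL n" "Y t \<in> GL n" by (auto simp: \<Theta>_def)
  define B where "B = seg (idm n) b"
  have B: "poly_mat n B" using b by (auto simp: B_def intro!: poly_mat_seg)
  define F where "F = {u. \<not> (\<exists>w p q. w \<in> slice n (K t) & p \<in> par n \<sigma> & q \<in> par n \<tau> &
    B u * X t = w * X t * p & B u * Y t = w * Y t * q)}"
  have "finite F" unfolding F_def B_def by (rule slice_reaches[where s = "s t"]) (use Ks t\<Theta> b GL in auto)
  moreover have "f (pt (B u * X t * p) (B u * Y t * q)) = 0" if "u \<notin> F" for u
  proof -
   obtain w p' q' where 1: "w \<in> slice n (K t)" "p' \<in> par n \<sigma>" "q' \<in> par n \<tau>"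
    "B u * X t = w * X t * p'" "B u * Y t = w * Y t * q'" using \<open>u \<notin> F\<close> unfolding F_def by blast
   have wc: "w \<in> sqm n" using 1(1) by (auto simp: slice_def)
   have "B u * X t * p = w * X t * (p' * p)" "B u * Y t * q = w * Y t * (q' * q)"
    unfolding 1(4,5) using wc GL p q 1(2,3) by (simp_all add: mult_assoc_sq[of _ n])
   thus ?thesis using on_slice[OF t 1(1) par_mult[OF 1(2) p] par_mult[OF 1(3) q]] by simp
  qed
  moreover have "is_poly (%u. f (pt (B u * X t * p) (B u * Y t * q)))" unfolding f_def
  proof (rule is_poly_grid_poly)
   fix e assume "e \<in> coords n"
   then obtain s r c where e: "e = (s, r, c)" "r < n" "c < n" by (auto simp: coords_def)
   have "poly_mat n (%u. B u * X t * p)" "poly_mat n (%u. B u * Y t * q)" using B GL p q by (auto intro!: poly_mat_mult poly_mat_const)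
   thus "is_poly (%u. pt (B u * X t * p) (B u * Y t * q) e)" using e(2,3) unfolding pt_def e(1) by (cases s) (auto dest: poly_matD(2))
  qed
  ultimately have "f (pt (B 1 * X t * p) (B 1 * Y t * q)) = 0" by (rule is_poly_zero_cofinite[rotated])
  thus ?thesis using seg_1[of "idm n" n n b] b by (simp add: B_def)
 qed
 have "f (pt (b * X t * p) (b * Y t * q)) = 0"
  if b: "b \<in> low n" and p: "p \<in> par n \<sigma>" and q: "q \<in> par n \<tau>" for t b p q
 proof (rule deg_le_zero[where f = "%t. f (pt (b * X t * p) (b * Y t * q))" and A = \<Theta>'])
  show "deg_le (card (coords n) * (d * 1)) (%t. f (pt (b * X t * p) (b * Y t * q)))" unfolding f_def
  proof (rule grid_poly_deg[OF finite_coords])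
   fix e assume "e \<in> coords n"
   then obtain s r c where e: "e = (s, r, c)" "r < n" "c < n" by (auto simp: coords_def)
   have "deg_le (0 + 1) (%t. (b * X t * p) $$ (r, c))" by (rule entry_deg) (use X b p e in \<open>auto intro: deg_le_const\<close>)
   moreover have "deg_le (0 + 1) (%t. (b * Y t * q) $$ (r, c))"
    by (rule entry_deg) (use Y b q e in \<open>auto intro: deg_le_const\<close>)
   ultimately show "deg_le 1 (%t. pt (b * X t * p) (b * Y t * q) e)" unfolding pt_def e(1) by (cases s) simp_all
  qed
  show "card (coords n) * (d * 1) < card \<Theta>'" using V(3) by simp
  show "finite \<Theta>'" by (rule V(2))
  show "f (pt (b * X t * p) (b * Y t * q)) = 0" if "t \<in> \<Theta>'" for t using on_low[OF that b p q] .
 qed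
 thus ?thesis using V(4) unfolding f_def by blast
qed

section \<open>Dense orbits: the spherical cases\<close>

definition levi_null :: "nat => (nat => nat) => (nat => nat) => complex mat => bool" where
 "levi_null n \<sigma> \<tau> g \<longleftrightarrow> (\<forall>A. levi n \<sigma> \<tau> g A --> A = zrm n)"

definition null :: "nat => (nat => nat) => (nat => nat) => complex mat => complex mat => bool" where
 "null n \<sigma> \<tau> g h \<longleftrightarrow> (\<forall>A B. conormal n \<sigma> \<tau> g h A B --> A = zrm n & B = zrm n)"

definition spherical :: "nat list => nat list => bool" where
 "spherical p q \<longleftrightarrow> (\<exists>g\<in>GL (sum_list p). \<exists>h\<in>GL (sum_list p). null (sum_list p) (block p) (block q) g h)"

lemma spherical_swap: "sum_list p = sum_list q ==> spherical p q ==> spherical q p"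
 unfolding spherical_def null_def using conormal_swap by metis

lemma spherical_of_levi:
 assumes "g \<in> GL (sum_list p)" "levi_null (sum_list p) (block p) (block q) g"
 shows "spherical p q"
proof -
 have "null (sum_list p) (block p) (block q) g (1\<^sub>m (sum_list p))" unfolding null_def
 proof (intro allI impI)
  fix A B assume con: "conormal (sum_list p) (block p) (block q) g (1\<^sub>m (sum_list p)) A B"
  have A: "A = 0\<^sub>m (sum_list p) (sum_list p)" using conormal_levi[OF assms(1) con] assms(2) unfolding levi_null_def by blast
  thus "A = 0\<^sub>m (sum_list p) (sum_list p) & B = 0\<^sub>m (sum_list p) (sum_list p)"
   using conormal_zero[OF assms(1) block_mono_on] con by blast
 qed
 thus ?thesis using assms(1) one_GL unfolding spherical_def by blast
qed

lemma levi_null_reorder: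
 assumes f: "f permutes {..<n}"
  and ord: "\<And>r c. r \<le> c ==> c < n ==> \<tau> r = \<tau> c ==> f r \<le> f c & \<tau>' (f r) = \<tau>' (f c)"
  and g: "g \<in> GL n" and nl: "levi_null n \<sigma> \<tau> g"
 shows "levi_null n \<sigma> \<tau>' (perm_mat n (inv_into UNIV f) * g)" unfolding levi_null_def
proof (intro allI impI)
 fix A assume A: "levi n \<sigma> \<tau>' (perm_mat n (inv_into UNIV f) * g) A"
 have "levi n \<sigma> \<tau> g A" by (rule levi_reorder[OF f _ g A]) (rule ord; assumption)
 thus "A = zrm n" using nl unfolding levi_null_def by blast
qed

lemma levi_null_exchange:
 assumes n: "sum_list (u @ [b, a] @ v) = n" and g: "g \<in> GL n" and nl: "levi_null n \<sigma> (block (u @ [b, a] @ v)) g"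
 shows "\<exists>g\<in>GL n. levi_null n \<sigma> (block (u @ [a, b] @ v)) g"
proof -
 have f: "exchange (sum_list u) a b permutes {..<n}" using n by (intro exchange_permutes) auto
 have "levi_null n \<sigma> (block (u @ [a, b] @ v)) (perm_mat n (inv_into UNIV (exchange (sum_list u) a b)) * g)"
  by (rule levi_null_reorder[OF f _ g nl]) (rule exchange_order; assumption)
 thus ?thesis using g permutes_inv[OF f] by (intro bexI[of _ "perm_mat n (inv_into UNIV (exchange (sum_list u) a b)) * g"]) simp_all
qed

text \<open>A permutation of the columns changes the labels of the first pattern.\<close>

lemma levi_relabel:
 assumes f: "f permutes {..<n}" and lab: "\<And>i. i < n ==> \<sigma>' i = \<sigma> (f i)"
  and g: "g \<in> GL n" and A: "levi n \<sigma> \<tau> (g * perm_mat n f) A"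
 shows "levi n \<sigma>' \<tau> g (perm_mat n f * A * perm_mat n (inv_into UNIV f))"
proof -
 have inv: "inv_into UNIV f permutes {..<n}" using f by (rule permutes_inv)
 have An: "A \<in> nilrad n \<sigma>" using A by (simp add: levi_def)
 define P where "P = perm_mat n f"
 define P' where "P' = perm_mat n (inv_into UNIV f)"
 have P: "P \<in> GL n" "P' \<in> GL n" "ginv P = P'" using f inv by (simp_all add: P_def P'_def)
 have ent: "(P * A * P') $$ (i, j) = A $$ (f i, f j)" if "i < n" "j < n" for i j
 proof -
  have fi: "f i < n" "f j < n" using permutes_in_image[OF f] that by auto
  have "(P * A * P') $$ (i, j) = (P * (A * P')) $$ (i, j)" using P An by (simp add: mult_assoc_sq[of _ n])
  also have "\<dots> = (A * P') $$ (f i, j)" unfolding P_def using P An fi that by (intro perm_mat_left) simp_all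
  also have "\<dots> = A $$ (f i, f j)"
   unfolding P'_def using perm_mat_right[of A n "inv_into UNIV f" "f i" "f j"] An inv fi permutes_inverses(2)[OF f] by simp
  finally show ?thesis .
 qed
 have "P * A * P' \<in> nilrad n \<sigma>'"
 proof (rule nilradI)
  fix i j assume "i < n" "j < n" "\<sigma>' j \<le> \<sigma>' i"
  thus "(P * A * P') $$ (i, j) = 0" using nilradD[OF An, of "f i" "f j"] permutes_in_image[OF f] lab ent by auto
 qed (use P An in simp)
 moreover have "g * (P * A * P') * ginv g = (g * P) * A * ginv (g * P)"
  using P g An by (simp add: ginv_mult[of _ n] mult_assoc_sq[of _ n])
 ultimately show ?thesis using A unfolding levi_def P_def P'_def by simp
qed

lemma levi_null_relabel:
 assumes f: "f permutes {..<n}" and lab: "\<And>i. i < n ==> \<sigma>' i = \<sigma> (f i)"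
  and g: "g \<in> GL n" and nl: "levi_null n \<sigma>' \<tau> g"
 shows "levi_null n \<sigma> \<tau> (g * perm_mat n f)" unfolding levi_null_def
proof (intro allI impI)
 fix A assume A: "levi n \<sigma> \<tau> (g * perm_mat n f) A"
 have inv: "inv_into UNIV f permutes {..<n}" using f by (rule permutes_inv)
 have "perm_mat n f * A * perm_mat n (inv_into UNIV f) = zrm n" using levi_relabel[OF f lab g A] nl unfolding levi_null_def by blast
 hence "ginv (perm_mat n (inv_into UNIV f)) * A * perm_mat n (inv_into UNIV f) = zrm n" using inv permutes_inv_inv[OF f] by simp
 thus "A = zrm n" using conj_zero[of "perm_mat n (inv_into UNIV f)" n A] perm_mat_GL(1)[OF inv] levi_carrier[OF A] by blast
qed

lemma ex_permutes_subset:
 assumes "S \<subseteq> {..<n}"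
 shows "\<exists>f. f permutes {..<n} & (\<forall>i<n. f i < card S \<longleftrightarrow> i \<in> S)"
proof -
 have fin: "finite S" "finite ({..<n} - S)" using assms finite_subset by auto
 have le: "card S \<le> n" using card_mono[OF _ assms] by simp
 obtain a where a: "bij_betw a S {..<card S}" using fin(1) by (metis bij_betw_iff_card card_lessThan finite_lessThan)
 have "card ({..<n} - S) = card {card S..<n}" using assms fin by (simp add: card_Diff_subset)
 then obtain b where b: "bij_betw b ({..<n} - S) {card S..<n}" using fin(2) by (metis bij_betw_iff_card finite_atLeastLessThan)
 define f where "f i = (if i \<in> S then a i else if i < n then b i else i)" for i
 have aS: "i \<in> S ==> a i < card S" for i using a by (auto simp: bij_betw_def)
 have bS: "i < n ==> i \<notin> S ==> card S \<le> b i & b i < n" for i using b by (auto simp: bij_betw_def)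
 have "f permutes {..<n}"
 proof (rule inj_imp_permutes)
  show "inj_on f {..<n}"
  proof (rule inj_onI)
   fix i j assume ij: "i \<in> {..<n}" "j \<in> {..<n}" "f i = f j"
   show "i = j"
   proof (cases "i \<in> S \<longleftrightarrow> j \<in> S")
    case True
    thus ?thesis using ij a b by (cases "i \<in> S") (auto simp: f_def bij_betw_def inj_on_def)
   next
    case False
    thus ?thesis using ij aS[of i] aS[of j] bS[of i] bS[of j] by (auto simp: f_def split: if_splits)
   qed
  qed
  show "f i \<in> {..<n}" if "i \<in> {..<n}" for i using that aS[of i] bS[of i] le by (auto simp: f_def)
  show "f i = i" if "i \<notin> {..<n}" for i using that assms by (auto simp: f_def)
 qed simp
 moreover have "f i < card S \<longleftrightarrow> i \<in> S" if "i < n" for i using that aS[of i] bS[of i] by (auto simp: f_def)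
 ultimately show ?thesis by blast
qed

text \<open>Conjugation by \<open>1 + N\<close> with \<open>N\<^sup>2 = 0\<close>.\<close>

lemma square_zero_conj:
 assumes N: "N \<in> sqm n" "N * N = zrm n" and A: "A \<in> sqm n"
 defines "g \<equiv> idm n + N"
 shows "g \<in> GL n"
  and "r < n ==> c < n ==> (g * A * ginv g) $$ (r, c) + (\<Sum>l<n. (g * A * ginv g) $$ (r, l) * N $$ (l, c))
    = A $$ (r, c) + (\<Sum>l<n. N $$ (r, l) * A $$ (l, c))"
  and "r < n ==> c < n ==> (g * A * ginv g) $$ (r, c) - (\<Sum>l<n. N $$ (r, l) * (g * A * ginv g) $$ (l, c))
    = A $$ (r, c) - (\<Sum>l<n. A $$ (r, l) * N $$ (l, c))"
proof -
 define k where "k = idm n - N"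
 have c: "g \<in> sqm n" "k \<in> sqm n" using N by (auto simp: g_def k_def)
 have "g * k = idm n * k + N * k" unfolding g_def using N c by (intro add_mult_distrib_mat) auto
 also have "\<dots> = k + (N * idm n - N * N)" unfolding k_def using N by (subst mult_minus_distrib_mat[of N n n _ n N]) auto
 also have "\<dots> = idm n" unfolding k_def N(2) using N(1) by (intro eq_matI) auto
 finally have gk: "g * k = idm n" .
 show g: "g \<in> GL n" using c gk by (rule GL_I)
 have kg: "ginv g = k" using g c(2) gk by (rule ginv_unique)
 define Y where "Y = g * A * ginv g"
 have Y: "Y \<in> sqm n" using g A by (simp add: Y_def)
 assume rc: "r < n" "c < n"
 have "Y * g = g * A" using g A by (simp add: Y_def mult_assoc_sq[of _ n])
 moreover have "Y * g = Y * idm n + Y * N" unfolding g_def using Y N by (intro mult_add_distrib_mat) auto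
 moreover have "g * A = idm n * A + N * A" unfolding g_def using A N by (intro add_mult_distrib_mat) auto
 ultimately have "Y + Y * N = A + N * A" using Y A by simp
 from arg_cong[OF this, of "%M. M $$ (r, c)"]
 show "(g * A * ginv g) $$ (r, c) + (\<Sum>l<n. (g * A * ginv g) $$ (r, l) * N $$ (l, c))
    = A $$ (r, c) + (\<Sum>l<n. N $$ (r, l) * A $$ (l, c))"
  using Y A N rc unfolding Y_def[symmetric] by (simp add: index_add_sq[of _ n] mult_mat_sum[of _ n n _ n] del: index_mult_mat index_add_mat)
 have "k * Y = A * k" unfolding Y_def kg using kg g A c by (simp flip: kg add: mult_assoc_sq[of _ n])
 moreover have "k * Y = idm n * Y - N * Y" unfolding k_def using Y N by (intro minus_mult_distrib_mat) auto
 moreover have "A * k = A * idm n - A * N" unfolding k_def using A N by (intro mult_minus_distrib_mat) auto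
 ultimately have e: "Y - N * Y = A - A * N" using Y A by simp
 have "(Y - N * Y) $$ (r, c) = Y $$ (r, c) - (N * Y) $$ (r, c)" "(A - A * N) $$ (r, c) = A $$ (r, c) - (A * N) $$ (r, c)"
  using Y A N rc by auto
 thus "(g * A * ginv g) $$ (r, c) - (\<Sum>l<n. N $$ (r, l) * (g * A * ginv g) $$ (l, c))
    = A $$ (r, c) - (\<Sum>l<n. A $$ (r, l) * N $$ (l, c))"
  using Y A N rc e unfolding Y_def[symmetric] by (simp add: mult_mat_sum[of _ n n _ n] del: index_mult_mat index_minus_mat)
qed

lemma levi_diag: "levi n \<sigma> \<tau> g A ==> r < n ==> (g * A * ginv g) $$ (r, r) = 0" unfolding levi_def by blast

lemma block2: "block [a, b] i = (if i < a then 0 else if i < a + b then 1 else 2)" by auto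

lemma conj_zero': "g \<in> GL n ==> A \<in> sqm n ==> g * A * ginv g = zrm n ==> A = zrm n" using conj_zero[of "ginv g" n A] by simp

lemma zero_matI:
 assumes "A \<in> sqm n" "\<And>i j. i < n ==> j < n ==> A $$ (i, j) = 0" shows "A = zrm n" using assms by (intro eq_matI) auto

text \<open>A general line and a pair of opposite full flags.\<close>

lemma spherical_line:
 assumes q: "sum_list q = 1 + l"
 shows "spherical [1, l] q"
proof -
 define n where "n = 1 + l"
 define N where "N = mat n n (%(r, s). if s = 0 & r ~= 0 then 1 else (0 :: complex))"
 have N: "N \<in> sqm n" by (simp add: N_def)
 have N2: "N * N = zrm n" by (rule zero_matI[OF mult_sq[OF N N]], subst mult_mat_sum[OF N N]) (auto simp: N_def intro!: sum.neutral)
 define g where "g = idm n + N"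
 have g: "g \<in> GL n" unfolding g_def by (rule square_zero_conj(1)[OF N N2 N])
 have "levi_null n (block [1, l]) (block q) g" unfolding levi_null_def
 proof (intro allI impI)
  fix A assume A: "levi n (block [1, l]) (block q) g A"
  hence An: "A \<in> nilrad n (block [1, l])" and Ac: "A \<in> sqm n" by (simp_all add: levi_def levi_carrier[OF A])
  have A0: "A $$ (r, s) = 0" if "r < n" "s < n" "r ~= 0" for r s using that nilradD[OF An that(1,2)] by (auto simp: block2 n_def)
  define Y where "Y = g * A * ginv g"
  have Yd: "Y $$ (r, r) = 0" if "r < n" for r using levi_diag[OF A that] by (simp add: Y_def)
  have Yr: "Y $$ (r, c) = Y $$ (0, c)" if rc: "r < n" "c < n" "r ~= 0" for r c
  proof -
   have "(\<Sum>l<n. N $$ (r, l) * Y $$ (l, c)) = (\<Sum>l<n. if l = 0 then Y $$ (l, c) else 0)"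
    using rc by (intro sum.cong) (auto simp: N_def)
   hence "(\<Sum>l<n. N $$ (r, l) * Y $$ (l, c)) = Y $$ (0, c)" using rc by simp
   moreover have "(\<Sum>l<n. A $$ (r, l) * N $$ (l, c)) = 0" using rc A0 by (intro sum.neutral) auto
   ultimately show ?thesis using square_zero_conj(3)[OF N N2 Ac rc(1,2)] A0[OF rc] unfolding Y_def g_def by simp
  qed
  have "Y $$ (r, c) = 0" if "r < n" "c < n" for r c
   using Yr[OF that] Yr[OF that(2,2)] Yd[OF that(2)] by (cases "r = 0"; cases "c = 0") auto
  hence "Y = zrm n" using g Ac by (intro zero_matI) (simp_all add: Y_def)
  thus "A = zrm n" using conj_zero'[OF g Ac] by (simp add: Y_def)
 qed
 thus ?thesis using g by (intro spherical_of_levi[of g]) (simp_all add: n_def)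
qed

text \<open>The dual of the case of a line.\<close>

lemma spherical_hyperplane:
 assumes q: "sum_list q = l + 1"
 shows "spherical [l, 1] q"
proof -
 define n where "n = l + 1"
 define N where "N = mat n n (%(r, s). if r = l & s ~= l then - 1 else (0 :: complex))"
 have N: "N \<in> sqm n" by (simp add: N_def)
 have N2: "N * N = zrm n" by (rule zero_matI[OF mult_sq[OF N N]], subst mult_mat_sum[OF N N]) (auto simp: N_def intro!: sum.neutral)
 define g where "g = idm n + N"
 have g: "g \<in> GL n" unfolding g_def by (rule square_zero_conj(1)[OF N N2 N])
 have ln: "l < n" by (simp add: n_def)
 have "levi_null n (block [l, 1]) (block q) g" unfolding levi_null_def
 proof (intro allI impI)
  fix A assume A: "levi n (block [l, 1]) (block q) g A"
  hence An: "A \<in> nilrad n (block [l, 1])" and Ac: "A \<in> sqm n" by (simp_all add: levi_def levi_carrier[OF A])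
  have A0: "A $$ (r, s) = 0" if "r < n" "s < n" "s ~= l" for r s using that nilradD[OF An that(1,2)] by (auto simp: block2 n_def)
  define Y where "Y = g * A * ginv g"
  have Yd: "Y $$ (r, r) = 0" if "r < n" for r using levi_diag[OF A that] by (simp add: Y_def)
  have Yr: "Y $$ (r, c) = Y $$ (r, l)" if rc: "r < n" "c < n" "c ~= l" for r c
  proof -
   have "(\<Sum>k<n. Y $$ (r, k) * N $$ (k, c)) = (\<Sum>k<n. if k = l then - Y $$ (r, k) else 0)"
    using rc by (intro sum.cong) (auto simp: N_def)
   hence "(\<Sum>k<n. Y $$ (r, k) * N $$ (k, c)) = - Y $$ (r, l)" using ln by simp
   moreover have "(\<Sum>k<n. N $$ (r, k) * A $$ (k, c)) = 0" using rc A0 by (intro sum.neutral) auto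
   ultimately show ?thesis using square_zero_conj(2)[OF N N2 Ac rc(1,2)] A0[OF rc] unfolding Y_def g_def by simp
  qed
  have "Y $$ (r, c) = 0" if "r < n" "c < n" for r c
   using Yr[OF that] Yr[OF that(1,1)] Yd[OF that(1)] by (cases "r = l"; cases "c = l") auto
  hence "Y = zrm n" using g Ac by (intro zero_matI) (simp_all add: Y_def)
  thus "A = zrm n" using conj_zero'[OF g Ac] by (simp add: Y_def)
 qed
 thus ?thesis using g by (intro spherical_of_levi[of g]) (simp_all add: n_def)
qed

text \<open>An explicit subspace in general position with respect to a three step flag that contains a line: it is spanned by coordinate vectors, by diagonal vectors that link the two other steps, and by one vector that links the line to everything.\<close>

lemma levi_null_three:
 fixes a a' m b c :: nat
 assumes ab: "a + m \<le> b" "a' + m \<le> c" "a = 0 \<or> a' + m = c" "a' = 0 \<or> a + m = b"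
 defines "n \<equiv> 1 + b + c" and "k \<equiv> 1 + a + a' + m"
 shows "\<exists>g\<in>GL n. levi_null n (block [k, n - k]) (block [1, b, c]) g"
proof -
 define PX where "PX = {1 + a..<1 + a + m}"
 define NX where "NX = {1 + a + m..<1 + b}"
 define AX where "AX = {1..<1 + a}"
 define PZ where "PZ = {1 + b + a'..<1 + b + a' + m}"
 define NZ where "NZ = {1 + b + a' + m..<1 + b + c}"
 define AZ where "AZ = {1 + b..<1 + b + a'}"
 define C where "C = 1 + a + a' + b + m"
 note D = PX_def NX_def AX_def PZ_def NZ_def AZ_def C_def
 define F where "F = {0} \<union> AX \<union> PZ \<union> AZ"
 define \<sigma> where "\<sigma> i = (if i \<in> F then 0 else 1 :: nat)" for i
 define N where "N = mat n n (%(r, s). if s = 0 & r \<in> PX \<union> NX \<union> NZ \<or> s \<in> PZ & r \<in> PX & r + s = C then 1 else (0 :: complex))"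
 have N: "N \<in> sqm n" by (simp add: N_def)
 have N2: "N * N = zrm n"
  by (rule zero_matI[OF mult_sq[OF N N]], subst mult_mat_sum[OF N N]) (use ab in \<open>auto simp: N_def D intro!: sum.neutral\<close>)
 define g where "g = idm n + N"
 have g: "g \<in> GL n" unfolding g_def by (rule square_zero_conj(1)[OF N N2 N])
 have Fsub: "F \<subseteq> {..<n}" using ab by (auto simp: F_def D n_def)
 have Fc: "card F = k"
 proof -
  have "card F = card {0 :: nat} + card AX + card PZ + card AZ" unfolding F_def using ab by (subst card_Un_disjoint, auto simp: D)+
  thus ?thesis by (simp add: D k_def)
 qed
 have notF: "j \<in> PX \<union> NX \<union> NZ" if "j < n" "j \<notin> F" for j using that ab by (auto simp: F_def D n_def)
 have inF: "j \<notin> F" "j < n" if "j \<in> PX \<union> NX \<union> NZ" for j using that ab by (auto simp: F_def D n_def)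
 have bl: "block [1, b, c] i = (if i < 1 then 0 else if i < 1 + b then 1 else if i < 1 + b + c then 2 else 3)" for i by auto
 have "levi_null n \<sigma> (block [1, b, c]) g" unfolding levi_null_def
 proof (intro allI impI)
  fix A assume A: "levi n \<sigma> (block [1, b, c]) g A"
  hence An: "A \<in> nilrad n \<sigma>" and Ac: "A \<in> sqm n" by (simp_all add: levi_def levi_carrier[OF A])
  have A0: "A $$ (r, s) = 0" if "r < n" "s < n" "r \<notin> F \<or> s \<in> F" for r s
   using that nilradD[OF An that(1,2)] by (auto simp: \<sigma>_def)
  define Y where "Y = g * A * ginv g"
  have Yz: "Y $$ (r, s) = 0" if "r \<le> s" "s < n" "block [1, b, c] r = block [1, b, c] s" for r s
   using A that unfolding levi_def Y_def by (meson le_less_trans)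
  have YX: "Y $$ (r, s) = 0" if "r \<le> s" "1 \<le> r" "s < 1 + b" for r s using that by (intro Yz) (auto simp: bl n_def)
  have YZ: "Y $$ (r, s) = 0" if "r \<le> s" "1 + b \<le> r" "s < 1 + b + c" for r s using that by (intro Yz) (auto simp: bl n_def)
  have row: "Y $$ (r, s) = (\<Sum>l<n. N $$ (r, l) * Y $$ (l, s))" if "r < n" "s < n" "r \<notin> F" for r s
  proof -
   have "(\<Sum>l<n. A $$ (r, l) * N $$ (l, s)) = 0" using that A0 by (intro sum.neutral) auto
   thus ?thesis using square_zero_conj(3)[OF N N2 Ac that(1,2)] A0[OF that(1,2)] that(3) unfolding Y_def g_def by simp
  qed
  have rowN: "Y $$ (r, s) = Y $$ (0, s)" if "r \<in> NX \<union> NZ" "s < n" for r s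
  proof -
   have r: "r < n" "r \<notin> F" using inF that(1) by blast+
   have "(\<Sum>l<n. N $$ (r, l) * Y $$ (l, s)) = (\<Sum>l<n. if l = 0 then Y $$ (l, s) else 0)"
    using that r ab by (intro sum.cong) (auto simp: N_def D)
   thus ?thesis using row[OF r(1) that(2) r(2)] r by simp
  qed
  have rowP: "Y $$ (r, s) = Y $$ (0, s) + Y $$ (C - r, s)" if "r \<in> PX" "s < n" for r s
  proof -
   have r: "r < n" "r \<notin> F" using inF that(1) by blast+
   have z: "C - r < n" "C - r ~= 0" using that ab by (auto simp: D n_def)
   have "(\<Sum>l<n. N $$ (r, l) * Y $$ (l, s)) = (\<Sum>l<n. (if l = 0 then Y $$ (l, s) else 0) + (if l = C - r then Y $$ (l, s) else 0))"
    using that r ab z by (intro sum.cong) (auto simp: N_def D)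
   also have "\<dots> = Y $$ (0, s) + Y $$ (C - r, s)" using z r by (simp add: sum.distrib)
   finally show ?thesis using row[OF r(1) that(2) r(2)] by simp
  qed
  have colP: "Y $$ (r, s) + Y $$ (r, C - s) = 0" if "s \<in> PZ" "r < n" for r s
  proof -
   have s: "s < n" "s \<in> F" using that ab by (auto simp: D n_def F_def)
   have z: "C - s < n" using that ab by (auto simp: D n_def)
   have "(\<Sum>l<n. Y $$ (r, l) * N $$ (l, s)) = (\<Sum>l<n. if l = C - s then Y $$ (r, l) else 0)"
    using that s ab z by (intro sum.cong) (auto simp: N_def D)
   hence "(\<Sum>l<n. Y $$ (r, l) * N $$ (l, s)) = Y $$ (r, C - s)" using z by simp
   moreover have "(\<Sum>l<n. N $$ (r, l) * A $$ (l, s)) = 0" using that s A0 by (intro sum.neutral) auto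
   ultimately show ?thesis using square_zero_conj(2)[OF N N2 Ac that(2) s(1)] A0[OF that(2) s(1)] s(2) unfolding Y_def g_def by simp
  qed
  have Y0: "Y $$ (0, j) = 0" if "j \<in> PX \<union> NX \<union> NZ" for j
  proof -
   have j: "j < n" using inF that by blast
   have d: "Y $$ (j, j) = 0" using j by (intro Yz) auto
   show ?thesis
   proof (cases "j \<in> PX")
    case True
    hence z: "C - j \<in> PZ" "C - (C - j) = j" "C - j < n" using ab by (auto simp: D n_def)
    have "Y $$ (C - j, C - j) = 0" using z by (intro Yz) auto
    hence "Y $$ (C - j, j) = 0" using colP[OF z(1,3)] z(2) by simp
    thus ?thesis using rowP[OF True j] d by simp
   next
    case False
    thus ?thesis using rowN[of j j] that j d by auto
   qed
  qed
  have main: "Y $$ (i, j) = 0" if i: "i \<in> F" and j: "j \<in> PX \<union> NX \<union> NZ" for i j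
  proof -
   have jn: "j < n" using inF j by blast
   have iN: "i < n" using i Fsub by auto
   have jz: "C - j \<in> PZ" "C - (C - j) = j" "C - j < n" if "j \<in> PX" using that ab by (auto simp: D n_def)
   consider "i = 0" | "i \<in> AX" | "i \<in> AZ" | "i \<in> PZ" using i by (auto simp: F_def)
   thus ?thesis
   proof cases
    case 1
    thus ?thesis using Y0[OF j] by simp
   next
    case 2
    hence "j \<notin> NZ" using ab by (auto simp: D)
    thus ?thesis using 2 j ab by (intro YX) (auto simp: D)
   next
    case 3
    show ?thesis
    proof (cases "j \<in> PX")
     case True
     have "Y $$ (i, C - j) = 0" using 3 jz[OF True] ab by (intro YZ) (auto simp: D)
     thus ?thesis using colP[OF jz(1)[OF True] iN] jz(2)[OF True] by simp
    next
     case False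
     moreover have "j \<notin> NX" using 3 ab by (auto simp: D)
     ultimately show ?thesis using 3 j ab by (intro YZ) (auto simp: D)
    qed
   next
    case 4
    hence x: "C - i \<in> PX" "C - (C - i) = i" using ab by (auto simp: D)
    have rx: "Y $$ (C - i, j) = Y $$ (i, j)" using rowP[OF x(1) jn] Y0[OF j] x(2) by simp
    consider "j \<in> NZ" | "j \<in> NX" | "j \<in> PX" using j by blast
    thus ?thesis
    proof cases
     case 1
     thus ?thesis using 4 ab by (intro YZ) (auto simp: D)
    next
     case 2
     hence "Y $$ (C - i, j) = 0" using x(1) ab by (intro YX) (auto simp: D)
     thus ?thesis using rx by simp
    next
     case 3
     show ?thesis
     proof (cases "C - i \<le> j")
      case True
      hence "Y $$ (C - i, j) = 0" using x(1) 3 ab by (intro YX) (auto simp: D)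
      thus ?thesis using rx by simp
     next
      case False
      hence "i \<le> C - j" using 4 3 x by (auto simp: D)
      hence "Y $$ (i, C - j) = 0" using 4 jz[OF 3] ab by (intro YZ) (auto simp: D)
      thus ?thesis using colP[OF jz(1)[OF 3] iN] jz(2)[OF 3] by simp
     qed
    qed
   qed
  qed
  show "A = zrm n"
  proof (rule zero_matI[OF Ac])
   fix i j assume ij: "i < n" "j < n"
   show "A $$ (i, j) = 0"
   proof (cases "i \<in> F & j \<notin> F")
    case True
    have "(\<Sum>l<n. N $$ (i, l) * Y $$ (l, j)) = 0" using True ij inF by (intro sum.neutral) (auto simp: N_def)
    moreover have "(\<Sum>l<n. A $$ (i, l) * N $$ (l, j)) = 0" using True ij by (intro sum.neutral) (auto simp: N_def F_def)
    ultimately have "A $$ (i, j) = Y $$ (i, j)" using square_zero_conj(3)[OF N N2 Ac ij] unfolding Y_def g_def by simp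
    thus ?thesis using main[of i j] notF[OF ij(2)] True by simp
   qed (use A0[OF ij] in blast)
  qed
 qed
 moreover obtain f where f: "f permutes {..<n}" "\<forall>i<n. f i < card F \<longleftrightarrow> i \<in> F"
  using ex_permutes_subset[OF Fsub] by blast
 moreover have "\<sigma> i = block [k, n - k] (f i)" if "i < n" for i
 proof -
  have "f i < n" using permutes_in_image[OF f(1)] that by auto
  thus ?thesis using f(2) that unfolding Fc \<sigma>_def by (auto simp: block2)
 qed
 ultimately have "levi_null n (block [k, n - k]) (block [1, b, c]) (g * perm_mat n f)"
  using g by (intro levi_null_relabel[of f n \<sigma>]) auto
 thus ?thesis using g f(1) by (intro bexI[of _ "g * perm_mat n f"]) simp_all
qed

lemma spherical_grass:
 assumes k: "1 \<le> k" "k + l = 1 + x + y" and q: "q = [1, x, y] \<or> q = [x, 1, y] \<or> q = [x, y, 1]"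
 shows "spherical [k, l] q"
proof -
 define n where "n = 1 + x + y"
 define a where "a = k - 1 - y"
 define a' where "a' = k - 1 - x"
 define m where "m = k - 1 - a - a'"
 have 1: "a + m \<le> x" "a' + m \<le> y" "a = 0 \<or> a' + m = y" "a' = 0 \<or> a + m = x" "1 + a + a' + m = k"
  using k by (auto simp: a_def a'_def m_def)
 have l: "n - k = l" using k by (simp add: n_def)
 obtain g where g: "g \<in> GL n" "levi_null n (block [k, l]) (block [1, x, y]) g"
  using levi_null_three[OF 1(1-4)] unfolding 1(5) n_def[symmetric] l by blast
 obtain g' where g': "g' \<in> GL n" "levi_null n (block [k, l]) (block [x, 1, y]) g'"
  using levi_null_exchange[of "[]" 1 x "[y]" n g "block [k, l]"] g by (auto simp: n_def)
 obtain g'' where g'': "g'' \<in> GL n" "levi_null n (block [k, l]) (block [x, y, 1]) g''"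
  using levi_null_exchange[of "[x]" 1 y "[]" n g' "block [k, l]"] g' by (auto simp: n_def)
 have n: "n = sum_list [k, l]" using k by (simp add: n_def)
 show ?thesis using q
 proof (elim disjE)
  show "spherical [k, l] q" if "q = [1, x, y]" using g unfolding that n by (rule spherical_of_levi)
  show "spherical [k, l] q" if "q = [x, 1, y]" using g' unfolding that n by (rule spherical_of_levi)
  show "spherical [k, l] q" if "q = [x, y, 1]" using g'' unfolding that n by (rule spherical_of_levi)
 qed
qed

text \<open>Coarser flags have smaller nilradicals.\<close>

lemma spherical_coarsen:
 assumes "spherical p (u @ [a, b] @ v)" shows "spherical p (u @ [a + b] @ v)"
proof -
 have "block (u @ [a, b] @ v) i < block (u @ [a, b] @ v) j"
  if "block (u @ [a + b] @ v) i < block (u @ [a + b] @ v) j" for i j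
  using that block_less[of i u] block_less[of j u] by (auto simp: block_append add.assoc split: if_splits)
 hence "nilrad n (block (u @ [a + b] @ v)) \<subseteq> nilrad n (block (u @ [a, b] @ v))" for n by (intro nilrad_mono) auto
 thus ?thesis using assms unfolding spherical_def null_def conormal_def by blast
qed

section \<open>Rational curves and irreducibility\<close>

definition ratl :: "complex set => (complex => complex) => bool" where
 "ratl F f \<longleftrightarrow> (\<exists>p q. is_poly p & is_poly q & (\<forall>t. t \<notin> F --> q t ~= 0 & f t = p t / q t))"

lemma ratl_div: "is_poly p ==> is_poly q ==> (\<And>t. t \<notin> F ==> q t ~= 0) ==> ratl F (%t. p t / q t)"
 unfolding ratl_def by blast

lemma ratl_poly: "is_poly p ==> ratl F p" using ratl_div[of p "%_. 1" F] by auto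

lemma ratl_add: assumes "ratl F f" "ratl F g" shows "ratl F (%t. f t + g t)"
proof -
 obtain p q p' q' where 1: "is_poly p" "is_poly q" "\<And>t. t \<notin> F ==> q t ~= 0 & f t = p t / q t"
  "is_poly p'" "is_poly q'" "\<And>t. t \<notin> F ==> q' t ~= 0 & g t = p' t / q' t" using assms unfolding ratl_def by blast
 have "is_poly (%t. p t * q' t + p' t * q t)" "is_poly (%t. q t * q' t)" using 1 by auto
 moreover have "q t * q' t ~= 0 & f t + g t = (p t * q' t + p' t * q t) / (q t * q' t)" if "t \<notin> F" for t
  using 1(3,6)[OF that] by (simp add: field_simps)
 ultimately show ?thesis unfolding ratl_def by blast
qed

lemma ratl_mult: assumes "ratl F f" "ratl F g" shows "ratl F (%t. f t * g t)"
proof -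
 obtain p q p' q' where 1: "is_poly p" "is_poly q" "\<And>t. t \<notin> F ==> q t ~= 0 & f t = p t / q t"
  "is_poly p'" "is_poly q'" "\<And>t. t \<notin> F ==> q' t ~= 0 & g t = p' t / q' t" using assms unfolding ratl_def by blast
 have "is_poly (%t. p t * p' t)" "is_poly (%t. q t * q' t)" using 1 by auto
 moreover have "q t * q' t ~= 0 & f t * g t = (p t * p' t) / (q t * q' t)" if "t \<notin> F" for t using 1(3,6)[OF that] by simp
 ultimately show ?thesis unfolding ratl_def by blast
qed

lemma ratl_sum: "(\<And>i. i \<in> I ==> ratl F (f i)) ==> ratl F (%t. \<Sum>i\<in>I. f i t)"
 by (induction I rule: infinite_finite_induct) (auto intro: ratl_add ratl_poly)

lemma ratl_cong: "ratl F f ==> (\<And>t. t \<notin> F ==> f t = g t) ==> ratl F g" unfolding ratl_def by metis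

lemma ratl_zeros:
 assumes "ratl F f" "a \<notin> F" "f a ~= 0"
 shows "finite {t. t \<notin> F & f t = 0}"
proof -
 obtain p q where 1: "is_poly p" "\<And>t. t \<notin> F ==> q t ~= 0 & f t = p t / q t" using assms(1) unfolding ratl_def by blast
 have "p a ~= 0" using 1(2)[OF assms(2)] assms(3) by auto
 hence "finite {t. p t = 0}" using 1(1) by (intro is_poly_finite_zeros)
 moreover have "{t. t \<notin> F & f t = 0} \<subseteq> {t. p t = 0}" using 1(2) by auto
 ultimately show ?thesis by (rule finite_subset[rotated])
qed

lemma poly_funs_ratl:
 assumes "f \<in> poly_funs C" "\<And>c. c \<in> C ==> ratl F (%t. c (\<gamma> t))"
 shows "ratl F (%t. f (\<gamma> t))" using assms(1) by induction (auto intro: ratl_add ratl_mult ratl_poly assms(2))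

definition curve :: "'a topology => complex set => (complex => 'a) => bool" where
 "curve T F \<gamma> \<longleftrightarrow> finite F & (\<forall>t. t \<notin> F --> \<gamma> t \<in> topspace T) &
   (\<forall>A. closedin T A --> (\<forall>t. t \<notin> F --> \<gamma> t \<in> A) \<or> finite {t. t \<notin> F & \<gamma> t \<in> A})"

lemma curve_zariski:
 assumes "finite F" "\<And>t. t \<notin> F ==> \<gamma> t \<in> S" "\<And>c. c \<in> C ==> ratl F (%t. c (\<gamma> t))"
 shows "curve (zariski S C) F \<gamma>" unfolding curve_def topspace_zariski
proof (intro conjI allI impI assms(1,2))
 fix A assume "closedin (zariski S C) A"
 then obtain Q where Q: "Q \<subseteq> poly_funs C" "A = {x \<in> S. \<forall>f\<in>Q. f x = 0}" unfolding closedin_zariski by blast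
 show "(\<forall>t. t \<notin> F --> \<gamma> t \<in> A) \<or> finite {t. t \<notin> F & \<gamma> t \<in> A}"
 proof (cases "\<forall>t. t \<notin> F --> \<gamma> t \<in> A")
  case False
  then obtain t f where t: "t \<notin> F" "f \<in> Q" "f (\<gamma> t) ~= 0" using Q(2) assms(2) by blast
  have "finite {t. t \<notin> F & f (\<gamma> t) = 0}"
  proof -
   have "ratl F (%t. f (\<gamma> t))" using poly_funs_ratl[of f C F \<gamma>] t(2) Q(1) assms(3) by blast
   thus ?thesis using ratl_zeros[of F "%t. f (\<gamma> t)" t] t by blast
  qed
  moreover have "{t. t \<notin> F & \<gamma> t \<in> A} \<subseteq> {t. t \<notin> F & f (\<gamma> t) = 0}" using t(2) Q(2) by blast
  ultimately show ?thesis using finite_subset by blast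
 qed blast
qed

lemma curve_map:
 assumes c: "curve T F \<gamma>" and q: "continuous_map T T' q"
 shows "curve T' F (%t. q (\<gamma> t))" unfolding curve_def
proof (intro conjI allI impI)
 show "finite F" using c by (simp add: curve_def)
 show "q (\<gamma> t) \<in> topspace T'" if "t \<notin> F" for t using c q that unfolding curve_def continuous_map_def by blast
 fix A assume "closedin T' A"
 hence "closedin T {x \<in> topspace T. q x \<in> A}" by (rule closedin_continuous_map_preimage[OF q])
 hence "(\<forall>t. t \<notin> F --> \<gamma> t \<in> {x \<in> topspace T. q x \<in> A}) \<or> finite {t. t \<notin> F & \<gamma> t \<in> {x \<in> topspace T. q x \<in> A}}"
  using c unfolding curve_def by blast
 moreover have "{t. t \<notin> F & \<gamma> t \<in> {x \<in> topspace T. q x \<in> A}} = {t. t \<notin> F & q (\<gamma> t) \<in> A}"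
  using c unfolding curve_def by blast
 ultimately show "(\<forall>t. t \<notin> F --> q (\<gamma> t) \<in> A) \<or> finite {t. t \<notin> F & q (\<gamma> t) \<in> A}" by auto
qed

lemma curve_closed:
 assumes "curve T F \<gamma>" "closedin T A" "finite E" "\<And>t. t \<notin> E ==> t \<notin> F ==> \<gamma> t \<in> A" "t \<notin> F"
 shows "\<gamma> t \<in> A"
proof (rule ccontr)
 assume "\<gamma> t \<notin> A"
 hence "finite {t. t \<notin> F & \<gamma> t \<in> A}" "finite F" using assms(1,2,5) unfolding curve_def by blast+
 moreover have "(UNIV :: complex set) = {t. t \<notin> F & \<gamma> t \<in> A} \<union> F \<union> E" using assms(4) by blast
 ultimately show False using assms(3) infinite_UNIV_char_0[where 'a = complex] by (metis finite_Un)
qed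

text \<open>A substitute for irreducibility that is easy to verify for orbits and for families of orbits.\<close>

definition linked :: "'a topology => 'a set => bool" where
 "linked T Y \<longleftrightarrow> Y \<subseteq> topspace T & (\<forall>y0\<in>Y. \<forall>y1\<in>Y. \<exists>F \<gamma>. curve T F \<gamma> & 0 \<notin> F & 1 \<notin> F &
   \<gamma> 0 = y0 & \<gamma> 1 = y1 & (\<forall>t. t \<notin> F --> \<gamma> t \<in> Y))"

lemma linked_closed:
 assumes "linked T Y" "closedin T A" "closedin T B" "Y \<subseteq> A \<union> B"
 shows "Y \<subseteq> A \<or> Y \<subseteq> B"
proof (rule ccontr)
 assume "\<not> ?thesis"
 then obtain y0 y1 where y: "y0 \<in> Y" "y0 \<notin> A" "y1 \<in> Y" "y1 \<notin> B" by blast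
 obtain F \<gamma> where g: "curve T F \<gamma>" "0 \<notin> F" "1 \<notin> F" "\<gamma> 0 = y0" "\<gamma> 1 = y1" "\<And>t. t \<notin> F ==> \<gamma> t \<in> Y"
  using assms(1) y(1,3) unfolding linked_def by blast
 have "finite {t. t \<notin> F & \<gamma> t \<in> A}" using g y(2) assms(2) unfolding curve_def by blast
 moreover have "\<gamma> t \<in> B" if "t \<notin> {t. t \<notin> F & \<gamma> t \<in> A}" "t \<notin> F" for t using that g(6)[of t] assms(4) by blast
 ultimately have "\<gamma> 1 \<in> B" using curve_closed[OF g(1) assms(3) _ _ g(3)] by blast
 thus False using g(5) y(4) by simp
qed

lemma linked_irreducible:
 assumes "linked T Y" "Y ~= {}"
 shows "irreducible_closedin T (T closure_of Y)"
proof -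
 have sub: "Y \<subseteq> T closure_of Y" using assms(1) by (intro closure_of_subset) (simp add: linked_def)
 show ?thesis unfolding irreducible_closedin_def
 proof (intro conjI allI impI)
  fix A B assume AB: "closedin T A" "closedin T B" "T closure_of Y \<subseteq> A \<union> B"
  hence "Y \<subseteq> A \<or> Y \<subseteq> B" using sub by (intro linked_closed[OF assms(1)]) auto
  thus "T closure_of Y \<subseteq> A \<or> T closure_of Y \<subseteq> B" using AB closure_of_minimal by metis
 qed (use sub assms(2) in auto)
qed

lemma linked_connected:
 assumes "linked T Y" shows "connectedin T Y" unfolding connectedin_closedin
proof (intro conjI notI)
 show "Y \<subseteq> topspace T" using assms by (simp add: linked_def)
 assume "\<exists>E1 E2. closedin T E1 & closedin T E2 & Y \<subseteq> E1 \<union> E2 & E1 \<inter> E2 \<inter> Y = {} & E1 \<inter> Y ~= {} & E2 \<inter> Y ~= {}"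
 then obtain E1 E2 where E: "closedin T E1" "closedin T E2" "Y \<subseteq> E1 \<union> E2" "E1 \<inter> E2 \<inter> Y = {}" "E1 \<inter> Y ~= {}" "E2 \<inter> Y ~= {}"
  by blast
 thus False using linked_closed[OF assms E(1-3)] by blast
qed

section \<open>Rational curves in the special linear group\<close>

lemma SL_iff: "A \<in> SG n \<longleftrightarrow> A \<in> sqm n & det A = 1" by (simp add: SL_def)

lemma SL_I: "A \<in> sqm n ==> det A = 1 ==> A \<in> SG n" by (simp add: SL_def)

lemma SL_carrier [simp]: "A \<in> SG n ==> A \<in> sqm n"
 and SL_det [simp]: "A \<in> SG n ==> det A = 1"
 and SL_GL [simp]: "A \<in> SG n ==> A \<in> GL n"
proof -
 assume "A \<in> SG n"
 thus 1: "A \<in> sqm n" "det A = 1" by (simp_all only: SL_iff)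
 show "A \<in> GL n" by (rule GLI[OF 1(1)]) (simp add: 1(2))
qed

lemma SL_mult [simp]: "A \<in> SG n ==> B \<in> SG n ==> A * B \<in> SG n" by (rule SL_I) (simp_all add: det_mult[of _ n])

lemma SL_one [simp]: "idm n \<in> SG n" by (rule SL_I) auto

lemma SL_ginv [simp]: "A \<in> SG n ==> ginv A \<in> SG n"
proof (rule SL_I)
 assume A: "A \<in> SG n"
 show "ginv A \<in> sqm n" using A by simp
 have "det (A * ginv A) = det A * det (ginv A)" using A by (intro det_mult[of A n]) simp_all
 thus "det (ginv A) = 1" using A ginv_right[of A n] by simp
qed

definition diag1 :: "nat => complex => complex mat" where
 "diag1 n c = multrow_mat n 0 c"

lemma diag1_carrier [simp]: "diag1 n c \<in> sqm n" by (simp add: diag1_def)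

lemma diag1_par [simp]: "diag1 n c \<in> par n \<sigma>" by (rule parI) (auto simp: diag1_def)

lemma diag1_low [simp]: "diag1 n c \<in> low n" unfolding low_def by simp

lemma det_diag1 [simp]: "n > 0 ==> det (diag1 n c) = c" by (simp add: diag1_def det_multrow_mat)

lemma diag1_GL [simp]: "n > 0 ==> c ~= 0 ==> diag1 n c \<in> GL n" by (rule GLI) auto

lemma mult_diag1_index:
 assumes "A \<in> sqm n" "i < n" "j < n"
 shows "(A * diag1 n c) $$ (i, j) = A $$ (i, j) * (if j = 0 then c else 1)"
proof -
 have "(A * diag1 n c) $$ (i, j) = (\<Sum>l<n. if l = j then A $$ (i, l) * (if j = 0 then c else 1) else 0)"
  unfolding mult_mat_sum[OF assms(1) diag1_carrier assms(2,3)] using assms by (intro sum.cong) (auto simp: diag1_def)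
 thus ?thesis using assms by simp
qed

text \<open>Rescaling the first column brings the determinant to \<open>1\<close>, and does not leave a coset of a pattern group.\<close>

definition normal :: "nat => complex mat => complex mat" where
 "normal n A = A * diag1 n (1 / det A)"

lemma normal_SL: "n > 0 ==> A \<in> GL n ==> normal n A \<in> SG n" by (rule SL_I) (simp_all add: normal_def det_mult[of _ n] GL_det)

lemma normal_id:
 assumes "A \<in> SG n" shows "normal n A = A" by (rule eq_matI) (use assms carrier_matD[OF SL_carrier[OF assms]] in
  \<open>auto simp: normal_def mult_diag1_index[of A n] carrier_matD[OF diag1_carrier] simp del: index_mult_mat(1)\<close>)

lemma normal_ratl:
 assumes M: "poly_mat n M" and F: "\<And>t. det (M t) = 0 ==> t \<in> F" and ij: "i < n" "j < n"
 shows "ratl F (%t. normal n (M t) $$ (i, j))"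
proof (cases "j = 0")
 case True
 have "ratl F (%t. M t $$ (i, j) / det (M t))" by (rule ratl_div[OF poly_matD(2)[OF M ij] poly_mat_det[OF M]]) (use F in blast)
 thus ?thesis using ij poly_matD(1)[OF M] True by (simp add: normal_def mult_diag1_index[of _ n] del: index_mult_mat)
next
 case False
 thus ?thesis using ratl_poly[OF poly_matD(2)[OF M ij]] ij poly_matD(1)[OF M]
  by (simp add: normal_def mult_diag1_index[of _ n] del: index_mult_mat)
qed

lemma mult_ratl:
 assumes "\<And>t. t \<notin> F ==> A t \<in> sqm n" "\<And>t. t \<notin> F ==> B t \<in> sqm n" "i < n" "j < n"
  "\<And>i j. i < n ==> j < n ==> ratl F (%t. A t $$ (i, j))" "\<And>i j. i < n ==> j < n ==> ratl F (%t. B t $$ (i, j))"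
 shows "ratl F (%t. (A t * B t) $$ (i, j))"
proof (rule ratl_cong)
 show "ratl F (%t. \<Sum>l<n. A t $$ (i, l) * B t $$ (l, j))" using assms by (intro ratl_sum ratl_mult) auto
 show "(\<Sum>l<n. A t $$ (i, l) * B t $$ (l, j)) = (A t * B t) $$ (i, j)" if "t \<notin> F" for t
  using assms(1,2)[OF that] assms(3,4) by (intro mult_mat_sum[symmetric])
qed

lemma curve_SL2:
 assumes "finite F" "\<And>t. t \<notin> F ==> A t \<in> SG n" "\<And>t. t \<notin> F ==> B t \<in> SG n"
  "\<And>i j. i < n ==> j < n ==> ratl F (%t. A t $$ (i, j))" "\<And>i j. i < n ==> j < n ==> ratl F (%t. B t $$ (i, j))"
 shows "curve (SL2_topology n) F (%t. (A t, B t))" unfolding SL2_topology_def by (rule curve_zariski) (use assms in auto)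

lemma curve_SL:
 assumes "finite F" "\<And>t. t \<notin> F ==> A t \<in> SG n"
  "\<And>i j. i < n ==> j < n ==> ratl F (%t. A t $$ (i, j))"
 shows "curve (SL_topology n) F A" unfolding SL_topology_def by (rule curve_zariski) (use assms in auto)

lemma finite_det_seg: "A \<in> GL n ==> B \<in> sqm n ==> finite {t. det (seg A B t) = 0}" by (rule seg_invertible) (auto simp: GL_det)

lemma seg_low: "A \<in> low n ==> B \<in> low n ==> seg A B t \<in> low n" unfolding seg_def low_def by (rule par_lin)

lemma seg_par: "A \<in> par n \<sigma> ==> B \<in> par n \<sigma> ==> seg A B t \<in> par n \<sigma>"
 unfolding seg_def by (rule par_lin)

lemma linked_par_SL:
 assumes "n > 0" shows "linked (SL_topology n) (par n \<sigma> \<inter> SG n)" unfolding linked_def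
proof (intro conjI ballI)
 show "par n \<sigma> \<inter> SG n \<subseteq> topspace (SL_topology n)" by (simp add: SL_topology_def)
 fix A B assume A: "A \<in> par n \<sigma> \<inter> SG n" and B: "B \<in> par n \<sigma> \<inter> SG n"
 define F where "F = {t. det (seg A B t) = 0}"
 have pm: "poly_mat n (seg A B)" using A B by (intro poly_mat_seg) auto
 have G: "seg A B t \<in> GL n" if "t \<notin> F" for t using that A B by (intro GLI) (auto simp: F_def)
 have e: "seg A B 0 = A" "seg A B 1 = B" using A B seg_0[of A n n B] seg_1[of A n n B] by auto
 have "curve (SL_topology n) F (%t. normal n (seg A B t))" using A B finite_det_seg[of A n B] normal_SL[OF assms G]
  by (intro curve_SL normal_ratl[OF pm]) (auto simp: F_def)
 moreover have "normal n (seg A B t) \<in> par n \<sigma> \<inter> SG n" if "t \<notin> F" for t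
  using normal_SL[OF assms G[OF that]] A B by (auto simp: normal_def intro!: par_mult seg_par)
 moreover have "0 \<notin> F" "1 \<notin> F" using A B by (auto simp: F_def e)
 ultimately show "\<exists>F \<gamma>. curve (SL_topology n) F \<gamma> & 0 \<notin> F & 1 \<notin> F & \<gamma> 0 = A & \<gamma> 1 = B &
   (\<forall>t. t \<notin> F --> \<gamma> t \<in> par n \<sigma> \<inter> SG n)"
  using A B by (intro exI[of _ F] exI[of _ "%t. normal n (seg A B t)"]) (auto simp: e normal_id)
qed

section \<open>Charts of the double flag variety\<close>

lemma continuous_map_zariski:
 assumes "\<And>x. x \<in> S ==> \<psi> x \<in> S'" and c: "\<And>c. c \<in> C' ==> \<exists>f\<in>poly_funs C. \<forall>x\<in>S. c (\<psi> x) = f x"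
 shows "continuous_map (zariski S C) (zariski S' C') \<psi>"
proof -
 have *: "\<exists>f'\<in>poly_funs C. \<forall>x\<in>S. f (\<psi> x) = f' x" if "f \<in> poly_funs C'" for f using that
 proof induction
  case (const a)
  thus ?case by (intro bexI[of _ "%_. a"]) (auto intro: poly_funs.const)
 next
  case (coord f)
  thus ?case by (rule c)
 next
  case (add f g)
  then obtain f' g' where fg: "f' \<in> poly_funs C" "\<forall>x\<in>S. f (\<psi> x) = f' x" "g' \<in> poly_funs C" "\<forall>x\<in>S. g (\<psi> x) = g' x" by blast
  show ?case by (rule bexI[OF _ poly_funs.add[OF fg(1,3)]]) (use fg(2,4) in auto)
 next
  case (mult f g)
  then obtain f' g' where fg: "f' \<in> poly_funs C" "\<forall>x\<in>S. f (\<psi> x) = f' x" "g' \<in> poly_funs C" "\<forall>x\<in>S. g (\<psi> x) = g' x" by blast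
  show ?case by (rule bexI[OF _ poly_funs.mult[OF fg(1,3)]]) (use fg(2,4) in auto)
 qed
 have "closedin (zariski S C) {x \<in> S. \<psi> x \<in> A}" if "closedin (zariski S' C') A" for A
 proof -
  obtain Q where Q: "Q \<subseteq> poly_funs C'" "A = {x \<in> S'. \<forall>f\<in>Q. f x = 0}" using \<open>closedin (zariski S' C') A\<close> unfolding closedin_zariski by blast
  obtain h where h: "\<And>f. f \<in> poly_funs C' ==> h f \<in> poly_funs C & (\<forall>x\<in>S. f (\<psi> x) = h f x)"
   using * by metis
  have "f (\<psi> x) = h f x" if "f \<in> Q" "x \<in> S" for f x using h that Q(1) by blast
  hence "{x \<in> S. \<psi> x \<in> A} = {x \<in> S. \<forall>f\<in>h ` Q. f x = 0}" unfolding Q(2) using assms(1) by auto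
  moreover have "h ` Q \<subseteq> poly_funs C" using Q(1) h by auto
  ultimately show ?thesis unfolding closedin_zariski by blast
 qed
 thus ?thesis unfolding continuous_map_closedin topspace_zariski using assms(1) by auto
qed

lemma poly_funs_sum: "(\<And>i. i \<in> I ==> f i \<in> poly_funs C) ==> (%x. \<Sum>i\<in>I. f i x) \<in> poly_funs C"
 by (induction I rule: infinite_finite_induct) (auto intro: poly_funs.const poly_funs.add)

lemma poly_funs_prod: "(\<And>i. i \<in> I ==> f i \<in> poly_funs C) ==> (%x. \<Prod>i\<in>I. f i x) \<in> poly_funs C"
 by (induction I rule: infinite_finite_induct) (auto intro: poly_funs.const poly_funs.mult)

lemma poly_funs_grid_poly:
 assumes "\<And>e. e \<in> T ==> X e \<in> poly_funs C"
 shows "(%s. grid_poly T d c (%e. X e s)) \<in> poly_funs C"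
proof -
 have "(%s. (X e s - a) / b) \<in> poly_funs C" if "e \<in> T" for e a b
  using poly_funs.mult[OF poly_funs.add[OF assms[OF that] poly_funs.const[of "- a"]] poly_funs.const[of "1 / b"]] by simp
 thus ?thesis unfolding grid_poly_def lag_def by (intro poly_funs_sum poly_funs.mult poly_funs_prod poly_funs.const) auto
qed

lemma grid_poly_cong: "(\<And>e. e \<in> T ==> x e = y e) ==> grid_poly T d c x = grid_poly T d c y"
proof -
 assume e: "\<And>e. e \<in> T ==> x e = y e"
 have "(\<Prod>e\<in>T. lag d (a e) (x e)) = (\<Prod>e\<in>T. lag d (a e) (y e))" for a by (rule prod.cong) (auto simp: e)
 thus ?thesis unfolding grid_poly_def by simp
qed

lemma grid_poly_SL_point:
 assumes n: "n > 0" and x: "grid_poly (coords n) d c x ~= 0"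
 shows "\<exists>A B c1 c2. A \<in> SG n & B \<in> SG n & grid_poly (coords n) d c (pt (c1 *% A) (c2 *% B)) ~= 0"
proof -
 define A0 where "A0 = mat n n (%p. x (True, p))"
 define B0 where "B0 = mat n n (%p. x (False, p))"
 define f where "f = grid_poly (coords n) d c"
 have C: "A0 \<in> sqm n" "B0 \<in> sqm n" by (auto simp: A0_def B0_def)
 have pm: "poly_mat n (seg (idm n) A0)" "poly_mat n (seg (idm n) B0)" using C by (auto intro: poly_mat_seg)
 have "f (pt A0 B0) = f x" unfolding f_def by (rule grid_poly_cong) (auto simp: coords_def pt_def A0_def B0_def)
 hence "f (pt (seg (idm n) A0 1) (seg (idm n) B0 1)) ~= 0"
  using x seg_1[OF one_carrier_mat C(1)] seg_1[OF one_carrier_mat C(2)] by (simp add: f_def)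
 moreover have "is_poly (%s. f (pt (seg (idm n) A0 s) (seg (idm n) B0 s)))" unfolding f_def
 proof (rule is_poly_grid_poly)
  fix e assume "e \<in> coords n"
  then obtain s r c where e: "e = (s, r, c)" "r < n" "c < n" by (auto simp: coords_def)
  show "is_poly (%t. pt (seg (idm n) A0 t) (seg (idm n) B0 t) e)"
   using poly_matD(2)[OF pm(1) e(2,3)] poly_matD(2)[OF pm(2) e(2,3)] by (cases s) (simp_all add: pt_def e(1))
 qed
 ultimately have "finite {s. f (pt (seg (idm n) A0 s) (seg (idm n) B0 s)) = 0}" by (intro is_poly_finite_zeros)
 moreover have "finite {s. det (seg (idm n) A0 s) = 0}" "finite {s. det (seg (idm n) B0 s) = 0}"
  using C finite_det_seg[OF one_GL] by auto
 ultimately have "finite ({s. f (pt (seg (idm n) A0 s) (seg (idm n) B0 s)) = 0} \<union> {s. det (seg (idm n) A0 s) = 0} \<union> {s. det (seg (idm n) B0 s) = 0})"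
  by auto
 from ex_new_if_finite[OF infinite_UNIV_char_0[where 'a = complex] this]
 obtain s where s: "f (pt (seg (idm n) A0 s) (seg (idm n) B0 s)) ~= 0" "det (seg (idm n) A0 s) ~= 0" "det (seg (idm n) B0 s) ~= 0"
  by (elim exE) (simp only: Un_iff mem_Collect_eq de_Morgan_disj, elim conjE, rule that)
 have *: "\<exists>c A. A \<in> SG n & c *% A = M" if M: "M \<in> sqm n" "det M ~= 0" for M :: "complex mat"
 proof -
  obtain c where c: "c ^ n = det M" using nth_root_exists[of n "det M"] n by auto
  hence c0: "c ~= 0" using M n by (auto simp: power_0_left)
  have "det ((1 / c) *% M) = 1" using M c c0 by (simp add: det_smult power_one_over)
  moreover have "c *% ((1 / c) *% M) = M" by (rule eq_matI) (use c0 in auto)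
  ultimately show ?thesis using M by (intro exI[of _ c] exI[of _ "(1 / c) *% M"]) (auto intro: SL_I)
 qed
 obtain c1 A where "A \<in> SG n" "c1 *% A = seg (idm n) A0 s" using *[OF _ s(2)] C by (auto)
 moreover obtain c2 B where "B \<in> SG n" "c2 *% B = seg (idm n) B0 s" using *[OF _ s(3)] C by (auto)
 ultimately show ?thesis using s(1) unfolding f_def by metis
qed

lemma normalize_right:
 assumes n: "n > 0" and g: "g \<in> GL n" and b: "b \<in> low n" "b \<in> GL n" and p: "p \<in> par n \<sigma>" "p \<in> GL n"
  and c: "c ~= 0" "c *% b \<in> SG n"
 shows "\<exists>p'\<in>par n \<sigma> \<inter> SG n. normal n (b * g * p) = (c *% b) * normal n g * p'"
proof -
 define D where "D = diag1 n (1 / det g)"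
 define D' where "D' = diag1 n (1 / det (b * g * p))"
 define p' where "p' = ginv D * ((1 / c) *% (p * D'))"
 have bgp: "b * g * p \<in> GL n" using assms by simp
 have D: "D \<in> GL n" "D' \<in> GL n" using n GL_det[OF g] GL_det[OF bgp] by (auto simp: D_def D'_def)
 have par: "p' \<in> par n \<sigma>" using p D by (simp add: p'_def D_def D'_def par_smult)
 have C: "g \<in> sqm n" "b \<in> sqm n" "p \<in> sqm n" "D \<in> sqm n" "D' \<in> sqm n" "ginv D \<in> sqm n"
  using assms D by (auto simp: D_def D'_def)
 have "(c *% b) * (g * D) = c *% (b * (g * D))" using C by (intro mult_smult_assoc_mat[of _ n n _ n]) auto
 hence "(c *% b) * (g * D) * p' = c *% (b * (g * D) * p')"
  using C par_carrier[OF par] mult_smult_assoc_mat[of "b * (g * D)" n n p' n c] by simp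
 also have "b * (g * D) * p' = (1 / c) *% (b * (g * D) * (ginv D * (p * D')))"
  unfolding p'_def using C by (simp add: mult_smult_distrib[of _ n n _ n])
 also have "b * (g * D) * (ginv D * (p * D')) = b * g * p * D'" using C D by (simp add: mult_assoc_sq[of _ n])
 also have "c *% ((1 / c) *% (b * g * p * D')) = b * g * p * D'" by (rule eq_matI) (use c in auto)
 finally have eq: "normal n (b * g * p) = (c *% b) * normal n g * p'" by (simp add: normal_def D_def D'_def)
 have p'C: "p' \<in> sqm n" using par by simp
 have "det (normal n (b * g * p)) = det (c *% b) * det (normal n g) * det p'"
  unfolding eq using SL_carrier[OF c(2)] SL_carrier[OF normal_SL[OF n g]] p'C by (simp add: det_mult[of _ n])
 hence "det p' = 1" using SL_det[OF c(2)] SL_det[OF normal_SL[OF n g]] SL_det[OF normal_SL[OF n bgp]] by simp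
 thus ?thesis using par eq by (intro bexI[of _ p']) (auto intro: SL_I)
qed

lemma codim_dense:
 assumes "T closure_of Y = topspace T" shows "codim T Y = 0"
proof -
 have "k = 0" if "Z 0 = T closure_of Y" "\<forall>i\<le>k. irreducible_closedin T (Z i)" "\<forall>i<k. Z i \<subset> Z (Suc i)" for k and Z :: "nat => 'a set"
 proof (rule ccontr)
  assume "k ~= 0"
  hence "Z 0 \<subset> Z (Suc 0)" "irreducible_closedin T (Z (Suc 0))" using that(2,3) by auto
  thus False using that(1) assms closedin_subset[of T "Z (Suc 0)"] unfolding irreducible_closedin_def by blast
 qed
 hence "{enat k | k. \<exists>Z :: nat => 'a set. Z 0 = T closure_of Y &
      (\<forall>i\<le>k. irreducible_closedin T (Z i)) & (\<forall>i<k. Z i \<subset> Z (Suc i))} \<subseteq> {0}"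
  by (auto simp: zero_enat_def)
 hence "codim T Y \<le> Sup {0}" unfolding codim_def by (rule Sup_subset_mono)
 thus ?thesis by simp
qed

lemma codim_chain:
 assumes "irreducible_closedin T (T closure_of Y)" "irreducible_closedin T Z1" "irreducible_closedin T Z2"
  "T closure_of Y \<subset> Z1" "Z1 \<subset> Z2"
 shows "codim T Y \<ge> 2"
proof -
 define Z where "Z i = (if i = 0 then T closure_of Y else if i = 1 then Z1 else Z2)" for i :: nat
 have "enat 2 \<in> {enat k | k. \<exists>Z :: nat => 'a set. Z 0 = T closure_of Y &
      (\<forall>i\<le>k. irreducible_closedin T (Z i)) & (\<forall>i<k. Z i \<subset> Z (Suc i))}"
  using assms by (intro CollectI exI[of _ 2] conjI refl exI[of _ Z]) (auto simp: Z_def less_2_cases_iff)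
 hence "enat 2 \<le> codim T Y" unfolding codim_def by (rule Sup_upper)
 thus ?thesis by (simp add: numeral_eq_enat)
qed

locale flag_chart =
 fixes n :: nat and \<sigma> \<tau> :: "nat => nat" and T :: "'x topology" and \<Phi> :: "complex mat \<times> complex mat => 'x"
 assumes n: "n > 0" and quot: "quotient_map (SL2_topology n) T \<Phi>"
  and fib: "\<And>g h g' h'. g \<in> SG n ==> h \<in> SG n ==> g' \<in> SG n ==> h' \<in> SG n ==>
   \<Phi> (g, h) = \<Phi> (g', h') \<longleftrightarrow>
   (\<exists>p\<in>par n \<sigma> \<inter> SG n. \<exists>q\<in>par n \<tau> \<inter> SG n. g' = g * p & h' = h * q)"
begin

definition borel_orbit :: "complex mat => complex mat => 'x set" where
 "borel_orbit g h = {\<Phi> (b * g, b * h) | b. b \<in> low n \<inter> SG n}"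

lemma top_SL2 [simp]: "topspace (SL2_topology n) = SG n \<times> SG n" by (simp add: SL2_topology_def)

lemma image_chart: "topspace T = \<Phi> ` (SG n \<times> SG n)" using quot unfolding quotient_map_def top_SL2 by blast

lemma chart_topspace [simp]: "g \<in> SG n ==> h \<in> SG n ==> \<Phi> (g, h) \<in> topspace T" unfolding image_chart by blast

lemma curve_chart: "curve (SL2_topology n) F \<gamma> ==> curve T F (%t. \<Phi> (\<gamma> t))"
 using curve_map[of _ F \<gamma> T \<Phi>] quotient_imp_continuous_map[OF quot] by blast

lemma borel_orbit_subset: "g \<in> SG n ==> h \<in> SG n ==> borel_orbit g h \<subseteq> topspace T"
 unfolding borel_orbit_def by (auto intro!: chart_topspace SL_mult)

text \<open>Any point is joined to \<open>(g, h)\<close> by a rational curve, and cofinitely many points of this curve lie in the orbit. The normalization of determinants replaces the general by the special linear group.\<close>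

lemma dense_borel_orbit:
 assumes g: "g \<in> GL n" and h: "h \<in> GL n" and null: "null n \<sigma> \<tau> g h"
 shows "T closure_of (borel_orbit (normal n g) (normal n h)) = topspace T"
proof (rule antisym[OF closure_of_subset_topspace], rule subsetI)
 fix y assume "y \<in> topspace T"
 then obtain z1 z2 where z: "z1 \<in> SG n" "z2 \<in> SG n" "y = \<Phi> (z1, z2)" unfolding image_chart by blast
 let ?Y = "borel_orbit (normal n g) (normal n h)"
 define X where "X = seg g z1"
 define Y where "Y = seg h z2"
 have pm: "poly_mat n X" "poly_mat n Y" using g h z by (auto simp: X_def Y_def intro: poly_mat_seg)
 have e: "X 0 = g" "X 1 = z1" "Y 0 = h" "Y 1 = z2"
  using g h z seg_0[of g n n z1] seg_1[of g n n z1] seg_0[of h n n z2] seg_1[of h n n z2] by (auto simp: X_def Y_def)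
 define F where "F = {t. det (X t) = 0} \<union> {t. det (Y t) = 0}"
 have G: "X t \<in> GL n" "Y t \<in> GL n" if "t \<notin> F" for t
  using that poly_matD(1)[OF pm(1), of t] poly_matD(1)[OF pm(2), of t] by (auto simp: F_def intro: GLI)
 have finF: "finite F" using finite_det_seg[OF g, of z1] finite_det_seg[OF h, of z2] z by (auto simp: F_def X_def Y_def)
 have cur: "curve T F (%t. \<Phi> (normal n (X t), normal n (Y t)))" by (rule curve_chart, rule curve_SL2[OF finF])
   (use normal_SL[OF n] G in \<open>auto intro!: normal_ratl[OF pm(1)] normal_ratl[OF pm(2)] simp: F_def\<close>)
 define E where "E = {t. \<not> (\<exists>b p q. b \<in> low n & b \<in> GL n & p \<in> par n \<sigma> & p \<in> GL n & q \<in> par n \<tau> & q \<in> GL n &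
  X t = b * X 0 * p & Y t = b * Y 0 * q)}"
 have finE: "finite E" unfolding E_def by (rule orbit_along_curve[OF pm]) (use g h null in \<open>auto simp: e null_def\<close>)
 have "\<Phi> (normal n (X t), normal n (Y t)) \<in> T closure_of ?Y" if t: "t \<notin> E" "t \<notin> F" for t
 proof -
  obtain b p q where b: "b \<in> low n" "b \<in> GL n" "p \<in> par n \<sigma>" "p \<in> GL n" "q \<in> par n \<tau>" "q \<in> GL n"
    "X t = b * g * p" "Y t = b * h * q" using t(1) unfolding E_def e by blast
  \<comment> \<open>\<open>b\<close> may be rescaled, because scalars lie in the parabolic algebras\<close>
  obtain c where c: "c ^ n = 1 / det b" using nth_root_exists[of n "1 / det b"] n by auto
  have c0: "c ~= 0" using c n GL_det[OF b(2)] by (auto simp: power_0_left)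
  have cb: "c *% b \<in> SG n" using b c GL_det[OF b(2)] carrier_matD[OF low_carrier[OF b(1)]] by (intro SL_I) (auto simp: det_smult)
  have cbl: "c *% b \<in> low n" using b(1) unfolding low_def by (rule par_smult)
  obtain p' where p': "p' \<in> par n \<sigma> \<inter> SG n" "normal n (X t) = (c *% b) * normal n g * p'"
   using normalize_right[OF n g b(1,2,3,4) c0 cb] unfolding b(7) by blast
  obtain q' where q': "q' \<in> par n \<tau> \<inter> SG n" "normal n (Y t) = (c *% b) * normal n h * q'"
   using normalize_right[OF n h b(1,2,5,6) c0 cb] unfolding b(8) by blast
  have s: "(c *% b) * normal n g \<in> SG n" "(c *% b) * normal n h \<in> SG n"
   using cb normal_SL[OF n g] normal_SL[OF n h] SL_mult by blast+
  have s': "normal n (X t) \<in> SG n" "normal n (Y t) \<in> SG n" using normal_SL[OF n] G[OF t(2)] by auto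
  have "\<Phi> ((c *% b) * normal n g, (c *% b) * normal n h) = \<Phi> (normal n (X t), normal n (Y t))"
   unfolding fib[OF s s'] using p' q' by blast
  moreover have "\<Phi> ((c *% b) * normal n g, (c *% b) * normal n h) \<in> ?Y" unfolding borel_orbit_def using cb cbl by blast
  ultimately show ?thesis using closure_of_subset[OF borel_orbit_subset[OF normal_SL[OF n g] normal_SL[OF n h]]] by auto
 qed
 hence "\<Phi> (normal n (X 1), normal n (Y 1)) \<in> T closure_of ?Y"
  by (rule curve_closed[OF cur closedin_closure_of finE]) (use z in \<open>auto simp: F_def e\<close>)
 thus "y \<in> T closure_of ?Y" using z by (simp add: e normal_id)
qed

text \<open>The Borel orbits that meet the line through two points.\<close>

definition orbit_family :: "complex mat => complex mat => complex mat => complex mat => 'x set" where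
 "orbit_family g h g' h' = {\<Phi> (b * normal n (seg g g' t), b * normal n (seg h h' t)) | b t.
   b \<in> low n \<inter> SG n & det (seg g g' t) ~= 0 & det (seg h h' t) ~= 0}"

lemma seg_same: "A \<in> sqm n ==> seg A A t = A" by (rule eq_matI) (auto simp: seg_def algebra_simps)

lemma orbit_family_const:
 assumes "g \<in> SG n" "h \<in> SG n" shows "orbit_family g h g h = borel_orbit g h"
 unfolding orbit_family_def borel_orbit_def using assms by (simp add: seg_same normal_id)

lemma borel_orbit_family:
 assumes "g \<in> SG n" "h \<in> SG n" "g' \<in> SG n" "h' \<in> SG n"
 shows "borel_orbit g h \<subseteq> orbit_family g h g' h'"
proof
 fix y assume "y \<in> borel_orbit g h"
 then obtain b where "b \<in> low n \<inter> SG n" "y = \<Phi> (b * g, b * h)" unfolding borel_orbit_def by blast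
 moreover have "seg g g' 0 = g" "seg h h' 0 = h" using assms by (simp_all add: seg_0[of _ n n])
 ultimately show "y \<in> orbit_family g h g' h'" unfolding orbit_family_def
  using assms by (intro CollectI exI[of _ b] exI[of _ 0]) (simp add: normal_id)
qed

lemma point_orbit_family:
 assumes "g \<in> SG n" "h \<in> SG n" "g' \<in> SG n" "h' \<in> SG n"
 shows "\<Phi> (g', h') \<in> orbit_family g h g' h'"
proof -
 have "seg g g' 1 = g'" "seg h h' 1 = h'" using assms by (simp_all add: seg_1[of _ n n])
 thus ?thesis unfolding orbit_family_def using assms by (intro CollectI exI[of _ "idm n"] exI[of _ 1]) (simp add: normal_id)
qed

lemma linked_orbit_family:
 assumes "g \<in> SG n" "h \<in> SG n" "g' \<in> SG n" "h' \<in> SG n"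
 shows "linked T (orbit_family g h g' h')" unfolding linked_def
proof (intro conjI ballI)
 have C: "g \<in> sqm n" "h \<in> sqm n" "g' \<in> sqm n" "h' \<in> sqm n" using assms by auto
 have nSL: "normal n (seg g g' t) \<in> SG n" if "det (seg g g' t) ~= 0" for t using that C by (intro normal_SL[OF n] GLI) auto
 have nSL': "normal n (seg h h' t) \<in> SG n" if "det (seg h h' t) ~= 0" for t using that C by (intro normal_SL[OF n] GLI) auto
 show "orbit_family g h g' h' \<subseteq> topspace T"
  unfolding orbit_family_def using nSL nSL' by (auto intro!: chart_topspace SL_mult)
 fix y0 y1 assume "y0 \<in> orbit_family g h g' h'" "y1 \<in> orbit_family g h g' h'"
 then obtain b0 a0 b1 a1 where b: "b0 \<in> low n" "b0 \<in> SG n" "b1 \<in> low n" "b1 \<in> SG n"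
   and a: "det (seg g g' a0) ~= 0" "det (seg h h' a0) ~= 0" "det (seg g g' a1) ~= 0" "det (seg h h' a1) ~= 0"
   and y: "y0 = \<Phi> (b0 * normal n (seg g g' a0), b0 * normal n (seg h h' a0))"
     "y1 = \<Phi> (b1 * normal n (seg g g' a1), b1 * normal n (seg h h' a1))" unfolding orbit_family_def by blast
 define l where "l s = a0 + s * (a1 - a0)" for s
 define \<beta> where "\<beta> = seg b0 b1"
 define X where "X s = seg g g' (l s)" for s
 define Y where "Y s = seg h h' (l s)" for s
 have l: "is_poly l" "is_poly (%s. 1 - l s)" unfolding l_def by (auto intro!: is_poly_add is_poly_mult is_poly_diff)
 have pX: "poly_mat n X" "poly_mat n Y"
  using C l by (auto intro!: poly_matI is_poly_add is_poly_mult simp: X_def Y_def seg_index[of _ n n])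
 have p\<beta>: "poly_mat n \<beta>" using b by (auto simp: \<beta>_def intro: poly_mat_seg)
 have e: "\<beta> 0 = b0" "\<beta> 1 = b1" using b by (simp_all add: \<beta>_def seg_0[of _ n n] seg_1[of _ n n])
 have l01: "l 0 = a0" "l 1 = a1" by (simp_all add: l_def)
 define F where "F = {s. det (\<beta> s) = 0} \<union> ({s. det (X s) = 0} \<union> {s. det (Y s) = 0})"
 have finF: "finite F" unfolding F_def
  using is_poly_finite_zeros[OF poly_mat_det[OF p\<beta>], of 0] is_poly_finite_zeros[OF poly_mat_det[OF pX(1)], of 0]
   is_poly_finite_zeros[OF poly_mat_det[OF pX(2)], of 0] a b by (simp add: e X_def Y_def l01)
 have mem: "0 \<notin> F" "1 \<notin> F" using a b by (auto simp: F_def e X_def Y_def l01)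
 have \<beta>GL: "\<beta> s \<in> GL n" if "s \<notin> F" for s using that poly_matD(1)[OF p\<beta>, of s] by (auto simp: F_def intro: GLI)
 have \<beta>low: "normal n (\<beta> s) \<in> low n" for s using b unfolding normal_def \<beta>_def by (intro low_mult diag1_low seg_low)
 have \<beta>SL: "normal n (\<beta> s) \<in> SG n" if "s \<notin> F" for s using \<beta>GL[OF that] by (rule normal_SL[OF n])
 have XSL: "normal n (X s) \<in> SG n" "normal n (Y s) \<in> SG n" if "s \<notin> F" for s
  using that nSL nSL' by (auto simp: F_def X_def Y_def)
 have rat: "ratl F (%s. normal n (\<beta> s) $$ (i, j))" "ratl F (%s. normal n (X s) $$ (i, j))" "ratl F (%s. normal n (Y s) $$ (i, j))"
  if "i < n" "j < n" for i j
  using that by (auto intro!: normal_ratl[OF p\<beta>] normal_ratl[OF pX(1)] normal_ratl[OF pX(2)] simp: F_def)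
 have "curve (SL2_topology n) F (%s. (normal n (\<beta> s) * normal n (X s), normal n (\<beta> s) * normal n (Y s)))"
  by (rule curve_SL2[OF finF]) (use \<beta>SL XSL rat in \<open>auto intro!: mult_ratl SL_mult\<close>)
 hence "curve T F (%s. \<Phi> (normal n (\<beta> s) * normal n (X s), normal n (\<beta> s) * normal n (Y s)))" by (rule curve_chart)
 moreover have "\<Phi> (normal n (\<beta> s) * normal n (X s), normal n (\<beta> s) * normal n (Y s)) \<in> orbit_family g h g' h'" if s: "s \<notin> F" for s
  unfolding orbit_family_def
  by (rule CollectI, rule exI[of _ "normal n (\<beta> s)"], rule exI[of _ "l s"]) (use s \<beta>low[of s] \<beta>SL[OF s] in \<open>auto simp: X_def Y_def F_def\<close>)
 ultimately show "\<exists>F \<gamma>. curve T F \<gamma> & 0 \<notin> F & 1 \<notin> F & \<gamma> 0 = y0 & \<gamma> 1 = y1 & (\<forall>t. t \<notin> F --> \<gamma> t \<in> orbit_family g h g' h')"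
  using mem b y by (intro exI[of _ F] exI[of _ "%s. \<Phi> (normal n (\<beta> s) * normal n (X s), normal n (\<beta> s) * normal n (Y s))"])
   (simp add: e X_def Y_def l01 normal_id)
qed

text \<open>The polynomial that vanishes on the family is not invariant under the two parabolic subgroups, but the set of points all of whose translates are zeros is closed and saturated, so its image in the double flag variety is closed.\<close>

lemma orbit_family_not_dense:
 assumes w: "wild n \<sigma> \<tau>" and gh: "g \<in> SG n" "h \<in> SG n" "g' \<in> SG n" "h' \<in> SG n"
 shows "T closure_of (orbit_family g h g' h') ~= topspace T"
proof -
 define X where "X = seg g g'"
 define Y where "Y = seg h h'"
 have C: "g \<in> sqm n" "h \<in> sqm n" "g' \<in> sqm n" "h' \<in> sqm n" using gh by auto
 have deg: "deg_le 1 (%t. seg A B t $$ (i, j))" if "A \<in> sqm n" "B \<in> sqm n" "i < n" "j < n" for A B i j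
 proof -
  have "seg A B t $$ (i, j) = poly [:A $$ (i, j), B $$ (i, j) - A $$ (i, j):] t" for t
   using that by (simp add: seg_index[of _ n n] algebra_simps)
  thus ?thesis unfolding deg_le_def by (intro exI[of _ "[:A $$ (i, j), B $$ (i, j) - A $$ (i, j):]"]) auto
 qed
 have inv: "det (X 0) ~= 0" "det (Y 0) ~= 0" using gh C by (simp_all add: X_def Y_def seg_0[of _ n n])
 have XC: "X t \<in> sqm n" "Y t \<in> sqm n" for t using C by (simp_all add: X_def Y_def)
 have dX: "deg_le 1 (%t. X t $$ (i, j))" "deg_le 1 (%t. Y t $$ (i, j))" if "i < n" "j < n" for i j
  using deg[OF C(1,3) that] deg[OF C(2,4) that] by (simp_all only: X_def Y_def)
 have "\<exists>d c. (\<exists>x. grid_poly (coords n) d c x ~= 0) &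
  (\<forall>t. \<forall>b\<in>low n. \<forall>p\<in>par n \<sigma>. \<forall>q\<in>par n \<tau>. grid_poly (coords n) d c (pt (b * X t * p) (b * Y t * q)) = 0)"
  by (rule wild_family_not_dense[of n \<sigma> \<tau> X Y 0 0, OF w n XC(1) _ XC(2) _ inv]) (rule dX; assumption)+
 then obtain d c where ne: "\<exists>x. grid_poly (coords n) d c x ~= 0"
  and van: "\<And>t b p q. b \<in> low n ==> p \<in> par n \<sigma> ==> q \<in> par n \<tau> ==> grid_poly (coords n) d c (pt (b * X t * p) (b * Y t * q)) = 0"
  by (elim exE conjE) (rule that, blast+)
 define f where "f = grid_poly (coords n) d c"
 obtain A B c1 c2 where AB: "A \<in> SG n" "B \<in> SG n" "f (pt (c1 *% A) (c2 *% B)) ~= 0"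
  using ne grid_poly_SL_point[OF n] unfolding f_def by blast
 define Zf where "Zf = {(x, y). x \<in> SG n & y \<in> SG n &
  (\<forall>p\<in>par n \<sigma> \<inter> SG n. \<forall>q\<in>par n \<tau> \<inter> SG n. f (pt (c1 *% (x * p)) (c2 *% (y * q))) = 0)}"
 define \<Psi> where "\<Psi> p q = (%z. grid_poly (coords n) d c (%e. (case e of (s, i, j) =>
   if s then c1 * (\<Sum>l<n. fst z $$ (i, l) * p $$ (l, j)) else c2 * (\<Sum>l<n. snd z $$ (i, l) * q $$ (l, j)))))" for p q :: "complex mat"
 let ?C = "{%(g, h). g $$ (i, j) | i j. i < n & j < n} \<union> {%(g, h). h $$ (i, j) | i j. i < n & j < n} :: (complex mat \<times> complex mat => complex) set"
 have co: "(%z. fst z $$ (i, l)) \<in> poly_funs ?C" "(%z. snd z $$ (i, l)) \<in> poly_funs ?C" if "i < n" "l < n" for i l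
  using that by (auto intro!: poly_funs.coord simp: case_prod_unfold)
 have \<Psi>: "\<Psi> p q \<in> poly_funs ?C" for p q unfolding \<Psi>_def
 proof (rule poly_funs_grid_poly)
  fix e assume "e \<in> coords n"
  then obtain s i j where e: "e = (s, i, j)" "i < n" "j < n" by (auto simp: coords_def)
  have "(%z. c1 * (\<Sum>l<n. fst z $$ (i, l) * p $$ (l, j))) \<in> poly_funs ?C" "(%z. c2 * (\<Sum>l<n. snd z $$ (i, l) * q $$ (l, j))) \<in> poly_funs ?C"
   using co e by (auto intro!: poly_funs.mult[OF poly_funs.const] poly_funs_sum poly_funs.mult[OF _ poly_funs.const] simp del: mult_cancel_left)
  thus "(%z. case e of (s, i, j) => if s then c1 * (\<Sum>l<n. fst z $$ (i, l) * p $$ (l, j)) else c2 * (\<Sum>l<n. snd z $$ (i, l) * q $$ (l, j))) \<in> poly_funs ?C"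
   by (cases s) (simp_all add: e(1))
 qed
 have \<Psi>_eq: "f (pt (c1 *% (x * p)) (c2 *% (y * q))) = \<Psi> p q (x, y)"
  if "x \<in> sqm n" "y \<in> sqm n" "p \<in> sqm n" "q \<in> sqm n" for x y p q unfolding f_def \<Psi>_def
 proof (rule grid_poly_cong)
  fix e assume "e \<in> coords n"
  then obtain s i j where e: "e = (s, i, j)" "i < n" "j < n" by (auto simp: coords_def)
  show "pt (c1 *% (x * p)) (c2 *% (y * q)) e = (case e of (s, i, j) => if s then c1 * (\<Sum>l<n. fst (x, y) $$ (i, l) * p $$ (l, j)) else c2 * (\<Sum>l<n. snd (x, y) $$ (i, l) * q $$ (l, j)))"
   using e that by (cases s) (simp_all add: pt_def index_smult_sq[of _ n] mult_mat_sum[of _ n n _ n] del: index_mult_mat index_smult_mat)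
 qed
 have "Zf = {z \<in> SG n \<times> SG n. \<forall>f\<in>{\<Psi> p q | p q. p \<in> par n \<sigma> \<inter> SG n & q \<in> par n \<tau> \<inter> SG n}. f z = 0}"
  unfolding Zf_def using \<Psi>_eq by (auto; metis SL_carrier)
 hence closed: "closedin (SL2_topology n) Zf"
  unfolding SL2_topology_def closedin_zariski using \<Psi> by (intro exI[of _ "{\<Psi> p q | p q. p \<in> par n \<sigma> \<inter> SG n & q \<in> par n \<tau> \<inter> SG n}"]) auto
 have sat: "(x', y') \<in> Zf" if "(x, y) \<in> Zf" "x' \<in> SG n" "y' \<in> SG n" "\<Phi> (x, y) = \<Phi> (x', y')" for x y x' y'
 proof -
  have xy: "x \<in> SG n" "y \<in> SG n" using that(1) by (auto simp: Zf_def)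
  have "\<exists>p\<in>par n \<sigma> \<inter> SG n. \<exists>q\<in>par n \<tau> \<inter> SG n. x' = x * p & y' = y * q"
   using that(4) unfolding fib[OF xy that(2,3)] .
  then obtain p q where pq: "p \<in> par n \<sigma> \<inter> SG n" "q \<in> par n \<tau> \<inter> SG n" "x' = x * p" "y' = y * q"
   by blast
  have "f (pt (c1 *% (x * p * p')) (c2 *% (y * q * q'))) = 0"
   if "p' \<in> par n \<sigma> \<inter> SG n" "q' \<in> par n \<tau> \<inter> SG n" for p' q'
  proof -
   have "p * p' \<in> par n \<sigma> \<inter> SG n" "q * q' \<in> par n \<tau> \<inter> SG n" using that pq by auto
   hence "f (pt (c1 *% (x * (p * p'))) (c2 *% (y * (q * q')))) = 0" using \<open>(x, y) \<in> Zf\<close> unfolding Zf_def by blast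
   thus ?thesis using that pq xy by (simp add: mult_assoc_sq[of _ n])
  qed
  thus ?thesis unfolding Zf_def using that(2,3) by (auto simp: pq(3,4))
 qed
 have pre: "{z \<in> topspace (SL2_topology n). \<Phi> z \<in> \<Phi> ` Zf} = Zf" using sat unfolding top_SL2 by (auto simp: Zf_def)
 have "\<Phi> ` Zf \<subseteq> topspace T" unfolding image_chart by (auto simp: Zf_def)
 moreover have "\<forall>U. U \<subseteq> topspace T --> (closedin (SL2_topology n) {z \<in> topspace (SL2_topology n). \<Phi> z \<in> U} \<longleftrightarrow> closedin T U)"
  using quot unfolding quotient_map_closedin by (rule conjunct2)
 ultimately have "closedin (SL2_topology n) {z \<in> topspace (SL2_topology n). \<Phi> z \<in> \<Phi> ` Zf} \<longleftrightarrow> closedin T (\<Phi> ` Zf)"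
  by (elim allE impE)
 hence cl: "closedin T (\<Phi> ` Zf)" using closed unfolding pre by (rule iffD1)
 have "orbit_family g h g' h' \<subseteq> \<Phi> ` Zf"
 proof
  fix y assume "y \<in> orbit_family g h g' h'"
  then obtain b t where b: "b \<in> low n" "b \<in> SG n" "det (X t) ~= 0" "det (Y t) ~= 0"
   "y = \<Phi> (b * normal n (X t), b * normal n (Y t))" unfolding orbit_family_def X_def Y_def by blast
  have nS: "normal n (X t) \<in> SG n" "normal n (Y t) \<in> SG n" using b XC by (auto intro!: normal_SL[OF n] GLI)
  have "f (pt (c1 *% (b * normal n (X t) * p)) (c2 *% (b * normal n (Y t) * q))) = 0"
   if pq: "p \<in> par n \<sigma> \<inter> SG n" "q \<in> par n \<tau> \<inter> SG n" for p q
  proof -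
   have par: "c1 *% (diag1 n (1 / det (X t)) * p) \<in> par n \<sigma>" "c2 *% (diag1 n (1 / det (Y t)) * q) \<in> par n \<tau>"
    using pq by (auto intro!: par_smult)
   have "c *% (b * normal n M * p) = b * M * (c *% (diag1 n (1 / det M) * p))"
    if "M \<in> sqm n" "p \<in> sqm n" for M p c
    using that b by (simp add: normal_def mult_smult_distrib[of _ n n _ n] mult_assoc_sq[of _ n])
   thus ?thesis using van[OF b(1) par, of t] XC pq unfolding f_def by simp
  qed
  hence "(b * normal n (X t), b * normal n (Y t)) \<in> Zf" unfolding Zf_def using b nS by auto
  thus "y \<in> \<Phi> ` Zf" unfolding b(5) by blast
 qed
 hence sub: "T closure_of (orbit_family g h g' h') \<subseteq> \<Phi> ` Zf" using cl by (rule closure_of_minimal)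
 have "(A, B) \<notin> Zf"
 proof
  assume "(A, B) \<in> Zf"
  hence "f (pt (c1 *% (A * idm n)) (c2 *% (B * idm n))) = 0" unfolding Zf_def by fastforce
  thus False using AB by simp
 qed
 hence "\<Phi> (A, B) \<notin> \<Phi> ` Zf" using sat AB by auto
 thus ?thesis using sub chart_topspace[OF AB(1,2)] by blast
qed

text \<open>Between the closure of an orbit and the whole variety there is the closure of the orbits of the points of a line through a point outside the first closure; it is irreducible, and it is not everything.\<close>

theorem codim_wild:
 assumes w: "wild n \<sigma> \<tau>" and gh: "g \<in> SG n" "h \<in> SG n"
 shows "codim T (borel_orbit g h) \<ge> 2"
proof -
 have top: "irreducible_closedin T (topspace T)"
 proof -
  let ?S = "\<Phi> ` (SG n \<times> SG n)"
  have "linked T (topspace T)" unfolding linked_def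
  proof (intro conjI ballI subset_refl)
   fix y0 y1 assume "y0 \<in> topspace T" "y1 \<in> topspace T"
   then obtain a b a' b' where ab: "a \<in> SG n" "b \<in> SG n" "a' \<in> SG n" "b' \<in> SG n"
    "y0 = \<Phi> (a, b)" "y1 = \<Phi> (a', b')" unfolding image_chart by blast
   have "y0 \<in> orbit_family a b a' b'" using borel_orbit_family[OF ab(1-4)] ab
    unfolding borel_orbit_def by (auto intro!: subsetD[OF borel_orbit_family[OF ab(1-4)]] exI[of _ "idm n"] simp: borel_orbit_def)
   moreover have "y1 \<in> orbit_family a b a' b'" using point_orbit_family[OF ab(1-4)] ab by simp
   ultimately obtain F \<gamma> where "curve T F \<gamma>" "0 \<notin> F" "1 \<notin> F" "\<gamma> 0 = y0" "\<gamma> 1 = y1"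
    using linked_orbit_family[OF ab(1-4)] unfolding linked_def by blast
   thus "\<exists>F \<gamma>. curve T F \<gamma> & 0 \<notin> F & 1 \<notin> F & \<gamma> 0 = y0 & \<gamma> 1 = y1 & (\<forall>t. t \<notin> F --> \<gamma> t \<in> topspace T)"
    unfolding curve_def by blast
  qed
  moreover have "topspace T ~= {}" using chart_topspace[OF gh] by blast
  ultimately show ?thesis using linked_irreducible by fastforce
 qed
 have ne: "T closure_of (borel_orbit g h) ~= topspace T"
  using orbit_family_not_dense[OF w gh gh] by (simp add: orbit_family_const[OF gh])
 then obtain y where "y \<in> topspace T" "y \<notin> T closure_of (borel_orbit g h)"
  using closure_of_subset_topspace[of T "borel_orbit g h"] by blast
 then obtain g' h' where z: "g' \<in> SG n" "h' \<in> SG n" "\<Phi> (g', h') \<notin> T closure_of (borel_orbit g h)"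
  unfolding image_chart by blast
 let ?S = "orbit_family g h g' h'"
 have SS: "?S \<subseteq> T closure_of ?S" using linked_orbit_family[OF gh z(1,2)] by (intro closure_of_subset) (simp add: linked_def)
 have irr: "irreducible_closedin T (T closure_of ?S)"
  by (rule linked_irreducible[OF linked_orbit_family[OF gh z(1,2)]]) (use point_orbit_family[OF gh z(1,2)] in blast)
 have irr0: "irreducible_closedin T (T closure_of (borel_orbit g h))"
  using linked_irreducible[OF linked_orbit_family[OF gh gh]] point_orbit_family[OF gh gh] unfolding orbit_family_const[OF gh] by blast
 show ?thesis
 proof (rule codim_chain[OF irr0 irr top])
  show "T closure_of (borel_orbit g h) \<subset> T closure_of ?S"
   using closure_of_mono[OF borel_orbit_family[OF gh z(1,2)]] point_orbit_family[OF gh z(1,2)] SS z(3) by blast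
  show "T closure_of ?S \<subset> topspace T" using orbit_family_not_dense[OF w gh z(1,2)] closure_of_subset_topspace[of T ?S] by blast
 qed
qed

end

section \<open>Bruhat decomposition\<close>

definition monomial :: "nat => (nat => nat) => complex mat => bool" where
 "monomial n w m \<longleftrightarrow> m \<in> sqm n & w permutes {..<n} & (\<forall>r<n. \<forall>c<n. m $$ (r, c) ~= 0 \<longleftrightarrow> r = w c)"

lemma monomialD:
 assumes "monomial n w m"
 shows "m \<in> sqm n" "w permutes {..<n}" "\<And>r c. r < n ==> c < n ==> m $$ (r, c) ~= 0 \<longleftrightarrow> r = w c"
  "\<And>c. c < n ==> w c < n" using assms permutes_in_image[of w "{..<n}"] by (auto simp: monomial_def)

lemma mult_monomial_index:
 assumes m: "monomial n w m" and A: "A \<in> sqm n" and rc: "r < n" "c < n"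
 shows "(A * m) $$ (r, c) = A $$ (r, w c) * m $$ (w c, c)"
proof -
 have "(A * m) $$ (r, c) = (\<Sum>l<n. if l = w c then A $$ (r, l) * m $$ (l, c) else 0)"
  unfolding mult_mat_sum[OF A monomialD(1)[OF m] rc] using monomialD(3)[OF m _ rc(2)] by (intro sum.cong) auto
 thus ?thesis using monomialD(4)[OF m rc(2)] by simp
qed

lemma monomial_mult:
 assumes "monomial n w a" "monomial n w' b" shows "monomial n (w \<circ> w') (a * b)" unfolding monomial_def
proof (intro conjI allI impI)
 show "a * b \<in> sqm n" using monomialD(1)[OF assms(1)] monomialD(1)[OF assms(2)] by simp
 show "w \<circ> w' permutes {..<n}" using monomialD(2)[OF assms(2)] monomialD(2)[OF assms(1)] by (rule permutes_compose)
 fix r c assume rc: "r < n" "c < n"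
 have "b $$ (w' c, c) ~= 0" using monomialD(3)[OF assms(2) monomialD(4)[OF assms(2) rc(2)] rc(2)] by simp
 thus "(a * b) $$ (r, c) ~= 0 \<longleftrightarrow> r = (w \<circ> w') c"
  unfolding mult_monomial_index[OF assms(2) monomialD(1)[OF assms(1)] rc]
  using monomialD(3)[OF assms(1) rc(1) monomialD(4)[OF assms(2) rc(2)]] by simp
qed

lemma monomial_diag1:
 assumes "monomial n w a" "c ~= 0" shows "monomial n w (a * diag1 n c)"
 using assms unfolding monomial_def by (auto simp: mult_diag1_index simp del: index_mult_mat(1))

lemma monomial_perm:
 assumes "v permutes {..<n}" shows "monomial n v (perm_mat n (inv_into UNIV v))"
 unfolding monomial_def perm_mat_def using assms permutes_inv_eq[OF assms] by auto

lemma unipotent_SL: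
 assumes "A \<in> upr n" "\<And>i. i < n ==> A $$ (i, i) = 1" shows "A \<in> SG n"
proof (rule SL_I)
 show A: "A \<in> sqm n" using assms by simp
 have "upper_triangular A" using A parD[OF assms(1)] by auto
 hence "det A = prod_list (diag_mat A)" using A by (rule det_upper_triangular)
 also have "diag_mat A = replicate n 1" unfolding diag_mat_def using A assms(2) by (intro nth_equalityI) auto
 finally show "det A = 1" by simp
qed

lemma clear_above:
 fixes a :: "nat => complex"
 assumes "r < n"
 defines "U \<equiv> mat n n (%(i, j). if i = j then 1 else if j = r & i < r then a i else 0)"
 shows "U \<in> upr n" "U \<in> SG n"
  "M \<in> sqm n ==> i < n ==> j < n ==> (U * M) $$ (i, j) = M $$ (i, j) + (if i < r then a i * M $$ (r, j) else 0)"
proof -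
 show par: "U \<in> upr n" by (rule parI) (auto simp: U_def)
 show "U \<in> SG n" by (rule unipotent_SL[OF par]) (auto simp: U_def)
 assume M: "M \<in> sqm n" "i < n" "j < n"
 have "(U * M) $$ (i, j) = (\<Sum>l<n. (if l = i then M $$ (l, j) else 0) + (if l = r then (if i < r then a i * M $$ (l, j) else 0) else 0))"
  unfolding mult_mat_sum[OF par_carrier[OF par] M] using M by (intro sum.cong) (auto simp: U_def)
 thus "(U * M) $$ (i, j) = M $$ (i, j) + (if i < r then a i * M $$ (r, j) else 0)" using M(2) assms(1) by (simp add: sum.distrib)
qed

lemma clear_right:
 fixes a :: "nat => complex"
 assumes "k < n"
 defines "Q \<equiv> mat n n (%(i, j). if i = j then 1 else if i = k & k < j then a j else 0)"
 shows "Q \<in> upr n" "Q \<in> SG n"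
  "M \<in> sqm n ==> i < n ==> j < n ==> (M * Q) $$ (i, j) = M $$ (i, j) + (if k < j then M $$ (i, k) * a j else 0)"
proof -
 show par: "Q \<in> upr n" by (rule parI) (auto simp: Q_def)
 show "Q \<in> SG n" by (rule unipotent_SL[OF par]) (auto simp: Q_def)
 assume M: "M \<in> sqm n" "i < n" "j < n"
 have "(M * Q) $$ (i, j) = (\<Sum>l<n. (if l = j then M $$ (i, l) else 0) + (if l = k then (if k < j then M $$ (i, l) * a j else 0) else 0))"
  unfolding mult_mat_sum[OF M(1) par_carrier[OF par] M(2,3)] using M by (intro sum.cong) (auto simp: Q_def)
 thus "(M * Q) $$ (i, j) = M $$ (i, j) + (if k < j then M $$ (i, k) * a j else 0)" using M(3) assms(1) by (simp add: sum.distrib)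
qed

text \<open>The columns are treated from left to right: the lowest nonzero entry of a column is the pivot; the entries above it are cleared by upper triangular row operations and the entries to its right by upper triangular column operations.\<close>

theorem bruhat:
 assumes d: "d \<in> GL n"
 shows "\<exists>u q w. u \<in> upr n \<inter> SG n & q \<in> upr n \<inter> SG n & monomial n w (u * d * q)"
proof -
 have "\<exists>u q w. u \<in> upr n \<inter> SG n & q \<in> upr n \<inter> SG n &
   (\<forall>c<k. w c < n) & inj_on w {..<k} & (\<forall>c<k. \<forall>r<n. (u * d * q) $$ (r, c) ~= 0 \<longleftrightarrow> r = w c) &
   (\<forall>c<k. \<forall>j<n. (u * d * q) $$ (w c, j) ~= 0 \<longleftrightarrow> j = c)" if "k \<le> n" for k using that
 proof (induction k)
  case 0
  show ?case by (intro exI[of _ "idm n"] exI[of _ id]) auto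
 next
  case (Suc k)
  from Suc.IH[OF Suc_leD[OF Suc.prems]] obtain u q w where uq0: "u \<in> upr n \<inter> SG n" "q \<in> upr n \<inter> SG n"
   and w0: "\<forall>c<k. w c < n" "inj_on w {..<k}"
    "\<forall>c<k. \<forall>r<n. (u * d * q) $$ (r, c) ~= 0 \<longleftrightarrow> r = w c" "\<forall>c<k. \<forall>j<n. (u * d * q) $$ (w c, j) ~= 0 \<longleftrightarrow> j = c"
   by (elim exE conjE) (rule that, assumption+)
  have IH: "u \<in> upr n \<inter> SG n" "q \<in> upr n \<inter> SG n"
   "\<And>c. c < k ==> w c < n" "inj_on w {..<k}"
   "\<And>c r. c < k ==> r < n ==> (u * d * q) $$ (r, c) ~= 0 \<longleftrightarrow> r = w c"
   "\<And>c j. c < k ==> j < n ==> (u * d * q) $$ (w c, j) ~= 0 \<longleftrightarrow> j = c" using uq0 w0 by blast+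
  define M where "M = u * d * q"
  have k: "k < n" using Suc by simp
  have uq: "u \<in> GL n" "q \<in> GL n" using IH(1,2) by auto
  have M: "M \<in> GL n" using uq d unfolding M_def by (intro GL_mult)
  hence MC: "M \<in> sqm n" by (rule GL_carrier)
  have "\<exists>r<n. M $$ (r, k) ~= 0"
  proof (rule ccontr)
   assume "\<not> ?thesis"
   hence "(ginv M * M) $$ (k, k) = 0" unfolding mult_mat_sum[OF ginv_carrier[OF M] MC k k] by (intro sum.neutral) auto
   thus False using M k by simp
  qed
  hence ne: "{r. r < n & M $$ (r, k) ~= 0} ~= {}" by blast
  define r where "r = Max {r. r < n & M $$ (r, k) ~= 0}"
  have "r \<in> {r. r < n & M $$ (r, k) ~= 0}" unfolding r_def using ne by (intro Max_in) auto
  hence r: "r < n" "M $$ (r, k) ~= 0" by auto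
  have above: "M $$ (i, k) = 0" if "i < n" "r < i" for i
   using Max_ge[of "{r. r < n & M $$ (r, k) ~= 0}" i] that unfolding r_def[symmetric] by auto
  have col: "M $$ (i, c) ~= 0 \<longleftrightarrow> i = w c" if "c < k" "i < n" for i c using IH(5) that unfolding M_def by blast
  have row: "M $$ (w c, j) ~= 0 \<longleftrightarrow> j = c" if "c < k" "j < n" for j c using IH(6) that unfolding M_def by blast
  have rw: "r ~= w c" if "c < k" for c using row[OF that k] r(2) that by auto
  define a where "a i = - M $$ (i, k) / M $$ (r, k)" for i
  define b where "b j = - M $$ (r, j) / M $$ (r, k)" for j
  define U where "U = mat n n (%(i, j). if i = j then 1 else if j = r & i < r then a i else 0)"
  define Q where "Q = mat n n (%(i, j). if i = j then 1 else if i = k & k < j then b j else 0)"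
  note U = clear_above[OF r(1), where a = a, folded U_def]
  note Q = clear_right[OF k, where a = b, folded Q_def]
  have M1C: "U * M \<in> sqm n" using U(2) MC by simp
  have M1: "(U * M) $$ (i, j) = M $$ (i, j) + (if i < r then a i * M $$ (r, j) else 0)" if "i < n" "j < n" for i j
   using U(3)[OF MC that] .
  have M2: "(U * M * Q) $$ (i, j) = (U * M) $$ (i, j) + (if k < j then (U * M) $$ (i, k) * b j else 0)" if "i < n" "j < n" for i j
   using Q(3)[OF M1C that] .
  have M1k: "(U * M) $$ (i, k) = (if i = r then M $$ (r, k) else 0)" if "i < n" for i
   using M1[OF that k] above[OF that] r(2) by (cases i r rule: linorder_cases) (auto simp: a_def)
  have M2k: "(U * M * Q) $$ (i, k) = (if i = r then M $$ (r, k) else 0)" if "i < n" for i using M2[OF that k] M1k[OF that] by simp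
  have M2c: "(U * M * Q) $$ (i, c) = M $$ (i, c)" if "i < n" "c < k" for i c
   using M2[of i c] M1[of i c] that k col[OF that(2) r(1)] rw[OF that(2)] by auto
  have M2w: "(U * M * Q) $$ (w c, j) = M $$ (w c, j)" if "c < k" "j < n" for c j
  proof -
   have "a (w c) = 0" "w c ~= r" using row[OF that(1) k] that(1) rw[OF that(1)] by (auto simp: a_def)
   thus ?thesis using M2[OF IH(3)[OF that(1)] that(2)] M1[OF IH(3)[OF that(1)] that(2)] M1k[OF IH(3)[OF that(1)]] by simp
  qed
  have M2r: "(U * M * Q) $$ (r, j) ~= 0 \<longleftrightarrow> j = k" if "j < n" for j
  proof (cases j k rule: linorder_cases)
   case less
   thus ?thesis using M2c[OF r(1) less] col[OF less r(1)] rw[OF less] by auto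
  next
   case equal
   thus ?thesis using M2k[OF r(1)] r(2) by simp
  next
   case greater
   thus ?thesis using M2[OF r(1) that] M1[OF r(1) that] M1k[OF r(1)] r(2) by (simp add: b_def)
  qed
  have eq: "U * u * d * (q * Q) = U * M * Q" unfolding M_def using U(2) Q(2) uq d by (simp add: mult_assoc_sq[of _ n])
  define w' where "w' = w(k := r)"
  have "U * u \<in> upr n \<inter> SG n" "q * Q \<in> upr n \<inter> SG n" using IH(1,2) U(1,2) Q(1,2) by auto
  moreover have "\<forall>c<Suc k. w' c < n" using IH(3) r(1) by (auto simp: w'_def less_Suc_eq)
  moreover have "inj_on w' {..<Suc k}" using IH(4) rw unfolding w'_def lessThan_Suc by (auto simp: inj_on_def)
  moreover have "\<forall>c<Suc k. \<forall>i<n. (U * M * Q) $$ (i, c) ~= 0 \<longleftrightarrow> i = w' c"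
  proof (intro allI impI)
   fix c i assume "c < Suc k" "i < n"
   thus "(U * M * Q) $$ (i, c) ~= 0 \<longleftrightarrow> i = w' c"
    using M2k[of i] r(2) M2c[of i c] col[of c i] by (cases "c = k") (auto simp: w'_def)
  qed
  moreover have "\<forall>c<Suc k. \<forall>j<n. (U * M * Q) $$ (w' c, j) ~= 0 \<longleftrightarrow> j = c"
  proof (intro allI impI)
   fix c j assume "c < Suc k" "j < n"
   thus "(U * M * Q) $$ (w' c, j) ~= 0 \<longleftrightarrow> j = c"
    using M2r[of j] M2w[of c j] row[of c j] by (cases "c = k") (auto simp: w'_def)
  qed
  ultimately show ?case by (intro exI[of _ "U * u"] exI[of _ "q * Q"] exI[of _ w']) (simp only: eq)
 qed
 from this[OF order_refl] obtain u q w where *: "u \<in> upr n \<inter> SG n" "q \<in> upr n \<inter> SG n"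
   "\<And>c. c < n ==> w c < n" "inj_on w {..<n}" "\<And>c r. c < n ==> r < n ==> (u * d * q) $$ (r, c) ~= 0 \<longleftrightarrow> r = w c" by metis
 define w' where "w' c = (if c < n then w c else c)" for c
 have "w' permutes {..<n}" by (rule inj_imp_permutes) (use *(3,4) in \<open>auto simp: w'_def inj_on_def\<close>)
 hence "monomial n w' (u * d * q)" unfolding monomial_def using * d by (auto simp: w'_def)
 thus ?thesis using *(1,2) by blast
qed

section \<open>Parabolic subgroups containing the upper triangular matrices\<close>

lemma mult_addrow_index:
 assumes "m \<in> sqm n" "i < n" "j < n" "r < n" "c < n"
 shows "(m * addrow_mat n t i j) $$ (r, c) = m $$ (r, c) + (if c = j then t * m $$ (r, i) else (0 :: complex))"
proof -
 have "(m * addrow_mat n t i j) $$ (r, c) = (\<Sum>l<n. (if l = c then m $$ (r, l) else 0) + (if l = i then (if c = j then t * m $$ (r, l) else 0) else 0))"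
  unfolding mult_mat_sum[OF assms(1) addrow_mat_carrier assms(4,5)] using assms by (intro sum.cong) (auto simp: algebra_simps)
 thus ?thesis using assms by (simp add: sum.distrib)
qed

lemma par_upper: "mono_on {..<n} \<sigma> ==> A \<in> upr n ==> A \<in> par n \<sigma>"
proof (rule parI)
 assume *: "mono_on {..<n} \<sigma>" "A \<in> upr n"
 show "A \<in> sqm n" using * by simp
 fix i j assume "i < n" "j < n" "\<sigma> j < \<sigma> i"
 hence "j < i" using mono_onD[OF *(1), of i j] by (auto simp: not_le[symmetric])
 thus "A $$ (i, j) = 0" using parD[OF *(2)] \<open>i < n\<close> \<open>j < n\<close> by blast
qed

locale upper_overgroup =
 fixes n :: nat and P :: "complex mat set"
 assumes n: "n > 0" and sub: "P \<subseteq> SG n"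
  and P_mult: "\<And>x y. x \<in> P ==> y \<in> P ==> x * y \<in> P" and P_ginv: "\<And>x. x \<in> P ==> ginv x \<in> P"
  and upper: "upr n \<inter> SG n \<subseteq> P"
begin

lemma P_carrier: "x \<in> P ==> x \<in> sqm n" and P_GL: "x \<in> P ==> x \<in> GL n" using sub by auto

definition root :: "nat => nat => bool" where
 "root i j \<longleftrightarrow> i < n & j < n & i ~= j & (\<forall>t. addrow_mat n t i j \<in> P)"

lemma root_upper: "i < j ==> j < n ==> root i j"
proof -
 assume ij: "i < j" "j < n"
 have "addrow_mat n t i j \<in> P" for t
 proof (rule subsetD[OF upper], rule IntI)
  show "addrow_mat n t i j \<in> upr n" by (rule parI) (use ij in auto)
  show "addrow_mat n t i j \<in> SG n" using ij by (intro SL_I) (auto simp: det_addrow_mat)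
 qed
 thus ?thesis using ij by (simp add: root_def)
qed

lemma root_trans: assumes "root i j" "root j k" "i ~= k" shows "root i k"
proof -
 have ijk: "i < n" "j < n" "k < n" "i ~= j" "j ~= k" using assms by (auto simp: root_def)
 have x: "addrow_mat n t i j \<in> P" "addrow_mat n t j k \<in> P" for t using assms by (auto simp: root_def)
 have "addrow_mat n t i k \<in> P" for t
 proof -
  \<comment> \<open>a commutator of elementary matrices is elementary\<close>
  have "addrow 1 i j (addrow t j k (addrow (-1) i j (addrow (-t) j k (idm n)))) = addrow_mat n t i k"
   by (rule eq_matI) (use ijk assms(3) in auto)
  moreover have "addrow 1 i j (addrow t j k (addrow (-1) i j (addrow (-t) j k (idm n)))) =
    addrow_mat n 1 i j * (addrow_mat n t j k * (addrow_mat n (-1) i j * (addrow_mat n (-t) j k * idm n)))"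
   using ijk by (simp add: addrow_mat[of _ n n])
  moreover have "addrow_mat n (-t) j k * idm n \<in> P" using x by simp
  ultimately show ?thesis using x P_mult by metis
 qed
 thus ?thesis using ijk assms(3) by (simp add: root_def)
qed

lemma root_monomial:
 assumes m: "monomial n w m" "m \<in> P" and r: "root i j" shows "root (w i) (w j)"
proof -
 have ij: "i < n" "j < n" "i ~= j" using r by (auto simp: root_def)
 note mC = monomialD(1)[OF m(1)] and wn = monomialD(4)[OF m(1)] and nz = monomialD(3)[OF m(1)]
 have winj: "w a = w b \<longleftrightarrow> a = b" for a b using permutes_inj[OF monomialD(2)[OF m(1)]] by (simp add: inj_eq)
 have "addrow_mat n s (w i) (w j) \<in> P" for s
 proof -
  define t where "t = s * m $$ (w j, j) / m $$ (w i, i)"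
  have mi: "m $$ (w i, i) ~= 0" using nz[OF wn ij(1)] ij by simp
  have "m * addrow_mat n t i j = addrow s (w i) (w j) m"
  proof (rule eq_matI)
   fix r c assume "r < dim_row (addrow s (w i) (w j) m)" "c < dim_col (addrow s (w i) (w j) m)"
   hence rc: "r < n" "c < n" using mC by auto
   have "m $$ (w j, c) ~= 0 \<longleftrightarrow> c = j" using nz[OF wn[OF ij(2)] rc(2)] winj by auto
   moreover have "m $$ (r, i) ~= 0 \<longleftrightarrow> r = w i" using nz[OF rc(1) ij(1)] .
   ultimately show "(m * addrow_mat n t i j) $$ (r, c) = addrow s (w i) (w j) m $$ (r, c)"
    unfolding mult_addrow_index[OF mC ij(1,2) rc] using rc mC mi by (auto simp: t_def)
  qed (use mC in auto)
  also have "\<dots> = addrow_mat n s (w i) (w j) * m" using mC wn[OF ij(2)] by (rule addrow_mat)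
  finally have "m * addrow_mat n t i j * ginv m = addrow_mat n s (w i) (w j) * m * ginv m" by simp
  also have "\<dots> = addrow_mat n s (w i) (w j)" using P_GL[OF m(2)] by (simp add: mult_assoc_sq[of _ n])
  finally show ?thesis using P_mult[OF P_mult[OF m(2), of "addrow_mat n t i j"] P_ginv[OF m(2)]] r by (simp add: root_def)
 qed
 thus ?thesis using wn ij winj by (auto simp: root_def)
qed

text \<open>Commutators with elementary matrices above the diagonal move a position below the diagonal towards the diagonal.\<close>

lemma root_interval: assumes "root j i" "i \<le> a" "a < b" "b \<le> j" shows "root b a"
proof -
 have "j < n" using assms(1) by (simp add: root_def)
 hence "root b i" using root_trans[OF root_upper[of b j] assms(1)] assms by (cases "b = j") auto
 thus ?thesis using root_trans[OF _ root_upper[of i a], of b] assms \<open>j < n\<close> by (cases "a = i") auto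
qed

definition cuts :: "nat set" where
 "cuts = {k. 0 < k & k < n & \<not> root k (k - 1)}"

definition blk :: "nat => nat" where
 "blk i = card {k \<in> cuts. k \<le> i}"

lemma finite_cuts [simp]: "finite {k \<in> cuts. Q k}" by (rule finite_subset[of _ "{..<n}"]) (auto simp: cuts_def)

lemma blk_mono: "mono_on A blk" unfolding blk_def by (intro mono_onI card_mono) auto

lemma root_block:
 assumes "i < n" "j < n" "i ~= j" "blk i = blk j" shows "root i j"
proof (cases "i < j")
 case True
 thus ?thesis using root_upper assms by blast
next
 case False
 hence ji: "j < i" using assms(3) by simp
 have "{k \<in> cuts. k \<le> j} = {k \<in> cuts. k \<le> i}"
  by (rule card_subset_eq) (use ji assms(4) in \<open>auto simp: blk_def\<close>)
 hence nc: "k \<notin> cuts" if "j < k" "k \<le> i" for k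
 proof -
  have "k \<notin> {k \<in> cuts. k \<le> j}" using that by simp
  hence "k \<notin> {k \<in> cuts. k \<le> i}" using \<open>{k \<in> cuts. k \<le> j} = {k \<in> cuts. k \<le> i}\<close> by simp
  thus ?thesis using that by simp
 qed
 have "root m j" if "j < m" "m \<le> i" for m using that
 proof (induction m)
  case (Suc m)
  have "root (Suc m) m" using nc[of "Suc m"] Suc.prems assms(1) by (auto simp: cuts_def)
  thus ?case using root_trans[of "Suc m" m j] Suc by (cases "j = m") auto
 qed simp
 thus ?thesis using ji by blast
qed

text \<open>If a monomial matrix of the group moved an index across a cut, it would move another index back, and would turn an upper triangular root subgroup into a lower triangular one that crosses the cut.\<close>

lemma monomial_blk:
 assumes m: "monomial n w m" "m \<in> P" and a: "a < n" shows "blk (w a) = blk a"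
proof -
 note wp = monomialD(2)[OF m(1)]
 have inj: "inj w" using wp by (rule permutes_inj)
 have iff: "w a < k \<longleftrightarrow> a < k" if k: "k \<in> cuts" for k
 proof -
  have kn: "0 < k" "k < n" "\<not> root k (k - 1)" using k by (auto simp: cuts_def)
  have "w ` {..<k} \<subseteq> {..<k}"
  proof (rule ccontr)
   assume "\<not> ?thesis"
   then obtain x where x: "x < k" "k \<le> w x" by force
   have "\<not> w ` {k..<n} \<subseteq> {k..<n}"
   proof
    assume "w ` {k..<n} \<subseteq> {k..<n}"
    hence "w ` {k..<n} = {k..<n}" using inj by (intro endo_inj_surj) (auto intro: inj_on_subset)
    moreover have "w x \<in> {k..<n}" using x kn monomialD(4)[OF m(1), of x] by simp
    ultimately have "w x \<in> w ` {k..<n}" by blast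
    hence "x \<in> {k..<n}" unfolding inj_image_mem_iff[OF inj] .
    thus False using x(1) by simp
   qed
   then obtain b where b: "k \<le> b" "b < n" "w b < k" using monomialD(4)[OF m(1)] by (auto simp: image_subset_iff not_le)
   have "root (w x) (w b)" using root_monomial[OF m root_upper[of x b]] x b by simp
   hence "root k (k - 1)" by (rule root_interval) (use x b kn in auto)
   thus False using kn by simp
  qed
  hence "w ` {..<k} = {..<k}" using inj by (intro endo_inj_surj) (auto intro: inj_on_subset)
  thus ?thesis using inj_image_mem_iff[OF inj, of a "{..<k}"] by auto
 qed
 hence "{k \<in> cuts. k \<le> w a} = {k \<in> cuts. k \<le> a}" by (auto simp: not_less[symmetric])
 thus ?thesis by (simp add: blk_def)
qed

lemma upper_blk: "A \<in> upr n ==> A \<in> par n blk" by (rule par_upper[OF blk_mono])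

lemma P_subset: assumes p: "p \<in> P" shows "p \<in> par n blk"
proof -
 obtain u q w where uq: "u \<in> upr n \<inter> SG n" "q \<in> upr n \<inter> SG n" "monomial n w (u * p * q)"
  using bruhat[OF P_GL[OF p]] by blast
 have m: "u * p * q \<in> P" using uq p upper P_mult by (meson subsetD)
 have mpar: "u * p * q \<in> par n blk"
 proof (rule parI)
  show "u * p * q \<in> sqm n" using m by (rule P_carrier)
  fix i j assume ij: "i < n" "j < n" "blk j < blk i"
  thus "(u * p * q) $$ (i, j) = 0" using monomial_blk[OF uq(3) m ij(2)] monomialD(3)[OF uq(3) ij(1,2)] by auto
 qed
 have G: "u \<in> GL n" "q \<in> GL n" using uq by auto
 have eq: "p = ginv u * (u * p * q) * ginv q" using G P_carrier[OF p] by (simp add: mult_assoc_sq[of _ n])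
 have up: "ginv u \<in> par n blk" "ginv q \<in> par n blk" using uq G upper_blk by auto
 show ?thesis by (subst eq) (rule par_mult[OF par_mult[OF up(1) mpar] up(2)])
qed

text \<open>Within a block all root subgroups are available, hence the monomial matrices of transpositions.\<close>

lemma monomial_in_P:
 assumes "monomial n w m" "m \<in> SG n" "\<And>c. c < n ==> blk (w c) = blk c"
 shows "m \<in> P" using assms
proof (induction "card {c. w c ~= c}" arbitrary: w m rule: less_induct)
 case less
 note mC = monomialD(1)[OF less(2)] and wn = monomialD(4)[OF less(2)] and nz = monomialD(3)[OF less(2)] and wp = monomialD(2)[OF less(2)]
 show ?case
 proof (cases "\<exists>c. w c ~= c")
  case False
  have "m \<in> upr n"
  proof (rule parI[OF mC])
   fix i j assume ij: "i < n" "j < n" "j < i"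
   hence "i ~= w j" using False by auto
   thus "m $$ (i, j) = 0" using nz[OF ij(1,2)] by blast
  qed
  thus ?thesis using upper less(3) by blast
 next
  case True
  then obtain c where c: "w c ~= c" by blast
  hence cn: "c < n" using wp unfolding permutes_def by auto
  define i where "i = w c"
  have i: "i < n" "i ~= c" "blk i = blk c" using wn[OF cn] c less(4)[OF cn] by (auto simp: i_def)
  have x: "addrow_mat n t i c \<in> P" "addrow_mat n t c i \<in> P" for t
   using root_block[OF i(1) cn i(2,3)] root_block[OF cn i(1)] i(2,3) by (auto simp: root_def)
  \<comment> \<open>up to a sign the permutation matrix of the transposition of \<open>i\<close> and \<open>c\<close>\<close>
  define N where "N = (addrow_mat n 1 i c :: complex mat) * (addrow_mat n (- 1) c i * addrow_mat n 1 i c)"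
  have N: "N \<in> P" unfolding N_def using x P_mult by blast
  define w' where "w' = Transposition.transpose i c \<circ> w"
  have fin: "finite {c. w c ~= c}" by (rule finite_subset[of _ "{..<n}"]) (use wp in \<open>auto simp: permutes_def\<close>)
  have Nm: "N * m = addrow 1 i c (addrow (- 1) c i (addrow 1 i c m))"
   unfolding N_def using mC i cn by (simp add: addrow_mat[of _ n n] mult_assoc_sq[of _ n])
  have ent: "(N * m) $$ (r, s) = (if r = i then m $$ (c, s) else if r = c then - m $$ (i, s) else m $$ (r, s))" if "r < n" "s < n" for r s
   unfolding Nm using that mC i cn by simp
  have tr: "Transposition.transpose i c permutes {..<n}" using i cn by (intro permutes_swap_id) auto
  have "monomial n w' (N * m)" unfolding monomial_def
  proof (intro conjI allI impI)
   show "N * m \<in> sqm n" using P_carrier[OF N] mC by simp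
   show "w' permutes {..<n}" unfolding w'_def using wp tr by (rule permutes_compose)
   fix r s assume rs: "r < n" "s < n"
   show "(N * m) $$ (r, s) ~= 0 \<longleftrightarrow> r = w' s"
    unfolding ent[OF rs] using nz[OF rs] nz[OF i(1) rs(2)] nz[OF cn rs(2)] i(2) by (auto simp: w'_def Transposition.transpose_def)
  qed
  moreover have "N * m \<in> SG n" using N sub less(3) by (auto intro: SL_mult)
  moreover have "blk (w' s) = blk s" if "s < n" for s
  proof -
   have "blk (Transposition.transpose i c x) = blk x" for x using i(3) by (simp add: Transposition.transpose_def)
   thus ?thesis using less(4)[OF that] by (simp add: w'_def)
  qed
  moreover have "{c. w' c ~= c} \<subset> {c. w c ~= c}"
  proof
   show "{c. w' c ~= c} \<subseteq> {c. w c ~= c}"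
   proof (rule subsetI, rule CollectI, rule notI)
    fix x assume x: "x \<in> {c. w' c ~= c}" "w x = x"
    have "x ~= i" using x(2) permutes_inj[OF wp] c by (auto simp: i_def inj_eq)
    moreover have "x ~= c" using x(2) c by auto
    ultimately show False using x by (simp add: w'_def Transposition.transpose_def)
   qed
   have "w' c = c" by (simp add: w'_def i_def)
   thus "{c. w' c ~= c} ~= {c. w c ~= c}" using c by blast
  qed
  ultimately have "N * m \<in> P" using less(1)[of w' "N * m"] psubset_card_mono[OF fin] by blast
  hence "ginv N * (N * m) \<in> P" using P_mult P_ginv[OF N] by blast
  thus ?thesis using P_GL[OF N] mC by simp
 qed
qed

text \<open>The group and the pattern group contain the same monomial matrices, hence are equal by the Bruhat decomposition.\<close>

theorem P_eq: "P = par n blk \<inter> SG n"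
proof (intro Set.set_eqI iffI)
 fix d assume d: "d \<in> par n blk \<inter> SG n"
 obtain u q w where uq: "u \<in> upr n \<inter> SG n" "q \<in> upr n \<inter> SG n" "monomial n w (u * d * q)"
  using bruhat[of d n] d by auto
 have mpar: "u * d * q \<in> par n blk" by (rule par_mult, rule par_mult) (use uq d in \<open>auto intro: upper_blk\<close>)
 have mSL: "u * d * q \<in> SG n" using uq d by auto
 note wp = monomialD(2)[OF uq(3)] and wn = monomialD(4)[OF uq(3)]
 have le: "blk (w c) \<le> blk c" if "c < n" for c
  using monomialD(3)[OF uq(3) wn[OF that] that] parD[OF mpar wn[OF that] that] by (auto simp: not_less[symmetric])
 have eq: "blk (w c) = blk c" if "c < n" for c
 proof (rule ccontr)
  assume "blk (w c) ~= blk c"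
  hence "blk (w c) < blk c" using le[OF that] by linarith
  hence "(\<Sum>c<n. blk (w c)) < (\<Sum>c<n. blk c)" using le that by (intro sum_strict_mono_ex1) auto
  moreover have "(\<Sum>c<n. blk c) = (\<Sum>c<n. blk (w c))" using sum.permute[OF wp, of blk] by (simp add: o_def)
  ultimately show False by simp
 qed
 have "u * d * q \<in> P" using uq(3) mSL eq by (rule monomial_in_P)
 hence "ginv u * (u * d * q) * ginv q \<in> P" using uq(1,2) upper P_ginv P_mult by (meson subsetD)
 moreover have "ginv u * (u * d * q) * ginv q = d"
 proof -
  have "u \<in> GL n" "q \<in> GL n" using uq by auto
  thus ?thesis using d by (simp add: mult_assoc_sq[of _ n])
 qed
 ultimately show "d \<in> P" by simp
qed (use P_subset sub in blast)

end

lemma block_of_steps: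
 assumes "n > 0" "f 0 = 0" "\<And>i. Suc i < n ==> f (Suc i) = f i \<or> f (Suc i) = Suc (f i)"
 shows "\<exists>p. (\<forall>x\<in>set p. x > 0) & sum_list p = n & (\<forall>i<n. block p i = f i) & length p = Suc (f (n - 1))"
 using assms(1,3)
proof (induction n rule: nat_induct_non_zero)
 case 1
 show ?case by (rule exI[of _ "[1]"]) (simp add: assms(2))
next
 case (Suc n)
 obtain p where p: "\<forall>x\<in>set p. x > 0" "sum_list p = n" "\<forall>i<n. block p i = f i" "length p = Suc (f (n - 1))"
  using Suc.IH Suc.prems by (meson less_SucI)
 show ?case
 proof (cases "f n = f (n - 1)")
  case True
  obtain u a where ua: "p = u @ [a]" using p(4) by (cases p rule: rev_cases) auto
  have "block (u @ [Suc a]) i = f i" if "i < Suc n" for i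
  proof (cases "i = n")
   case True
   thus ?thesis using p(2,4) ua \<open>f n = f (n - 1)\<close> by (simp add: block_append)
  next
   case False
   hence "i < n" using that by simp
   hence "block (u @ [a]) i = f i" using p(3) ua by blast
   thus ?thesis using p(2) ua \<open>i < n\<close> by (auto simp: block_append split: if_splits)
  qed
  thus ?thesis using p ua True by (intro exI[of _ "u @ [Suc a]"]) auto
 next
  case False
  hence fn: "f n = Suc (f (n - 1))" using Suc.prems[of "n - 1"] Suc.hyps by auto
  have "block (p @ [1]) i = f i" if "i < Suc n" for i using p(2,3,4) fn that by (cases "i = n") (auto simp: block_append)
  thus ?thesis using p fn by (intro exI[of _ "p @ [1]"]) auto
 qed
qed

context upper_overgroup
begin

theorem P_block: "\<exists>p. (\<forall>x\<in>set p. x > 0) & sum_list p = n & P = par n (block p) \<inter> SG n"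
proof -
 have "blk 0 = 0" by (auto simp: blk_def cuts_def)
 moreover have "blk (Suc i) = blk i \<or> blk (Suc i) = Suc (blk i)" for i
 proof (cases "Suc i \<in> cuts")
  case True
  hence "{k \<in> cuts. k \<le> Suc i} = insert (Suc i) {k \<in> cuts. k \<le> i}" by (auto simp: le_Suc_eq)
  thus ?thesis by (simp add: blk_def)
 next
  case False
  hence "{k \<in> cuts. k \<le> Suc i} = {k \<in> cuts. k \<le> i}" by (auto simp: le_Suc_eq)
  thus ?thesis by (simp add: blk_def)
 qed
 ultimately obtain p where p: "\<forall>x\<in>set p. x > 0" "sum_list p = n" "\<forall>i<n. block p i = blk i"
  using block_of_steps[OF n, of blk] by blast
 have "par n (block p) = par n blk" unfolding par_def using p(3) by auto
 thus ?thesis using p P_eq by (intro exI[of _ p]) auto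
qed

end

section \<open>Counting double cosets\<close>

definition position_type :: "nat => (nat => nat) => (nat => nat) => (nat => nat) => (nat \<times> nat) multiset" where
 "position_type n \<sigma> \<tau> w = image_mset (%c. (\<sigma> (w c), \<tau> c)) (mset_set {..<n})"

text \<open>If the positions have the same types with multiplicities, then a permutation of the columns inside the blocks of \<open>\<tau>\<close> turns one monomial pattern into the other up to a permutation inside the blocks of \<open>\<sigma>\<close>.\<close>

lemma same_double_coset:
 assumes n: "n > 0" and d: "monomial n w d" "d \<in> SG n" and d': "monomial n w' d'" "d' \<in> SG n"
  and eq: "position_type n \<sigma> \<tau> w = position_type n \<sigma> \<tau> w'"
 shows "\<exists>p\<in>par n \<sigma> \<inter> SG n. \<exists>q\<in>par n \<tau> \<inter> SG n. d' = p * d * q"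
proof -
 obtain v where v: "v permutes {..<n}" "\<forall>c\<in>{..<n}. (\<sigma> (w c), \<tau> c) = (\<sigma> (w' (v c)), \<tau> (v c))"
  using eq unfolding position_type_def by (rule image_mset_eq_implies_permutes[rotated]) auto
 define q where "q = normal n (perm_mat n (inv_into UNIV v))"
 have PG: "perm_mat n (inv_into UNIV v) \<in> GL n" using v(1) by (intro perm_mat_GL permutes_inv)
 have q: "monomial n v q" unfolding q_def normal_def using v(1) GL_det[OF PG] by (intro monomial_diag1 monomial_perm) auto
 have qSL: "q \<in> SG n" unfolding q_def by (rule normal_SL[OF n PG])
 have q\<tau>: "q \<in> par n \<tau>"
 proof (rule parI)
  fix i j assume ij: "i < n" "j < n" "\<tau> j < \<tau> i"
  hence "i ~= v j" using v(2) by auto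
  thus "q $$ (i, j) = 0" using monomialD(3)[OF q ij(1,2)] by blast
 qed (use qSL in auto)
 define p where "p = d' * q * ginv d"
 have pSL: "p \<in> SG n" unfolding p_def using d d' qSL by (intro SL_mult SL_ginv)
 have G: "d \<in> GL n" "q \<in> GL n" using d(2) qSL by auto
 have pd: "p * d = d' * q" unfolding p_def using G SL_carrier[OF d'(2)] by (simp add: mult_assoc_sq[of _ n])
 have p\<sigma>: "p \<in> par n \<sigma>"
 proof (rule parI)
  fix i j assume ij: "i < n" "j < n" "\<sigma> j < \<sigma> i"
  note wp = monomialD(2)[OF d(1)]
  define c where "c = inv_into UNIV w j"
  have c: "w c = j" "c < n" using permutes_inverses(1)[OF wp] permutes_in_image[OF permutes_inv[OF wp], of j] ij by (auto simp: c_def)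
  have "(p * d) $$ (i, c) = p $$ (i, j) * d $$ (j, c)" using mult_monomial_index[OF d(1) SL_carrier[OF pSL] ij(1) c(2)] c by simp
  moreover have "(d' * q) $$ (i, c) = 0"
  proof -
   have "i ~= (w' \<circ> v) c" using v(2) c ij by auto
   thus ?thesis using monomialD(3)[OF monomial_mult[OF d'(1) q] ij(1) c(2)] by blast
  qed
  moreover have "d $$ (j, c) ~= 0" using monomialD(3)[OF d(1) ij(2) c(2)] c by simp
  ultimately show "p $$ (i, j) = 0" using pd by simp
 qed (use pSL in auto)
 have "d' = p * d * ginv q" unfolding pd using G SL_carrier[OF d'(2)] by (simp add: mult_assoc_sq[of _ n])
 thus ?thesis using p\<sigma> pSL q\<tau> qSL by (intro bexI[of _ p] bexI[of _ "ginv q"]) auto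
qed

context flag_chart
begin

definition group_orbit :: "complex mat => complex mat => 'x set" where
 "group_orbit g h = {\<Phi> (a * g, a * h) | a. a \<in> SG n}"

lemma group_orbit_move:
 assumes g: "g \<in> SG n" "h \<in> SG n" and s: "s \<in> SG n"
  and p: "p \<in> par n \<sigma> \<inter> SG n" and q: "q \<in> par n \<tau> \<inter> SG n"
 shows "group_orbit (s * g * p) (s * h * q) = group_orbit g h"
proof -
 have *: "\<Phi> (a * (s * g * p), a * (s * h * q)) = \<Phi> ((a * s) * g, (a * s) * h)" if a: "a \<in> SG n" for a
 proof -
  have e: "a * (s * g * p) = a * s * g * p" "a * (s * h * q) = a * s * h * q" using a g s p q by (auto simp: mult_assoc_sq[of _ n])
  have S: "a * s * g \<in> SG n" "a * s * h \<in> SG n" "a * s * g * p \<in> SG n" "a * s * h * q \<in> SG n" using a g s p q by auto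
  have "\<Phi> (a * s * g, a * s * h) = \<Phi> (a * s * g * p, a * s * h * q)" unfolding fib[OF S] using p q by blast
  thus ?thesis unfolding e by simp
 qed
 show ?thesis
 proof (rule antisym; rule subsetI)
  fix y assume "y \<in> group_orbit (s * g * p) (s * h * q)"
  then obtain a where a: "a \<in> SG n" "y = \<Phi> (a * (s * g * p), a * (s * h * q))" unfolding group_orbit_def by blast
  show "y \<in> group_orbit g h" unfolding group_orbit_def a(2) *[OF a(1)] using SL_mult[OF a(1) s] by blast
 next
  fix y assume "y \<in> group_orbit g h"
  then obtain a where a: "a \<in> SG n" "y = \<Phi> (a * g, a * h)" unfolding group_orbit_def by blast
  have as: "a * ginv s \<in> SG n" using a s by (intro SL_mult SL_ginv)
  have "a * ginv s * s = a" using SL_carrier[OF a(1)] SL_GL[OF s] by (simp add: mult_assoc_sq[of _ n])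
  hence "y = \<Phi> (a * ginv s * (s * g * p), a * ginv s * (s * h * q))" using *[OF as] a by simp
  thus "y \<in> group_orbit (s * g * p) (s * h * q)" unfolding group_orbit_def using as by blast
 qed
qed

lemma group_orbit_monomial:
 assumes mono: "mono_on {..<n} \<sigma>" "mono_on {..<n} \<tau>" and g: "g \<in> SG n" "h \<in> SG n"
 shows "\<exists>w m. monomial n w m & m \<in> SG n & group_orbit g h = group_orbit (idm n) m"
proof -
 have gh: "ginv g * h \<in> SG n" using g by (intro SL_mult SL_ginv)
 then obtain u q w where uq: "u \<in> upr n \<inter> SG n" "q \<in> upr n \<inter> SG n"
   "monomial n w (u * (ginv g * h) * q)" using bruhat[OF SL_GL[OF gh]] by blast
 have S: "u * ginv g \<in> SG n" "ginv u \<in> par n \<sigma> \<inter> SG n" "q \<in> par n \<tau> \<inter> SG n"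
  using uq g par_upper[OF mono(1)] par_upper[OF mono(2)] by auto
 have G: "g \<in> GL n" "u \<in> GL n" "h \<in> sqm n" "q \<in> sqm n" using g uq by auto
 have "u * ginv g * g * ginv u = idm n" "u * ginv g * h * q = u * (ginv g * h) * q" using G by (simp_all add: mult_assoc_sq[of _ n])
 hence "group_orbit g h = group_orbit (idm n) (u * (ginv g * h) * q)" using group_orbit_move[OF g S] by simp
 moreover have "u * (ginv g * h) * q \<in> SG n" using uq gh by auto
 ultimately show ?thesis using uq(3) by blast
qed

text \<open>Every orbit of the group contains a point \<open>\<Phi> (1, m)\<close> with \<open>m\<close> monomial, and is determined by the type of \<open>m\<close>.\<close>

theorem card_group_orbits:
 assumes mono: "mono_on {..<n} \<sigma>" "mono_on {..<n} \<tau>"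
  and N: "finite N" "card N \<le> k" "\<And>w. w permutes {..<n} ==> position_type n \<sigma> \<tau> w \<in> N"
  and O: "\<And>Y. Y \<in> \<O> ==> \<exists>g\<in>SG n. \<exists>h\<in>SG n. Y = group_orbit g h"
 shows "finite \<O> & card \<O> \<le> k"
proof -
 have "\<exists>w m. monomial n w m & m \<in> SG n & Y = group_orbit (idm n) m" if "Y \<in> \<O>" for Y
  using O[OF that] group_orbit_monomial[OF mono] by blast
 then obtain W M where WM: "\<And>Y. Y \<in> \<O> ==> monomial n (W Y) (M Y) & M Y \<in> SG n & Y = group_orbit (idm n) (M Y)" by metis
 have "inj_on (%Y. position_type n \<sigma> \<tau> (W Y)) \<O>"
 proof (rule inj_onI)
  fix Y Y' assume Y: "Y \<in> \<O>" "Y' \<in> \<O>" "position_type n \<sigma> \<tau> (W Y) = position_type n \<sigma> \<tau> (W Y')"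
  note 1 = WM[OF Y(1)] and 2 = WM[OF Y(2)]
  obtain p q where pq: "p \<in> par n \<sigma> \<inter> SG n" "q \<in> par n \<tau> \<inter> SG n" "M Y' = p * M Y * q"
   using same_double_coset[OF n _ _ _ _ Y(3)] 1 2 by blast
  have "group_orbit (p * idm n * ginv p) (p * M Y * q) = group_orbit (idm n) (M Y)" using 1 pq by (intro group_orbit_move) auto
  moreover have "p \<in> GL n" using pq by auto
  hence "p * idm n * ginv p = idm n" by simp
  ultimately show "Y = Y'" using 1 2 pq(3) by simp
 qed
 moreover have "(%Y. position_type n \<sigma> \<tau> (W Y)) ` \<O> \<subseteq> N" using WM N(3) monomialD(2) by blast
 ultimately show ?thesis using N(1,2) card_inj_on_le[of _ \<O> N] inj_on_finite[of _ \<O> N] by fastforce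
qed

end

section \<open>Contingency tables\<close>

definition margin :: "nat list => nat multiset" where
 "margin p = image_mset (block p) (mset_set {..<sum_list p})"

definition tables :: "nat list => nat list => (nat \<times> nat) multiset set" where
 "tables p q = {N. image_mset fst N = margin p & image_mset snd N = margin q}"

lemma position_type_tables:
 assumes "sum_list p = n" "sum_list q = n" "w permutes {..<n}"
 shows "position_type n (block p) (block q) w \<in> tables p q"
proof -
 have "image_mset (%c. block p (w c)) (mset_set {..<n}) = image_mset (block p) (image_mset w (mset_set {..<n}))"
  by (simp add: multiset.map_comp o_def)
 also have "image_mset w (mset_set {..<n}) = mset_set {..<n}"
  using image_mset_mset_set[of w "{..<n}"] permutes_inj_on[OF assms(3)] permutes_image[OF assms(3)] by simp
 finally show ?thesis using assms unfolding tables_def position_type_def margin_def by (simp add: multiset.map_comp o_def)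
qed

lemma count_margin: "count (margin p) i = (if i < length p then p ! i else 0)"
proof -
 have "count (margin p) i = card {x. x < sum_list p & block p x = i}"
  unfolding margin_def count_image_mset by (simp add: vimage_def Int_def conj_commute)
 also have "\<dots> = (if i < length p then p ! i else 0)"
 proof (induction p arbitrary: i)
  case (Cons a p)
  show ?case
  proof (cases i)
   case 0
   have "{x. x < sum_list (a # p) & block (a # p) x = 0} = {..<a}" by auto
   thus ?thesis using 0 by simp
  next
   case (Suc j)
   have "{x. x < sum_list (a # p) & block (a # p) x = Suc j} = (+) a ` {x. x < sum_list p & block p x = j}"
   proof (intro Set.set_eqI iffI)
    fix x assume "x \<in> {x. x < sum_list (a # p) & block (a # p) x = Suc j}"
    hence "\<not> x < a" "x - a < sum_list p" "block p (x - a) = j" by (auto split: if_splits)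
    thus "x \<in> (+) a ` {x. x < sum_list p & block p x = j}" by (intro image_eqI[of _ _ "x - a"]) auto
   qed auto
   thus ?thesis using Cons[of j] Suc by (simp add: card_image)
  qed
 qed simp
 finally show ?thesis .
qed

lemma tables_swap: "N \<in> tables p q ==> image_mset prod.swap N \<in> tables q p"
 unfolding tables_def by (simp add: multiset.map_comp o_def)

lemma card_tables_swap:
 assumes "finite (tables p q)" shows "finite (tables q p)" "card (tables q p) = card (tables p q)"
proof -
 have "image_mset prod.swap (image_mset prod.swap N) = N" for N :: "(nat \<times> nat) multiset" by (simp add: multiset.map_comp o_def)
 hence "bij_betw (image_mset prod.swap) (tables p q) (tables q p)"
  by (intro bij_betwI[of _ _ _ "image_mset prod.swap"]) (auto intro: tables_swap)
 thus "finite (tables q p)" "card (tables q p) = card (tables p q)" using assms bij_betw_finite bij_betw_same_card by fastforce+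
qed

lemma count_image_finite:
 assumes "finite J" "\<And>x. x \<in># N ==> f x = i ==> x \<in> J" "\<And>x. x \<in> J ==> f x = i"
 shows "count (image_mset f N) i = (\<Sum>x\<in>J. count N x)"
proof -
 have "count (image_mset f N) i = (\<Sum>x\<in>f -` {i} \<inter> set_mset N. count N x)" by (rule count_image_mset)
 also have "\<dots> = (\<Sum>x\<in>J. count N x)" by (rule sum.mono_neutral_left) (use assms in \<open>auto simp: not_in_iff\<close>)
 finally show ?thesis .
qed

lemma tables_support:
 assumes "N \<in> tables p q" "(i, j) \<in># N" shows "i < length p" "j < length q"
proof -
 have "i \<in># image_mset fst N" "j \<in># image_mset snd N" using assms(2) by force+
 moreover have m: "image_mset fst N = margin p" "image_mset snd N = margin q" using assms(1) by (auto simp: tables_def)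
 ultimately have "i \<in># margin p" "j \<in># margin q" by (simp_all only: m)
 hence "count (margin p) i ~= 0" "count (margin q) j ~= 0" by (simp_all only: count_eq_zero_iff not_not)
 thus "i < length p" "j < length q" using count_margin[of p i] count_margin[of q j] by metis+
qed

lemma table_sums:
 assumes N: "N \<in> tables p q"
 shows "i < length p ==> (\<Sum>j<length q. count N (i, j)) = p ! i"
  and "j < length q ==> (\<Sum>i<length p. count N (i, j)) = q ! j"
proof -
 assume i: "i < length p"
 have "count (image_mset fst N) i = (\<Sum>x\<in>{i} \<times> {..<length q}. count N x)"
  by (rule count_image_finite) (use tables_support[OF N] in auto)
 also have "\<dots> = (\<Sum>j<length q. count N (i, j))" by (rule sum.reindex_bij_witness[of _ "%j. (i, j)" snd]) auto
 finally show "(\<Sum>j<length q. count N (i, j)) = p ! i" using N i by (simp add: tables_def count_margin)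
next
 assume j: "j < length q"
 have "count (image_mset snd N) j = (\<Sum>x\<in>{..<length p} \<times> {j}. count N x)"
  by (rule count_image_finite) (use tables_support[OF N] in auto)
 also have "\<dots> = (\<Sum>i<length p. count N (i, j))" by (rule sum.reindex_bij_witness[of _ "%i. (i, j)" fst]) auto
 finally show "(\<Sum>i<length p. count N (i, j)) = q ! j" using N j by (simp add: tables_def count_margin)
qed

text \<open>A table is determined by its entries outside one row and one column.\<close>

lemma tables_eqI:
 assumes N: "N \<in> tables p q" "N' \<in> tables p q" and ij: "i0 < length p" "j0 < length q"
  and eq: "\<And>i j. i < length p ==> j < length q ==> i ~= i0 ==> j ~= j0 ==> count N (i, j) = count N' (i, j)"
 shows "N = N'"
proof (rule multiset_eqI)
 have rows: "count N (i, j) = count N' (i, j)" if i: "i < length p" "i ~= i0" and j: "j < length q" for i j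
 proof (cases "j = j0")
  case True
  have "(\<Sum>j<length q. count M (i, j)) = count M (i, j0) + (\<Sum>j\<in>{..<length q} - {j0}. count M (i, j))" for M :: "(nat \<times> nat) multiset"
   using ij by (intro sum.remove) auto
  moreover have "(\<Sum>j\<in>{..<length q} - {j0}. count N (i, j)) = (\<Sum>j\<in>{..<length q} - {j0}. count N' (i, j))"
   by (rule sum.cong) (use eq i in auto)
  ultimately show ?thesis using table_sums(1)[OF N(1) i(1)] table_sums(1)[OF N(2) i(1)] True by simp
 qed (use eq i j in blast)
 have all: "count N (i, j) = count N' (i, j)" if i: "i < length p" and j: "j < length q" for i j
 proof (cases "i = i0")
  case True
  have "(\<Sum>i<length p. count M (i, j)) = count M (i0, j) + (\<Sum>i\<in>{..<length p} - {i0}. count M (i, j))" for M :: "(nat \<times> nat) multiset"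
   using ij by (intro sum.remove) auto
  moreover have "(\<Sum>i\<in>{..<length p} - {i0}. count N (i, j)) = (\<Sum>i\<in>{..<length p} - {i0}. count N' (i, j))"
   by (rule sum.cong) (use rows j in auto)
  ultimately show ?thesis using table_sums(2)[OF N(1) j] table_sums(2)[OF N(2) j] True by simp
 qed (use rows i j in blast)
 fix x :: "nat \<times> nat"
 obtain i j where x: "x = (i, j)" by fastforce
 show "count N x = count N' x"
 proof (cases "i < length p & j < length q")
  case False
  hence "(i, j) \<notin># N" "(i, j) \<notin># N'" using tables_support[OF N(1)] tables_support[OF N(2)] by blast+
  thus ?thesis by (simp add: x not_in_iff)
 qed (use all x in blast)
qed

lemma table_le:
 assumes "N \<in> tables p q" "i < length p" "j < length q" shows "count N (i, j) \<le> p ! i" "count N (i, j) \<le> q ! j"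
proof -
 show "count N (i, j) \<le> p ! i" using table_sums(1)[OF assms(1,2)] member_le_sum[of j "{..<length q}" "%j. count N (i, j)"] assms(3) by simp
 show "count N (i, j) \<le> q ! j" using table_sums(2)[OF assms(1,3)] member_le_sum[of i "{..<length p}" "%i. count N (i, j)"] assms(2) by simp
qed

lemma table_row:
 assumes "N \<in> tables p q" "i < length p" "J \<subseteq> {..<length q}" shows "(\<Sum>j\<in>J. count N (i, j)) \<le> p ! i"
 using table_sums(1)[OF assms(1,2)] sum_mono2[of "{..<length q}" J "%j. count N (i, j)"] assms(3) by simp

lemma table_col:
 assumes "N \<in> tables p q" "j < length q" "I \<subseteq> {..<length p}" shows "(\<Sum>i\<in>I. count N (i, j)) \<le> q ! j"
 using table_sums(2)[OF assms(1,2)] sum_mono2[of "{..<length p}" I "%i. count N (i, j)"] assms(3) by simp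

text \<open>The tables of a shape embed into the possible values of the entries outside one row and one column.\<close>

definition few :: "nat list => nat list => bool" where
 "few p q \<longleftrightarrow> finite (tables p q) & card (tables p q) \<le> 10"

lemma few_swap: "few p q ==> few q p" unfolding few_def using card_tables_swap by metis

lemma few_inj:
 assumes "inj_on f (tables p q)" "\<And>N. N \<in> tables p q ==> f N \<in> S" "finite S" "card S \<le> 10" shows "few p q"
 unfolding few_def
proof
 have im: "f ` tables p q \<subseteq> S" using assms(2) by blast
 show "finite (tables p q)" using inj_on_finite[OF assms(1) im assms(3)] .
 show "card (tables p q) \<le> 10" using card_inj_on_le[OF assms(1) im assms(3)] assms(4) by linarith
qed

lemma few_single: assumes "length p = 1" shows "few p q"
proof (cases "length q = 0")
 case True
 hence "N = {#}" if "N \<in> tables p q" for N using tables_support(2)[OF that] by (metis less_zeroE multiset_nonemptyE surj_pair)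
 hence "inj_on (%N. 0 :: nat) (tables p q)" by (auto simp: inj_on_def)
 thus ?thesis by (rule few_inj[where S = "{0}"]) auto
next
 case False
 have "inj_on (%N. 0 :: nat) (tables p q)" by (rule inj_onI) (rule tables_eqI[of _ p q _ 0 0], use assms False in auto)
 thus ?thesis by (rule few_inj[where S = "{0}"]) auto
qed

lemma lt2: "i < 2 \<longleftrightarrow> i = 0 \<or> i = (1 :: nat)" and lt3: "i < 3 \<longleftrightarrow> i = 0 \<or> i = 1 \<or> i = (2 :: nat)"
 and lt4: "i < 4 \<longleftrightarrow> i = 0 \<or> i = 1 \<or> i = 2 \<or> i = (3 :: nat)" by arith+

lemma ex2: "(\<exists>i<2. P i) \<longleftrightarrow> P 0 \<or> P (1 :: nat)" and ex3: "(\<exists>i<3. P i) \<longleftrightarrow> P 0 \<or> P 1 \<or> P (2 :: nat)"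
 and ex4: "(\<exists>i<4. P i) \<longleftrightarrow> P 0 \<or> P 1 \<or> P 2 \<or> P (3 :: nat)"
 and all4: "(\<forall>i<4. P i) \<longleftrightarrow> P 0 & P 1 & P 2 & P (3 :: nat)" by (auto simp: lt2 lt3 lt4)

text \<open>Two entries determine a table with two rows and three columns.\<close>

lemma few_two_three:
 assumes len: "length p = 2" "length q = 3" and c: "(\<exists>i<2. p ! i \<le> 3) \<or> (\<exists>j<3. \<exists>j'<3. j ~= j' & q ! j \<le> 2 & q ! j' \<le> 2)"
 shows "few p q"
proof -
 have key: "inj_on (%N. (count N (i, j), count N (i, j'))) (tables p q)"
  if "i < 2" "j < 3" "j' < 3" "j ~= j'" for i j j' :: nat
 proof (rule inj_onI)
  fix N N' assume N: "N \<in> tables p q" "N' \<in> tables p q" "(count N (i, j), count N (i, j')) = (count N' (i, j), count N' (i, j'))"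
  have j3: "k = j \<or> k = j' \<or> k = 3 - j - j'" if "k < 3" for k
   using that \<open>j < 3\<close> \<open>j' < 3\<close> \<open>j ~= j'\<close> by arith
  show "N = N'"
  proof (rule tables_eqI[OF N(1,2), of "1 - i" "3 - j - j'"])
   show "1 - i < length p" "3 - j - j' < length q" using len that by auto
   fix a b assume "a < length p" "b < length q" "a ~= 1 - i" "b ~= 3 - j - j'"
   hence "a = i" "b = j \<or> b = j'" using j3[of b] that(1) len by auto
   thus "count N (a, b) = count N' (a, b)" using N(3) by auto
  qed
 qed
 from c show ?thesis
 proof
  assume "\<exists>i<2. p ! i \<le> 3"
  then obtain i where i: "i < 2" "p ! i \<le> 3" by blast
  show ?thesis
  proof (rule few_inj[OF key[of i 0 1], where S = "SIGMA a:{..3}. {..3 - a}"])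
   fix N assume N: "N \<in> tables p q"
   have "(\<Sum>j\<in>{0,1}. count N (i, j)) \<le> 3" using table_row[OF N, of i "{0, 1}"] len i by auto
   thus "(count N (i, 0), count N (i, 1)) \<in> (SIGMA a:{..3}. {..3 - a})" by auto
  qed (use i in \<open>auto simp: eval_nat_numeral\<close>)
 next
  assume "\<exists>j<3. \<exists>j'<3. j ~= j' & q ! j \<le> 2 & q ! j' \<le> 2"
  then obtain j j' where j: "j < 3" "j' < 3" "j ~= j'" "q ! j \<le> 2" "q ! j' \<le> 2" by blast
  show ?thesis
  proof (rule few_inj[OF key[of 0 j j'], where S = "{..2} \<times> {..2}"])
   fix N assume N: "N \<in> tables p q"
   have "count N (0, j) \<le> 2" "count N (0, j') \<le> 2" using table_le(2)[OF N, of 0 j] table_le(2)[OF N, of 0 j'] len j by auto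
   thus "(count N (0, j), count N (0, j')) \<in> {..2} \<times> {..2}" by simp
  qed (use j in auto)
 qed
qed

lemma few_two_four:
 assumes len: "length p = 2" "length q = 4"
  and c: "(\<exists>i<2. p ! i \<le> 2) \<or> (\<exists>l<4. \<forall>j<4. j ~= l --> q ! j \<le> 1)"
 shows "few p q"
proof -
 have key: "inj_on (%N. (count N (i, (l + 1) mod 4), count N (i, (l + 2) mod 4), count N (i, (l + 3) mod 4))) (tables p q)"
  if "i < 2" "l < 4" for i l :: nat
 proof (rule inj_onI)
  fix N N' assume N: "N \<in> tables p q" "N' \<in> tables p q"
   "(count N (i, (l + 1) mod 4), count N (i, (l + 2) mod 4), count N (i, (l + 3) mod 4)) =
    (count N' (i, (l + 1) mod 4), count N' (i, (l + 2) mod 4), count N' (i, (l + 3) mod 4))"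
  show "N = N'"
  proof (rule tables_eqI[OF N(1,2), of "1 - i" l])
   show "1 - i < length p" "l < length q" using len that by auto
   fix a b assume ab: "a < length p" "b < length q" "a ~= 1 - i" "b ~= l"
   have "b < 4" using ab(2) len by simp
   hence "b = (l + 1) mod 4 \<or> b = (l + 2) mod 4 \<or> b = (l + 3) mod 4" using ab(4) that(2) unfolding lt4 by auto
   moreover have "a = i" using ab(1,3) that len by auto
   ultimately show "count N (a, b) = count N' (a, b)" using N(3) by blast
  qed
 qed
 from c show ?thesis
 proof
  assume "\<exists>i<2. p ! i \<le> 2"
  then obtain i where i: "i < 2" "p ! i \<le> 2" by blast
  show ?thesis
  proof (rule few_inj[OF key[of i 3], where S = "SIGMA a:{..2}. SIGMA b:{..2 - a}. {..2 - a - b}"])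
   fix N assume N: "N \<in> tables p q"
   have "(\<Sum>j\<in>{0,1,2}. count N (i, j)) \<le> 2" using table_row[OF N, of i "{0, 1, 2}"] len i by auto
   thus "(count N (i, (3 + 1) mod 4), count N (i, (3 + 2) mod 4), count N (i, (3 + 3) mod 4)) \<in> (SIGMA a:{..2}. SIGMA b:{..2 - a}. {..2 - a - b})"
    by auto
  qed (use i in \<open>auto simp: eval_nat_numeral\<close>)
 next
  assume "\<exists>l<4. \<forall>j<4. j ~= l --> q ! j \<le> 1"
  then obtain l where l: "l < 4" "\<And>j. j < 4 ==> j ~= l ==> q ! j \<le> 1" by blast
  show ?thesis
  proof (rule few_inj[OF key[of 0 l], where S = "{..1} \<times> {..1} \<times> {..1}"])
   fix N assume N: "N \<in> tables p q"
   have *: "count N (0, j) \<le> 1" if "j < 4" "j ~= l" for j using l(2)[OF that] table_le(2)[OF N, of 0 j] len that(1) by simp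
   have "(l + 1) mod 4 ~= l" "(l + 2) mod 4 ~= l" "(l + 3) mod 4 ~= l" using l(1) by presburger+
   hence "count N (0, (l + 1) mod 4) \<le> 1" "count N (0, (l + 2) mod 4) \<le> 1" "count N (0, (l + 3) mod 4) \<le> 1"
    using *[of "(l + 1) mod 4"] *[of "(l + 2) mod 4"] *[of "(l + 3) mod 4"] by simp_all
   thus "(count N (0, (l + 1) mod 4), count N (0, (l + 2) mod 4), count N (0, (l + 3) mod 4)) \<in> {..1} \<times> {..1} \<times> {..1}"
    by (simp only: mem_Sigma_iff atMost_iff)
  qed (use l in auto)
 qed
qed

lemma few_three_three:
 assumes len: "length p = 3" "length q = 3" and j: "j < 3" "j' < 3" "j ~= j'" "q ! j \<le> 1" "q ! j' \<le> 1"
 shows "few p q"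
proof -
 let ?f = "%N. ((count N (0, j), count N (1, j)), (count N (0, j'), count N (1, j')))"
 let ?T = "SIGMA a:{..1 :: nat}. {..1 - a}"
 have inj: "inj_on ?f (tables p q)"
 proof (rule inj_onI)
  fix N N' assume N: "N \<in> tables p q" "N' \<in> tables p q" "?f N = ?f N'"
  show "N = N'"
  proof (rule tables_eqI[OF N(1,2), of 2 "3 - j - j'"])
   show "2 < length p" "3 - j - j' < length q" using len j by auto
   fix a b assume ab: "a < length p" "b < length q" "a ~= 2" "b ~= 3 - j - j'"
   have "b = j \<or> b = j'" using ab(2,4) len j(1-3) by arith
   moreover have "a = 0 \<or> a = 1" using ab(1,3) len by arith
   ultimately show "count N (a, b) = count N' (a, b)" using N(3) by auto
  qed
 qed
 show ?thesis
 proof (rule few_inj[OF inj, where S = "?T \<times> ?T"])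
  fix N assume N: "N \<in> tables p q"
  have "(\<Sum>i\<in>{0,1}. count N (i, l)) \<le> 1" if "l = j \<or> l = j'" for l using table_col[OF N, of l "{0, 1}"] len j that by auto
  hence "count N (0, l) + count N (1, l) \<le> 1" if "l = j \<or> l = j'" for l using that by simp
  hence "count N (0, j) + count N (1, j) \<le> 1" "count N (0, j') + count N (1, j') \<le> 1" by blast+
  thus "?f N \<in> ?T \<times> ?T" by (simp only: mem_Sigma_iff atMost_iff) arith
 qed (auto simp: eval_nat_numeral)
qed

section \<open>The classification\<close>

definition settled :: "nat list => nat list => bool" where
 "settled p q \<longleftrightarrow> wildl p q \<or> spherical p q \<or> few p q"

lemma settled_swap: "sum_list p = sum_list q ==> settled p q ==> settled q p"
 unfolding settled_def using wildl_swap spherical_swap few_swap by blast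

lemma wildl_dominated:
 assumes "wildl p0 q0" "list_all2 (\<le>) p0 p'" "mset p' = mset p" "list_all2 (\<le>) q0 q'" "mset q' = mset q" "sum_list p = sum_list q"
 shows "wildl p q"
proof -
 have "sum_list p' = sum_list q'" using assms(3,5,6) by (metis sum_mset_sum_list)
 hence "wildl p' q'" using wildl_grow[OF assms(1,2,4)] by blast
 thus ?thesis by (rule wildl_perm[OF assms(3,5)])
qed

lemma wildl_merge_tail:
 assumes "wildl (u @ [sum_list v]) q" "v ~= []" shows "wildl (u @ v) q" using assms
proof (induction v arbitrary: u)
 case (Cons a v)
 show ?case
 proof (cases "v = []")
  case False
  have "wildl ((a + sum_list v) # u) q" using Cons.prems(1) by (rule wildl_perm[rotated 2]) auto
  hence "wildl (a # sum_list v # u) q" by (rule wildl_refine)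
  hence "wildl ((u @ [a]) @ [sum_list v]) q" by (rule wildl_perm[rotated 2]) auto
  thus ?thesis using Cons.IH[of "u @ [a]"] False by simp
 qed (use Cons.prems in simp)
qed simp

lemma wildl_coarse_right:
 assumes "length q \<ge> k" "k > 0" "\<And>x. x \<in> set q ==> x > 0" "sum_list p = sum_list q"
  and w: "\<And>q'. length q' = k ==> (\<And>x. x \<in> set q' ==> x > 0) ==> sum_list p = sum_list q' ==> wildl p q'"
 shows "wildl p q"
proof -
 let ?u = "take (k - 1) q" and ?v = "drop (k - 1) q"
 have v: "?v ~= []" using assms(1,2) by auto
 have "sum_list ?v > 0" using v assms(3) by (cases ?v) (auto dest: in_set_dropD, metis in_set_dropD list.set_intros(1) add_gr_0)
 moreover have "sum_list ?u + sum_list ?v = sum_list q" by (metis append_take_drop_id sum_list_append)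
 ultimately have "wildl p (?u @ [sum_list ?v])" using assms by (intro w) (auto dest: in_set_takeD)
 hence "wildl (?u @ [sum_list ?v]) p" by (rule wildl_swap)
 hence "wildl (?u @ ?v) p" using v by (rule wildl_merge_tail)
 thus ?thesis using wildl_swap by simp
qed

lemma list2: "length p = 2 ==> \<exists>a b. p = [a, b]" and list3: "length p = 3 ==> \<exists>a b c. p = [a, b, c]"
 and list4: "length p = 4 ==> \<exists>a b c d. p = [a, b, c, d]" and list5: "length p = 5 ==> \<exists>a b c d e. p = [a, b, c, d, e]"
 by (auto simp: numeral_eq_Suc length_Suc_conv)

text \<open>The classification for at most as many blocks on the left as on the right. Every case in which neither a dense orbit nor a short list of tables is available dominates one of the five wild shapes.\<close>

lemma settled_le:
 assumes pos: "\<And>x. x \<in> set p ==> x > 0" "\<And>x. x \<in> set q ==> x > 0" and s: "sum_list p = sum_list q"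
  and le: "length p \<le> length q" and ne: "p ~= []"
 shows "settled p q"
proof -
 consider "length p = 1" | "length p = 2" "length q = 2" | "length p = 2" "length q = 3" | "length p = 2" "length q = 4"
  | "length p = 2" "length q \<ge> 5" | "length p = 3" "length q = 3" | "length p \<ge> 3" "length q \<ge> 4"
 proof -
  have "length p \<ge> 1" using ne by (cases p) auto
  hence "length p = 1 \<or> length p = 2 & length q = 2 \<or> length p = 2 & length q = 3 \<or> length p = 2 & length q = 4 \<or>
   length p = 2 & length q \<ge> 5 \<or> length p = 3 & length q = 3 \<or> length p \<ge> 3 & length q \<ge> 4" using le by arith
  thus ?thesis using that by blast
 qed
 thus ?thesis
 proof cases
  case 1
  thus ?thesis using few_single by (simp add: settled_def)
 next
  case 2
  obtain a b where p: "p = [a, b]" using list2 2 by blast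
  obtain c d where q: "q = [c, d]" using list2 2 by blast
  have ab: "a > 0" "b > 0" "c > 0" "d > 0" "a + b = c + d" using pos s p q by auto
  show ?thesis
  proof (cases "d = 1")
   case True
   hence "spherical q p" using spherical_hyperplane[of p c] ab p q by simp
   thus ?thesis using spherical_swap[of q p] s by (simp add: settled_def)
  next
   case False
   \<comment> \<open>refined by a line, the second flag is still spherical\<close>
   have "spherical [a, b] [c, 1, d - 1]" using ab False by (intro spherical_grass[of a b c "d - 1"]) auto
   hence "spherical [a, b] ([c] @ [1, d - 1] @ [])" by simp
   hence "spherical [a, b] ([c] @ [1 + (d - 1)] @ [])" by (rule spherical_coarsen)
   thus ?thesis using ab p q by (simp add: settled_def)
  qed
 next
  case 3
  obtain a b where p: "p = [a, b]" using list2 3 by blast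
  obtain c d e where q: "q = [c, d, e]" using list3 3 by blast
  have ab: "a > 0" "b > 0" "c > 0" "d > 0" "e > 0" "a + b = c + d + e" using pos s p q by auto
  show ?thesis
  proof (cases "c = 1 \<or> d = 1 \<or> e = 1")
   case True
   hence "spherical [a, b] [c, d, e]"
   proof (elim disjE)
    assume "c = 1" thus ?thesis using ab by (intro spherical_grass[of a b d e]) auto
   next
    assume "d = 1" thus ?thesis using ab by (intro spherical_grass[of a b c e]) auto
   next
    assume "e = 1" thus ?thesis using ab by (intro spherical_grass[of a b c d]) auto
   qed
   thus ?thesis by (simp add: settled_def p q)
  next
   case no1: False
   show ?thesis
   proof (cases "a \<le> 3 \<or> b \<le> 3 \<or> c \<le> 2 & d \<le> 2 \<or> c \<le> 2 & e \<le> 2 \<or> d \<le> 2 & e \<le> 2")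
    case True
    have "(\<exists>i<2. p ! i \<le> 3) \<or> (\<exists>j<3. \<exists>j'<3. j ~= j' & q ! j \<le> 2 & q ! j' \<le> 2)"
     unfolding ex2 ex3 p q using True by auto
    thus ?thesis using few_two_three[OF 3] by (simp add: settled_def)
   next
    case False
    have "list_all2 (\<le>) [2, 3, 3] [c, d, e] \<or> list_all2 (\<le>) [2, 3, 3] [d, c, e] \<or> list_all2 (\<le>) [2, 3, 3] [e, c, d]"
     using False ab no1 by simp arith
    moreover have "mset [d, c, e] = mset q" "mset [e, c, d] = mset q" "mset [c, d, e] = mset q" by (simp_all add: q add_mset_commute)
    moreover have "list_all2 (\<le>) [4, 4] p" using False by (simp add: p)
    ultimately have "wildl p q" using wildl_dominated[OF wild_base1 _ refl _ _ s] by blast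
    thus ?thesis by (simp add: settled_def)
   qed
  qed
 next
  case 4
  obtain a b where p: "p = [a, b]" using list2 4 by blast
  obtain c d e f where q: "q = [c, d, e, f]" using list4 4 by blast
  have ab: "a > 0" "b > 0" "c > 0" "d > 0" "e > 0" "f > 0" "a + b = c + d + e + f" using pos s p q by auto
  show ?thesis
  proof (cases "a \<le> 2 \<or> b \<le> 2 \<or> c \<le> 1 & d \<le> 1 & e \<le> 1 \<or> c \<le> 1 & d \<le> 1 & f \<le> 1 \<or> c \<le> 1 & e \<le> 1 & f \<le> 1 \<or> d \<le> 1 & e \<le> 1 & f \<le> 1")
   case True
   have "(\<exists>i<2. p ! i \<le> 2) \<or> (\<exists>l<4. \<forall>j<4. j ~= l --> q ! j \<le> 1)"
    unfolding ex2 ex4 all4 p q using True by auto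
   thus ?thesis using few_two_four[OF 4] by (simp add: settled_def)
  next
   case False
   have le1: "x \<le> 1 \<longleftrightarrow> \<not> 2 \<le> x" for x :: nat by auto
   have "list_all2 (\<le>) [1, 1, 2, 2] [c, d, e, f] \<or> list_all2 (\<le>) [1, 1, 2, 2] [c, e, d, f] \<or> list_all2 (\<le>) [1, 1, 2, 2] [c, f, d, e] \<or>
     list_all2 (\<le>) [1, 1, 2, 2] [d, e, c, f] \<or> list_all2 (\<le>) [1, 1, 2, 2] [d, f, c, e] \<or> list_all2 (\<le>) [1, 1, 2, 2] [e, f, c, d]"
    using False ab unfolding le1 by (cases "2 \<le> c"; cases "2 \<le> d"; cases "2 \<le> e"; cases "2 \<le> f") auto
   moreover have "mset [c, d, e, f] = mset q" "mset [c, e, d, f] = mset q" "mset [c, f, d, e] = mset q"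
     "mset [d, e, c, f] = mset q" "mset [d, f, c, e] = mset q" "mset [e, f, c, d] = mset q" by (simp_all add: q add_mset_commute)
   moreover have "list_all2 (\<le>) [3, 3] p" using False by (simp add: p)
   ultimately have "wildl p q" using wildl_dominated[OF wild_base2 _ refl _ _ s] by blast
   thus ?thesis by (simp add: settled_def)
  qed
 next
  case 5
  obtain a b where p: "p = [a, b]" using list2 5 by blast
  have ab: "a > 0" "b > 0" using pos p by auto
  show ?thesis
  proof (cases "a = 1 \<or> b = 1")
   case True
   hence "spherical p q" using spherical_line[of q b] spherical_hyperplane[of q a] s p by auto
   thus ?thesis by (simp add: settled_def)
  next
   case False
   have "wildl p q"
   proof (rule wildl_coarse_right[of 5])
    fix q' :: "nat list" assume q': "length q' = 5" "\<And>x. x \<in> set q' ==> x > 0" "sum_list p = sum_list q'"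
    obtain c d e f g where q: "q' = [c, d, e, f, g]" using list5[OF q'(1)] by blast
    have pos5: "c > 0" "d > 0" "e > 0" "f > 0" "g > 0" using q'(2) unfolding q by simp_all
    have r: "list_all2 (\<le>) [1, 1, 1, 1, 1] q'" using pos5 by (simp add: q Suc_le_eq)
    have "a + b \<ge> 5" using q'(3) pos5 by (simp add: p q)
    hence "list_all2 (\<le>) [2, 3] [a, b] \<or> list_all2 (\<le>) [2, 3] [b, a]" using False ab by simp arith
    moreover have "mset [a, b] = mset p" "mset [b, a] = mset p" by (simp_all add: p add_mset_commute)
    ultimately show "wildl p q'" using wildl_dominated[OF wild_base3 _ _ r refl q'(3)] by blast
   qed (use 5 pos s in auto)
   thus ?thesis by (simp add: settled_def)
  qed
 next
  case 6
  obtain a b g where p: "p = [a, b, g]" using list3 6 by blast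
  obtain c d e where q: "q = [c, d, e]" using list3 6 by blast
  have ab: "a > 0" "b > 0" "g > 0" "c > 0" "d > 0" "e > 0" using pos p q by auto
  show ?thesis
  proof (cases "c \<le> 1 & d \<le> 1 \<or> c \<le> 1 & e \<le> 1 \<or> d \<le> 1 & e \<le> 1")
   case True
   hence "\<exists>j<3. \<exists>j'<3. j ~= j' & q ! j \<le> 1 & q ! j' \<le> 1" by (simp add: q numeral_eq_Suc Ex_less_Suc) auto
   hence "few p q" using few_three_three[OF 6] by blast
   thus ?thesis by (simp add: settled_def)
  next
   case q1: False
   show ?thesis
   proof (cases "a \<le> 1 & b \<le> 1 \<or> a \<le> 1 & g \<le> 1 \<or> b \<le> 1 & g \<le> 1")
    case True
    have "\<exists>j<3. \<exists>j'<3. j ~= j' & p ! j \<le> 1 & p ! j' \<le> 1" unfolding ex3 p using True by auto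
    hence "few q p" using few_three_three[OF 6(2,1)] by blast
    thus ?thesis using few_swap by (simp add: settled_def)
   next
    case False
    have "list_all2 (\<le>) [1, 2, 2] [a, b, g] \<or> list_all2 (\<le>) [1, 2, 2] [b, a, g] \<or> list_all2 (\<le>) [1, 2, 2] [g, a, b]"
     using False ab by simp arith
    moreover have "list_all2 (\<le>) [1, 2, 2] [c, d, e] \<or> list_all2 (\<le>) [1, 2, 2] [d, c, e] \<or> list_all2 (\<le>) [1, 2, 2] [e, c, d]"
     using q1 ab by simp arith
    moreover have "mset [b, a, g] = mset p" "mset [g, a, b] = mset p" "mset [a, b, g] = mset p"
     "mset [d, c, e] = mset q" "mset [e, c, d] = mset q" "mset [c, d, e] = mset q" by (simp_all add: p q add_mset_commute)
    ultimately have "wildl p q" using wildl_dominated[OF wild_base4 _ _ _ _ s] by blast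
    thus ?thesis by (simp add: settled_def)
   qed
  qed
 next
  case 7
  have "wildl p q"
  proof (rule wildl_coarse_right[of 4])
   fix q' :: "nat list" assume q': "length q' = 4" "\<And>x. x \<in> set q' ==> x > 0" "sum_list p = sum_list q'"
   have "wildl q' p"
   proof (rule wildl_coarse_right[of 3])
    fix p' :: "nat list" assume p': "length p' = 3" "\<And>x. x \<in> set p' ==> x > 0" "sum_list q' = sum_list p'"
    obtain a b g where p: "p' = [a, b, g]" using list3 p' by blast
    obtain c d e f where q: "q' = [c, d, e, f]" using list4 q' by blast
    have ab: "a > 0" "b > 0" "g > 0" "c > 0" "d > 0" "e > 0" "f > 0" using p'(2) q'(2) p q by auto
    have "a + b + g = c + d + e + f" using p'(3) by (simp add: p q)
    hence "list_all2 (\<le>) [1, 1, 2] [a, b, g] \<or> list_all2 (\<le>) [1, 1, 2] [a, g, b] \<or> list_all2 (\<le>) [1, 1, 2] [b, g, a]"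
     using ab by simp arith
    moreover have "mset [a, b, g] = mset p'" "mset [a, g, b] = mset p'" "mset [b, g, a] = mset p'" by (simp_all add: p add_mset_commute)
    moreover have "list_all2 (\<le>) [1, 1, 1, 1] q'" using ab by (simp add: q Suc_le_eq)
    ultimately have "wildl p' q'" using wildl_dominated[OF wild_base5 _ _ _ refl p'(3)[symmetric]] by blast
    thus "wildl q' p'" by (rule wildl_swap)
   qed (use 7 pos q' in auto)
   thus "wildl p q'" by (rule wildl_swap)
  qed (use 7 pos s in auto)
  thus ?thesis by (simp add: settled_def)
 qed
qed

theorem classification:
 assumes "\<And>x. x \<in> set p ==> x > 0" "\<And>x. x \<in> set q ==> x > 0" "sum_list p = sum_list q" "sum_list p > 0"
 shows "settled p q"
proof -
 have "sum_list q > 0" using assms(3,4) by simp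
 hence "p ~= []" "q ~= []" using assms(4) by (metis sum_list.Nil less_irrefl)+
 thus ?thesis using settled_le[of p q] settled_le[of q p] settled_swap[of q p] assms by (cases "length p \<le> length q") auto
qed

section \<open>Subspaces and eigenvectors\<close>

definition vsub :: "nat => (nat => complex) set => bool" where
 "vsub m W \<longleftrightarrow> (\<forall>v\<in>W. \<forall>i\<ge>m. v i = 0) & (%_. 0) \<in> W &
   (\<forall>u\<in>W. \<forall>v\<in>W. \<forall>a b. (%i. a * u i + b * v i) \<in> W)"

lemma vsubD:
 assumes "vsub m W"
 shows "v \<in> W ==> i \<ge> m ==> v i = 0" "(%_. 0) \<in> W" "u \<in> W ==> v \<in> W ==> (%i. a * u i + b * v i) \<in> W"
 using assms unfolding vsub_def by blast+

lemma vsub_scale: "vsub m W ==> v \<in> W ==> (%i. a * v i) \<in> W" using vsubD(3)[of m W v v a 0] by simp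

lemma vsub_sum:
 assumes "vsub m W" "\<And>k. x k \<in> W" shows "(%i. \<Sum>k\<le>(N :: nat). c k * x k i) \<in> W"
proof (induction N)
 case 0
 show ?case using vsub_scale[OF assms(1,2), of "c 0" 0] by simp
next
 case (Suc N)
 thus ?case using vsubD(3)[OF assms(1) Suc assms(2)[of "Suc N"], of 1 "c (Suc N)"] by simp
qed

definition leading :: "nat => (nat => complex) set => nat set" where
 "leading m W = {i. i < m & (\<exists>w\<in>W. w i ~= 0 & (\<forall>j<i. w j = 0))}"

text \<open>The number of leading positions is the dimension; a proper subspace misses one of them. This serves as the measure for choosing minimal subspaces.\<close>

lemma leading_eq:
 assumes W: "vsub m W" and E: "vsub m E" and sub: "E \<subseteq> W" and eq: "leading m E = leading m W"
 shows "E = W"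
proof (rule ccontr)
 assume "E ~= W"
 define D where "D i \<longleftrightarrow> (\<exists>w\<in>W - E. \<forall>j<i. w j = 0)" for i
 have "\<exists>w. w \<in> W - E" using \<open>E ~= W\<close> sub by blast
 hence D0: "D 0" unfolding D_def by blast
 have bd: "D i ==> i \<le> m" for i
 proof (rule ccontr)
  assume "D i" "\<not> i \<le> m"
  then obtain w where w: "w \<in> W - E" "\<forall>j<i. w j = 0" unfolding D_def by blast
  have "w j = 0" for j using w(2) vsubD(1)[OF W, of w j] w(1) \<open>\<not> i \<le> m\<close> by (cases "j < i") auto
  hence "w = (%_. 0)" by (rule ext)
  thus False using w(1) vsubD(2)[OF E] by blast
 qed
 define i where "i = (GREATEST i. D i)"
 have i: "D i" unfolding i_def by (rule GreatestI_nat[of D 0 m]) (use D0 bd in auto)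
 have i_max: "i' \<le> i" if "D i'" for i' unfolding i_def by (rule Greatest_le_nat[of D i' m]) (use that bd in auto)
 from i obtain w where w: "w \<in> W" "w \<notin> E" "\<And>j. j < i ==> w j = 0" unfolding D_def by blast
 have "\<not> D (Suc i)" using i_max[of "Suc i"] Suc_n_not_le_n by blast
 hence "\<not> (\<forall>j<Suc i. w j = 0)" using w(1,2) by (simp only: D_def) blast
 hence wi: "w i ~= 0" using w(3) by (metis less_Suc_eq)
 hence "i < m" using vsubD(1)[OF W w(1), of i] by (meson not_le)
 hence "i \<in> leading m W" unfolding leading_def using w(1,3) wi by (auto intro!: bexI[of _ w])
 hence "i \<in> leading m E" unfolding eq .
 then obtain e where e: "e \<in> E" "e i ~= 0" "\<And>j. j < i ==> e j = 0" unfolding leading_def by blast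
 define u where "u = (%j. 1 * w j + (- (w i / e i)) * e j)"
 have "u \<in> W" unfolding u_def using w(1) e(1) sub by (intro vsubD(3)[OF W]) auto
 moreover have "u \<notin> E"
 proof
  assume "u \<in> E"
  hence "(%j. 1 * u j + (w i / e i) * e j) \<in> E" using e(1) by (intro vsubD(3)[OF E])
  moreover have "(%j. 1 * u j + (w i / e i) * e j) = w" by (intro ext) (simp add: u_def)
  ultimately show False using w(2) by simp
 qed
 moreover have "u j = 0" if "j < Suc i" for j using that w(3)[of j] e(2,3) by (cases "j = i") (auto simp: u_def)
 ultimately have "D (Suc i)" unfolding D_def by blast
 thus False using \<open>\<not> D (Suc i)\<close> by blast
qed

text \<open>The powers of the operator applied to a vector are dependent; a root of a polynomial of least degree that annihilates the vector is an eigenvalue.\<close>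

lemma eigenvector_in_subspace:
 fixes A :: "(nat => complex) => nat => complex"
 assumes W: "vsub m W" and A: "\<And>v. v \<in> W ==> A v \<in> W"
  and lin: "\<And>u v a b. A (%i. a * u i + b * v i) = (%i. a * A u i + b * A v i)"
  and w: "w \<in> W" "w ~= (%_. 0)"
 shows "\<exists>u c. u \<in> W & u ~= (%_. 0) & A u = (%i. c * u i)"
proof -
 define pw where "pw k = (A ^^ k) w" for k
 have pwW: "pw k \<in> W" for k unfolding pw_def by (induction k) (auto simp: w A)
 define S where "S p = (%i. \<Sum>k\<le>Suc m. coeff p k * pw k i)" for p
 have SW: "S p \<in> W" for p unfolding S_def using W pwW by (rule vsub_sum)
 have linS: "A (%i. \<Sum>k\<le>N. c k * pw k i) = (%i. \<Sum>k\<le>N. c k * pw (Suc k) i)" for c N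
 proof (induction N)
  case 0
  show ?case using lin[of "c 0" "pw 0" 0 "pw 0"] by (simp add: pw_def)
 next
  case (Suc N)
  thus ?case using lin[of 1 "%i. \<Sum>k\<le>N. c k * pw k i" "c (Suc N)" "pw (Suc N)"] by (simp add: pw_def)
 qed
 have main: "\<exists>u c. u \<in> W & u ~= (%_. 0) & A u = (%i. c * u i)"
  if "p ~= 0" "degree p \<le> m" "S p = (%_. 0)" for p using that
 proof (induction "degree p" arbitrary: p rule: less_induct)
  case less
  show ?case
  proof (cases "degree p = 0")
   case True
   then obtain a where p: "p = [:a:]" by (metis degree_eq_zeroE)
   have "S p = (%i. a * w i)"
   proof
    fix i
    have "S p i = (\<Sum>k\<le>Suc m. if k = 0 then a * w i else 0)" unfolding S_def p
     by (intro sum.cong) (auto simp: pw_def coeff_pCons split: nat.split)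
    thus "S p i = a * w i" by simp
   qed
   hence "w = (%_. 0)" using less.prems(1,3) p by (auto simp: fun_eq_iff)
   thus ?thesis using w(2) by blast
  next
   case False
   hence "\<not> constant (poly p)" by (simp add: constant_degree)
   then obtain z where "poly p z = 0" using fundamental_theorem_of_algebra by blast
   then obtain q where q: "p = [:- z, 1:] * q" unfolding poly_eq_0_iff_dvd dvd_def by blast
   have q0: "q ~= 0" using less.prems(1) q by auto
   have dq: "degree p = Suc (degree q)" using q0 unfolding q by (subst degree_mult_eq) auto
   have cp: "coeff p k = (case k of 0 => 0 | Suc l => coeff q l) - z * coeff q k" for k
    unfolding q by (simp add: coeff_pCons split: nat.split)
   have qm: "coeff q (Suc m) = 0" "coeff q m = 0" using dq less.prems(2) by (auto intro!: coeff_eq_0)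
   have "S p = (%i. A (S q) i - z * S q i)"
   proof
    fix i
    have "S p i = (\<Sum>k\<le>Suc m. (case k of 0 => 0 | Suc l => coeff q l) * pw k i) - z * S q i"
     unfolding S_def cp by (simp only: left_diff_distrib sum_subtractf sum_distrib_left mult.assoc)
    also have "(\<Sum>k\<le>Suc m. (case k of 0 => 0 | Suc l => coeff q l) * pw k i) = (\<Sum>k\<le>m. coeff q k * pw (Suc k) i)"
     by (subst sum.atMost_Suc_shift) simp
    also have "\<dots> = A (S q) i" unfolding S_def linS using qm by simp
    finally show "S p i = A (S q) i - z * S q i" .
   qed
   hence ev: "A (S q) = (%i. z * S q i)" using less.prems(3) by (auto simp: fun_eq_iff)
   show ?thesis
   proof (cases "S q = (%_. 0)")
    case True
    thus ?thesis using less.hyps[of q] q0 dq less.prems(2) by auto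
   qed (use ev SW in blast)
  qed
 qed
 obtain v where v: "\<exists>k\<in>{..m}. v k ~= 0" "\<And>k. k \<notin> {..m} ==> v k = 0" "\<And>e. e \<in> {..<m} ==> (\<Sum>k\<in>{..m}. pw k e * v k) = 0"
  using nonzero_solution[of "{..<m}" "{..m}" "%e k. pw k e"] by auto
 define p where "p = (\<Sum>k\<le>m. monom (v k) k)"
 have cp: "coeff p k = v k" for k
 proof -
  have "coeff p k = (\<Sum>j\<le>m. if j = k then v j else 0)" by (simp add: p_def coeff_sum)
  thus ?thesis using v(2)[of k] by auto
 qed
 have "p ~= 0" using v(1) cp by auto
 moreover have "degree p \<le> m" by (rule degree_le) (use cp v(2) in auto)
 moreover have "S p = (%_. 0)"
 proof
  fix i
  show "S p i = 0"
  proof (cases "i < m")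
   case True
   thus ?thesis using v(3)[of i] v(2)[of "Suc m"] by (simp add: S_def cp mult.commute)
  qed (use vsubD(1)[OF W SW] in auto)
 qed
 ultimately show ?thesis by (rule main)
qed

lemma finite_eigenvalues:
 fixes M :: "nat => nat => complex"
 shows "finite {c. \<exists>u. (\<exists>i<m. u i ~= 0) & (\<forall>i<m. (\<Sum>j<m. M i j * u j) = c * u i)}"
proof -
 define A where "A = mat m m (%(i, j). M i j)"
 have A: "A \<in> carrier_mat m m" by (simp add: A_def)
 have "char_poly A ~= 0" using degree_monic_char_poly[OF A] by auto
 hence "finite {c. poly (char_poly A) c = 0}" by (rule poly_roots_finite)
 moreover have "poly (char_poly A) c = 0" if u: "i < m" "u i ~= 0" "\<forall>i<m. (\<Sum>j<m. M i j * u j) = c * u i" for c u i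
 proof -
  have "vec m u ~= 0\<^sub>v m"
  proof
   assume "vec m u = 0\<^sub>v m"
   hence "vec m u $ i = 0\<^sub>v m $ i" by simp
   thus False using u by simp
  qed
  moreover have "A *\<^sub>v vec m u = c \<cdot>\<^sub>v vec m u"
   by (rule eq_vecI) (use u(3) in \<open>auto simp: A_def scalar_prod_def lessThan_atLeast0\<close>)
  ultimately have "eigenvector A (vec m u) c" unfolding eigenvector_def using A by auto
  thus ?thesis using eigenvalue_root_char_poly[OF A] unfolding eigenvalue_def by blast
 qed
 ultimately show ?thesis by (elim finite_subset[rotated]) blast
qed

section \<open>Regular functions on the special linear group\<close>

definition regular :: "nat => (complex mat => complex) => bool" where
 "regular n f \<longleftrightarrow> (\<exists>f'\<in>poly_funs {%A. A $$ (i, j) | i j. i < n & j < n}. \<forall>x\<in>SG n. f x = f' x)"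

lemma regularI: "f' \<in> poly_funs {%A. A $$ (i, j) | i j. i < n & j < n} ==> (\<And>x. x \<in> SG n ==> f x = f' x) ==> regular n f"
 unfolding regular_def by blast

lemma regular_cong: "regular n f ==> (\<And>x. x \<in> SG n ==> f x = g x) ==> regular n g" unfolding regular_def by auto

lemma regular_const: "regular n (%x. c)" by (rule regularI[OF poly_funs.const]) simp

lemma regular_coord: "i < n ==> j < n ==> regular n (%x. x $$ (i, j))" by (rule regularI[OF poly_funs.coord]) auto

lemma regular_add: assumes "regular n f" "regular n g" shows "regular n (%x. f x + g x)"
proof -
 obtain f' g' where "f' \<in> poly_funs {%A. A $$ (i, j) | i j. i < n & j < n}" "\<forall>x\<in>SG n. f x = f' x"
  "g' \<in> poly_funs {%A. A $$ (i, j) | i j. i < n & j < n}" "\<forall>x\<in>SG n. g x = g' x"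
  using assms unfolding regular_def by blast
 thus ?thesis by (intro regularI[OF poly_funs.add[of f' _ g']]) auto
qed

lemma regular_mult: assumes "regular n f" "regular n g" shows "regular n (%x. f x * g x)"
proof -
 obtain f' g' where "f' \<in> poly_funs {%A. A $$ (i, j) | i j. i < n & j < n}" "\<forall>x\<in>SG n. f x = f' x"
  "g' \<in> poly_funs {%A. A $$ (i, j) | i j. i < n & j < n}" "\<forall>x\<in>SG n. g x = g' x"
  using assms unfolding regular_def by blast
 thus ?thesis by (intro regularI[OF poly_funs.mult[of f' _ g']]) auto
qed

lemma regular_sum: "(\<And>i. i \<in> I ==> regular n (f i)) ==> regular n (%x. \<Sum>i\<in>I. f i x)"
 by (induction I rule: infinite_finite_induct) (auto intro: regular_const regular_add)

lemma regular_prod: "(\<And>i. i \<in> I ==> regular n (f i)) ==> regular n (%x. \<Prod>i\<in>I. f i x)"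
 by (induction I rule: infinite_finite_induct) (auto intro: regular_const regular_mult)

definition regular_mat :: "nat => (complex mat => complex mat) => bool" where
 "regular_mat n \<phi> \<longleftrightarrow> (\<forall>x\<in>SG n. \<phi> x \<in> SG n) & (\<forall>i<n. \<forall>j<n. regular n (%x. \<phi> x $$ (i, j)))"

lemma regular_comp:
 assumes f: "regular n f" and \<phi>: "regular_mat n \<phi>"
 shows "regular n (%x. f (\<phi> x))"
proof -
 let ?C = "{%A. A $$ (i, j) | i j. i < n & j < n}"
 have "regular n (%x. f' (\<phi> x))" if "f' \<in> poly_funs ?C" for f' using that
 proof induction
  case (coord f)
  thus ?case using \<phi> unfolding regular_mat_def by blast
 qed (auto intro: regular_const regular_add regular_mult)
 moreover obtain f' where f': "f' \<in> poly_funs ?C" "\<forall>x\<in>SG n. f x = f' x" using f unfolding regular_def by blast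
 ultimately have "regular n (%x. f' (\<phi> x))" by blast
 thus ?thesis by (rule regular_cong) (use f'(2) \<phi> in \<open>auto simp: regular_mat_def\<close>)
qed

lemma regular_mat_id: "regular_mat n (%x. x)" unfolding regular_mat_def by (auto intro: regular_coord)

lemma regular_mat_const: "b \<in> SG n ==> regular_mat n (%x. b)" unfolding regular_mat_def by (auto intro: regular_const)

lemma regular_mat_mult:
 assumes "regular_mat n \<phi>" "regular_mat n \<psi>" shows "regular_mat n (%x. \<phi> x * \<psi> x)" unfolding regular_mat_def
proof (intro conjI ballI allI impI)
 fix i j assume ij: "i < n" "j < n"
 have "regular n (%x. \<Sum>l<n. \<phi> x $$ (i, l) * \<psi> x $$ (l, j))"
  using assms ij unfolding regular_mat_def by (intro regular_sum regular_mult) auto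
 thus "regular n (%x. (\<phi> x * \<psi> x) $$ (i, j))"
 proof (rule regular_cong)
  fix x assume "x \<in> SG n"
  hence "\<phi> x \<in> sqm n" "\<psi> x \<in> sqm n" using assms unfolding regular_mat_def by (auto intro: SL_carrier)
  thus "(\<Sum>l<n. \<phi> x $$ (i, l) * \<psi> x $$ (l, j)) = (\<phi> x * \<psi> x) $$ (i, j)"
   using ij by (intro mult_mat_sum[symmetric])
 qed
qed (use assms in \<open>auto simp: regular_mat_def\<close>)

lemma regular_mat_ginv: "regular_mat n ginv" unfolding regular_mat_def
proof (intro conjI ballI allI impI)
 fix i j assume ij: "i < n" "j < n"
 define e where "e x k l = x $$ (if k < j then k else Suc k, if l < i then l else Suc l)" for x :: "complex mat" and k l
 have "regular n (%x. (- 1) ^ (j + i) * (\<Sum>p\<in>{p. p permutes {0..<n - 1}}. signof p * (\<Prod>k=0..<n - 1. e x k (p k))))"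
 proof (intro regular_mult regular_const regular_sum regular_prod)
  fix p k assume "p \<in> {p. p permutes {0..<n - 1}}" "k \<in> {0..<n - 1}"
  hence "k < n - 1" "p k < n - 1" using permutes_in_image[of p "{0..<n - 1}" k] by auto
  thus "regular n (%x. e x k (p k))" unfolding e_def by (intro regular_coord) auto
 qed
 thus "regular n (%x. ginv x $$ (i, j))"
 proof (rule regular_cong)
  fix x assume x: "x \<in> SG n"
  have xC: "x \<in> sqm n" using x by simp
  have "ginv x $$ (i, j) = cofactor x j i" using ij x carrier_matD[OF xC] by (simp add: ginv_def adj_mat_def)
  also have "\<dots> = (- 1) ^ (j + i) * det (mat_delete x j i)" by (simp add: cofactor_def)
  also have "det (mat_delete x j i) = (\<Sum>p\<in>{p. p permutes {0..<n - 1}}. signof p * (\<Prod>k=0..<n - 1. mat_delete x j i $$ (k, p k)))"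
   by (rule det_def') (use xC ij in \<open>auto simp: mat_delete_def\<close>)
  also have "\<dots> = (\<Sum>p\<in>{p. p permutes {0..<n - 1}}. signof p * (\<Prod>k=0..<n - 1. e x k (p k)))"
  proof (intro sum.cong refl arg_cong2[where f = "(*)"] prod.cong)
   fix p k assume "p \<in> {p. p permutes {0..<n - 1}}" "k \<in> {0..<n - 1}"
   hence "k < n - 1" "p k < n - 1" using permutes_in_image[of p "{0..<n - 1}" k] by auto
   thus "mat_delete x j i $$ (k, p k) = e x k (p k)" using xC ij by (simp add: mat_delete_def e_def)
  qed
  finally show "(- 1) ^ (j + i) * (\<Sum>p\<in>{p. p permutes {0..<n - 1}}. signof p * (\<Prod>k=0..<n - 1. e x k (p k))) = ginv x $$ (i, j)" by simp
 qed
qed auto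

lemma regular_mat_comp: assumes "regular_mat n \<phi>" "regular_mat n \<psi>" shows "regular_mat n (%x. \<phi> (\<psi> x))"
 unfolding regular_mat_def
proof (intro conjI ballI allI impI)
 fix x assume "x \<in> SG n"
 hence "\<psi> x \<in> SG n" using assms(2) by (simp add: regular_mat_def)
 thus "\<phi> (\<psi> x) \<in> SG n" using assms(1) by (simp add: regular_mat_def)
next
 fix i j assume "i < n" "j < n"
 hence "regular n (%x. \<phi> x $$ (i, j))" using assms(1) by (simp add: regular_mat_def)
 thus "regular n (%x. \<phi> (\<psi> x) $$ (i, j))" by (rule regular_comp[OF _ assms(2)])
qed

lemma regular_mat_inverse: "regular_mat n \<phi> ==> regular_mat n (%x. ginv (\<phi> x))"
 by (rule regular_mat_comp[OF regular_mat_ginv])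

section \<open>Connected groups\<close>

lemma SL_ops [simp]: "mult (SL n) = (*)" "one (SL n) = idm n" unfolding SL_def by simp_all

lemma SL_inv [simp]: assumes a: "a \<in> SG n" shows "m_inv (SL n) a = ginv a"
proof (rule group.inv_equality[OF group_SL])
 show "mult (SL n) (ginv a) a = one (SL n)" unfolding SL_ops using ginv_left[OF SL_GL[OF a]] .
 show "a \<in> SG n" by (rule a)
 show "ginv a \<in> SG n" using a by (rule SL_ginv)
qed

lemma SL_cancel [simp]:
 assumes "g \<in> SG n"
 shows "g * ginv g = idm n" "ginv g * g = idm n" "ginv (ginv g) = g"
  "A \<in> sqm n ==> ginv g * (g * A) = A" "A \<in> sqm n ==> g * (ginv g * A) = A" using SL_GL[OF assms] by simp_all

lemma subgroup_SL:
 "subgroup H (SL n) \<longleftrightarrow> H \<subseteq> SG n & idm n \<in> H & (\<forall>a\<in>H. \<forall>b\<in>H. a * b \<in> H) & (\<forall>a\<in>H. ginv a \<in> H)"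
proof
 assume H: "subgroup H (SL n)"
 hence sub: "H \<subseteq> SG n" by (rule subgroup.subset)
 have "ginv a \<in> H" if "a \<in> H" for a using subgroup.m_inv_closed[OF H that] SL_inv[of a n] sub that by auto
 thus "H \<subseteq> SG n & idm n \<in> H & (\<forall>a\<in>H. \<forall>b\<in>H. a * b \<in> H) & (\<forall>a\<in>H. ginv a \<in> H)"
  using sub subgroup.m_closed[OF H] subgroup.one_closed[OF H] by simp
next
 assume H: "H \<subseteq> SG n & idm n \<in> H & (\<forall>a\<in>H. \<forall>b\<in>H. a * b \<in> H) & (\<forall>a\<in>H. ginv a \<in> H)"
 hence "m_inv (SL n) a \<in> H" if "a \<in> H" for a using SL_inv[of a n] that by auto
 thus "subgroup H (SL n)" using H by (intro subgroup.intro) auto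
qed

text \<open>A connected group admits no nonconstant regular function with finitely many values; unlike
 connectedness itself, this property passes to the derived subgroup by a direct computation.\<close>

definition rigid :: "nat => complex mat set => bool" where
 "rigid n H \<longleftrightarrow> (\<forall>f. regular n f --> finite (f ` H) --> (\<forall>h\<in>H. f h = f (idm n)))"

lemma rigidD: "rigid n H ==> regular n f ==> finite (f ` H) ==> h \<in> H ==> f h = f (idm n)" unfolding rigid_def by blast

lemma connected_rigid:
 assumes con: "connectedin (SL_topology n) H" and sub: "H \<subseteq> SG n" and one: "idm n \<in> H"
 shows "rigid n H" unfolding rigid_def
proof (intro allI impI ballI, rule ccontr)
 fix f h assume f: "regular n f" "finite (f ` H)" and h: "h \<in> H" "f h ~= f (idm n)"
 let ?C = "{%A. A $$ (i, j) | i j. i < n & j < n} :: (complex mat => complex) set"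
 obtain f' where f': "f' \<in> poly_funs ?C" "\<forall>x\<in>SG n. f x = f' x" using f(1) unfolding regular_def by blast
 define c where "c = f (idm n)"
 define R where "R = f ` H - {c}"
 have fR: "finite R" unfolding R_def using f(2) by blast
 have g1: "(%x. f' x + - c) \<in> poly_funs ?C" using f'(1) by (intro poly_funs.add poly_funs.const)
 have g2: "(%x. \<Prod>a\<in>R. f' x + - a) \<in> poly_funs ?C" using f'(1) by (intro poly_funs_prod poly_funs.add poly_funs.const)
 define E1 where "E1 = {x \<in> SG n. \<forall>g\<in>{%x. f' x + - c}. g x = 0}"
 define E2 where "E2 = {x \<in> SG n. \<forall>g\<in>{%x. \<Prod>a\<in>R. f' x + - a}. g x = 0}"
 have "closedin (SL_topology n) E1" unfolding SL_topology_def closedin_zariski E1_def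
  by (rule exI[of _ "{%x. f' x + - c}"]) (use g1 in blast)
 moreover have "closedin (SL_topology n) E2" unfolding SL_topology_def closedin_zariski E2_def
  by (rule exI[of _ "{%x. \<Prod>a\<in>R. f' x + - a}"]) (use g2 in blast)
 moreover have m1: "x \<in> E1 \<longleftrightarrow> f x = c" and m2: "x \<in> E2 \<longleftrightarrow> f x \<in> R" if "x \<in> H" for x
  using that sub f'(2) fR by (auto simp: E1_def E2_def)
 have "H \<subseteq> E1 \<union> E2"
 proof
  fix x assume "x \<in> H"
  thus "x \<in> E1 \<union> E2" using m1[of x] m2[of x] by (auto simp: R_def)
 qed
 moreover have "E1 \<inter> E2 \<inter> H = {}" using m1 m2 by (auto simp: R_def)
 moreover have "E1 \<inter> H ~= {}" using m1[OF one] one by (auto simp: c_def)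
 moreover have "E2 \<inter> H ~= {}" using m2[OF h(1)] h by (auto simp: R_def c_def)
 ultimately show False using con unfolding connectedin_closedin by blast
qed

lemma commutator_derived:
 assumes H: "subgroup H (SL n)" and ab: "a \<in> H" "b \<in> H"
 shows "a * b * ginv a * ginv b \<in> derived (SL n) H"
proof -
 have "a \<in> SG n" "b \<in> SG n" using ab subgroup.subset[OF H] by auto
 thus ?thesis unfolding derived_def by (intro generate.incl) (use ab in force)
qed

text \<open>For fixed \<open>b\<close> the commutator of \<open>a\<close> and \<open>b\<close> is a regular function of \<open>a\<close> that is trivial for \<open>a = 1\<close>, so on commutators a function with finitely many values has the value at \<open>1\<close>; products are reached by translation.\<close>

lemma rigid_derived:
 assumes H: "subgroup H (SL n)" and r: "rigid n H"
 shows "rigid n (derived (SL n) H)" unfolding rigid_def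
proof (intro allI impI ballI)
 fix f h assume f: "regular n f" "finite (f ` derived (SL n) H)" and h: "h \<in> derived (SL n) H"
 have HS: "H \<subseteq> SG n" using H by (rule subgroup.subset)
 have D: "subgroup (derived (SL n) H) (SL n)" using group.derived_is_subgroup[OF group_SL HS] .
 have comm: "f (a * b * ginv a * ginv b) = f (idm n)"
  if f: "regular n f" "finite (f ` derived (SL n) H)" and ab: "a \<in> H" "b \<in> H" for f a b
 proof -
  have abS: "a \<in> SG n" "b \<in> SG n" using ab HS by auto
  have "regular n (%x. f (x * b * ginv x * ginv b))"
   using abS by (intro regular_comp[OF f(1)] regular_mat_mult regular_mat_id regular_mat_const regular_mat_inverse SL_ginv)
  moreover have "finite ((%x. f (x * b * ginv x * ginv b)) ` H)"
   using commutator_derived[OF H _ ab(2)] by (intro finite_subset[OF _ f(2)]) auto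
  ultimately have "f (a * b * ginv a * ginv b) = f (idm n * b * ginv (idm n) * ginv b)"
   using rigidD[OF r, of "%x. f (x * b * ginv x * ginv b)" a] ab(1) by blast
  also have "idm n * b * ginv (idm n) * ginv b = idm n" using abS by simp
  finally show ?thesis .
 qed
 have "\<forall>f. regular n f --> finite (f ` derived (SL n) H) --> f h = f (idm n)" using h unfolding derived_def
 proof (induction)
  case one
  show ?case by simp
 next
  case (incl h)
  then obtain a b where ab: "a \<in> H" "b \<in> H" "h = a * b * m_inv (SL n) a * m_inv (SL n) b" by auto
  have "a \<in> SG n" "b \<in> SG n" using ab HS by auto
  hence "h = a * b * ginv a * ginv b" using ab(3) by simp
  thus ?case using comm ab(1,2) unfolding derived_def by blast
 next
  case (inv h)
  then obtain a b where ab: "a \<in> H" "b \<in> H" "h = a * b * m_inv (SL n) a * m_inv (SL n) b" by auto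
  have S: "a \<in> SG n" "b \<in> SG n" using ab HS by auto
  hence h: "h = a * b * ginv a * ginv b" using ab(3) by simp
  have hS: "h \<in> SG n" unfolding h using S by (intro SL_mult SL_ginv)
  have "m_inv (SL n) h = ginv h" using hS by simp
  also have "ginv h = b * a * ginv b * ginv a" unfolding h using S by (simp add: ginv_mult[of _ n] mult_assoc_sq[of _ n])
  finally show ?case using comm ab(1,2) unfolding derived_def by auto
 next
  case (eng h1 h2)
  have S: "h1 \<in> derived (SL n) H" "h2 \<in> derived (SL n) H" using eng.hyps by (simp_all add: derived_def)
  have S': "h1 \<in> SG n" "h2 \<in> SG n" using S subgroup.subset[OF D] by auto
  show ?case
  proof (intro allI impI)
   fix f assume f: "regular n f" "finite (f ` generate (SL n) (\<Union>h1\<in>H. \<Union>h2\<in>H. {h1 \<otimes>\<^bsub>SL n\<^esub> h2 \<otimes>\<^bsub>SL n\<^esub> inv\<^bsub>SL n\<^esub> h1 \<otimes>\<^bsub>SL n\<^esub> inv\<^bsub>SL n\<^esub> h2}))"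
   hence f2: "finite (f ` derived (SL n) H)" by (simp only: derived_def)
   have "regular n (%x. f (x * h2))" using S' by (intro regular_comp[OF f(1)] regular_mat_mult regular_mat_id regular_mat_const)
   moreover have "finite ((%x. f (x * h2)) ` derived (SL n) H)"
    using S(2) D unfolding subgroup_SL by (intro finite_subset[OF _ f2]) auto
   ultimately have "f (h1 * h2) = f (idm n * h2)" using eng.IH(1)[rule_format, of "%x. f (x * h2)"] unfolding derived_def by blast
   also have "\<dots> = f h2" using S' by simp
   also have "\<dots> = f (idm n)" using eng.IH(2) f by blast
   finally show "f (h1 \<otimes>\<^bsub>SL n\<^esub> h2) = f (idm n)" by simp
  qed
 qed
 thus "f h = f (idm n)" using f by blast
qed

section \<open>The Lie--Kolchin theorem\<close>

locale sl_rep =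
 fixes n m :: nat and \<rho> :: "complex mat => nat => nat => complex"
 assumes m: "m > 0" and reg: "\<And>i j. i < m ==> j < m ==> regular n (%x. \<rho> x i j)"
begin

definition act :: "complex mat => (nat => complex) => nat => complex" where
 "act h v = (%i. if i < m then \<Sum>j<m. \<rho> h i j * v j else 0)"

lemma act_lin: "act h (%i. a * u i + b * v i) = (%i. a * act h u i + b * act h v i)"
 unfolding act_def by (intro ext) (simp add: algebra_simps sum.distrib sum_distrib_left)

lemma act_scale: "act h (%i. a * u i) = (%i. a * act h u i)" using act_lin[of h a u 0 u] by simp

definition rep_on :: "complex mat set => bool" where
 "rep_on H \<longleftrightarrow> subgroup H (SL n) & (\<forall>i<m. \<forall>j<m. \<rho> (idm n) i j = (if i = j then 1 else 0)) &
   (\<forall>a\<in>H. \<forall>b\<in>H. \<forall>i<m. \<forall>j<m. \<rho> (a * b) i j = (\<Sum>l<m. \<rho> a i l * \<rho> b l j))"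

lemma act_mult: assumes "rep_on H" "a \<in> H" "b \<in> H" shows "act (a * b) v = act a (act b v)"
proof
 fix i
 show "act (a * b) v i = act a (act b v) i"
 proof (cases "i < m")
  case True
  have "act (a * b) v i = (\<Sum>j<m. \<Sum>l<m. \<rho> a i l * \<rho> b l j * v j)"
   using True assms unfolding act_def rep_on_def by (simp add: sum_distrib_right)
  also have "\<dots> = (\<Sum>l<m. \<Sum>j<m. \<rho> a i l * \<rho> b l j * v j)" by (rule sum.swap)
  also have "\<dots> = act a (act b v) i" using True by (simp add: act_def sum_distrib_left mult.assoc)
  finally show ?thesis .
 qed (simp add: act_def)
qed

lemma act_one: assumes "rep_on H" "\<And>i. i \<ge> m ==> v i = 0" shows "act (idm n) v = v"
proof
 fix i
 show "act (idm n) v i = v i"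
 proof (cases "i < m")
  case True
  have "(\<Sum>j<m. \<rho> (idm n) i j * v j) = (\<Sum>j<m. if j = i then v j else 0)"
   using assms(1) True unfolding rep_on_def by (intro sum.cong) auto
  thus ?thesis using True by (simp add: act_def)
 qed (use assms(2) in \<open>simp add: act_def\<close>)
qed

lemma act_nonzero:
 assumes "rep_on H" "h \<in> H" "\<And>i. i \<ge> m ==> v i = 0" "v ~= (%_. 0)" shows "act h v ~= (%_. 0)"
proof
 assume 0: "act h v = (%_. 0)"
 have H: "subgroup H (SL n)" using assms(1) by (simp add: rep_on_def)
 have hS: "h \<in> SG n" "ginv h \<in> H" using H assms(2) unfolding subgroup_SL by auto
 have "v = act (ginv h * h) v" using act_one[OF assms(1), of v] assms(3) hS by simp
 also have "\<dots> = act (ginv h) (act h v)" using assms(1) hS(2) assms(2) by (rule act_mult)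
 also have "\<dots> = (%_. 0)" by (subst 0, rule ext) (simp add: act_def)
 finally show False using assms(4) by blast
qed

definition eigs :: "complex mat => complex set" where
 "eigs h = {c. \<exists>u. (\<exists>i<m. u i ~= 0) & (\<forall>i<m. (\<Sum>j<m. \<rho> h i j * u j) = c * u i)}"

lemma finite_eigs: "finite (eigs h)" unfolding eigs_def by (rule finite_eigenvalues)

lemma eigsI: "act h u = (%i. c * u i) ==> (\<And>i. i \<ge> m ==> u i = 0) ==> u ~= (%_. 0) ==> c \<in> eigs h"
 unfolding eigs_def act_def by (intro CollectI exI[of _ u]) (metis not_le)

lemma act_support: "i \<ge> m ==> act h v i = 0" by (simp add: act_def)

text \<open>Let \<open>W0\<close> be a weight space of the derived group. Conjugates of a derived element have the same finite set of eigenvalues, so rigidity makes \<open>W0\<close> stable. A commutator of \<open>a\<close> and \<open>b\<close> acts on \<open>W0\<close> by a scalar that is a quotient of eigenvalues of \<open>b\<close>, so by rigidity again this scalar is \<open>1\<close>. Thus the group acts on \<open>W0\<close> by commuting operators, and a smallest stable subspace of \<open>W0\<close> consists of common eigenvectors.\<close>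

theorem common_eigenvector:
 assumes "rep_on H" "rigid n H" "(derived (SL n) ^^ k) H = {idm n}"
 shows "\<exists>v \<omega>. v ~= (%_. 0) & (\<forall>i\<ge>m. v i = 0) & (\<forall>h\<in>H. act h v = (%i. \<omega> h * v i))"
 using assms
proof (induction k arbitrary: H)
 case 0
 define v where "v = (%i :: nat. if i = 0 then 1 else 0 :: complex)"
 have sup: "v i = 0" if "i \<ge> m" for i using that m by (simp add: v_def)
 have "v 0 ~= 0" by (simp add: v_def)
 hence "v ~= (%_. 0)" by metis
 moreover have "act h v = (%i. 1 * v i)" if "h \<in> H" for h using that 0(3) act_one[OF 0(1), of v] sup by simp
 ultimately show ?case using sup by (intro exI[of _ v] exI[of _ "%_. 1"]) auto
next
 case (Suc k)
 define D where "D = derived (SL n) H"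
 have H: "subgroup H (SL n)" using Suc.prems(1) by (simp add: rep_on_def)
 have HS: "H \<subseteq> SG n" and H1: "idm n \<in> H" and Hm: "\<And>a b. a \<in> H ==> b \<in> H ==> a * b \<in> H" and Hi: "\<And>a. a \<in> H ==> ginv a \<in> H"
  using H unfolding subgroup_SL by auto
 have DS: "subgroup D (SL n)" unfolding D_def using group.derived_is_subgroup[OF group_SL HS] .
 have DH: "D \<subseteq> H" unfolding D_def using group.derived_incl[OF group_SL subset_refl H] .
 have D1: "idm n \<in> D" and Dm: "\<And>a b. a \<in> D ==> b \<in> D ==> a * b \<in> D" using DS unfolding subgroup_SL by auto
 have repD: "rep_on D" using Suc.prems(1) DS DH unfolding rep_on_def by blast
 obtain v0 \<omega> where v0: "v0 ~= (%_. 0)" "\<And>i. i \<ge> m ==> v0 i = 0" "\<And>h. h \<in> D ==> act h v0 = (%i. \<omega> h * v0 i)"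
 proof -
  have "rigid n D" unfolding D_def using H Suc.prems(2) by (rule rigid_derived)
  moreover have "(derived (SL n) ^^ k) D = {idm n}" using Suc.prems(3) by (simp add: D_def funpow_swap1)
  ultimately show thesis using Suc.IH[OF repD] that by blast
 qed
 then obtain i0 where i0: "v0 i0 ~= 0" by (auto simp: fun_eq_iff)
 hence i0m: "i0 < m" using v0(2)[of i0] by (meson not_le)
 define F where "F h = (\<Sum>j<m. \<rho> h i0 j * (v0 j / v0 i0))" for h
 have F\<omega>: "F h = \<omega> h" if "h \<in> D" for h
 proof -
  have "(\<Sum>j<m. \<rho> h i0 j * v0 j) = \<omega> h * v0 i0" using fun_cong[OF v0(3)[OF that], of i0] i0m by (simp add: act_def)
  moreover have "F h = (\<Sum>j<m. \<rho> h i0 j * v0 j) / v0 i0" unfolding F_def sum_divide_distrib by simp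
  ultimately show ?thesis using i0 by simp
 qed
 have regF: "regular n F" unfolding F_def using i0m by (intro regular_sum regular_mult reg regular_const) auto
 have conjD: "ginv x * h * x \<in> D" if "h \<in> D" "x \<in> H" for h x
 proof -
  have S: "h \<in> SG n" "x \<in> SG n" "h \<in> H" using that DH HS by auto
  have "ginv h * ginv x * ginv (ginv h) * ginv (ginv x) \<in> D"
   unfolding D_def using S(3) that(2) by (intro commutator_derived[OF H] Hi)
  hence "h * (ginv h * ginv x * h * x) \<in> D" using Dm[OF that(1)] S by simp
  thus ?thesis using S by (simp add: mult_assoc_sq[of _ n])
 qed
 have \<omega>conj: "\<omega> (ginv x * h * x) = \<omega> h" if h: "h \<in> D" and x: "x \<in> H" for h x
 proof -
  have S: "h \<in> SG n" "h \<in> H" using h DH HS by auto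
  have "regular n (%y. F (ginv y * h * y))"
   using S by (intro regular_comp[OF regF] regular_mat_mult regular_mat_id regular_mat_const regular_mat_inverse)
  moreover have "F (ginv y * h * y) \<in> eigs h" if y: "y \<in> H" for y
  proof -
   have yS: "y \<in> SG n" using y HS by auto
   have yc: "ginv y * h * y \<in> D" "ginv y * h * y \<in> H" using conjD[OF h y] DH by auto
   have "act h (act y v0) = act (h * y) v0" using act_mult[OF Suc.prems(1) S(2) y] by simp
   also have "h * y = y * (ginv y * h * y)" using S yS by (simp add: mult_assoc_sq[of _ n])
   also have "act (y * (ginv y * h * y)) v0 = act y (%i. \<omega> (ginv y * h * y) * v0 i)"
    using act_mult[OF Suc.prems(1) y yc(2)] v0(3)[OF yc(1)] by simp
   also have "\<dots> = (%i. \<omega> (ginv y * h * y) * act y v0 i)" by (rule act_scale)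
   finally have "\<omega> (ginv y * h * y) \<in> eigs h"
    using act_nonzero[OF Suc.prems(1) y, of v0] v0(1,2) by (intro eigsI) (auto simp: act_support)
   thus ?thesis using F\<omega>[OF yc(1)] by simp
  qed
  hence "finite ((%y. F (ginv y * h * y)) ` H)" by (intro finite_subset[OF _ finite_eigs[of h]]) auto
  ultimately have "F (ginv x * h * x) = F (ginv (idm n) * h * idm n)"
   using rigidD[OF Suc.prems(2), of "%y. F (ginv y * h * y)" x] x by blast
  thus ?thesis using F\<omega>[OF h] F\<omega>[OF conjD[OF h x]] S by simp
 qed
 define W0 where "W0 = {v. (\<forall>i\<ge>m. v i = 0) & (\<forall>h\<in>D. act h v = (%i. \<omega> h * v i))}"
 have W0: "vsub m W0" unfolding vsub_def W0_def by (auto simp: act_lin fun_eq_iff algebra_simps) (simp add: act_def)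
 have W0st: "act x v \<in> W0" if "x \<in> H" "v \<in> W0" for x v
 proof -
  have "act h (act x v) = (%i. \<omega> h * act x v i)" if h: "h \<in> D" for h
  proof -
   have S: "h \<in> SG n" "h \<in> H" "x \<in> SG n" using h DH HS \<open>x \<in> H\<close> by auto
   have yc: "ginv x * h * x \<in> D" "ginv x * h * x \<in> H" using conjD[OF h \<open>x \<in> H\<close>] DH by auto
   have "act h (act x v) = act (h * x) v" using act_mult[OF Suc.prems(1) S(2) \<open>x \<in> H\<close>] by simp
   also have "h * x = x * (ginv x * h * x)" using S by (simp add: mult_assoc_sq[of _ n])
   also have "act (x * (ginv x * h * x)) v = act x (%i. \<omega> (ginv x * h * x) * v i)"
    using act_mult[OF Suc.prems(1) \<open>x \<in> H\<close> yc(2)] \<open>v \<in> W0\<close> yc(1) unfolding W0_def by simp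
   also have "\<dots> = (%i. \<omega> h * act x v i)" unfolding act_scale \<omega>conj[OF h \<open>x \<in> H\<close>] ..
   finally show ?thesis .
  qed
  thus ?thesis unfolding W0_def by (auto simp: act_support)
 qed
 have v0W: "v0 \<in> W0" unfolding W0_def using v0 by auto
 have sup: "v i = 0" if "v \<in> W0" "i \<ge> m" for v i using that by (simp add: W0_def)
 have \<omega>comm: "\<omega> (a * b * ginv a * ginv b) = 1" if a: "a \<in> H" and b: "b \<in> H" for a b
 proof -
  have bS: "b \<in> SG n" using b HS by auto
  have cD: "y * b * ginv y * ginv b \<in> D" if "y \<in> H" for y unfolding D_def using commutator_derived[OF H that b] .
  have "\<exists>u c. u \<in> W0 & u ~= (%_. 0) & act b u = (%i. c * u i)"
   by (rule eigenvector_in_subspace[OF W0 _ _ v0W v0(1)]) (rule W0st[OF b], assumption, rule act_lin)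
  then obtain u c where u: "u \<in> W0" "u ~= (%_. 0)" "act b u = (%i. c * u i)" by blast
  have "regular n (%y. F (y * b * ginv y * ginv b))"
   using bS by (intro regular_comp[OF regF] regular_mat_mult regular_mat_id regular_mat_const regular_mat_inverse SL_ginv)
  moreover have "F (y * b * ginv y * ginv b) \<in> (%e. c / e) ` eigs b" if y: "y \<in> H" for y
  proof -
   define d where "d = \<omega> (y * b * ginv y * ginv b)"
   have yS: "y \<in> SG n" using y HS by auto
   have "act (y * b) u = (%i. c * act y u i)" using act_mult[OF Suc.prems(1) y b] u(3) act_scale by simp
   moreover have "y * b = (y * b * ginv y * ginv b) * (b * y)" using yS bS by (simp add: mult_assoc_sq[of _ n])
   moreover have "act ((y * b * ginv y * ginv b) * (b * y)) u = (%i. d * act (b * y) u i)"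
    using act_mult[OF Suc.prems(1) subsetD[OF DH cD[OF y]] Hm[OF b y]] W0st[OF Hm[OF b y] u(1)] cD[OF y] unfolding W0_def d_def by simp
   ultimately have eq: "(%i. d * act b (act y u) i) = (%i. c * act y u i)" using act_mult[OF Suc.prems(1) b y] by simp
   have nz: "act y u ~= (%_. 0)" using act_nonzero[OF Suc.prems(1) y, of u] sup[OF u(1)] u(2) by simp
   have c0: "c ~= 0" using act_nonzero[OF Suc.prems(1) b, of u] sup[OF u(1)] u(2) u(3) by auto
   have d0: "d ~= 0"
   proof
    assume "d = 0"
    hence "(%i. c * act y u i) = (%_. 0)" using eq by simp
    thus False using nz c0 by (auto simp: fun_eq_iff)
   qed
   have "act b (act y u) i = (c / d) * act y u i" for i using fun_cong[OF eq, of i] d0 by (simp add: field_simps)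
   hence "c / d \<in> eigs b" using nz by (intro eigsI[of b "act y u"]) (auto simp: act_support)
   moreover have "d = c / (c / d)" using c0 d0 by simp
   ultimately show ?thesis using F\<omega>[OF cD[OF y]] unfolding d_def[symmetric] by blast
  qed
  hence "finite ((%y. F (y * b * ginv y * ginv b)) ` H)" using finite_eigs[of b] by (meson finite_imageI finite_subset image_subsetI)
  ultimately have "F (a * b * ginv a * ginv b) = F (idm n * b * ginv (idm n) * ginv b)"
   using rigidD[OF Suc.prems(2), of "%y. F (y * b * ginv y * ginv b)" a] a by blast
  also have "idm n * b * ginv (idm n) * ginv b = idm n" using bS by simp
  also have "F (idm n) = 1"
  proof -
   have "\<omega> (idm n) * v0 i0 = v0 i0" using fun_cong[OF v0(3)[OF D1], of i0] act_one[OF Suc.prems(1), of v0] v0(2) by simp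
   thus ?thesis using i0 F\<omega>[OF D1] by simp
  qed
  finally show ?thesis using F\<omega>[OF cD[OF a]] by simp
 qed
 have commute: "act a (act b v) = act b (act a v)" if a: "a \<in> H" and b: "b \<in> H" and v: "v \<in> W0" for a b v
 proof -
  have S: "a \<in> SG n" "b \<in> SG n" using a b HS by auto
  have cD: "a * b * ginv a * ginv b \<in> D" unfolding D_def using commutator_derived[OF H a b] .
  have "act a (act b v) = act (a * b) v" using act_mult[OF Suc.prems(1) a b] by simp
  also have "a * b = (a * b * ginv a * ginv b) * (b * a)" using S by (simp add: mult_assoc_sq[of _ n])
  also have "act ((a * b * ginv a * ginv b) * (b * a)) v = act (b * a) v"
   using act_mult[OF Suc.prems(1) subsetD[OF DH cD] Hm[OF b a]] W0st[OF Hm[OF b a] v] cD \<omega>comm[OF a b] unfolding W0_def by simp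
  also have "\<dots> = act b (act a v)" using act_mult[OF Suc.prems(1) b a] by simp
  finally show ?thesis .
 qed
 define good where "good W \<longleftrightarrow> vsub m W & W \<subseteq> W0 & (\<exists>w\<in>W. w ~= (%_. 0)) & (\<forall>x\<in>H. \<forall>w\<in>W. act x w \<in> W)" for W
 have "good W0" unfolding good_def using W0 v0W v0(1) W0st by blast
 then obtain W where W: "good W" "\<And>E. good E ==> card (leading m W) \<le> card (leading m E)"
  using ex_has_least_nat[of good W0 "%W. card (leading m W)"] by blast
 have Ws: "vsub m W" "W \<subseteq> W0" "\<And>x w. x \<in> H ==> w \<in> W ==> act x w \<in> W" using W(1) unfolding good_def by auto
 obtain w where w: "w \<in> W" "w ~= (%_. 0)" using W(1) unfolding good_def by blast
 have "\<exists>c. act b w = (%i. c * w i)" if b: "b \<in> H" for b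
 proof -
  have "\<exists>u c. u \<in> W & u ~= (%_. 0) & act b u = (%i. c * u i)"
   by (rule eigenvector_in_subspace[OF Ws(1) _ _ w]) (rule Ws(3)[OF b], assumption, rule act_lin)
  then obtain u c where u: "u \<in> W" "u ~= (%_. 0)" "act b u = (%i. c * u i)" by blast
  define E where "E = {w \<in> W. act b w = (%i. c * w i)}"
  have vE: "vsub m E"
   unfolding vsub_def E_def using vsubD[OF Ws(1)] by (auto simp: act_lin fun_eq_iff algebra_simps) (simp add: act_def)
  have "act b (act x w) = (%i. c * act x w i)" if "x \<in> H" "w \<in> E" for x w
   using commute[OF b that(1), of w] that(2) Ws(2) act_scale[of x c w] unfolding E_def by auto
  hence "good E" unfolding good_def using vE u Ws by (auto simp: E_def)
  hence "card (leading m W) \<le> card (leading m E)" by (rule W(2))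
  moreover have "leading m E \<subseteq> leading m W" "finite (leading m W)" unfolding leading_def E_def by auto
  ultimately have "leading m E = leading m W" by (intro card_seteq) auto
  hence "E = W" using vE Ws(1) by (intro leading_eq) (auto simp: E_def)
  thus ?thesis using w(1) unfolding E_def by blast
 qed
 then obtain \<omega>' where "\<And>b. b \<in> H ==> act b w = (%i. \<omega>' b * w i)" by metis
 thus ?case using w Ws(2) sup by (intro exI[of _ w] exI[of _ \<omega>']) auto
qed

end

lemma sum_shift:
 fixes F :: "nat => complex"
 assumes "j0 \<le> n" "\<And>l. l < j0 ==> F l = 0" shows "(\<Sum>l<n. F l) = (\<Sum>j<n - j0. F (j + j0))"
proof -
 have "(\<Sum>j<n - j0. F (j + j0)) = (\<Sum>l\<in>(%j. j + j0) ` {..<n - j0}. F l)" by (subst sum.reindex) (auto simp: inj_on_def)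
 also have "\<dots> = (\<Sum>l<n. F l)"
 proof (rule sum.mono_neutral_left)
  show "\<forall>i\<in>{..<n} - (%j. j + j0) ` {..<n - j0}. F i = 0"
  proof
   fix i assume i: "i \<in> {..<n} - (%j. j + j0) ` {..<n - j0}"
   have "i < j0"
   proof (rule ccontr)
    assume "\<not> i < j0"
    hence "i = (i - j0) + j0" "i - j0 \<in> {..<n - j0}" using i by auto
    thus False using i by blast
   qed
   thus "F i = 0" by (rule assms(2))
  qed
 qed auto
 finally show ?thesis by simp
qed

lemma extend_column:
 assumes q: "j0 \<le> q" "q < n" "v q ~= 0"
 shows "\<exists>f\<in>GL n. (\<forall>r<n. \<forall>c<j0. f $$ (r, c) = (if r = c then 1 else 0)) & (\<forall>r<n. f $$ (r, j0) = v r)"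
proof -
 define E where "E = mat n n (%(r, c). if c = q then v r else if r = c then 1 else 0)"
 define w where "w r = (if r = q then 1 / v q else - v r / v q)" for r
 define E' where "E' = mat n n (%(r, c). if c = q then w r else if r = c then 1 else 0)"
 have C: "E \<in> sqm n" "E' \<in> sqm n" by (auto simp: E_def E'_def)
 have "E * E' = idm n"
 proof (rule eq_matI)
  fix r c assume "r < dim_row (idm n :: complex mat)" "c < dim_col (idm n :: complex mat)"
  hence rc: "r < n" "c < n" by auto
  show "(E * E') $$ (r, c) = idm n $$ (r, c)"
  proof (cases "c = q")
   case True
   have "(E * E') $$ (r, c) = (\<Sum>l<n. (if l = r then (if r = q then 0 else w r) else 0) + (if l = q then v r * w q else 0))"
    unfolding mult_mat_sum[OF C rc] using True rc q by (intro sum.cong) (auto simp: E_def E'_def)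
   also have "\<dots> = (if r = q then 0 else w r) + v r * w q" using rc q by (simp add: sum.distrib)
   finally show ?thesis using rc q True by (auto simp: w_def)
  next
   case False
   have "(E * E') $$ (r, c) = (\<Sum>l<n. if l = c then E $$ (r, l) else 0)"
    unfolding mult_mat_sum[OF C rc] using False rc by (intro sum.cong) (auto simp: E'_def)
   thus ?thesis using rc False by (auto simp: E_def)
  qed
 qed (use C in auto)
 hence EG: "E \<in> GL n" using GL_I[OF C] by blast
 define s where "s = Transposition.transpose j0 q"
 have s: "s permutes {..<n}" unfolding s_def using q by (intro permutes_swap_id) auto
 have ent: "(E * perm_mat n s) $$ (r, s c) = E $$ (r, c)" if "r < n" "c < n" for r c using perm_mat_right[OF C(1) s that] .
 show ?thesis
 proof (intro bexI[of _ "E * perm_mat n s"] conjI allI impI)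
  show "E * perm_mat n s \<in> GL n" using EG perm_mat_GL(1)[OF s] by (rule GL_mult)
  fix r assume r: "r < n"
  show "(E * perm_mat n s) $$ (r, j0) = v r" using ent[OF r q(2)] r q by (simp add: s_def E_def)
  fix c assume c: "c < j0"
  hence "s c = c" "c < n" "c ~= q" using q by (auto simp: s_def Transposition.transpose_def)
  thus "(E * perm_mat n s) $$ (r, c) = (if r = c then 1 else 0)" using ent[OF r, of c] r by (simp add: E_def)
 qed
qed

lemma conj_column:
 assumes f: "f \<in> GL n" and A: "A \<in> sqm n" and ij: "i < n" "j < n"
  and y: "\<And>r. r < n ==> (A * f) $$ (r, j) = (\<Sum>s<n. f $$ (r, s) * y s)"
 shows "(ginv f * A * f) $$ (i, j) = y i"
proof -
 have C: "ginv f \<in> sqm n" "A * f \<in> sqm n" "f \<in> sqm n" using f A by auto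
 have "(ginv f * A * f) $$ (i, j) = (ginv f * (A * f)) $$ (i, j)" using C A by (simp add: mult_assoc_sq[of _ n])
 also have "\<dots> = (\<Sum>r<n. ginv f $$ (i, r) * (\<Sum>s<n. f $$ (r, s) * y s))"
  unfolding mult_mat_sum[OF C(1,2) ij] by (intro sum.cong refl) (simp add: y)
 also have "\<dots> = (\<Sum>r<n. \<Sum>s<n. ginv f $$ (i, r) * f $$ (r, s) * y s)" by (simp add: sum_distrib_left mult.assoc)
 also have "\<dots> = (\<Sum>s<n. \<Sum>r<n. ginv f $$ (i, r) * f $$ (r, s) * y s)" by (rule sum.swap)
 also have "\<dots> = (\<Sum>s<n. (ginv f * f) $$ (i, s) * y s)"
  by (intro sum.cong refl) (subst mult_mat_sum[OF C(1,3) ij(1)], auto simp: sum_distrib_right)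
 also have "\<dots> = (\<Sum>s<n. if s = i then y s else 0)" using f ij by (intro sum.cong) auto
 finally show ?thesis using ij by simp
qed

text \<open>The first \<open>j0\<close> columns are already triangular; the block to the lower right is a representation, and a common eigenvector of it becomes the next column of the base change.\<close>

theorem lie_kolchin:
 assumes n: "n > 0" and H: "subgroup H (SL n)" and rig: "rigid n H" and der: "(derived (SL n) ^^ d) H = {idm n}"
 shows "\<exists>g\<in>SG n. \<forall>h\<in>H. ginv g * h * g \<in> upr n"
proof -
 have HS: "h \<in> SG n" if "h \<in> H" for h using H that unfolding subgroup_SL by blast
 have "\<exists>g\<in>SG n. \<forall>h\<in>H. ginv g * h * g \<in> par n (%i. min i j0)" if "j0 \<le> n" for j0 using that
 proof (induction j0)
  case 0
  have "ginv (idm n) * h * idm n \<in> par n (%i. min i 0)" if "h \<in> H" for h using SL_carrier[OF HS[OF that]] by (intro parI) auto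
  thus ?case by (intro bexI[of _ "idm n"]) auto
 next
  case (Suc j0)
  then obtain g where g: "g \<in> SG n" "\<And>h. h \<in> H ==> ginv g * h * g \<in> par n (%i. min i j0)" by (meson Suc_leD)
  have j0: "j0 < n" using Suc.prems by simp
  have gG: "g \<in> GL n" using g(1) by simp
  define M where "M h = ginv g * h * g" for h
  have MC: "M h \<in> sqm n" if "h \<in> H" for h using g(2)[OF that] by (auto simp: M_def)
  have M0: "M h $$ (i, l) = 0" if "h \<in> H" "i < n" "l < j0" "l < i" for h i l
   using parD[OF g(2)[OF that(1)], of i l] that j0 by (simp add: M_def del: index_mult_mat)
  have Mm: "M (a * b) = M a * M b" if "a \<in> H" "b \<in> H" for a b
   using gG SL_carrier[OF HS[OF that(1)]] SL_carrier[OF HS[OF that(2)]] by (simp add: M_def mult_assoc_sq[of _ n])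
  define m where "m = n - j0"
  define \<rho> where "\<rho> h i j = M h $$ (i + j0, j + j0)" for h i j
  have regM: "regular_mat n M" unfolding M_def using g(1) by (intro regular_mat_mult regular_mat_const regular_mat_id SL_ginv)
  interpret sl_rep n m \<rho>
  proof
   show "m > 0" using j0 by (simp add: m_def)
   show "regular n (%x. \<rho> x i j)" if "i < m" "j < m" for i j using regM that unfolding regular_mat_def \<rho>_def m_def by simp
  qed
  have "rep_on H" unfolding rep_on_def
  proof (intro conjI ballI allI impI H)
   fix i j assume ij: "i < m" "j < m"
   have "M (idm n) = idm n" unfolding M_def using gG by simp
   thus "\<rho> (idm n) i j = (if i = j then 1 else 0)" using ij by (simp add: \<rho>_def m_def)
   fix a b assume ab: "a \<in> H" "b \<in> H"
   have "\<rho> (a * b) i j = (\<Sum>l<n. M a $$ (i + j0, l) * M b $$ (l, j + j0))"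
    unfolding \<rho>_def Mm[OF ab] using ij by (intro mult_mat_sum[OF MC[OF ab(1)] MC[OF ab(2)]]) (auto simp: m_def)
   also have "\<dots> = (\<Sum>l<m. \<rho> a i l * \<rho> b l j)" unfolding m_def \<rho>_def
    using j0 ij M0[OF ab(1), of "i + j0"] by (intro sum_shift) (auto simp: m_def)
   finally show "\<rho> (a * b) i j = (\<Sum>l<m. \<rho> a i l * \<rho> b l j)" .
  qed
  then obtain v \<omega> where v: "v ~= (%_. 0)" "\<forall>i\<ge>m. v i = 0" "\<forall>h\<in>H. act h v = (%i. \<omega> h * v i)"
   using common_eigenvector[OF _ rig der] by blast
  define v' where "v' l = (if l < j0 then 0 else v (l - j0))" for l
  obtain q where q: "v q ~= 0" using v(1) by (auto simp: fun_eq_iff)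
  hence "q < m" using v(2) by (meson not_le)
  hence qn: "q + j0 < n" by (simp add: m_def)
  have vq: "v' (q + j0) ~= 0" using q by (simp add: v'_def)
  have "\<exists>f\<in>GL n. (\<forall>r<n. \<forall>c<j0. f $$ (r, c) = (if r = c then 1 else 0)) & (\<forall>r<n. f $$ (r, j0) = v' r)"
   by (rule extend_column[of j0 "q + j0" n v', OF _ qn vq]) simp
  then obtain f where f: "f \<in> GL n" "\<And>r c. r < n ==> c < j0 ==> f $$ (r, c) = (if r = c then 1 else 0)" "\<And>r. r < n ==> f $$ (r, j0) = v' r"
   by (elim bexE conjE) (rule that, assumption, blast, blast)
  have fC: "f \<in> sqm n" using f(1) by simp
  have conj: "ginv f * M h * f \<in> par n (%i. min i (Suc j0))" if h: "h \<in> H" for h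
  proof (rule parI)
   show "ginv f * M h * f \<in> sqm n" using f(1) MC[OF h] by simp
   fix i j assume ij: "i < n" "j < n" "min j (Suc j0) < min i (Suc j0)"
   hence ji: "j < i" "j \<le> j0" by auto
   have low: "(\<Sum>s<n. f $$ (r, s) * (if s < j0 then x s else 0)) = (if r < j0 then x r else 0)" if "r < n" for r x
   proof -
    have "(\<Sum>s<n. f $$ (r, s) * (if s < j0 then x s else 0)) = (\<Sum>s<n. if s = r then (if r < j0 then x r else 0) else 0)"
     using that f(2) by (intro sum.cong) auto
    thus ?thesis using that by simp
   qed
   show "(ginv f * M h * f) $$ (i, j) = 0"
   proof (cases "j = j0")
    case True
    define y where "y s = (if s < j0 then \<Sum>l<n. M h $$ (s, l) * v' l else if s = j0 then \<omega> h else 0)" for s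
    have "(M h * f) $$ (r, j) = (\<Sum>s<n. f $$ (r, s) * y s)" if r: "r < n" for r
    proof -
     have "(M h * f) $$ (r, j) = (\<Sum>l<n. M h $$ (r, l) * f $$ (l, j))" by (rule mult_mat_sum[OF MC[OF h] fC r ij(2)])
     also have "\<dots> = (\<Sum>l<n. M h $$ (r, l) * v' l)" using f(3) True by (intro sum.cong) auto
     finally have lhs: "(M h * f) $$ (r, j) = (\<Sum>l<n. M h $$ (r, l) * v' l)" .
     have "(\<Sum>s<n. f $$ (r, s) * y s) =
       (\<Sum>s<n. f $$ (r, s) * (if s < j0 then \<Sum>l<n. M h $$ (s, l) * v' l else 0) + (if s = j0 then v' r * \<omega> h else 0))"
      using f(3)[OF r] by (intro sum.cong) (auto simp: y_def)
     also have "\<dots> = (if r < j0 then \<Sum>l<n. M h $$ (r, l) * v' l else 0) + v' r * \<omega> h"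
      unfolding sum.distrib low[OF r] using j0 by simp
     also have "\<dots> = (\<Sum>l<n. M h $$ (r, l) * v' l)"
     proof (cases "r < j0")
      case False
      have "(\<Sum>l<n. M h $$ (r, l) * v' l) = (\<Sum>l<m. M h $$ (r, l + j0) * v' (l + j0))"
       unfolding m_def using j0 by (intro sum_shift) (auto simp: v'_def)
      also have "\<dots> = act h v (r - j0)"
      proof -
       have "r - j0 < m" "r - j0 + j0 = r" using False r by (auto simp: m_def)
       thus ?thesis by (simp add: act_def \<rho>_def v'_def)
      qed
      also have "\<dots> = \<omega> h * v (r - j0)" using v(3) h by simp
      finally show ?thesis using False by (simp add: v'_def)
     qed (simp add: v'_def)
     finally show ?thesis using lhs by simp
    qed
    hence "(ginv f * M h * f) $$ (i, j) = y i" by (rule conj_column[OF f(1) MC[OF h] ij(1,2)])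
    thus ?thesis using ji True by (simp add: y_def)
   next
    case False
    hence jj: "j < j0" using ji by simp
    define y where "y s = (if s < j0 then M h $$ (s, j) else 0)" for s
    have "(M h * f) $$ (r, j) = (\<Sum>s<n. f $$ (r, s) * y s)" if r: "r < n" for r
    proof -
     have "(M h * f) $$ (r, j) = (\<Sum>l<n. if l = j then M h $$ (r, l) else 0)"
      unfolding mult_mat_sum[OF MC[OF h] fC r ij(2)] using f(2)[OF _ jj] by (intro sum.cong) auto
     hence "(M h * f) $$ (r, j) = M h $$ (r, j)" using ij by simp
     thus ?thesis unfolding y_def low[OF r] using M0[OF h r jj] jj by auto
    qed
    hence "(ginv f * M h * f) $$ (i, j) = y i" by (rule conj_column[OF f(1) MC[OF h] ij(1,2)])
    thus ?thesis using M0[OF h ij(1) jj ji(1)] by (simp add: y_def)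
   qed
  qed
  define D where "D = diag1 n (1 / det f)"
  have D: "D \<in> GL n" "\<And>\<sigma>. D \<in> par n \<sigma>" using n GL_det[OF f(1)] by (auto simp: D_def)
  have fD: "f * D \<in> SG n" using normal_SL[OF n f(1)] by (simp add: normal_def D_def)
  have "ginv (g * (f * D)) * h * (g * (f * D)) \<in> par n (%i. min i (Suc j0))" if h: "h \<in> H" for h
  proof -
   have "ginv (g * (f * D)) * h * (g * (f * D)) = ginv D * (ginv f * M h * f) * D"
    unfolding M_def using gG f(1) D(1) SL_carrier[OF HS[OF h]] by (simp add: ginv_mult[of _ n] mult_assoc_sq[of _ n])
   also have "\<dots> \<in> par n (%i. min i (Suc j0))" by (rule par_mult[OF par_mult[OF par_ginv[OF D(2,1)] conj[OF h]] D(2)])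
   finally show ?thesis .
  qed
  thus ?case using SL_mult[OF g(1) fD] by blast
 qed
 from this[OF order_refl] obtain g where g: "g \<in> SG n" "\<And>h. h \<in> H ==> ginv g * h * g \<in> par n (%i. min i n)" by blast
 have "par n (%i. min i n) = upr n" unfolding par_def by auto
 thus ?thesis using g by auto
qed

section \<open>Borel subgroups\<close>

definition conjugate :: "complex mat => complex mat set => complex mat set" where
 "conjugate k H = (%x. k * x * ginv k) ` H"

lemma conj_cancel:
 assumes "k \<in> SG n" "x \<in> sqm n"
 shows "ginv k * (k * x * ginv k) * k = x" "k * (ginv k * x * k) * ginv k = x"
proof -
 have k: "k \<in> GL n" using assms(1) by simp
 show "ginv k * (k * x * ginv k) * k = x" "k * (ginv k * x * k) * ginv k = x" using k assms(2) by (simp_all add: mult_assoc_sq[of _ n])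
qed

lemma conj_mult:
 assumes "k \<in> SG n" "x \<in> sqm n" "y \<in> sqm n"
 shows "(k * x * ginv k) * (k * y * ginv k) = k * (x * y) * ginv k"
proof -
 have k: "k \<in> GL n" using assms(1) by simp
 show ?thesis using k assms(2,3) by (simp add: mult_assoc_sq[of _ n])
qed

lemma conj_ginv:
 assumes "k \<in> SG n" "x \<in> GL n" shows "ginv (k * x * ginv k) = k * ginv x * ginv k"
proof -
 have k: "k \<in> GL n" using assms(1) by simp
 show ?thesis using k assms(2) by (simp add: ginv_mult[of _ n] mult_assoc_sq[of _ n])
qed

lemma conjugate_mem:
 assumes "k \<in> SG n" "H \<subseteq> SG n" "y \<in> SG n"
 shows "y \<in> conjugate k H \<longleftrightarrow> ginv k * y * k \<in> H"
proof
 assume "y \<in> conjugate k H"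
 then obtain x where x: "x \<in> H" "y = k * x * ginv k" unfolding conjugate_def by blast
 thus "ginv k * y * k \<in> H" using conj_cancel(1)[OF assms(1), of x] assms(2) by auto
next
 assume "ginv k * y * k \<in> H"
 thus "y \<in> conjugate k H" unfolding conjugate_def
  using conj_cancel(2)[OF assms(1) SL_carrier[OF assms(3)]] by (intro image_eqI[of _ _ "ginv k * y * k"]) auto
qed

lemma subgroup_conjugate:
 assumes k: "k \<in> SG n" and H: "subgroup H (SL n)" shows "subgroup (conjugate k H) (SL n)"
proof -
 have HS: "H \<subseteq> SG n" "idm n \<in> H" "\<And>a b. a \<in> H ==> b \<in> H ==> a * b \<in> H" "\<And>a. a \<in> H ==> ginv a \<in> H"
  using H unfolding subgroup_SL by auto
 have kG: "k \<in> GL n" using k by simp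
 show ?thesis unfolding subgroup_SL
 proof (intro conjI ballI)
  show "conjugate k H \<subseteq> SG n" unfolding conjugate_def using HS(1) k by (auto intro!: SL_mult SL_ginv)
  show "idm n \<in> conjugate k H" unfolding conjugate_def using HS(2) kG by (intro image_eqI[of _ _ "idm n"]) auto
  fix a assume "a \<in> conjugate k H"
  then obtain x where x: "x \<in> H" "a = k * x * ginv k" unfolding conjugate_def by blast
  have xS: "x \<in> SG n" using x HS by auto
  show "ginv a \<in> conjugate k H" unfolding x(2) conj_ginv[OF k SL_GL[OF xS]] conjugate_def using HS(4)[OF x(1)] by blast
  fix b assume "b \<in> conjugate k H"
  then obtain y where y: "y \<in> H" "b = k * y * ginv k" unfolding conjugate_def by blast
  have yS: "y \<in> SG n" using y HS by auto
  show "a * b \<in> conjugate k H"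
   unfolding x(2) y(2) conj_mult[OF k SL_carrier[OF xS] SL_carrier[OF yS]] conjugate_def using HS(3)[OF x(1) y(1)] by blast
 qed
qed

text \<open>The descending central series of the unipotent upper triangular group, preceded by the whole upper
 triangular group.\<close>

definition ucs :: "nat => nat => complex mat set" where
 "ucs n r = {a \<in> upr n \<inter> SG n. r > 0 --> (\<forall>i<n. \<forall>j<n. j < i + r --> a $$ (i, j) = (if i = j then 1 else 0))}"

lemma ucs_mult_index:
 assumes a: "a \<in> ucs n r" and r: "r > 0" and b: "b \<in> upr n" and ij: "i < n" "j < n" "j \<le> i + r"
 shows "(a * b) $$ (i, j) = b $$ (i, j) + (if j = i + r then a $$ (i, j) * b $$ (j, j) else 0)"
proof -
 have aC: "a \<in> sqm n" using a by (auto simp: ucs_def)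
 have aU: "a $$ (i, l) = (if i = l then 1 else 0)" if "l < n" "l < i + r" for l using a r ij that unfolding ucs_def by blast
 have bU: "b $$ (l, j) = 0" if "l < n" "j < l" for l using parD[OF b that(1) ij(2)] that by simp
 have "(a * b) $$ (i, j) = (\<Sum>l<n. (if l = i then b $$ (l, j) else 0) + (if l = j then (if j = i + r then a $$ (i, l) * b $$ (l, j) else 0) else 0))"
  unfolding mult_mat_sum[OF aC par_carrier[OF b] ij(1,2)]
 proof (rule sum.cong[OF refl])
  fix l assume "l \<in> {..<n}"
  hence l: "l < n" by simp
  show "a $$ (i, l) * b $$ (l, j) = (if l = i then b $$ (l, j) else 0) + (if l = j then (if j = i + r then a $$ (i, l) * b $$ (l, j) else 0) else 0)"
  proof (cases "l < i + r")
   case True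
   thus ?thesis using aU[OF l True] r by auto
  next
   case False
   thus ?thesis using bU[OF l] ij(3) r by (cases "j < l") auto
  qed
 qed
 thus ?thesis using ij by (simp add: sum.distrib)
qed

lemma ucs_subgroup: "subgroup (ucs n r) (SL n)" unfolding subgroup_SL
proof (intro conjI ballI)
 show "ucs n r \<subseteq> SG n" "idm n \<in> ucs n r" by (auto simp: ucs_def)
 fix a assume a: "a \<in> ucs n r"
 hence aP: "a \<in> upr n" "a \<in> SG n" by (auto simp: ucs_def)
 have gP: "ginv a \<in> upr n" "ginv a \<in> SG n" using aP by auto
 have "ginv a $$ (i, j) = (if i = j then 1 else 0)" if "r > 0" "i < n" "j < n" "j < i + r" for i j
 proof -
  have "(a * ginv a) $$ (i, j) = ginv a $$ (i, j)" using ucs_mult_index[OF a that(1) gP(1) that(2,3)] that(4) by simp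
  moreover have "a * ginv a = idm n" using SL_GL[OF aP(2)] by simp
  ultimately show ?thesis using that by simp
 qed
 thus "ginv a \<in> ucs n r" using gP unfolding ucs_def by simp
 fix b assume b: "b \<in> ucs n r"
 hence bP: "b \<in> upr n" "b \<in> SG n" by (auto simp: ucs_def)
 have "(a * b) $$ (i, j) = (if i = j then 1 else 0)" if "r > 0" "i < n" "j < n" "j < i + r" for i j
 proof -
  have "(a * b) $$ (i, j) = b $$ (i, j)" using ucs_mult_index[OF a that(1) bP(1) that(2,3)] that(4) by simp
  thus ?thesis using b that unfolding ucs_def by simp
 qed
 thus "a * b \<in> ucs n r" using aP bP unfolding ucs_def by (simp del: index_mult_mat)
qed

text \<open>The products \<open>a b\<close> and \<open>b a\<close> agree up to the \<open>r\<close>-th superdiagonal.\<close>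

lemma ucs_commutator:
 assumes a: "a \<in> ucs n r" and b: "b \<in> ucs n r"
 shows "a * b * ginv a * ginv b \<in> ucs n (Suc r)"
proof -
 have S: "a \<in> upr n" "a \<in> SG n" "b \<in> upr n" "b \<in> SG n" using a b by (auto simp: ucs_def)
 have G: "a \<in> GL n" "b \<in> GL n" using S by auto
 define g where "g = ginv a * ginv b"
 have gP: "g \<in> upr n" unfolding g_def using S by auto
 have c: "a * b * ginv a * ginv b = a * b * g" "b * a * g = idm n" using G by (simp_all add: g_def mult_assoc_sq[of _ n])
 have same: "(a * b) $$ (i, l) = (b * a) $$ (i, l)" if "i < n" "l < n" "l \<le> i + r" for i l
 proof (cases "r = 0")
  case True
  have diag: "(x * y) $$ (i, l) = (if l = i then x $$ (i, i) * y $$ (i, i) else 0)" if "x \<in> upr n" "y \<in> upr n" for x y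
  proof -
   have "(x * y) $$ (i, l) = (\<Sum>s<n. if s = i then (if l = i then x $$ (i, i) * y $$ (i, i) else 0) else 0)"
    unfolding mult_mat_sum[OF par_carrier[OF that(1)] par_carrier[OF that(2)] \<open>i < n\<close> \<open>l < n\<close>]
   proof (rule sum.cong[OF refl])
    fix s assume "s \<in> {..<n}"
    hence "s < n" by simp
    show "x $$ (i, s) * y $$ (s, l) = (if s = i then (if l = i then x $$ (i, i) * y $$ (i, i) else 0) else 0)"
     using parD[OF that(1) \<open>i < n\<close> \<open>s < n\<close>] parD[OF that(2) \<open>s < n\<close> \<open>l < n\<close>] \<open>l \<le> i + r\<close> True
     by (cases s i rule: linorder_cases) auto
   qed
   thus ?thesis using \<open>i < n\<close> by simp
  qed
  show ?thesis using diag[OF S(1,3)] diag[OF S(3,1)] by simp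
 next
  case False
  hence r: "r > 0" by simp
  have d: "a $$ (l, l) = 1" "b $$ (l, l) = 1" using a b r that(2) unfolding ucs_def by auto
  show ?thesis using ucs_mult_index[OF a r S(3) that] ucs_mult_index[OF b r S(1) that] d a b r that unfolding ucs_def
   by (cases "l = i + r") auto
 qed
 have "(a * b * g) $$ (i, j) = (if i = j then 1 else 0)" if ij: "i < n" "j < n" "j < i + Suc r" for i j
 proof -
  have C: "a * b \<in> sqm n" "b * a \<in> sqm n" "g \<in> sqm n" using S gP by auto
  have "(a * b * g) $$ (i, j) = (\<Sum>l<n. (a * b) $$ (i, l) * g $$ (l, j))" by (rule mult_mat_sum[OF C(1,3) ij(1,2)])
  also have "\<dots> = (\<Sum>l<n. (b * a) $$ (i, l) * g $$ (l, j))"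
  proof (rule sum.cong[OF refl])
   fix l assume "l \<in> {..<n}"
   hence l: "l < n" by simp
   show "(a * b) $$ (i, l) * g $$ (l, j) = (b * a) $$ (i, l) * g $$ (l, j)"
    using same[OF ij(1) l] parD[OF gP l ij(2)] ij(3) by (cases "l \<le> i + r") auto
  qed
  also have "\<dots> = (b * a * g) $$ (i, j)" by (rule mult_mat_sum[OF C(2,3) ij(1,2), symmetric])
  finally show ?thesis using ij by (simp add: c(2))
 qed
 moreover have "a * b * g \<in> upr n" "a * b * g \<in> SG n" using S gP by (auto simp: g_def)
 ultimately show ?thesis unfolding c(1) ucs_def by (simp del: index_mult_mat)
qed

lemma derived_conjugate_ucs:
 assumes k: "k \<in> SG n" shows "derived (SL n) (conjugate k (ucs n r)) \<subseteq> conjugate k (ucs n (Suc r))" unfolding derived_def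
proof (rule group.generate_subgroup_incl[OF group_SL _ subgroup_conjugate[OF k ucs_subgroup]])
 show "(\<Union>h1\<in>conjugate k (ucs n r). \<Union>h2\<in>conjugate k (ucs n r). {h1 \<otimes>\<^bsub>SL n\<^esub> h2 \<otimes>\<^bsub>SL n\<^esub> inv\<^bsub>SL n\<^esub> h1 \<otimes>\<^bsub>SL n\<^esub> inv\<^bsub>SL n\<^esub> h2})
   \<subseteq> conjugate k (ucs n (Suc r))"
 proof (intro UN_least, rule subsetI)
  fix h1 h2 x assume h: "h1 \<in> conjugate k (ucs n r)" "h2 \<in> conjugate k (ucs n r)"
   and x: "x \<in> {h1 \<otimes>\<^bsub>SL n\<^esub> h2 \<otimes>\<^bsub>SL n\<^esub> inv\<^bsub>SL n\<^esub> h1 \<otimes>\<^bsub>SL n\<^esub> inv\<^bsub>SL n\<^esub> h2}"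
  have hS: "h1 \<in> SG n" "h2 \<in> SG n" using h subgroup.subset[OF subgroup_conjugate[OF k ucs_subgroup]] by auto
  obtain a b where ab: "a \<in> ucs n r" "b \<in> ucs n r" "h1 = k * a * ginv k" "h2 = k * b * ginv k"
   using h unfolding conjugate_def by blast
  have abS: "a \<in> GL n" "b \<in> GL n" "k \<in> GL n" using ab(1,2) k by (auto simp: ucs_def)
  have "x = h1 * h2 * ginv h1 * ginv h2" using x hS by simp
  also have "\<dots> = k * (a * b * ginv a * ginv b) * ginv k"
   unfolding ab(3,4) conj_ginv[OF k abS(1)] conj_ginv[OF k abS(2)] using abS by (simp add: mult_assoc_sq[of _ n])
  finally show "x \<in> conjugate k (ucs n (Suc r))" unfolding conjugate_def using ucs_commutator[OF ab(1,2)] by blast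
 qed
qed

lemma derived_seq_subgroup:
 assumes H: "subgroup H (SL n)"
 shows "(derived (SL n) ^^ i) H \<subseteq> H" "(derived (SL n\<lparr>carrier := H\<rparr>) ^^ i) H = (derived (SL n) ^^ i) H"
proof -
 show sub: "(derived (SL n) ^^ i) H \<subseteq> H" for i by (induction i) (auto dest: subsetD[OF group.derived_incl[OF group_SL _ H]])
 show "(derived (SL n\<lparr>carrier := H\<rparr>) ^^ i) H = (derived (SL n) ^^ i) H"
  by (induction i) (simp_all add: group.derived_consistent[OF group_SL sub H])
qed

lemma solvable_subgroup_iff:
 assumes H: "subgroup H (SL n)"
 shows "solvable (SL n\<lparr>carrier := H\<rparr>) \<longleftrightarrow> (\<exists>i. (derived (SL n) ^^ i) H = {idm n})"
 using group.solvable_iff_trivial_derived_seq[OF subgroup.subgroup_is_group[OF H group_SL]] derived_seq_subgroup(2)[OF H] by simp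

lemma solvable_conjugate_upper:
 assumes n: "n > 0" and k: "k \<in> SG n"
 shows "solvable (SL n\<lparr>carrier := conjugate k (ucs n 0)\<rparr>)"
proof -
 let ?K = "conjugate k (ucs n 0)"
 have K: "subgroup ?K (SL n)" using k ucs_subgroup by (rule subgroup_conjugate)
 have "(derived (SL n) ^^ r) ?K \<subseteq> conjugate k (ucs n r)" for r
 proof (induction r)
  case (Suc r)
  hence "derived (SL n) ((derived (SL n) ^^ r) ?K) \<subseteq> derived (SL n) (conjugate k (ucs n r))"
   by (rule group.mono_derived[OF group_SL])
  thus ?case using derived_conjugate_ucs[OF k, of r] by simp
 qed simp
 moreover have "ucs n n \<subseteq> {idm n}"
 proof
  fix a assume a: "a \<in> ucs n n"
  hence aC: "a \<in> sqm n" by (auto simp: ucs_def)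
  have "a = idm n" by (rule eq_matI) (use a carrier_matD[OF aC] n in \<open>auto simp: ucs_def\<close>)
  thus "a \<in> {idm n}" by simp
 qed
 moreover have "k \<in> GL n" using k by simp
 ultimately have "(derived (SL n) ^^ n) ?K \<subseteq> {idm n}" unfolding conjugate_def by fastforce
 moreover have "idm n \<in> (derived (SL n) ^^ n) ?K"
  using group.exp_of_derived_is_subgroup[OF group_SL K, of n] unfolding subgroup_SL by blast
 ultimately have "(derived (SL n) ^^ n) ?K = {idm n}" by blast
 thus ?thesis unfolding solvable_subgroup_iff[OF K] by blast
qed

lemma closedin_regular:
 assumes "\<And>p. p \<in> I ==> regular n (f p)"
 shows "closedin (SL_topology n) {x \<in> SG n. \<forall>p\<in>I. f p x = 0}"
proof -
 let ?C = "{%A. A $$ (i, j) | i j. i < n & j < n} :: (complex mat => complex) set"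
 have ex: "\<exists>f'. f' \<in> poly_funs ?C & (\<forall>x\<in>SG n. f p x = f' x)" if "p \<in> I" for p
  using assms[OF that] unfolding regular_def by blast
 have "\<forall>p\<in>I. \<exists>f'. f' \<in> poly_funs ?C & (\<forall>x\<in>SG n. f p x = f' x)" using ex by (rule ballI)
 from bchoice[OF this] obtain F where F: "\<forall>p\<in>I. F p \<in> poly_funs ?C & (\<forall>x\<in>SG n. f p x = F p x)" ..
 have "{x \<in> SG n. \<forall>p\<in>I. f p x = 0} = {x \<in> SG n. \<forall>g\<in>F ` I. g x = 0}" using F by auto
 moreover have "F ` I \<subseteq> poly_funs ?C" using F by blast
 ultimately show ?thesis unfolding SL_topology_def closedin_zariski by blast
qed

lemma continuous_regular_mat:
 assumes "regular_mat n \<phi>" shows "continuous_map (SL_topology n) (SL_topology n) \<phi>" unfolding SL_topology_def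
proof (rule continuous_map_zariski)
 show "\<phi> x \<in> SG n" if "x \<in> SG n" for x using assms that unfolding regular_mat_def by blast
 fix c :: "complex mat => complex" assume "c \<in> {%A. A $$ (i, j) | i j. i < n & j < n}"
 then obtain i j where c: "c = (%A. A $$ (i, j))" "i < n" "j < n" by blast
 thus "\<exists>f\<in>poly_funs {%A. A $$ (i, j) | i j. i < n & j < n}. \<forall>x\<in>SG n. c (\<phi> x) = f x"
  using assms unfolding regular_mat_def regular_def by blast
qed

lemma ucs_0: "ucs n 0 = upr n \<inter> SG n" by (auto simp: ucs_def)

lemma conjugate_upper:
 assumes n: "n > 0" and k: "k \<in> SG n"
 shows "closed_connected_solvable (SL n) (SL_topology n) (conjugate k (ucs n 0))" unfolding closed_connected_solvable_def
proof (intro conjI)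
 show K: "subgroup (conjugate k (ucs n 0)) (SL n)" using k ucs_subgroup by (rule subgroup_conjugate)
 show "solvable (SL n\<lparr>carrier := conjugate k (ucs n 0)\<rparr>)" using n k by (rule solvable_conjugate_upper)
 have "regular_mat n (%x. k * x * ginv k)" using k by (intro regular_mat_mult regular_mat_const regular_mat_id SL_ginv)
 hence "continuous_map (SL_topology n) (SL_topology n) (%x. k * x * ginv k)" by (rule continuous_regular_mat)
 thus "connectedin (SL_topology n) (conjugate k (ucs n 0))"
  unfolding conjugate_def ucs_0 by (rule connectedin_continuous_map_image) (rule linked_connected[OF linked_par_SL[OF n]])
 let ?I = "{(i, j). i < n & j < i}"
 have r: "regular_mat n (%x. ginv k * x * k)" using k by (intro regular_mat_mult regular_mat_const regular_mat_id SL_ginv)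
 have "closedin (SL_topology n) {x \<in> SG n. \<forall>p\<in>?I. (ginv k * x * k) $$ p = 0}"
  by (rule closedin_regular) (use r in \<open>auto simp: regular_mat_def\<close>)
 moreover have "conjugate k (ucs n 0) = {x \<in> SG n. \<forall>p\<in>?I. (ginv k * x * k) $$ p = 0}"
 proof (intro Set.set_eqI)
  fix x
  show "x \<in> conjugate k (ucs n 0) \<longleftrightarrow> x \<in> {x \<in> SG n. \<forall>p\<in>?I. (ginv k * x * k) $$ p = 0}"
  proof (cases "x \<in> SG n")
   case True
   have cS: "ginv k * x * k \<in> SG n" using True k by (intro SL_mult SL_ginv)
   have "x \<in> conjugate k (ucs n 0) \<longleftrightarrow> ginv k * x * k \<in> upr n"
    using conjugate_mem[OF k _ True, of "ucs n 0"] cS unfolding ucs_0 by blast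
   also have "\<dots> \<longleftrightarrow> (\<forall>p\<in>?I. (ginv k * x * k) $$ p = 0)"
    using parI[OF SL_carrier[OF cS], of "%i. i"] parD[of "ginv k * x * k" n "%i. i"] by (auto simp del: index_mult_mat)
   finally show ?thesis using True by blast
  next
   case False
   thus ?thesis using subgroup.subset[OF K] by blast
  qed
 qed
 ultimately show "closedin (SL_topology n) (conjugate k (ucs n 0))" by simp
qed

text \<open>By the theorem of Lie and Kolchin a Borel subgroup is contained in a conjugate of the upper triangular group, which is itself closed, connected and solvable.\<close>

theorem borel_conjugate:
 assumes n: "n > 0" and B: "borel_subgroup (SL n) (SL_topology n) B"
 shows "\<exists>k\<in>SG n. B = conjugate k (ucs n 0)"
proof -
 have H: "subgroup B (SL n)" and con: "connectedin (SL_topology n) B" and sol: "solvable (SL n\<lparr>carrier := B\<rparr>)"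
  and mx: "\<And>H. closed_connected_solvable (SL n) (SL_topology n) H ==> B \<subseteq> H ==> H = B"
  using B unfolding borel_subgroup_def closed_connected_solvable_def by blast+
 have BS: "B \<subseteq> SG n" "idm n \<in> B" using H unfolding subgroup_SL by auto
 obtain d where d: "(derived (SL n) ^^ d) B = {idm n}" using sol unfolding solvable_subgroup_iff[OF H] by blast
 obtain k where k: "k \<in> SG n" "\<And>h. h \<in> B ==> ginv k * h * k \<in> upr n"
  using lie_kolchin[OF n H connected_rigid[OF con BS] d] by blast
 have "B \<subseteq> conjugate k (ucs n 0)"
 proof
  fix h assume h: "h \<in> B"
  hence hS: "h \<in> SG n" using BS by blast
  have "ginv k * h * k \<in> ucs n 0" unfolding ucs_0 using k(2)[OF h] k(1) hS by (auto intro!: SL_mult SL_ginv)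
  thus "h \<in> conjugate k (ucs n 0)" using conjugate_mem[OF k(1) _ hS, of "ucs n 0"] unfolding ucs_0 by blast
 qed
 thus ?thesis using mx[OF conjugate_upper[OF n k(1)]] k(1) by blast
qed

theorem parabolic_conjugate:
 assumes n: "n > 0" and P: "parabolic_subgroup (SL n) (SL_topology n) P"
 shows "\<exists>k\<in>SG n. \<exists>p. (\<forall>x\<in>set p. x > 0) & sum_list p = n & P = conjugate k (par n (block p) \<inter> SG n)"
proof -
 obtain B where B: "borel_subgroup (SL n) (SL_topology n) B" "B \<subseteq> P" and H: "subgroup P (SL n)"
  using P unfolding parabolic_subgroup_def by blast
 have PS: "P \<subseteq> SG n" using H unfolding subgroup_SL by blast
 obtain k where k: "k \<in> SG n" "B = conjugate k (ucs n 0)" using borel_conjugate[OF n B(1)] by blast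
 have ki: "ginv k \<in> SG n" "ginv (ginv k) = k" using k(1) by auto
 define P0 where "P0 = conjugate (ginv k) P"
 have P0: "subgroup P0 (SL n)" unfolding P0_def using ki(1) H by (rule subgroup_conjugate)
 have restore: "conjugate k P0 = P"
 proof -
  have "k * (ginv k * x * ginv (ginv k)) * ginv k = x" if "x \<in> P" for x
   using conj_cancel(2)[OF k(1), of x] that PS unfolding ki(2) by (auto)
  thus ?thesis unfolding P0_def conjugate_def image_image by simp
 qed
 interpret upper_overgroup n P0
 proof
  show "n > 0" by (rule n)
  show "P0 \<subseteq> SG n" "\<And>x y. x \<in> P0 ==> y \<in> P0 ==> x * y \<in> P0" "\<And>x. x \<in> P0 ==> ginv x \<in> P0"
   using P0 unfolding subgroup_SL by auto
  show "upr n \<inter> SG n \<subseteq> P0"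
  proof
   fix x assume x: "x \<in> upr n \<inter> SG n"
   hence "k * x * ginv k \<in> P" using B(2) unfolding k(2) conjugate_def ucs_0 by blast
   hence "ginv k * (k * x * ginv k) * ginv (ginv k) \<in> P0" unfolding P0_def conjugate_def by blast
   thus "x \<in> P0" unfolding ki(2) using conj_cancel(1)[OF k(1), of x] x by auto
  qed
 qed
 obtain p where p: "\<forall>x\<in>set p. x > 0" "sum_list p = n" "P0 = par n (block p) \<inter> SG n" using P_block by blast
 thus ?thesis using restore k(1) by auto
qed

lemma monomial_conj_index:
 assumes R: "monomial n w R" "R \<in> SG n" and x: "x \<in> sqm n" and ij: "i < n" "j < n"
 shows "(ginv R * x * R) $$ (i, j) = 0 \<longleftrightarrow> x $$ (w i, w j) = 0"
proof -
 have RG: "R \<in> GL n" using R(2) by simp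
 have RC: "R \<in> sqm n" using RG by simp
 define y where "y = ginv R * x * R"
 have yC: "y \<in> sqm n" unfolding y_def using RG x by simp
 have wi: "w i < n" "w j < n" using monomialD(4)[OF R(1)] ij by auto
 have "R * y = x * R" unfolding y_def using RG x by (simp add: mult_assoc_sq[of _ n])
 moreover have "(R * y) $$ (w i, j) = R $$ (w i, i) * y $$ (i, j)"
 proof -
  have "(R * y) $$ (w i, j) = (\<Sum>l<n. if l = i then R $$ (w i, l) * y $$ (l, j) else 0)"
   unfolding mult_mat_sum[OF RC yC wi(1) ij(2)]
  proof (rule sum.cong[OF refl])
   fix l assume "l \<in> {..<n}"
   hence "R $$ (w i, l) ~= 0 \<longleftrightarrow> w i = w l" using monomialD(3)[OF R(1) wi(1)] by simp
   hence "R $$ (w i, l) = 0" if "l ~= i" using that permutes_inj[OF monomialD(2)[OF R(1)]] by (metis injD)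
   thus "R $$ (w i, l) * y $$ (l, j) = (if l = i then R $$ (w i, l) * y $$ (l, j) else 0)" by simp
  qed
  thus ?thesis using ij by simp
 qed
 moreover have "(x * R) $$ (w i, j) = x $$ (w i, w j) * R $$ (w j, j)" by (rule mult_monomial_index[OF R(1) x wi(1) ij(2)])
 moreover have "R $$ (w i, i) ~= 0" "R $$ (w j, j) ~= 0" using monomialD(3)[OF R(1)] wi ij by auto
 ultimately show ?thesis unfolding y_def[symmetric] by (metis mult_eq_0_iff)
qed

theorem borel_conjugate_lower:
 assumes n: "n > 0" and B: "borel_subgroup (SL n) (SL_topology n) B"
 shows "\<exists>k\<in>SG n. B = conjugate k (low n \<inter> SG n)"
proof -
 obtain k where k: "k \<in> SG n" "B = conjugate k (ucs n 0)" using borel_conjugate[OF n B] by blast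
 define w where "w i = (if i < n then n - 1 - i else i)" for i
 have w: "w permutes {..<n}" by (rule inj_imp_permutes) (auto simp: w_def inj_on_def)
 define R where "R = normal n (perm_mat n (inv_into UNIV w))"
 have PG: "perm_mat n (inv_into UNIV w) \<in> GL n" using w by (intro perm_mat_GL permutes_inv)
 have R: "monomial n w R" unfolding R_def normal_def using w GL_det[OF PG] by (intro monomial_diag1 monomial_perm) auto
 have RS: "R \<in> SG n" unfolding R_def by (rule normal_SL[OF n PG])
 have kR: "k * R \<in> SG n" using k(1) RS by (rule SL_mult)
 have key: "x \<in> upr n \<longleftrightarrow> ginv R * x * R \<in> low n" if x: "x \<in> SG n" for x
 proof
  have c: "ginv R * x * R \<in> sqm n" using RS x by auto
  assume xu: "x \<in> upr n"
  show "ginv R * x * R \<in> low n"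
  proof (rule lowI[OF c])
   fix i j assume ij: "i < n" "j < n" "i < j"
   have "x $$ (w i, w j) = 0" using parD[OF xu, of "w i" "w j"] ij by (simp add: w_def)
   thus "(ginv R * x * R) $$ (i, j) = 0" using monomial_conj_index[OF R RS SL_carrier[OF x] ij(1,2)] by simp
  qed
 next
  assume l: "ginv R * x * R \<in> low n"
  show "x \<in> upr n"
  proof (rule parI[OF SL_carrier[OF x]])
   fix i j assume ij: "i < n" "j < n" "j < i"
   have wn: "w i < n" "w j < n" "w i < w j" "w (w i) = i" "w (w j) = j" using ij by (auto simp: w_def)
   have "(ginv R * x * R) $$ (w i, w j) = 0" using lowD[OF l wn(1,2,3)] .
   thus "x $$ (i, j) = 0" using monomial_conj_index[OF R RS SL_carrier[OF x] wn(1,2)] wn(4,5) by simp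
  qed
 qed
 have "B = conjugate (k * R) (low n \<inter> SG n)"
 proof (intro Set.set_eqI)
  fix y
  have BS: "B \<subseteq> SG n" "conjugate (k * R) (low n \<inter> SG n) \<subseteq> SG n"
   unfolding k(2) conjugate_def ucs_0 using k(1) kR by (auto intro!: SL_mult SL_ginv)
  show "y \<in> B \<longleftrightarrow> y \<in> conjugate (k * R) (low n \<inter> SG n)"
  proof (cases "y \<in> SG n")
   case True
   have x: "ginv k * y * k \<in> SG n" using True k(1) by (intro SL_mult SL_ginv)
   have x': "ginv R * (ginv k * y * k) * R \<in> SG n" by (rule SL_mult[OF SL_mult[OF SL_ginv[OF RS] x] RS])
   have G: "k \<in> GL n" "R \<in> GL n" "y \<in> sqm n" using k(1) RS True by auto
   have e: "ginv (k * R) * y * (k * R) = ginv R * (ginv k * y * k) * R" using G by (simp add: ginv_mult[of _ n] mult_assoc_sq[of _ n])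
   have "y \<in> B \<longleftrightarrow> ginv k * y * k \<in> upr n"
    using conjugate_mem[OF k(1) _ True, of "ucs n 0"] x unfolding k(2) ucs_0 by blast
   also have "\<dots> \<longleftrightarrow> ginv (k * R) * y * (k * R) \<in> low n \<inter> SG n" unfolding e using key[OF x] x' by blast
   also have "\<dots> \<longleftrightarrow> y \<in> conjugate (k * R) (low n \<inter> SG n)"
    using conjugate_mem[OF kR _ True, of "low n \<inter> SG n"] by blast
   finally show ?thesis .
  next
   case False
   thus ?thesis using BS by blast
  qed
 qed
 thus ?thesis using kR by blast
qed

section \<open>Orbits in a product of two flag varieties\<close>

lemma l_coset_eq:
 assumes P: "subgroup P (SL n)" and x: "x \<in> SG n" and y: "y \<in> SG n"
 shows "x <#\<^bsub>SL n\<^esub> P = y <#\<^bsub>SL n\<^esub> P \<longleftrightarrow> ginv x * y \<in> P"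
proof
 have G: "x \<in> GL n" "y \<in> sqm n" using x y by auto
 have P': "P \<subseteq> SG n" "idm n \<in> P" using P unfolding subgroup_SL by auto
 assume "x <#\<^bsub>SL n\<^esub> P = y <#\<^bsub>SL n\<^esub> P"
 moreover have "y \<in> y <#\<^bsub>SL n\<^esub> P" unfolding l_coset_def using P'(2) G(2) by (auto intro!: bexI[of _ "idm n"])
 ultimately obtain h where h: "h \<in> P" "y = x * h" unfolding l_coset_def by auto
 have "h \<in> sqm n" using h P' by auto
 thus "ginv x * y \<in> P" unfolding h(2) using G h(1) by simp
next
 assume h: "ginv x * y \<in> P"
 have "x \<in> GL n" "y \<in> sqm n" using x y by auto
 hence "y = x * (ginv x * y)" by simp
 hence "y \<in> x <#\<^bsub>SL n\<^esub> P" unfolding l_coset_def using h by auto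
 thus "x <#\<^bsub>SL n\<^esub> P = y <#\<^bsub>SL n\<^esub> P" using group.l_repr_independence[OF group_SL _ x P] by blast
qed

lemma coset_fibre:
 assumes k: "k \<in> SG n" and a: "a \<in> SG n" and Q: "subgroup Q (SL n)"
  and g: "g \<in> SG n" "g' \<in> SG n"
 shows "(k * g * ginv a) <#\<^bsub>SL n\<^esub> conjugate a Q = (k * g' * ginv a) <#\<^bsub>SL n\<^esub> conjugate a Q \<longleftrightarrow> (\<exists>p\<in>Q. g' = g * p)"
proof -
 have QS: "Q \<subseteq> SG n" using Q unfolding subgroup_SL by blast
 have G: "k \<in> GL n" "a \<in> GL n" "g \<in> GL n" "g' \<in> GL n" using k a g by auto
 have S: "k * g * ginv a \<in> SG n" "k * g' * ginv a \<in> SG n" using k a g by (auto intro!: SL_mult SL_ginv)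
 have z: "ginv (k * g * ginv a) * (k * g' * ginv a) \<in> SG n" by (rule SL_mult[OF SL_ginv[OF S(1)] S(2)])
 have e: "ginv a * (ginv (k * g * ginv a) * (k * g' * ginv a)) * a = ginv g * g'"
  using G by (simp add: ginv_mult[of _ n] mult_assoc_sq[of _ n])
 have "(k * g * ginv a) <#\<^bsub>SL n\<^esub> conjugate a Q = (k * g' * ginv a) <#\<^bsub>SL n\<^esub> conjugate a Q \<longleftrightarrow> ginv g * g' \<in> Q"
  unfolding l_coset_eq[OF subgroup_conjugate[OF a Q] S] conjugate_mem[OF a QS z] e ..
 also have "\<dots> \<longleftrightarrow> (\<exists>p\<in>Q. g' = g * p)"
 proof
  assume "ginv g * g' \<in> Q"
  moreover have "g' = g * (ginv g * g')" using G by simp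
  ultimately show "\<exists>p\<in>Q. g' = g * p" by blast
 next
  assume "\<exists>p\<in>Q. g' = g * p"
  then obtain p where p: "p \<in> Q" "g' = g * p" by blast
  hence "p \<in> sqm n" using QS by auto
  thus "ginv g * g' \<in> Q" unfolding p(2) using G(3) p(1) by simp
 qed
 finally show ?thesis .
qed

lemma continuous_translate:
 assumes "a \<in> SG n" "b \<in> SG n" "c \<in> SG n" "d \<in> SG n"
 shows "continuous_map (SL2_topology n) (SL2_topology n) (%(g, h). (a * g * b, c * h * d))" unfolding SL2_topology_def
proof (rule continuous_map_zariski)
 let ?C = "{%(g, h). g $$ (i, j) | i j. i < n & j < n} \<union> {%(g, h). h $$ (i, j) | i j. i < n & j < n} :: (complex mat \<times> complex mat => complex) set"
 show "(case x of (g, h) => (a * g * b, c * h * d)) \<in> SG n \<times> SG n"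
  if "x \<in> SG n \<times> SG n" for x using that assms by (auto intro!: SL_mult)
 have ent: "(u * x * v) $$ (i, j) = (\<Sum>s<n. (\<Sum>l<n. u $$ (i, l) * x $$ (l, s)) * v $$ (s, j))"
  if "u \<in> sqm n" "v \<in> sqm n" "x \<in> sqm n" "i < n" "j < n" for u v x :: "complex mat" and i j
 proof -
  have "(u * x * v) $$ (i, j) = (\<Sum>s<n. (u * x) $$ (i, s) * v $$ (s, j))" by (rule mult_mat_sum) (use that in auto)
  also have "\<dots> = (\<Sum>s<n. (\<Sum>l<n. u $$ (i, l) * x $$ (l, s)) * v $$ (s, j))"
   by (intro sum.cong refl arg_cong2[where f = "(*)"] mult_mat_sum) (use that in auto)
  finally show ?thesis .
 qed
 have co: "(%z. fst z $$ (i, l)) \<in> poly_funs ?C" "(%z. snd z $$ (i, l)) \<in> poly_funs ?C" if "i < n" "l < n" for i l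
  using that by (auto intro!: poly_funs.coord simp: case_prod_unfold)
 have pf: "(%z. \<Sum>s<n. (\<Sum>l<n. u $$ (i, l) * fst z $$ (l, s)) * v $$ (s, j)) \<in> poly_funs ?C"
  "(%z. \<Sum>s<n. (\<Sum>l<n. u $$ (i, l) * snd z $$ (l, s)) * v $$ (s, j)) \<in> poly_funs ?C" for u v :: "complex mat" and i j
  by (intro poly_funs_sum poly_funs.mult poly_funs.const co; simp)+
 fix f assume "f \<in> ?C"
 then consider i j where "i < n" "j < n" "f = (%(g, h). g $$ (i, j))" | i j where "i < n" "j < n" "f = (%(g, h). h $$ (i, j))" by blast
 thus "\<exists>f'\<in>poly_funs ?C. \<forall>x\<in>SG n \<times> SG n. f (case x of (g, h) => (a * g * b, c * h * d)) = f' x"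
 proof cases
  case 1
  thus ?thesis using assms ent[of a b] by (intro bexI[OF _ pf(1)[of a i b j]]) auto
 next
  case 2
  thus ?thesis using assms ent[of c d] by (intro bexI[OF _ pf(2)[of c i d j]]) auto
 qed
qed

lemma homeomorphic_translate:
 assumes "a \<in> SG n" "b \<in> SG n" "c \<in> SG n" "d \<in> SG n"
 shows "homeomorphic_map (SL2_topology n) (SL2_topology n) (%(g, h). (a * g * b, c * h * d))"
proof -
 have G: "a \<in> GL n" "b \<in> GL n" "c \<in> GL n" "d \<in> GL n" using assms by auto
 have inv: "ginv u * (u * x * v) * ginv v = x" "u * (ginv u * x * ginv v) * v = x"
  if "u \<in> GL n" "v \<in> GL n" "x \<in> sqm n" for u v x using that by (simp_all add: mult_assoc_sq[of _ n])
 have "homeomorphic_maps (SL2_topology n) (SL2_topology n) (%(g, h). (a * g * b, c * h * d)) (%(g, h). (ginv a * g * ginv b, ginv c * h * ginv d))"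
  unfolding homeomorphic_maps_def
  using continuous_translate[OF assms] continuous_translate[of "ginv a" n "ginv b" "ginv c" "ginv d"] assms inv[OF G(1,2)] inv[OF G(3,4)]
  by (auto simp: SL2_topology_def)
 thus ?thesis unfolding homeomorphic_map_maps by blast
qed

lemma subgroup_par: "subgroup (par n \<sigma> \<inter> SG n) (SL n)" unfolding subgroup_SL by auto

theorem mainTheorem2:
  fixes n :: nat and B P1 P2 :: "complex mat set"
  assumes "n > 0"
    and "borel_subgroup (SL n) (SL_topology n) B"
    and "parabolic_subgroup (SL n) (SL_topology n) P1"
    and "parabolic_subgroup (SL n) (SL_topology n) P2"
    and "complexity (SL n) B (double_flag_topology n P1 P2) (diag_action n) = 1"
  shows "finite (orbits (SL n) (double_flag n P1 P2) (diag_action n)) \<and>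
         card (orbits (SL n) (double_flag n P1 P2) (diag_action n)) \<le> 10"
proof -
 obtain k where k: "k \<in> SG n" "B = conjugate k (low n \<inter> SG n)" using borel_conjugate_lower[OF assms(1,2)] by blast
 obtain k1 p where p: "k1 \<in> SG n" "\<forall>x\<in>set p. x > 0" "sum_list p = n" "P1 = conjugate k1 (par n (block p) \<inter> SG n)"
  using parabolic_conjugate[OF assms(1,3)] by blast
 obtain k2 q where q: "k2 \<in> SG n" "\<forall>x\<in>set q. x > 0" "sum_list q = n" "P2 = conjugate k2 (par n (block q) \<inter> SG n)"
  using parabolic_conjugate[OF assms(1,4)] by blast
 define T where "T = double_flag_topology n P1 P2"
 \<comment> \<open>In this chart the three subgroups become standard: the Borel subgroup is lower triangular, the stabilizers are block upper triangular.\<close>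
 define \<Phi> where "\<Phi> = (%(g, h). (g <#\<^bsub>SL n\<^esub> P1, h <#\<^bsub>SL n\<^esub> P2)) \<circ> (%(g, h). (k * g * ginv k1, k * h * ginv k2))"
 have \<Phi>: "\<Phi> (g, h) = ((k * g * ginv k1) <#\<^bsub>SL n\<^esub> P1, (k * h * ginv k2) <#\<^bsub>SL n\<^esub> P2)" for g h by (simp add: \<Phi>_def)
 have PP: "P1 \<subseteq> SG n" "P2 \<subseteq> SG n"
  unfolding p(4) q(4) using subgroup.subset[OF subgroup_conjugate[OF p(1) subgroup_par]] subgroup.subset[OF subgroup_conjugate[OF q(1) subgroup_par]] by blast+
 interpret flag_chart n "block p" "block q" T \<Phi>
 proof
  show "n > 0" by (rule assms(1))
  show "quotient_map (SL2_topology n) T \<Phi>" unfolding \<Phi>_def T_def double_flag_topology_def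
   by (rule quotient_map_compose[OF homeomorphic_translate[unfolded homeomorphic_map_def, THEN conjunct1] quotient_map_quotient_topology])
    (use k p q in auto)
  fix g h g' h' assume S: "g \<in> SG n" "h \<in> SG n" "g' \<in> SG n" "h' \<in> SG n"
  show "\<Phi> (g, h) = \<Phi> (g', h') \<longleftrightarrow> (\<exists>p\<in>par n (block p) \<inter> SG n. \<exists>q\<in>par n (block q) \<inter> SG n. g' = g * p & h' = h * q)"
   unfolding \<Phi> prod.inject p(4) q(4) coset_fibre[OF k(1) p(1) subgroup_par S(1,3)] coset_fibre[OF k(1) q(1) subgroup_par S(2,4)] by blast
 qed
 have top: "topspace T = double_flag n P1 P2" unfolding T_def by (rule topspace_double_flag_topology)
 have act: "diag_action n (k * b * ginv k) (\<Phi> (g, h)) = \<Phi> (b * g, b * h)"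
  if S: "b \<in> SG n" "g \<in> SG n" "h \<in> SG n" for b g h
 proof -
  have G: "k \<in> GL n" "b \<in> GL n" "g \<in> GL n" "h \<in> GL n" "k1 \<in> GL n" "k2 \<in> GL n" using S k p q by auto
  have "(k * b * ginv k) <#\<^bsub>SL n\<^esub> ((k * x * ginv a) <#\<^bsub>SL n\<^esub> P) = (k * (b * x) * ginv a) <#\<^bsub>SL n\<^esub> P"
   if "P \<subseteq> SG n" "x \<in> SG n" "a \<in> SG n" for x a P
  proof -
   have "(k * b * ginv k) <#\<^bsub>SL n\<^esub> ((k * x * ginv a) <#\<^bsub>SL n\<^esub> P) = ((k * b * ginv k) * (k * x * ginv a)) <#\<^bsub>SL n\<^esub> P"
    using group.lcos_m_assoc[OF group_SL that(1), of "k * b * ginv k" "k * x * ginv a"] S k that by simp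
   also have "(k * b * ginv k) * (k * x * ginv a) = k * (b * x) * ginv a"
    using G SL_GL[OF that(2)] SL_GL[OF that(3)] by (simp add: mult_assoc_sq[of _ n])
   finally show ?thesis .
  qed
  thus ?thesis unfolding \<Phi> diag_action_def using PP S p q by simp
 qed
 have sf: "settled p q" by (rule classification) (use p q assms(1) in auto)
 have Borbits: "orbits (SL n\<lparr>carrier := B\<rparr>) (topspace T) (diag_action n) = {borel_orbit g h | g h. g \<in> SG n & h \<in> SG n}"
 proof -
  have ob: "orbit (SL n\<lparr>carrier := B\<rparr>) (diag_action n) (\<Phi> (g, h)) = borel_orbit g h" if gh: "g \<in> SG n" "h \<in> SG n" for g h
  proof (intro Set.set_eqI iffI)
   fix y assume "y \<in> orbit (SL n\<lparr>carrier := B\<rparr>) (diag_action n) (\<Phi> (g, h))"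
   then obtain b where b: "b \<in> low n \<inter> SG n" "y = diag_action n (k * b * ginv k) (\<Phi> (g, h))"
    unfolding orbit_def k(2) conjugate_def by auto
   have "y = \<Phi> (b * g, b * h)" unfolding b(2) using b(1) gh by (intro act) auto
   thus "y \<in> borel_orbit g h" unfolding borel_orbit_def using b(1) by blast
  next
   fix y assume "y \<in> borel_orbit g h"
   then obtain b where b: "b \<in> low n \<inter> SG n" "y = \<Phi> (b * g, b * h)" unfolding borel_orbit_def by blast
   have "y = diag_action n (k * b * ginv k) (\<Phi> (g, h))" unfolding b(2) using b(1) gh by (intro act[symmetric]) auto
   moreover have "k * b * ginv k \<in> B" unfolding k(2) conjugate_def using b(1) by blast
   ultimately show "y \<in> orbit (SL n\<lparr>carrier := B\<rparr>) (diag_action n) (\<Phi> (g, h))" unfolding orbit_def by auto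
  qed
  show ?thesis
  proof (intro Set.set_eqI iffI)
   fix Y assume "Y \<in> orbits (SL n\<lparr>carrier := B\<rparr>) (topspace T) (diag_action n)"
   then obtain g h where "g \<in> SG n" "h \<in> SG n" "Y = orbit (SL n\<lparr>carrier := B\<rparr>) (diag_action n) (\<Phi> (g, h))"
    unfolding orbits_def image_chart by blast
   thus "Y \<in> {borel_orbit g h | g h. g \<in> SG n & h \<in> SG n}" using ob by blast
  next
   fix Y assume "Y \<in> {borel_orbit g h | g h. g \<in> SG n & h \<in> SG n}"
   then obtain g h where gh: "g \<in> SG n" "h \<in> SG n" "Y = borel_orbit g h" by blast
   show "Y \<in> orbits (SL n\<lparr>carrier := B\<rparr>) (topspace T) (diag_action n)"
    unfolding orbits_def gh(3) ob[OF gh(1,2), symmetric] using chart_topspace[OF gh(1,2)] by blast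
  qed
 qed
 have one: "(INF Y \<in> {borel_orbit g h | g h. g \<in> SG n & h \<in> SG n}. codim T Y) = 1"
  using assms(5) unfolding complexity_def T_def[symmetric] Borbits .
 have "\<not> spherical p q"
 proof
  assume "spherical p q"
  then obtain g h where gh: "g \<in> GL n" "h \<in> GL n" "null n (block p) (block q) g h" unfolding spherical_def p(3) by blast
  have "codim T (borel_orbit (normal n g) (normal n h)) = 0" by (rule codim_dense[OF dense_borel_orbit[OF gh]])
  moreover have "(INF Y \<in> {borel_orbit g h | g h. g \<in> SG n & h \<in> SG n}. codim T Y) \<le> codim T (borel_orbit (normal n g) (normal n h))"
   by (rule INF_lower) (use normal_SL[OF assms(1)] gh in blast)
  ultimately show False using one by simp
 qed
 moreover have "\<not> wildl p q"
 proof
  assume "wildl p q"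
  hence w: "wild n (block p) (block q)" unfolding wildl_def p(3) by blast
  have "2 \<le> (INF Y \<in> {borel_orbit g h | g h. g \<in> SG n & h \<in> SG n}. codim T Y)"
   by (rule INF_greatest) (use codim_wild[OF w] in blast)
  thus False using one by (simp add: numeral_eq_enat one_enat_def)
 qed
 ultimately have few: "few p q" using sf by (simp add: settled_def)
 show ?thesis
 proof (rule card_group_orbits[OF block_mono_on block_mono_on, of "tables p q"])
  show "finite (tables p q)" "card (tables p q) \<le> 10" using few by (auto simp: few_def)
  show "position_type n (block p) (block q) w \<in> tables p q" if "w permutes {..<n}" for w
   using position_type_tables[OF p(3) q(3) that] .
  fix Y assume "Y \<in> orbits (SL n) (double_flag n P1 P2) (diag_action n)"
  then obtain x where x: "x \<in> topspace T" "Y = orbit (SL n) (diag_action n) x" unfolding orbits_def top by blast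
  then obtain g h where gh: "g \<in> SG n" "h \<in> SG n" "x = \<Phi> (g, h)" unfolding image_chart by blast
  have "Y = group_orbit g h" unfolding x(2) gh(3)
  proof (intro Set.set_eqI iffI)
   fix y assume "y \<in> orbit (SL n) (diag_action n) (\<Phi> (g, h))"
   then obtain a where a: "a \<in> SG n" "y = diag_action n a (\<Phi> (g, h))" unfolding orbit_def by blast
   have "ginv k * a * k \<in> SG n" using a k by (intro SL_mult SL_ginv)
   moreover have "k * (ginv k * a * k) * ginv k = a" using conj_cancel(2)[OF k(1) SL_carrier[OF a(1)]] .
   ultimately show "y \<in> group_orbit g h" unfolding group_orbit_def using act[of "ginv k * a * k", OF _ gh(1,2)] a(2) by auto
  next
   fix y assume "y \<in> group_orbit g h"
   then obtain a where a: "a \<in> SG n" "y = \<Phi> (a * g, a * h)" unfolding group_orbit_def by blast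
   have "k * a * ginv k \<in> SG n" using a k by (intro SL_mult SL_ginv)
   thus "y \<in> orbit (SL n) (diag_action n) (\<Phi> (g, h))" unfolding orbit_def a(2) act[OF a(1) gh(1,2), symmetric] by blast
  qed
  thus "\<exists>g\<in>SG n. \<exists>h\<in>SG n. Y = group_orbit g h" using gh by blast
 qed
qed

end
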